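(* Let $\mathcal A:\mathsf{Emb}_1\to\mathsf{Obs}$ be any functor. Then the composite $\mathcal A\circ Q:\chi\mathsf{Loc}\to\mathsf{Obs}$ obeys the chiral time-slice axiom. Moreover, if $\mathcal A$ obeys the causality axiom with respect to the orthogonality relation $\bowtie_{\mathrm{set}}$ on $\mathsf{Emb}_1$, then $\mathcal A\circ Q$ obeys the causality axiom with respect to the orthogonality relation $\bowtie_{\chi^+}$ on $\chi\mathsf{Loc}$.
   Context: A 2D oriented spacetime $(M,g)$ is a smooth (Hausdorff, paracompact), oriented and time-oriented Lorentzian manifold of dimension 2, with signature $(-+)$, not necessarily connected. A map $f:(M,g)\to(N,h)$ is conformal if it is smooth and $f^*h=e^{\omega}g$ for some $\omega\in C^\infty(M)$. Let $\Omega$ be a nowhere-vanishing 2-form representing the orientation and $T$ an everywhere-timelike vector field representing the time-orientation. A nonzero non-timelike tangent vector $v$ at $p$ is right-pointing if $\Omega_p(T,v)>0$ and left-pointing if $\Omega_p(T,v)<0$ (independent of the choices). A curve $\gamma:I\to M$ on an interval is right-chiral if it is smooth and, on the interior of $I$, $\dot\gamma$ is either everywhere (nonzero) null, future-directed and right-pointing, or everywhere null, past-directed and left-pointing; in the former case it is called right-moving. It is inextendable if neither limit of $\gamma(t)$ as $t\to\inf I^+$ nor as $t\to\sup I^-$ exists in $M$. The right-chiral relation is $\chi^+_M=\{(p,q)\in M\times M:p=q$ or there is a right-moving null curve $\gamma:[0,1]\to M$ with $\gamma(0)=p,\gamma(1)=q\}$, and $s\chi^+_M=\chi^+_M\cup(\chi^+_M)^T$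 is its symmetric closure, which is an equivalence relation on $M$. A right-chiral 1-form on $M$ is a 1-form $\eta$ such that the vector field $\eta^\sharp$ with $\eta=g(\eta^\sharp,\cdot)$ is smooth and everywhere nonzero, null, future-directed and right-pointing. A $\chi^+$-Cauchy surface in $M$ is a smoothly embedded one-dimensional submanifold $S\subseteq M$ such that for every inextendable right-chiral curve $\gamma:I\to M$ there is a unique $t\in I$ with $\gamma(t)\in S$. $M$ is $\chi^+$-initial if it contains a $\chi^+$-Cauchy surface. A subset $U\subseteq M$ is $\chi^+$-convex if every right-chiral curve $\gamma:[0,1]\to M$ with $\gamma(0),\gamma(1)\in U$ satisfies $\gamma([0,1])\subseteq U$. An orientation- and time-orientation-preserving conformal map $f:M\to N$ between 2D oriented spacetimes is a $\chi^+$-Cauchy map if $f(M)$ contains a $\chi^+$-Cauchy surface of $N$. $\chi\mathsf{Loc}$ is the category whose objects are $\chi^+$-initial 2D oriented spacetimes and whose morphisms $f:M\to N$ are the orientation- and time-orientation-preserving conformal maps that are overlap-monic for $\bowtie_{\chi^+}$ in the category of all such spacetimes and all orientation- and time-orientation-preserving conformal maps; equivalently, those that are injective with $\chi^+$-convex image in $N$. Here, for morphisms $f_1:M_1\to N\leftarrow M_2:f_2$, $f_1\bowtie_{\chi^+}f_2$ means $s\chi^+_N\cap(f_1(M_1)\times f_2(M_2))=\varnothing$; $h$ is overlap-monic if $f_1\bowtie_{\chi^+}f_2$ always implies $h\circ f_1\bowtie_{\chi^+}h\circ f_2$. $\mathsf{Emb}_1$ is the category of smooth oriented one-dimensional manifolds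 and injective orientation-preserving local diffeomorphisms. On it, for $g_1:X_1\to Y\leftarrow X_2:g_2$, $g_1\bowtie_{\mathrm{set}}g_2$ means $g_1(X_1)\cap g_2(X_2)=\varnothing$. The functor $Q:\chi\mathsf{Loc}\to\mathsf{Emb}_1$ sends $M$ to the quotient $QM=M/s\chi^+_M$, a smooth 1-manifold with the unique smooth structure for which the quotient map $\pi_M$ is a smooth submersion, oriented by any nowhere-vanishing 1-form $\omega$ such that $\pi_M^*\omega$ is a right-chiral 1-form; and sends $f:M\to N$ to $Qf:[p]\mapsto[f(p)]$. $\mathsf{Obs}$ is the category of associative unital complex $*$-algebras and unit-preserving $*$-homomorphisms. A functor $\mathcal B:\mathsf D\to\mathsf{Obs}$ obeys the causality axiom with respect to a relation $\bowtie$ on pairs of morphisms with common codomain in $\mathsf D$ if whenever $f_1:M_1\to N\leftarrow M_2:f_2$ satisfy $f_1\bowtie f_2$, one has $[\mathcal Bf_1(a_1),\mathcal Bf_2(a_2)]=0$ in $\mathcal BN$ for all $a_1\in\mathcal BM_1$, $a_2\in\mathcal BM_2$. A functor $\mathcal B:\chi\mathsf{Loc}\to\mathsf{Obs}$ obeys the chiral time-slice axiom if $\mathcal Bf$ is an isomorphism for every morphism $f$ of $\chi\mathsf{Loc}$ that is a $\chi^+$-Cauchy map. An orthogonality relation is a symmetric relation on morphisms with common codomain that is stable under arbitrary pre- and post-composition. *)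

theory Defs
  imports "HOL-Analysis.Analysis" "HOL-Algebra.Module"
begin

section \<open>Smooth manifolds\<close>

text \<open>\<open>Ck_on\<close> and \<open>smooth_on\<close> are only meant for open \<open>S\<close>.\<close>

primrec Ck_on ::
  "nat \<Rightarrow> 'e::real_normed_vector set \<Rightarrow> ('e \<Rightarrow> 'f::real_normed_vector) \<Rightarrow> bool" where
  "Ck_on 0 S f \<longleftrightarrow> continuous_on S f"
| "Ck_on (Suc k) S f \<longleftrightarrow>
     f differentiable_on S \<and> (\<forall>v. Ck_on k S (\<lambda>x. frechet_derivative f (at x) v))"

definition smooth_on :: "'e::real_normed_vector set \<Rightarrow> ('e \<Rightarrow> 'f::real_normed_vector) \<Rightarrow> bool" where
  "smooth_on S f \<longleftrightarrow> (\<forall>k. Ck_on k S f)"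

definition paracompact_space :: "'a topology \<Rightarrow> bool" where
  "paracompact_space X \<longleftrightarrow>
     (\<forall>\<U>. (\<forall>U\<in>\<U>. openin X U) \<and> \<Union>\<U> = topspace X \<longrightarrow>
        (\<exists>\<V>. (\<forall>V\<in>\<V>. openin X V) \<and> \<Union>\<V> = topspace X \<and>
             (\<forall>V\<in>\<V>. \<exists>U\<in>\<U>. V \<subseteq> U) \<and> locally_finite_in X \<V>))"

text \<open>
  A chart is a pair of its domain and its coordinate map, the latter being \<open>undefined\<close> off the
  domain so that equal charts are equal as pairs. Atlases are maximal, so a record determines and
  is determined by the manifold.
\<close>

type_synonym ('a, 'e) chart = "'a set \<times> ('a \<Rightarrow> 'e)"

record ('a, 'e) manifold =
  mtop :: "'a topology"
  atlas :: "('a, 'e) chart set"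

abbreviation points :: "('a, 'e, 'z) manifold_scheme \<Rightarrow> 'a set" where
  "points M \<equiv> topspace (mtop M)"

abbreviation inv_chart :: "('a, 'e) chart \<Rightarrow> 'e \<Rightarrow> 'a" where
  "inv_chart c \<equiv> inv_into (fst c) (snd c)"

definition local_rep :: "('a, 'e) chart \<Rightarrow> ('b, 'f) chart \<Rightarrow> ('a \<Rightarrow> 'b) \<Rightarrow> 'e \<Rightarrow> 'f" where
  "local_rep c d f = snd d \<circ> f \<circ> inv_chart c"

text \<open>
  A tangent vector at \<open>p\<close> is given by its components \<open>v :: 'e\<close> in a chart \<open>c\<close> around \<open>p\<close>.
  \<open>mdiff c d f p\<close> is the differential of \<open>f\<close> at \<open>p\<close>, from components in \<open>c\<close> to components
  in \<open>d\<close>; for \<open>f\<close> the identity it is the change of components from \<open>c\<close> to \<open>d\<close>.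
\<close>

definition mdiff ::
  "('a, 'e::real_normed_vector) chart \<Rightarrow> ('b, 'f::real_normed_vector) chart \<Rightarrow>
   ('a \<Rightarrow> 'b) \<Rightarrow> 'a \<Rightarrow> 'e \<Rightarrow> 'f" where
  "mdiff c d f p = frechet_derivative (local_rep c d f) (at (snd c p))"

definition is_chart :: "'a topology \<Rightarrow> ('a, 'e::euclidean_space) chart \<Rightarrow> bool" where
  "is_chart X c \<longleftrightarrow>
     openin X (fst c) \<and> snd c \<in> extensional (fst c) \<and> open (snd c ` fst c) \<and>
     homeomorphic_map (subtopology X (fst c)) (top_of_set (snd c ` fst c)) (snd c)"

definition chart_compat ::
  "('a, 'e::euclidean_space) chart \<Rightarrow> ('a, 'e) chart \<Rightarrow> bool" where
  "chart_compat c d \<longleftrightarrow>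
     smooth_on (snd c ` (fst c \<inter> fst d)) (local_rep c d (\<lambda>p. p)) \<and>
     smooth_on (snd d ` (fst c \<inter> fst d)) (local_rep d c (\<lambda>p. p))"

definition smooth_manifold :: "('a, 'e::euclidean_space, 'z) manifold_scheme \<Rightarrow> bool" where
  "smooth_manifold M \<longleftrightarrow>
     Hausdorff_space (mtop M) \<and> paracompact_space (mtop M) \<and>
     (\<forall>c\<in>atlas M. is_chart (mtop M) c) \<and>
     (\<Union>c\<in>atlas M. fst c) = points M \<and>
     (\<forall>c\<in>atlas M. \<forall>d\<in>atlas M. chart_compat c d) \<and>
     (\<forall>c. is_chart (mtop M) c \<and> (\<forall>d\<in>atlas M. chart_compat c d) \<longrightarrow> c \<in> atlas M)"

definition smooth_map_on ::
  "('a, 'e::euclidean_space, 'y) manifold_scheme \<Rightarrow> 'a set \<Rightarrow>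
   ('b, 'f::euclidean_space, 'z) manifold_scheme \<Rightarrow> ('a \<Rightarrow> 'b) \<Rightarrow> bool" where
  "smooth_map_on M W N f \<longleftrightarrow>
     openin (mtop M) W \<and> continuous_map (subtopology (mtop M) W) (mtop N) f \<and>
     (\<forall>c\<in>atlas M. \<forall>d\<in>atlas N.
        smooth_on (snd c ` {p \<in> W \<inter> fst c. f p \<in> fst d}) (local_rep c d f))"

abbreviation smooth_map ::
  "('a, 'e::euclidean_space, 'y) manifold_scheme \<Rightarrow>
   ('b, 'f::euclidean_space, 'z) manifold_scheme \<Rightarrow> ('a \<Rightarrow> 'b) \<Rightarrow> bool" where
  "smooth_map M N f \<equiv> smooth_map_on M (points M) N f"

definition smooth_function ::
  "('a, 'e::euclidean_space, 'z) manifold_scheme \<Rightarrow> ('a \<Rightarrow> real) \<Rightarrow> bool" where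
  "smooth_function M f \<longleftrightarrow> (\<forall>c\<in>atlas M. smooth_on (snd c ` fst c) (f \<circ> inv_chart c))"

definition submersion ::
  "('a, 'e::euclidean_space, 'y) manifold_scheme \<Rightarrow>
   ('b, 'f::euclidean_space, 'z) manifold_scheme \<Rightarrow> ('a \<Rightarrow> 'b) \<Rightarrow> bool" where
  "submersion M N f \<longleftrightarrow>
     smooth_map M N f \<and>
     (\<forall>c\<in>atlas M. \<forall>d\<in>atlas N. \<forall>p\<in>fst c. f p \<in> fst d \<longrightarrow> surj (mdiff c d f p))"

definition local_diffeo ::
  "('a, 'e::euclidean_space, 'y) manifold_scheme \<Rightarrow>
   ('b, 'f::euclidean_space, 'z) manifold_scheme \<Rightarrow> ('a \<Rightarrow> 'b) \<Rightarrow> bool" where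
  "local_diffeo M N f \<longleftrightarrow>
     (\<forall>p\<in>points M. \<exists>U. openin (mtop M) U \<and> p \<in> U \<and> openin (mtop N) (f ` U) \<and> inj_on f U \<and>
        smooth_map_on M U N f \<and> smooth_map_on N (f ` U) M (inv_into U f))"

text \<open>
  Tensor fields are families of component functions: \<open>X c p\<close> are the components of the vector
  \<open>X\<^sub>p\<close> in \<open>c\<close>, and \<open>t c p v w\<close> is the value of \<open>t\<^sub>p\<close> on the two vectors with components \<open>v\<close>
  and \<open>w\<close> in \<open>c\<close>.
\<close>

type_synonym ('a, 'e) vfield = "('a, 'e) chart \<Rightarrow> 'a \<Rightarrow> 'e"
type_synonym ('a, 'e) covector_field = "('a, 'e) chart \<Rightarrow> 'a \<Rightarrow> 'e \<Rightarrow> real"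
type_synonym ('a, 'e) tensor2 = "('a, 'e) chart \<Rightarrow> 'a \<Rightarrow> 'e \<Rightarrow> 'e \<Rightarrow> real"

definition smooth_vector_field_on ::
  "('a, 'e::euclidean_space, 'z) manifold_scheme \<Rightarrow> 'a set \<Rightarrow> ('a, 'e) vfield \<Rightarrow> bool" where
  "smooth_vector_field_on M W X \<longleftrightarrow>
     (\<forall>c\<in>atlas M. smooth_on (snd c ` (W \<inter> fst c)) (\<lambda>x. X c (inv_chart c x))) \<and>
     (\<forall>c\<in>atlas M. \<forall>d\<in>atlas M. \<forall>p\<in>W \<inter> fst c \<inter> fst d.
        X d p = mdiff c d (\<lambda>q. q) p (X c p))"

definition smooth_tensor2 ::
  "('a, 'e::euclidean_space, 'z) manifold_scheme \<Rightarrow> ('a, 'e) tensor2 \<Rightarrow> bool" where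
  "smooth_tensor2 M t \<longleftrightarrow>
     (\<forall>c\<in>atlas M. \<forall>p\<in>fst c. bilinear (t c p)) \<and>
     (\<forall>c\<in>atlas M. \<forall>v w. smooth_on (snd c ` fst c) (\<lambda>x. t c (inv_chart c x) v w)) \<and>
     (\<forall>c\<in>atlas M. \<forall>d\<in>atlas M. \<forall>p\<in>fst c \<inter> fst d. \<forall>v w.
        t c p v w = t d p (mdiff c d (\<lambda>q. q) p v) (mdiff c d (\<lambda>q. q) p w))"

section \<open>Two-dimensional oriented spacetimes\<close>

text \<open>
  The orientation is the set of all nowhere-vanishing 2-forms representing it, and the
  time-orientation is the set of all everywhere-timelike vector fields representing it.
\<close>

type_synonym plane = "real \<times> real"

record 'a spacetime = "('a, plane) manifold" +
  lmetric :: "('a, plane) tensor2"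
  orientation :: "('a, plane) tensor2 set"
  time_orientation :: "('a, plane) vfield set"

text \<open>The last clause only makes the component family of a metric unique.\<close>

definition lorentzian_metric :: "'a spacetime \<Rightarrow> bool" where
  "lorentzian_metric M \<longleftrightarrow>
     smooth_tensor2 M (lmetric M) \<and>
     (\<forall>c\<in>atlas M. \<forall>p\<in>fst c. \<forall>v w. lmetric M c p v w = lmetric M c p w v) \<and>
     (\<forall>c\<in>atlas M. \<forall>p\<in>fst c. \<exists>e0 e1.
        lmetric M c p e0 e0 = -1 \<and> lmetric M c p e1 e1 = 1 \<and> lmetric M c p e0 e1 = 0) \<and>
     (\<forall>c p. c \<notin> atlas M \<or> p \<notin> fst c \<longrightarrow> lmetric M c p = (\<lambda>v w. 0))"

definition volume_form :: "'a spacetime \<Rightarrow> ('a, plane) tensor2 \<Rightarrow> bool" where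
  "volume_form M \<Omega> \<longleftrightarrow>
     smooth_tensor2 M \<Omega> \<and>
     (\<forall>c\<in>atlas M. \<forall>p\<in>fst c. (\<forall>v. \<Omega> c p v v = 0) \<and> (\<exists>v w. \<Omega> c p v w \<noteq> 0))"

definition timelike_field :: "'a spacetime \<Rightarrow> ('a, plane) vfield \<Rightarrow> bool" where
  "timelike_field M T \<longleftrightarrow>
     smooth_vector_field_on M (points M) T \<and>
     (\<forall>c\<in>atlas M. \<forall>p\<in>fst c. lmetric M c p (T c p) (T c p) < 0)"

definition is_orientation :: "'a spacetime \<Rightarrow> ('a, plane) tensor2 set \<Rightarrow> bool" where
  "is_orientation M \<O> \<longleftrightarrow>
     (\<exists>\<Omega>. volume_form M \<Omega> \<and>
        \<O> = {\<Omega>'. volume_form M \<Omega>' \<and>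
               (\<forall>c\<in>atlas M. \<forall>p\<in>fst c. \<exists>k>0. \<forall>v w. \<Omega>' c p v w = k * \<Omega> c p v w)})"

text \<open>With signature \<open>(-+)\<close>, timelike \<open>v\<close>, \<open>w\<close> lie in the same cone iff \<open>g(v, w) < 0\<close>.\<close>

definition is_time_orientation :: "'a spacetime \<Rightarrow> ('a, plane) vfield set \<Rightarrow> bool" where
  "is_time_orientation M \<T> \<longleftrightarrow>
     (\<exists>T. timelike_field M T \<and>
        \<T> = {T'. timelike_field M T' \<and>
               (\<forall>c\<in>atlas M. \<forall>p\<in>fst c. lmetric M c p (T c p) (T' c p) < 0)})"

definition oriented_spacetime :: "'a spacetime \<Rightarrow> bool" where
  "oriented_spacetime M \<longleftrightarrow>
     smooth_manifold M \<and> lorentzian_metric M \<and>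
     is_orientation M (orientation M) \<and> is_time_orientation M (time_orientation M)"

text \<open>
  The next four predicates are used only for nonzero null vectors; their truth value there does
  not depend on the representatives \<open>T\<close> and \<open>\<Omega>\<close>.
\<close>

definition future_directed :: "'a spacetime \<Rightarrow> ('a, plane) chart \<Rightarrow> 'a \<Rightarrow> plane \<Rightarrow> bool" where
  "future_directed M c p v \<longleftrightarrow> (\<exists>T\<in>time_orientation M. lmetric M c p (T c p) v < 0)"

definition past_directed :: "'a spacetime \<Rightarrow> ('a, plane) chart \<Rightarrow> 'a \<Rightarrow> plane \<Rightarrow> bool" where
  "past_directed M c p v \<longleftrightarrow> (\<exists>T\<in>time_orientation M. lmetric M c p (T c p) v > 0)"

definition right_pointing :: "'a spacetime \<Rightarrow> ('a, plane) chart \<Rightarrow> 'a \<Rightarrow> plane \<Rightarrow> bool" where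
  "right_pointing M c p v \<longleftrightarrow>
     (\<exists>T\<in>time_orientation M. \<exists>\<Omega>\<in>orientation M. \<Omega> c p (T c p) v > 0)"

definition left_pointing :: "'a spacetime \<Rightarrow> ('a, plane) chart \<Rightarrow> 'a \<Rightarrow> plane \<Rightarrow> bool" where
  "left_pointing M c p v \<longleftrightarrow>
     (\<exists>T\<in>time_orientation M. \<exists>\<Omega>\<in>orientation M. \<Omega> c p (T c p) v < 0)"

definition null_vector :: "'a spacetime \<Rightarrow> ('a, plane) chart \<Rightarrow> 'a \<Rightarrow> plane \<Rightarrow> bool" where
  "null_vector M c p v \<longleftrightarrow> v \<noteq> 0 \<and> lmetric M c p v v = 0"

definition future_right_null :: "'a spacetime \<Rightarrow> ('a, plane) chart \<Rightarrow> 'a \<Rightarrow> plane \<Rightarrow> bool" where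
  "future_right_null M c p v \<longleftrightarrow>
     null_vector M c p v \<and> future_directed M c p v \<and> right_pointing M c p v"

definition past_left_null :: "'a spacetime \<Rightarrow> ('a, plane) chart \<Rightarrow> 'a \<Rightarrow> plane \<Rightarrow> bool" where
  "past_left_null M c p v \<longleftrightarrow>
     null_vector M c p v \<and> past_directed M c p v \<and> left_pointing M c p v"

section \<open>Right-chiral curves and Cauchy surfaces\<close>

text \<open>At end points belonging to \<open>I\<close>, smoothness means existence of a smooth local extension.\<close>

definition smooth_curve ::
  "('a, 'e::euclidean_space, 'z) manifold_scheme \<Rightarrow> real set \<Rightarrow> (real \<Rightarrow> 'a) \<Rightarrow> bool" where
  "smooth_curve M I \<gamma> \<longleftrightarrow>
     \<gamma> ` I \<subseteq> points M \<and>
     (\<forall>t\<in>I. \<forall>c\<in>atlas M. \<gamma> t \<in> fst c \<longrightarrow>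
        (\<exists>J h. open J \<and> t \<in> J \<and> \<gamma> ` (I \<inter> J) \<subseteq> fst c \<and> smooth_on J h \<and>
               (\<forall>s\<in>I \<inter> J. snd c (\<gamma> s) = h s)))"

definition proper_interval :: "real set \<Rightarrow> bool" where
  "proper_interval I \<longleftrightarrow> is_interval I \<and> interior I \<noteq> {}"

definition velocity_everywhere ::
  "'a spacetime \<Rightarrow> (('a, plane) chart \<Rightarrow> 'a \<Rightarrow> plane \<Rightarrow> bool) \<Rightarrow>
   real set \<Rightarrow> (real \<Rightarrow> 'a) \<Rightarrow> bool" where
  "velocity_everywhere M P I \<gamma> \<longleftrightarrow>
     (\<forall>t\<in>interior I. \<forall>c\<in>atlas M. \<gamma> t \<in> fst c \<longrightarrow>
        P c (\<gamma> t) (vector_derivative (snd c \<circ> \<gamma>) (at t)))"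

definition right_moving_curve :: "'a spacetime \<Rightarrow> real set \<Rightarrow> (real \<Rightarrow> 'a) \<Rightarrow> bool" where
  "right_moving_curve M I \<gamma> \<longleftrightarrow>
     proper_interval I \<and> smooth_curve M I \<gamma> \<and> velocity_everywhere M (future_right_null M) I \<gamma>"

definition right_chiral_curve :: "'a spacetime \<Rightarrow> real set \<Rightarrow> (real \<Rightarrow> 'a) \<Rightarrow> bool" where
  "right_chiral_curve M I \<gamma> \<longleftrightarrow>
     proper_interval I \<and> smooth_curve M I \<gamma> \<and>
     (velocity_everywhere M (future_right_null M) I \<gamma> \<or>
      velocity_everywhere M (past_left_null M) I \<gamma>)"

definition to_left_end :: "real set \<Rightarrow> real filter" where
  "to_left_end I = (if bdd_below I then at_right (Inf I) else at_bot)"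

definition to_right_end :: "real set \<Rightarrow> real filter" where
  "to_right_end I = (if bdd_above I then at_left (Sup I) else at_top)"

definition inextendable :: "'a spacetime \<Rightarrow> real set \<Rightarrow> (real \<Rightarrow> 'a) \<Rightarrow> bool" where
  "inextendable M I \<gamma> \<longleftrightarrow>
     (\<nexists>p. limitin (mtop M) \<gamma> p (to_left_end I)) \<and>
     (\<nexists>p. limitin (mtop M) \<gamma> p (to_right_end I))"

definition chi :: "'a spacetime \<Rightarrow> 'a rel" where
  "chi M = {(p, q). p \<in> points M \<and> q \<in> points M \<and>
     (p = q \<or> (\<exists>\<gamma>. right_moving_curve M {0..1} \<gamma> \<and> \<gamma> 0 = p \<and> \<gamma> 1 = q))}"

definition schi :: "'a spacetime \<Rightarrow> 'a rel" where
  "schi M = chi M \<union> (chi M)\<inverse>"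

definition embedded_curve :: "'a spacetime \<Rightarrow> 'a set \<Rightarrow> bool" where
  "embedded_curve M S \<longleftrightarrow>
     S \<subseteq> points M \<and>
     (\<forall>p\<in>S. \<exists>c\<in>atlas M. p \<in> fst c \<and>
        snd c ` (S \<inter> fst c) = snd c ` fst c \<inter> {x. snd x = 0})"

definition chi_cauchy_surface :: "'a spacetime \<Rightarrow> 'a set \<Rightarrow> bool" where
  "chi_cauchy_surface M S \<longleftrightarrow>
     embedded_curve M S \<and>
     (\<forall>I \<gamma>. right_chiral_curve M I \<gamma> \<and> inextendable M I \<gamma> \<longrightarrow> (\<exists>!t. t \<in> I \<and> \<gamma> t \<in> S))"

definition chi_initial :: "'a spacetime \<Rightarrow> bool" where
  "chi_initial M \<longleftrightarrow> (\<exists>S. chi_cauchy_surface M S)"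

text \<open>
  \<open>right_chiral_form_on M W \<eta>\<close>: on the open set \<open>W\<close>, \<open>\<eta>\<close> is a right-chiral 1-form; here
  \<open>X\<close> is \<open>\<eta>\<^sup>\<sharp>\<close>.
\<close>

definition right_chiral_form_on ::
  "'a spacetime \<Rightarrow> 'a set \<Rightarrow> ('a, plane) covector_field \<Rightarrow> bool" where
  "right_chiral_form_on M W \<eta> \<longleftrightarrow>
     (\<exists>X. smooth_vector_field_on M W X \<and>
        (\<forall>c\<in>atlas M. \<forall>p\<in>W \<inter> fst c.
           (\<forall>v. \<eta> c p v = lmetric M c p (X c p) v) \<and> future_right_null M c p (X c p)))"

section \<open>Categories and functors\<close>

text \<open>
  Morphisms are tagged by their source and target: \<open>Cmp C L M N g f\<close> is the composite of
  \<open>f : L \<rightarrow> M\<close> and \<open>g : M \<rightarrow> N\<close>. In the concrete categories below, morphisms are functions that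
  are \<open>undefined\<close> off the underlying set of the source.
\<close>

record ('o, 'm) cat =
  Obj :: "'o set"
  Hom :: "'o \<Rightarrow> 'o \<Rightarrow> 'm set"
  Idt :: "'o \<Rightarrow> 'm"
  Cmp :: "'o \<Rightarrow> 'o \<Rightarrow> 'o \<Rightarrow> 'm \<Rightarrow> 'm \<Rightarrow> 'm"

record ('o, 'm, 'p, 'n) func =
  fobj :: "'o \<Rightarrow> 'p"
  fmap :: "'o \<Rightarrow> 'o \<Rightarrow> 'm \<Rightarrow> 'n"

definition is_functor :: "('o, 'm) cat \<Rightarrow> ('p, 'n) cat \<Rightarrow> ('o, 'm, 'p, 'n) func \<Rightarrow> bool" where
  "is_functor C D F \<longleftrightarrow>
     (\<forall>M\<in>Obj C. fobj F M \<in> Obj D) \<and>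
     (\<forall>M\<in>Obj C. \<forall>N\<in>Obj C. \<forall>f\<in>Hom C M N. fmap F M N f \<in> Hom D (fobj F M) (fobj F N)) \<and>
     (\<forall>M\<in>Obj C. fmap F M M (Idt C M) = Idt D (fobj F M)) \<and>
     (\<forall>L\<in>Obj C. \<forall>M\<in>Obj C. \<forall>N\<in>Obj C. \<forall>f\<in>Hom C L M. \<forall>g\<in>Hom C M N.
        fmap F L N (Cmp C L M N g f) =
        Cmp D (fobj F L) (fobj F M) (fobj F N) (fmap F M N g) (fmap F L M f))"

definition functor_comp ::
  "('p, 'n, 'q, 'k) func \<Rightarrow> ('o, 'm, 'p, 'n) func \<Rightarrow> ('o, 'm, 'q, 'k) func"
  (infixr \<open>\<circ>\<^sub>F\<close> 55) where
  "G \<circ>\<^sub>F F = \<lparr>fobj = (\<lambda>M. fobj G (fobj F M)),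
            fmap = (\<lambda>M N f. fmap G (fobj F M) (fobj F N) (fmap F M N f))\<rparr>"

definition is_iso :: "('o, 'm) cat \<Rightarrow> 'o \<Rightarrow> 'o \<Rightarrow> 'm \<Rightarrow> bool" where
  "is_iso C M N f \<longleftrightarrow>
     f \<in> Hom C M N \<and>
     (\<exists>g\<in>Hom C N M. Cmp C M N M g f = Idt C M \<and> Cmp C N M N f g = Idt C N)"

text \<open>A relation on morphisms \<open>f1 : M1 \<rightarrow> N\<close>, \<open>f2 : M2 \<rightarrow> N\<close> is written \<open>R M1 M2 N f1 f2\<close>.\<close>

type_synonym ('o, 'm) cospan_rel = "'o \<Rightarrow> 'o \<Rightarrow> 'o \<Rightarrow> 'm \<Rightarrow> 'm \<Rightarrow> bool"

definition overlap_monic ::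
  "('o, 'm) cat \<Rightarrow> ('o, 'm) cospan_rel \<Rightarrow> 'o \<Rightarrow> 'o \<Rightarrow> 'm \<Rightarrow> bool" where
  "overlap_monic C R M N h \<longleftrightarrow>
     (\<forall>M1\<in>Obj C. \<forall>M2\<in>Obj C. \<forall>f1\<in>Hom C M1 M. \<forall>f2\<in>Hom C M2 M.
        R M1 M2 M f1 f2 \<longrightarrow> R M1 M2 N (Cmp C M1 M N h f1) (Cmp C M2 M N h f2))"

section \<open>The category of chiral spacetimes\<close>

definition conformal_map :: "'a spacetime \<Rightarrow> 'a spacetime \<Rightarrow> ('a \<Rightarrow> 'a) \<Rightarrow> bool" where
  "conformal_map M N f \<longleftrightarrow>
     smooth_map M N f \<and>
     (\<exists>\<omega>. smooth_function M \<omega> \<and>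
        (\<forall>c\<in>atlas M. \<forall>d\<in>atlas N. \<forall>p\<in>fst c. f p \<in> fst d \<longrightarrow>
           (\<forall>v w. lmetric N d (f p) (mdiff c d f p v) (mdiff c d f p w) =
                  exp (\<omega> p) * lmetric M c p v w)))"

definition preserves_orientation :: "'a spacetime \<Rightarrow> 'a spacetime \<Rightarrow> ('a \<Rightarrow> 'a) \<Rightarrow> bool" where
  "preserves_orientation M N f \<longleftrightarrow>
     (\<forall>\<Omega>\<in>orientation M. \<forall>\<Omega>'\<in>orientation N.
        \<forall>c\<in>atlas M. \<forall>d\<in>atlas N. \<forall>p\<in>fst c. f p \<in> fst d \<longrightarrow>
          (\<exists>k>0. \<forall>v w. \<Omega>' d (f p) (mdiff c d f p v) (mdiff c d f p w) = k * \<Omega> c p v w))"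

definition preserves_time_orientation ::
  "'a spacetime \<Rightarrow> 'a spacetime \<Rightarrow> ('a \<Rightarrow> 'a) \<Rightarrow> bool" where
  "preserves_time_orientation M N f \<longleftrightarrow>
     (\<forall>T\<in>time_orientation M. \<forall>T'\<in>time_orientation N.
        \<forall>c\<in>atlas M. \<forall>d\<in>atlas N. \<forall>p\<in>fst c. f p \<in> fst d \<longrightarrow>
          lmetric N d (f p) (T' d (f p)) (mdiff c d f p (T c p)) < 0)"

definition Conf :: "('a spacetime, 'a \<Rightarrow> 'a) cat" where
  "Conf = \<lparr>Obj = {M. oriented_spacetime M},
           Hom = (\<lambda>M N. {f \<in> extensional (points M). conformal_map M N f \<and>
                          preserves_orientation M N f \<and> preserves_time_orientation M N f}),
           Idt = (\<lambda>M. restrict (\<lambda>p. p) (points M)),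
           Cmp = (\<lambda>L M N g f. compose (points L) g f)\<rparr>"

definition orth_chi :: "('a spacetime, 'a \<Rightarrow> 'a) cospan_rel" where
  "orth_chi M1 M2 N f1 f2 \<longleftrightarrow> schi N \<inter> ((f1 ` points M1) \<times> (f2 ` points M2)) = {}"

definition chiLoc :: "('a spacetime, 'a \<Rightarrow> 'a) cat" where
  "chiLoc = \<lparr>Obj = {M \<in> Obj Conf. chi_initial M},
             Hom = (\<lambda>M N. {f \<in> Hom Conf M N. overlap_monic Conf orth_chi M N f}),
             Idt = Idt Conf,
             Cmp = Cmp Conf\<rparr>"

definition chi_cauchy_map :: "'a spacetime \<Rightarrow> 'a spacetime \<Rightarrow> ('a \<Rightarrow> 'a) \<Rightarrow> bool" where
  "chi_cauchy_map M N f \<longleftrightarrow>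
     f \<in> Hom Conf M N \<and> (\<exists>S. chi_cauchy_surface N S \<and> S \<subseteq> f ` points M)"

section \<open>Oriented one-dimensional manifolds\<close>

text \<open>
  The orientation is given by the maximal set of positively oriented charts. A nowhere-vanishing
  1-form represents it iff its component in every positively oriented chart is positive.
\<close>

record 'a oriented_curve = "('a, real) manifold" +
  pos_charts :: "('a, real) chart set"

definition oriented_1manifold :: "'a oriented_curve \<Rightarrow> bool" where
  "oriented_1manifold X \<longleftrightarrow>
     smooth_manifold X \<and>
     pos_charts X \<subseteq> atlas X \<and>
     (\<Union>c\<in>pos_charts X. fst c) = points X \<and>
     (\<forall>c\<in>pos_charts X. \<forall>d\<in>pos_charts X. \<forall>p\<in>fst c \<inter> fst d. mdiff c d (\<lambda>q. q) p 1 > 0) \<and>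
     (\<forall>c\<in>atlas X. (\<forall>d\<in>pos_charts X. \<forall>p\<in>fst c \<inter> fst d. mdiff c d (\<lambda>q. q) p 1 > 0) \<longrightarrow>
        c \<in> pos_charts X)"

definition preserves_orientation1 ::
  "'a oriented_curve \<Rightarrow> 'a oriented_curve \<Rightarrow> ('a \<Rightarrow> 'a) \<Rightarrow> bool" where
  "preserves_orientation1 X Y f \<longleftrightarrow>
     (\<forall>c\<in>pos_charts X. \<forall>d\<in>pos_charts Y. \<forall>p\<in>fst c. f p \<in> fst d \<longrightarrow> mdiff c d f p 1 > 0)"

definition Emb1 :: "('a oriented_curve, 'a \<Rightarrow> 'a) cat" where
  "Emb1 = \<lparr>Obj = {X. oriented_1manifold X},
           Hom = (\<lambda>X Y. {f \<in> extensional (points X). inj_on f (points X) \<and>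
                          local_diffeo X Y f \<and> preserves_orientation1 X Y f}),
           Idt = (\<lambda>X. restrict (\<lambda>p. p) (points X)),
           Cmp = (\<lambda>X Y Z g f. compose (points X) g f)\<rparr>"

definition orth_set :: "('a oriented_curve, 'a \<Rightarrow> 'a) cospan_rel" where
  "orth_set X1 X2 Y g1 g2 \<longleftrightarrow> g1 ` points X1 \<inter> g2 ` points X2 = {}"

section \<open>The quotient functor\<close>

definition chi_proj :: "'a spacetime \<Rightarrow> 'a \<Rightarrow> 'a set" where
  "chi_proj M p = schi M `` {p}"

text \<open>
  The orientation clause is the orientation by the 1-forms \<open>\<omega>\<close> with \<open>\<pi>\<^sub>M\<^sup>*\<omega>\<close> right-chiral, read
  off chart by chart: with \<open>W\<close> the preimage of the domain of \<open>d\<close> and \<open>x\<close> the coordinate of \<open>d\<close>,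
  the form \<open>\<lambda>c p. mdiff c d (chi_proj M) p\<close> on \<open>W\<close> is \<open>\<pi>\<^sub>M\<^sup>*(dx)\<close>, and \<open>d\<close> is positively
  oriented iff \<open>\<omega> = dx\<close> is such a 1-form.
\<close>

definition is_chi_quotient :: "'a spacetime \<Rightarrow> 'a set oriented_curve \<Rightarrow> bool" where
  "is_chi_quotient M X \<longleftrightarrow>
     oriented_1manifold X \<and>
     points X = points M // schi M \<and>
     submersion M X (chi_proj M) \<and>
     pos_charts X = {d \<in> atlas X.
       right_chiral_form_on M {p \<in> points M. chi_proj M p \<in> fst d}
         (\<lambda>c p. mdiff c d (chi_proj M) p)}"

definition chi_Q :: "('a spacetime, 'a \<Rightarrow> 'a, 'a set oriented_curve, 'a set \<Rightarrow> 'a set) func" where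
  "chi_Q = \<lparr>fobj = (\<lambda>M. THE X. is_chi_quotient M X),
        fmap = (\<lambda>M N f. \<lambda>x\<in>points M // schi M. \<Union>p\<in>x. chi_proj N (f p))\<rparr>"

section \<open>Observable algebras\<close>

record 'c star_algebra = "(complex, 'c) module" +
  star :: "'c \<Rightarrow> 'c"

definition is_star_algebra :: "'c star_algebra \<Rightarrow> bool" where
  "is_star_algebra A \<longleftrightarrow>
     ring A \<and>
     (\<forall>a. \<forall>x\<in>carrier A. a \<odot>\<^bsub>A\<^esub> x \<in> carrier A) \<and>
     (\<forall>a b. \<forall>x\<in>carrier A. (a + b) \<odot>\<^bsub>A\<^esub> x = a \<odot>\<^bsub>A\<^esub> x \<oplus>\<^bsub>A\<^esub> b \<odot>\<^bsub>A\<^esub> x) \<and>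
     (\<forall>a. \<forall>x\<in>carrier A. \<forall>y\<in>carrier A. a \<odot>\<^bsub>A\<^esub> (x \<oplus>\<^bsub>A\<^esub> y) = a \<odot>\<^bsub>A\<^esub> x \<oplus>\<^bsub>A\<^esub> a \<odot>\<^bsub>A\<^esub> y) \<and>
     (\<forall>a b. \<forall>x\<in>carrier A. (a * b) \<odot>\<^bsub>A\<^esub> x = a \<odot>\<^bsub>A\<^esub> (b \<odot>\<^bsub>A\<^esub> x)) \<and>
     (\<forall>x\<in>carrier A. 1 \<odot>\<^bsub>A\<^esub> x = x) \<and>
     (\<forall>a. \<forall>x\<in>carrier A. \<forall>y\<in>carrier A.
        (a \<odot>\<^bsub>A\<^esub> x) \<otimes>\<^bsub>A\<^esub> y = a \<odot>\<^bsub>A\<^esub> (x \<otimes>\<^bsub>A\<^esub> y) \<and> x \<otimes>\<^bsub>A\<^esub> (a \<odot>\<^bsub>A\<^esub> y) = a \<odot>\<^bsub>A\<^esub> (x \<otimes>\<^bsub>A\<^esub> y)) \<and>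
     (\<forall>x\<in>carrier A. star A x \<in> carrier A \<and> star A (star A x) = x) \<and>
     (\<forall>x\<in>carrier A. \<forall>y\<in>carrier A.
        star A (x \<oplus>\<^bsub>A\<^esub> y) = star A x \<oplus>\<^bsub>A\<^esub> star A y \<and>
        star A (x \<otimes>\<^bsub>A\<^esub> y) = star A y \<otimes>\<^bsub>A\<^esub> star A x) \<and>
     (\<forall>a. \<forall>x\<in>carrier A. star A (a \<odot>\<^bsub>A\<^esub> x) = cnj a \<odot>\<^bsub>A\<^esub> star A x)"

text \<open>Unit preservation is part of \<open>ring_hom\<close>.\<close>

definition Obs :: "('c star_algebra, 'c \<Rightarrow> 'c) cat" where
  "Obs = \<lparr>Obj = {A. is_star_algebra A},
          Hom = (\<lambda>A B. {f \<in> extensional (carrier A). f \<in> ring_hom A B \<and>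
                   (\<forall>a. \<forall>x\<in>carrier A. f (a \<odot>\<^bsub>A\<^esub> x) = a \<odot>\<^bsub>B\<^esub> f x) \<and>
                   (\<forall>x\<in>carrier A. f (star A x) = star B (f x))}),
          Idt = (\<lambda>A. restrict (\<lambda>x. x) (carrier A)),
          Cmp = (\<lambda>A B C g f. compose (carrier A) g f)\<rparr>"

definition causality_axiom ::
  "('o, 'm) cat \<Rightarrow> ('o, 'm) cospan_rel \<Rightarrow> ('o, 'm, 'c star_algebra, 'c \<Rightarrow> 'c) func \<Rightarrow> bool" where
  "causality_axiom D R B \<longleftrightarrow>
     (\<forall>M1\<in>Obj D. \<forall>M2\<in>Obj D. \<forall>N\<in>Obj D. \<forall>f1\<in>Hom D M1 N. \<forall>f2\<in>Hom D M2 N.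
        R M1 M2 N f1 f2 \<longrightarrow>
        (\<forall>a1\<in>carrier (fobj B M1). \<forall>a2\<in>carrier (fobj B M2).
           let x = fmap B M1 N f1 a1; y = fmap B M2 N f2 a2
           in (x \<otimes>\<^bsub>fobj B N\<^esub> y) \<ominus>\<^bsub>fobj B N\<^esub> (y \<otimes>\<^bsub>fobj B N\<^esub> x) = \<zero>\<^bsub>fobj B N\<^esub>))"

definition chiral_time_slice_axiom ::
  "('a spacetime, 'a \<Rightarrow> 'a, 'c star_algebra, 'c \<Rightarrow> 'c) func \<Rightarrow> bool" where
  "chiral_time_slice_axiom B \<longleftrightarrow>
     (\<forall>M\<in>Obj chiLoc. \<forall>N\<in>Obj chiLoc. \<forall>f\<in>Hom chiLoc M N.
        chi_cauchy_map M N f \<longrightarrow> is_iso Obs (fobj B M) (fobj B N) (fmap B M N f))"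

end

theory Submission
  imports Defs
begin

text \<open>
  Flow boxes for the future-directed right-pointing null field show that the classes of \<open>schi M\<close> are
  the orbits of its flow. A maximal flow line is inextendable, so it meets a Cauchy surface exactly
  once; transversals through the surface then make the leaf space a Hausdorff paracompact
  1-manifold with smooth submersive projection, the only such structure.

  A conformal map that preserves both orientations sends right-moving curves to right-moving curves
  and hence induces a smooth map of leaf spaces with positive derivative. It is injective because
  overlap-monicity, applied to inclusions of small open sets around distinct leaves, keeps the leaves
  apart. If the image contains a Cauchy surface, then it meets every leaf, so the induced map is
  bijective and thus an isomorphism. Functors preserve isomorphisms, and orthogonality of two maps
  for \<open>schi N\<close> says exactly that the induced maps have disjoint images.
\<close>

section \<open>Calculus of smooth maps\<close>

text \<open>The obstacle is that a Cauchy surface may be tangent to the null direction, like a cubic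
  graph at its inflection, so the surface's own coordinate need not be a smooth chart of the leaf
  space. What remains is that the transverse coordinate of a flow box is continuous and injective
  along the surface, hence open by invariance of domain in dimension one. This gives the topology;
  the smooth charts are taken from the transverse coordinates themselves.

  In charts where the null field is the constant \<open>(0, 1)\<close>, transition maps commute with
  small vertical translations. Flow lines can therefore be defined as curves that are locally
  unit-speed vertical translations, and their uniqueness, gluing and propagation along leaves become
  connectedness arguments on intervals.

  Smoothness on the leaf space is always tested after pulling back along the projection. This
  determines the atlas without choices, forces uniqueness of the structure, and reduces smoothness
  of induced maps to smoothness upstairs. Orientations are compared by the sign of the pulled-back
  coordinate form on a timelike field.\<close>

lemma Ck_on_cong:
  assumes "open S" "\<And>x. x \<in> S \<Longrightarrow> f x = g x"
  shows "Ck_on k S f \<longleftrightarrow> Ck_on k S g"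
  using assms(2)
proof (induction k arbitrary: f g)
  case 0
  then show ?case unfolding Ck_on.simps by (rule continuous_on_cong[OF refl])
next
  case (Suc k)
  have *: "(f has_derivative D) (at x) \<longleftrightarrow> (g has_derivative D) (at x)" if "x \<in> S" for x D
  proof
    show "(g has_derivative D) (at x)" if "(f has_derivative D) (at x)"
      by (rule has_derivative_transform_within_open[OF that assms(1) \<open>x \<in> S\<close>]) (rule Suc.prems)
    show "(f has_derivative D) (at x)" if "(g has_derivative D) (at x)"
      by (rule has_derivative_transform_within_open[OF that assms(1) \<open>x \<in> S\<close>])
        (simp add: Suc.prems)
  qed
  have "frechet_derivative f (at x) = frechet_derivative g (at x)" if "x \<in> S" for x
    unfolding frechet_derivative_def using * that by simp
  then have "Ck_on k S (\<lambda>x. frechet_derivative f (at x) v) \<longleftrightarrow>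
      Ck_on k S (\<lambda>x. frechet_derivative g (at x) v)" for v
    by (intro Suc.IH) simp
  moreover have "f differentiable_on S \<longleftrightarrow> g differentiable_on S"
    using * by (auto simp: differentiable_on_def differentiable_def at_within_open[OF _ assms(1)])
  ultimately show ?case by simp
qed

text \<open>The step of all inductions on the order: a derivative known in closed form takes the
  place of \<open>frechet_derivative\<close>, so that closure properties already proved at order
  \<open>k\<close> apply to it.\<close>

lemma Ck_onI:
  assumes "open S" "\<And>x. x \<in> S \<Longrightarrow> (f has_derivative f' x) (at x)"
    "\<And>v. Ck_on k S (\<lambda>x. f' x v)"
  shows "Ck_on (Suc k) S f"
proof -
  have "f differentiable_on S"
    unfolding differentiable_on_def
    using assms(2) differentiable_at_withinI differentiable_def by blast
  moreover have "frechet_derivative f (at x) = f' x" if "x \<in> S" for x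
    using frechet_derivative_at[OF assms(2)[OF that]] by simp
  then have "Ck_on k S (\<lambda>x. frechet_derivative f (at x) v)" for v
    using assms(3)[of v] Ck_on_cong[OF assms(1), of "\<lambda>x. frechet_derivative f (at x) v" "\<lambda>x. f' x v"] by simp
  ultimately show ?thesis by simp
qed

lemma Ck_on_has_derivative:
  assumes "Ck_on (Suc k) S f" "open S" "x \<in> S"
  shows "(f has_derivative frechet_derivative f (at x)) (at x)"
  using assms by (metis Ck_on.simps(2) at_within_open differentiable_on_def frechet_derivative_works)

lemma Ck_on_Suc_imp: "Ck_on (Suc k) S f \<Longrightarrow> Ck_on k S f"
proof (induction k arbitrary: f)
  case 0
  then show ?case by (simp add: differentiable_imp_continuous_on)
next
  case (Suc k)
  then show ?case by (metis Ck_on.simps(2))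
qed

lemma Ck_on_imp_continuous_on: "Ck_on k S f \<Longrightarrow> continuous_on S f"
  by (cases k) (auto intro: differentiable_imp_continuous_on)

lemma Ck_on_subset: "Ck_on k S f \<Longrightarrow> T \<subseteq> S \<Longrightarrow> Ck_on k T f"
proof (induction k arbitrary: f)
  case 0
  then show ?case by (simp add: continuous_on_subset)
next
  case (Suc k)
  then show ?case by (auto intro: differentiable_on_subset)
qed

lemma Ck_on_local:
  assumes "\<And>x. x \<in> S \<Longrightarrow> \<exists>U. open U \<and> x \<in> U \<and> Ck_on k U f"
  shows "Ck_on k S f"
  using assms
proof (induction k arbitrary: f)
  case 0
  have "continuous (at x) f" if "x \<in> S" for x
    using 0[OF that] continuous_on_eq_continuous_at by auto
  then show ?case by (simp add: continuous_at_imp_continuous_on)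
next
  case (Suc k)
  have "f differentiable (at x)" if "x \<in> S" for x
    using Suc.prems[OF that] by (metis Ck_on.simps(2) at_within_open differentiable_on_def)
  moreover have "Ck_on k S (\<lambda>x. frechet_derivative f (at x) v)" for v
    by (rule Suc.IH) (use Suc.prems in fastforce)
  ultimately show ?case
    by (auto simp: differentiable_on_def intro: differentiable_at_withinI)
qed

lemma Ck_on_const: "open S \<Longrightarrow> Ck_on k S (\<lambda>x. c)"
proof (induction k arbitrary: c)
  case (Suc k)
  show ?case by (rule Ck_onI[where f' = "\<lambda>x v. 0"]) (use Suc in auto)
qed simp

lemma Ck_on_linear:
  assumes "open S" "bounded_linear h" shows "Ck_on k S h"
proof (cases k)
  case 0
  then show ?thesis using assms by (simp add: linear_continuous_on)
next
  case (Suc j)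
  show ?thesis unfolding Suc
    by (rule Ck_onI[where f' = "\<lambda>x. h"])
      (use assms in \<open>auto intro: Ck_on_const bounded_linear_imp_has_derivative\<close>)
qed

lemma Ck_on_linear_comp:
  assumes "open S" "bounded_linear h" "Ck_on k S f"
  shows "Ck_on k S (\<lambda>x. h (f x))"
  using assms(3)
proof (induction k arbitrary: f)
  case 0
  then show ?case using bounded_linear.continuous_on[OF assms(2)] by simp
next
  case (Suc k)
  show ?case
    by (rule Ck_onI[OF assms(1) bounded_linear.has_derivative[OF assms(2)
          Ck_on_has_derivative[OF Suc.prems assms(1)]]])
      (use Suc in auto)
qed

lemma Ck_on_add:
  assumes "open S" "Ck_on k S f" "Ck_on k S g"
  shows "Ck_on k S (\<lambda>x. f x + g x)"
  using assms(2,3)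
proof (induction k arbitrary: f g)
  case 0
  then show ?case by (simp add: continuous_on_add)
next
  case (Suc k)
  show ?case
    by (rule Ck_onI[OF assms(1) has_derivative_add[OF Ck_on_has_derivative[OF Suc.prems(1) assms(1)]
          Ck_on_has_derivative[OF Suc.prems(2) assms(1)]]])
      (use Suc in auto)
qed

lemma Ck_on_sum:
  assumes "open S" "\<And>i. i \<in> A \<Longrightarrow> Ck_on k S (f i)"
  shows "Ck_on k S (\<lambda>x. \<Sum>i\<in>A. f i x)"
proof (cases "finite A")
  case True
  then show ?thesis using assms(2)
    by (induction A rule: finite_induct) (auto intro: Ck_on_const Ck_on_add assms(1))
qed (simp add: Ck_on_const assms(1))

lemma Ck_on_bilinear:
  assumes "open S" "bounded_bilinear pr" "Ck_on k S f" "Ck_on k S g"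
  shows "Ck_on k S (\<lambda>x. pr (f x) (g x))"
  using assms(3,4)
proof (induction k arbitrary: f g)
  case 0
  then show ?case using bounded_bilinear.continuous_on[OF assms(2)] by simp
next
  case (Suc k)
  have "Ck_on k S f" "Ck_on k S g" using Suc.prems Ck_on_Suc_imp by blast+
  then show ?case using Suc
    by (intro Ck_onI[OF assms(1) bounded_bilinear.FDERIV[OF assms(2)
          Ck_on_has_derivative[OF Suc.prems(1) assms(1)]
          Ck_on_has_derivative[OF Suc.prems(2) assms(1)]]] Ck_on_add assms(1)) auto
qed

lemma Ck_on_Pair:
  assumes "open S" "Ck_on k S f" "Ck_on k S g"
  shows "Ck_on k S (\<lambda>x. (f x, g x))"
  using assms(2,3)
proof (induction k arbitrary: f g)
  case 0
  then show ?case by (simp add: continuous_on_Pair)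
next
  case (Suc k)
  show ?case
    by (rule Ck_onI[OF assms(1) has_derivative_Pair[OF Ck_on_has_derivative[OF Suc.prems(1) assms(1)]
          Ck_on_has_derivative[OF Suc.prems(2) assms(1)]]])
      (use Suc in auto)
qed

text \<open>\<open>Ck_on\<close> differentiates in fixed directions only. Expanding a varying
  direction in the basis turns a derivative applied to it into a finite sum of products with
  fixed-direction derivatives.\<close>

lemma linear_Basis_expand:
  fixes D :: "'b::euclidean_space \<Rightarrow> 'c::real_normed_vector"
  assumes "linear D" shows "D w = (\<Sum>i\<in>Basis. (w \<bullet> i) *\<^sub>R D i)"
proof -
  have "D w = D (\<Sum>i\<in>Basis. (w \<bullet> i) *\<^sub>R i)" by (simp add: euclidean_representation)
  then show ?thesis using assms by (simp add: linear_sum linear_scale)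
qed

text \<open>The chain rule applies the outer derivative to the direction \<open>?f' x v\<close>,
  which moves with \<open>x\<close>. After expansion in the basis every factor is of order
  \<open>k\<close>, by induction for the outer derivatives composed with \<open>f\<close>.\<close>

lemma Ck_on_compose:
  fixes f :: "'a::real_normed_vector \<Rightarrow> 'b::euclidean_space" and g :: "'b \<Rightarrow> 'c::real_normed_vector"
  assumes "open S" "open T" "Ck_on k S f" "Ck_on k T g" "f ` S \<subseteq> T"
  shows "Ck_on k S (\<lambda>x. g (f x))"
  using assms(3,4)
proof (induction k arbitrary: g)
  case 0
  then show ?case using assms(5) by (auto intro: continuous_on_compose2)
next
  case (Suc k)
  have f: "Ck_on k S f" using Suc.prems Ck_on_Suc_imp by blast
  let ?f' = "\<lambda>x. frechet_derivative f (at x)" and ?g' = "\<lambda>x. frechet_derivative g (at x)"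
  have g: "(g has_derivative ?g' y) (at y)" if "y \<in> T" for y
    using Ck_on_has_derivative[OF Suc.prems(2) assms(2) that] .
  have "((\<lambda>x. g (f x)) has_derivative (\<lambda>v. ?g' (f x) (?f' x v))) (at x)" if "x \<in> S" for x
  proof -
    have "f x \<in> T" using assms(5) that by blast
    then show ?thesis
      using diff_chain_at[OF Ck_on_has_derivative[OF Suc.prems(1) assms(1) that] g] 
      by (simp add: o_def)
  qed
  moreover have "?g' (f x) (?f' x v) = (\<Sum>i\<in>Basis. (?f' x v \<bullet> i) *\<^sub>R ?g' (f x) i)" if "x \<in> S" for x v
    by (rule linear_Basis_expand) (use that g assms(5) has_derivative_linear in blast)
  ultimately have *: "((\<lambda>x. g (f x)) has_derivative
      (\<lambda>v. \<Sum>i\<in>Basis. (?f' x v \<bullet> i) *\<^sub>R ?g' (f x) i)) (at x)" if "x \<in> S" for x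
    using that by (metis (no_types, lifting) ext)
  have "Ck_on k S (\<lambda>x. ?f' x v \<bullet> i)" for v i
    by (rule Ck_on_linear_comp[OF assms(1) bounded_linear_inner_left]) (use Suc.prems in simp)
  moreover have "Ck_on k S (\<lambda>x. ?g' (f x) i)" for i
    by (rule Suc.IH[OF f]) (use Suc.prems in simp)
  ultimately show ?case
    by (intro Ck_onI[OF assms(1) *] Ck_on_sum assms(1) Ck_on_bilinear[OF assms(1) bounded_bilinear_scaleR])
qed

lemma smooth_on_cong:
  assumes "open S" "\<And>x. x \<in> S \<Longrightarrow> f x = g x"
  shows "smooth_on S f \<longleftrightarrow> smooth_on S g"
  using Ck_on_cong[OF assms] by (simp add: smooth_on_def)

lemma smooth_on_eq:
  assumes "open S" "smooth_on S f" "\<And>x. x \<in> S \<Longrightarrow> f x = g x" shows "smooth_on S g"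
  using assms(2) smooth_on_cong[OF assms(1,3)] by (simp only:)

lemma smooth_on_subset: "smooth_on S f \<Longrightarrow> T \<subseteq> S \<Longrightarrow> smooth_on T f"
  unfolding smooth_on_def using Ck_on_subset by blast

lemma smooth_on_local:
  assumes "\<And>x. x \<in> S \<Longrightarrow> \<exists>U. open U \<and> x \<in> U \<and> smooth_on U f"
  shows "smooth_on S f"
  using assms unfolding smooth_on_def by (metis Ck_on_local)

lemma smooth_on_imp_continuous_on: "smooth_on S f \<Longrightarrow> continuous_on S f"
  unfolding smooth_on_def by (metis Ck_on.simps(1))

lemma smooth_on_has_derivative:
  "smooth_on S f \<Longrightarrow> open S \<Longrightarrow> x \<in> S \<Longrightarrow> (f has_derivative frechet_derivative f (at x)) (at x)"
  unfolding smooth_on_def by (metis Ck_on_has_derivative)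

lemma smooth_on_frechet: "smooth_on S f \<Longrightarrow> smooth_on S (\<lambda>x. frechet_derivative f (at x) v)"
  unfolding smooth_on_def by (metis Ck_on.simps(2))

lemma smooth_on_const: "open S \<Longrightarrow> smooth_on S (\<lambda>x. c)"
  by (simp add: smooth_on_def Ck_on_const)

lemma smooth_on_linear: "open S \<Longrightarrow> bounded_linear h \<Longrightarrow> smooth_on S h"
  by (simp add: smooth_on_def Ck_on_linear)

lemma smooth_on_linear_comp:
  "open S \<Longrightarrow> bounded_linear h \<Longrightarrow> smooth_on S f \<Longrightarrow> smooth_on S (\<lambda>x. h (f x))"
  by (simp add: smooth_on_def Ck_on_linear_comp)

lemma smooth_on_add: "open S \<Longrightarrow> smooth_on S f \<Longrightarrow> smooth_on S g \<Longrightarrow> smooth_on S (\<lambda>x. f x + g x)"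
  by (simp add: smooth_on_def Ck_on_add)

lemma smooth_on_sum:
  "open S \<Longrightarrow> (\<And>i. i \<in> A \<Longrightarrow> smooth_on S (f i)) \<Longrightarrow> smooth_on S (\<lambda>x. \<Sum>i\<in>A. f i x)"
  by (simp add: smooth_on_def Ck_on_sum)

lemma smooth_on_scaleR:
  "open S \<Longrightarrow> smooth_on S f \<Longrightarrow> smooth_on S g \<Longrightarrow> smooth_on S (\<lambda>x. f x *\<^sub>R g x)"
  by (simp add: smooth_on_def Ck_on_bilinear[OF _ bounded_bilinear_scaleR])

lemma smooth_on_mult:
  fixes f g :: "'a::real_normed_vector \<Rightarrow> real"
  shows "open S \<Longrightarrow> smooth_on S f \<Longrightarrow> smooth_on S g \<Longrightarrow> smooth_on S (\<lambda>x. f x * g x)"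
  by (simp add: smooth_on_def Ck_on_bilinear[OF _ bounded_bilinear_mult])

lemma smooth_on_Pair: "open S \<Longrightarrow> smooth_on S f \<Longrightarrow> smooth_on S g \<Longrightarrow> smooth_on S (\<lambda>x. (f x, g x))"
  by (simp add: smooth_on_def Ck_on_Pair)

lemma smooth_on_fst: "open S \<Longrightarrow> smooth_on S f \<Longrightarrow> smooth_on S (\<lambda>x. fst (f x))"
  and smooth_on_snd: "open S \<Longrightarrow> smooth_on S f \<Longrightarrow> smooth_on S (\<lambda>x. snd (f x))"
  by (rule smooth_on_linear_comp[OF _ bounded_linear_fst] smooth_on_linear_comp[OF _ bounded_linear_snd]; assumption)+

lemma smooth_on_minus: "open S \<Longrightarrow> smooth_on S f \<Longrightarrow> smooth_on S (\<lambda>x. - f x)"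
  by (rule smooth_on_linear_comp[OF _ bounded_linear_minus[OF bounded_linear_ident]])

lemma smooth_on_diff: "open S \<Longrightarrow> smooth_on S f \<Longrightarrow> smooth_on S g \<Longrightarrow> smooth_on S (\<lambda>x. f x - g x)"
  using smooth_on_add[OF _ _ smooth_on_minus, of S f g] by simp

lemma smooth_on_id: "open S \<Longrightarrow> smooth_on S (\<lambda>x. x)"
  by (rule smooth_on_linear[OF _ bounded_linear_ident])

lemma smooth_on_compose:
  fixes f :: "'a::real_normed_vector \<Rightarrow> 'b::euclidean_space"
  assumes "open S" "open T" "smooth_on S f" "smooth_on T g" "f ` S \<subseteq> T"
  shows "smooth_on S (\<lambda>x. g (f x))"
  using assms(3,4) Ck_on_compose[OF assms(1,2) _ _ assms(5)] unfolding smooth_on_def by blast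

text \<open>The derivative is a polynomial in the function itself, so order \<open>k\<close> yields
  order \<open>k + 1\<close>. The same self-reference carries the inductions for \<open>exp\<close>
  and \<open>sqrt\<close>.\<close>

lemma Ck_on_inverse_real: "Ck_on k (- {0}) (inverse :: real \<Rightarrow> real)"
proof (induction k)
  case (Suc k)
  have "open (- {0::real})" by (simp add: open_Compl)
  then show ?case using Suc
    by (intro Ck_onI[where f' = "\<lambda>x h. - (inverse x * h * inverse x)"])
      (auto intro!: has_derivative_inverse' Ck_on_bilinear[OF _ bounded_bilinear_mult] Ck_on_const
        Ck_on_linear_comp[OF _ bounded_linear_minus[OF bounded_linear_ident]])
qed (auto intro!: continuous_intros)

lemma Ck_on_inverse:
  fixes f :: "'a::real_normed_vector \<Rightarrow> real"
  assumes "open S" "Ck_on k S f" "\<And>x. x \<in> S \<Longrightarrow> f x \<noteq> 0"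
  shows "Ck_on k S (\<lambda>x. inverse (f x))"
  by (rule Ck_on_compose[OF assms(1) _ assms(2) Ck_on_inverse_real]) (use assms(3) in auto)

lemma Ck_on_divide:
  fixes f :: "'a::real_normed_vector \<Rightarrow> real"
  assumes "open S" "Ck_on k S f" "Ck_on k S g" "\<And>x. x \<in> S \<Longrightarrow> g x \<noteq> 0"
  shows "Ck_on k S (\<lambda>x. f x / g x)"
  unfolding divide_inverse
  by (intro Ck_on_bilinear[OF _ bounded_bilinear_mult] Ck_on_inverse assms)

lemma smooth_on_divide:
  fixes f :: "'a::real_normed_vector \<Rightarrow> real"
  assumes "open S" "smooth_on S f" "smooth_on S g" "\<And>x. x \<in> S \<Longrightarrow> g x \<noteq> 0"
  shows "smooth_on S (\<lambda>x. f x / g x)"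
  using assms by (simp add: smooth_on_def Ck_on_divide)

lemma Ck_on_exp: "Ck_on k UNIV (exp :: real \<Rightarrow> real)"
proof (induction k)
  case (Suc k)
  then show ?case
    by (intro Ck_onI[where f' = "\<lambda>x h. h * exp x"])
      (auto intro!: derivative_eq_intros Ck_on_bilinear[OF _ bounded_bilinear_mult] Ck_on_const)
qed (auto intro!: continuous_intros)

lemma Ck_on_sqrt: "Ck_on k {0<..} sqrt"
proof (induction k)
  case (Suc k)
  have "(sqrt has_derivative (\<lambda>h. h * (inverse (sqrt x) / 2))) (at x)" if "x \<in> {0<..}" for x
  proof -
    have "(\<lambda>h. h * (inverse (sqrt x) / 2)) = (*) (inverse (sqrt x) / 2)"
      by (simp add: fun_eq_iff)
    then show ?thesis using DERIV_real_sqrt[of x] that by (simp add: has_field_derivative_def)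
  qed
  moreover have "Ck_on k {0<..} (\<lambda>x. h * (inverse (sqrt x) / 2))" for h
    using Suc by (intro Ck_on_bilinear[OF _ bounded_bilinear_mult] Ck_on_divide Ck_on_inverse Ck_on_const) auto
  ultimately show ?case by (intro Ck_onI) auto
qed (auto intro!: continuous_intros)

lemma smooth_on_sqrt:
  assumes "open S" "smooth_on S f" "\<And>x. x \<in> S \<Longrightarrow> f x > 0"
  shows "smooth_on S (\<lambda>x. sqrt (f x))"
  by (rule smooth_on_compose[OF assms(1) _ assms(2), of "{0<..}"])
    (use assms(3) Ck_on_sqrt in \<open>auto simp: smooth_on_def\<close>)

lemma smooth_on_frechet_apply:
  fixes f :: "'a::euclidean_space \<Rightarrow> 'b::real_normed_vector"
  assumes "open S" "smooth_on S f" "smooth_on S w"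
  shows "smooth_on S (\<lambda>x. frechet_derivative f (at x) (w x))"
proof -
  have "frechet_derivative f (at x) (w x) = (\<Sum>i\<in>Basis. (w x \<bullet> i) *\<^sub>R frechet_derivative f (at x) i)"
    if "x \<in> S" for x
    by (rule linear_Basis_expand)
      (use smooth_on_has_derivative[OF assms(2,1) that] has_derivative_linear in blast)
  moreover have "smooth_on S (\<lambda>x. \<Sum>i\<in>Basis. (w x \<bullet> i) *\<^sub>R frechet_derivative f (at x) i)"
    by (intro smooth_on_sum smooth_on_scaleR smooth_on_frechet assms
        smooth_on_linear_comp[OF _ bounded_linear_inner_left])
  ultimately show ?thesis using smooth_on_cong[OF assms(1)] by (metis (no_types, lifting))
qed

section \<open>Smooth inverse functions in one and two real dimensions\<close>

lemma blinfun_derivative_continuous: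
  fixes f :: "'a::euclidean_space \<Rightarrow> 'b::real_normed_vector"
  assumes "open S" "\<And>x. x \<in> S \<Longrightarrow> (f has_derivative f' x) (at x)"
    "\<And>v. continuous_on S (\<lambda>x. f' x v)"
  shows "continuous_on S (\<lambda>x. Blinfun (f' x))"
    and "\<And>x. x \<in> S \<Longrightarrow> blinfun_apply (Blinfun (f' x)) = f' x"
proof -
  show 1: "blinfun_apply (Blinfun (f' x)) = f' x" if "x \<in> S" for x
    using assms(2)[OF that] bounded_linear_Blinfun_apply has_derivative_bounded_linear by blast
  show "continuous_on S (\<lambda>x. Blinfun (f' x))"
  \<comment> \<open>In finite dimension, continuity in each direction gives continuity as a map into
    the bounded linear maps, the form in which the inverse function theorem takes its
    hypothesis.\<close>
  proof (rule continuous_on_blinfun_componentwise)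
    show "continuous_on S (\<lambda>x. blinfun_apply (Blinfun (f' x)) i)" for i
      by (rule continuous_on_eq[OF assms(3)]) (simp add: 1)
  qed
qed

text \<open>The inverse function theorem gives an inverse that is differentiable once. The last
  clause records the equation for its derivative, from which the next two inversion lemmas bootstrap
  to all orders.\<close>

lemma local_inverse_aux:
  fixes f :: "'a::euclidean_space \<Rightarrow> 'a"
  assumes "open S" "smooth_on S f" "z \<in> S" "inj (frechet_derivative f (at z))"
  obtains U V g where "open U" "z \<in> U" "U \<subseteq> S" "open V" "f z \<in> V" "homeomorphism U V f g"
    "\<And>y. y \<in> V \<Longrightarrow> inj (frechet_derivative f (at (g y)))"
    "\<And>y. y \<in> V \<Longrightarrow> \<exists>g'. (g has_derivative g') (at y) \<and>
       (\<forall>v. frechet_derivative f (at (g y)) (g' v) = v)"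
proof -
  let ?f' = "\<lambda>x. frechet_derivative f (at x)"
  have der: "(f has_derivative ?f' x) (at x)" if "x \<in> S" for x
    using smooth_on_has_derivative[OF assms(2,1) that] .
  have cont: "continuous_on S (\<lambda>x. ?f' x v)" for v
    using smooth_on_frechet[OF assms(2)] smooth_on_imp_continuous_on by blast
  have B: "continuous_on S (\<lambda>x. Blinfun (?f' x))"
    "\<And>x. x \<in> S \<Longrightarrow> blinfun_apply (Blinfun (?f' x)) = ?f' x"
    using blinfun_derivative_continuous[OF assms(1) der cont] by auto
  have lin: "linear (?f' z)" using der[OF assms(3)] has_derivative_linear by blast
  obtain h where h: "linear h" "h \<circ> ?f' z = id"
    using linear_injective_left_inverse[OF lin assms(4)] by blast
  have X: "(f has_derivative blinfun_apply (Blinfun (?f' x))) (at x)" if "x \<in> S" for x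
    using der[OF that] B(2)[OF that] by simp
  have inv: "Blinfun h o\<^sub>L Blinfun (?f' z) = id_blinfun"
    by (rule blinfun_eqI) (use h B(2)[OF assms(3)] in
        \<open>simp add: bounded_linear_Blinfun_apply linear_conv_bounded_linear pointfree_idE\<close>)
  obtain U V g g' where *: "open U" "U \<subseteq> S" "z \<in> U" "open V" "f z \<in> V" "homeomorphism U V f g"
    "\<And>y. y \<in> V \<Longrightarrow> (g has_derivative g' y) (at y)"
    "\<And>y. y \<in> V \<Longrightarrow> g' y = inv_into UNIV (blinfun_apply (Blinfun (?f' (g y))))"
    "\<And>y. y \<in> V \<Longrightarrow> bij (blinfun_apply (Blinfun (?f' (g y))))"
    by (rule inverse_function_theorem[OF assms(1) X B(1) assms(3) inv]) blast+
  have gS: "g y \<in> S" if "y \<in> V" for y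
    using *(2,6) that homeomorphism_image2 by blast
  show ?thesis
  proof (rule that[OF *(1,3,2,4,5,6)])
    fix y assume y: "y \<in> V"
    show "inj (?f' (g y))" using *(9)[OF y] B(2)[OF gS[OF y]] bij_is_inj by metis
    show "\<exists>g'. (g has_derivative g') (at y) \<and> (\<forall>v. ?f' (g y) (g' v) = v)"
      using *(7,8,9)[OF y] B(2)[OF gS[OF y]] bij_is_surj surj_f_inv_f by metis
  qed
qed

text \<open>The derivative of the inverse is the reciprocal of the derivative of \<open>f\<close>
  composed with \<open>g\<close>, so \<open>g\<close> of order \<open>k\<close> has a derivative of
  order \<open>k\<close>.\<close>

lemma local_inverse_real:
  fixes f :: "real \<Rightarrow> real"
  assumes "open S" "smooth_on S f" "z \<in> S" "frechet_derivative f (at z) 1 \<noteq> 0"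
  obtains U V g where "open U" "z \<in> U" "U \<subseteq> S" "open V" "f z \<in> V" "homeomorphism U V f g"
    "smooth_on V g"
proof -
  have lin: "linear (frechet_derivative f (at x))" if "x \<in> S" for x
    using smooth_on_has_derivative[OF assms(2,1) that] has_derivative_linear by blast
  have lin1: "frechet_derivative f (at x) v = v * frechet_derivative f (at x) 1" if "x \<in> S" for x v
    using linear_scale[OF lin[OF that], of v 1] by simp
  have "inj (frechet_derivative f (at z))"
    using lin[OF assms(3)] lin1[OF assms(3)] assms(4) by (metis injI mult_right_cancel)
  from local_inverse_aux[OF assms(1-3) this]
  obtain U V g where *: "open U" "z \<in> U" "U \<subseteq> S" "open V" "f z \<in> V" "homeomorphism U V f g"
    "\<And>y. y \<in> V \<Longrightarrow> \<exists>g'. (g has_derivative g') (at y) \<and>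
       (\<forall>v. frechet_derivative f (at (g y)) (g' v) = v)" by metis
  have gS: "g y \<in> S" if "y \<in> V" for y
    using *(3,6) that homeomorphism_image2 by blast
  have der: "(g has_derivative (\<lambda>v. v / frechet_derivative f (at (g y)) 1)) (at y)"
    and ne: "frechet_derivative f (at (g y)) 1 \<noteq> 0" if y: "y \<in> V" for y
  proof -
    obtain g' where g': "(g has_derivative g') (at y)" "\<And>v. frechet_derivative f (at (g y)) (g' v) = v"
      using *(7)[OF y] by blast
    then have e: "g' v * frechet_derivative f (at (g y)) 1 = v" for v
      using lin1[OF gS[OF y]] by metis
    then show ne: "frechet_derivative f (at (g y)) 1 \<noteq> 0" by (metis mult_zero_right zero_neq_one)
    then have "g' = (\<lambda>v. v / frechet_derivative f (at (g y)) 1)" 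
      using e by (auto simp: fun_eq_iff field_simps)
    then show "(g has_derivative (\<lambda>v. v / frechet_derivative f (at (g y)) 1)) (at y)"
      using g' by simp
  qed
  have "Ck_on k V g" for k
  proof (induction k)
    case 0
    show ?case using *(6) by (auto simp: homeomorphism_def)
  next
    case (Suc k)
    have "Ck_on k V (\<lambda>y. frechet_derivative f (at (g y)) 1)"
      by (rule Ck_on_compose[OF *(4) assms(1) Suc]) 
        (use assms(2) gS in \<open>auto simp: smooth_on_frechet[unfolded smooth_on_def] smooth_on_def\<close>)
    then show ?case
      by (intro Ck_onI[OF *(4) der] Ck_on_divide Ck_on_const *(4)) (auto simp: ne)
  qed
  then show ?thesis using that * unfolding smooth_on_def by blast
qed

text \<open>Cramer's rule with the determinant kept on the left, so that no division occurs.\<close>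

lemma cramer_plane:
  fixes a b c d :: real
  assumes "a * h1 + b * h2 = v1" "c * h1 + d * h2 = v2"
  shows "(a * d - b * c) * h1 = d * v1 - b * v2" "(a * d - b * c) * h2 = a * v2 - c * v1"
  unfolding assms[symmetric] by (simp_all add: algebra_simps)

lemma linear_plane_expand:
  fixes D :: "plane \<Rightarrow> 'c::real_vector"
  assumes "linear D" shows "D v = fst v *\<^sub>R D (1, 0) + snd v *\<^sub>R D (0, 1)"
proof -
  have "D v = D (fst v *\<^sub>R (1, 0) + snd v *\<^sub>R (0, 1))" by (simp add: prod_eq_iff)
  then show ?thesis using assms by (simp only: linear_add linear_scale)
qed

text \<open>The bootstrap of the real case: by Cramer's rule the derivative of \<open>g\<close> is a
  rational expression in the partial derivatives of \<open>f\<close> along \<open>g\<close>, with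
  the Jacobian determinant \<open>E\<close> as denominator.\<close>

lemma local_inverse_plane:
  fixes f :: "plane \<Rightarrow> plane"
  assumes "open S" "smooth_on S f" "z \<in> S" "inj (frechet_derivative f (at z))"
  obtains U V g where "open U" "z \<in> U" "U \<subseteq> S" "open V" "f z \<in> V" "homeomorphism U V f g"
    "smooth_on V g" "\<And>y. y \<in> V \<Longrightarrow> inj (frechet_derivative f (at (g y)))"
proof -
  let ?f' = "\<lambda>x. frechet_derivative f (at x)"
  obtain U V g where *: "open U" "z \<in> U" "U \<subseteq> S" "open V" "f z \<in> V" "homeomorphism U V f g"
    "\<And>y. y \<in> V \<Longrightarrow> inj (?f' (g y))"
    "\<And>y. y \<in> V \<Longrightarrow> \<exists>g'. (g has_derivative g') (at y) \<and> (\<forall>v. ?f' (g y) (g' v) = v)"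
    using local_inverse_aux[OF assms] by metis
  have gS: "g y \<in> S" if "y \<in> V" for y
    using *(3,6) that homeomorphism_image2 by blast
  define a where "a x = fst (?f' x (1, 0))" for x
  define b where "b x = fst (?f' x (0, 1))" for x
  define c where "c x = snd (?f' x (1, 0))" for x
  define d where "d x = snd (?f' x (0, 1))" for x
  define E where "E x = a x * d x - b x * c x" for x
  have lin: "?f' x v = (fst v * a x + snd v * b x, fst v * c x + snd v * d x)" if "x \<in> S" for x v
  proof -
    have "linear (?f' x)"
      using smooth_on_has_derivative[OF assms(2,1) that] has_derivative_linear by blast
    from linear_plane_expand[OF this, of v] show ?thesis
      by (simp add: a_def b_def c_def d_def prod_eq_iff)
  qed
  have ne: "E (g y) \<noteq> 0" if y: "y \<in> V" for y
  proof
    let ?x = "g y"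
    assume E: "E ?x = 0"
    have 0: "?f' ?x (0, 0) = (0, 0)" using lin[OF gS[OF y]] by simp
    have inj: "v = (0, 0)" if "?f' ?x v = (0, 0)" for v
      using injD[OF *(7)[OF y], of v "(0,0)"] 0 that by simp
    \<comment> \<open>The columns of the adjugate matrix are killed when the determinant vanishes.
      Injectivity makes these columns zero, hence all four entries, and then \<open>(1, 0)\<close>
      lies in the kernel too.\<close>
    have "?f' ?x (d ?x, - c ?x) = (0, 0)" "?f' ?x (- b ?x, a ?x) = (0, 0)"
      using E by (simp_all add: lin[OF gS[OF y]] E_def algebra_simps)
    then have "a ?x = 0" "b ?x = 0" "c ?x = 0" "d ?x = 0" using inj by fastforce+
    then have "?f' ?x (1, 0) = (0, 0)" using lin[OF gS[OF y]] by simp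
    then show False using inj by fastforce
  qed
  have der: "(g has_derivative (\<lambda>v. ((d (g y) * fst v - b (g y) * snd v) / E (g y),
     (a (g y) * snd v - c (g y) * fst v) / E (g y)))) (at y)" if y: "y \<in> V" for y
  proof -
    obtain g' where g': "(g has_derivative g') (at y)" "\<And>v. ?f' (g y) (g' v) = v"
      using *(8)[OF y] by blast
    have "g' v = ((d (g y) * fst v - b (g y) * snd v) / E (g y),
        (a (g y) * snd v - c (g y) * fst v) / E (g y))" for v
    proof -
      have "a (g y) * fst (g' v) + b (g y) * snd (g' v) = fst v"
        "c (g y) * fst (g' v) + d (g y) * snd (g' v) = snd v"
        using g'(2)[of v] lin[OF gS[OF y], of "g' v"] by (auto simp: prod_eq_iff algebra_simps)
      from cramer_plane[OF this] ne[OF y] show ?thesis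
        by (auto simp: E_def prod_eq_iff field_simps)
    qed
    then have "g' = (\<lambda>v. ((d (g y) * fst v - b (g y) * snd v) / E (g y),
        (a (g y) * snd v - c (g y) * fst v) / E (g y)))" by (rule ext)
    with g'(1) show ?thesis by simp
  qed
  have "Ck_on k V g" for k
  proof (induction k)
    case 0
    show ?case using *(6) by (auto simp: homeomorphism_def)
  next
    case (Suc k)
    have *: "Ck_on k V (\<lambda>y. h (?f' (g y) v))" if "bounded_linear h" for h :: "plane \<Rightarrow> real" and v
    proof (rule Ck_on_linear_comp[OF *(4) that], rule Ck_on_compose[OF *(4) assms(1) Suc])
      show "Ck_on k S (\<lambda>x. ?f' x v)"
        using assms(2) smooth_on_frechet[of S f v] by (simp add: smooth_on_def)
    qed (use gS in auto)
    have abcd: "Ck_on k V (\<lambda>y. a (g y))" "Ck_on k V (\<lambda>y. b (g y))" "Ck_on k V (\<lambda>y. c (g y))"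
      "Ck_on k V (\<lambda>y. d (g y))"
      unfolding a_def b_def c_def d_def
      by (rule *[OF bounded_linear_fst] *[OF bounded_linear_snd])+
    have diff: "Ck_on k V (\<lambda>x. p x - q x)" if "Ck_on k V p" "Ck_on k V q" for p q :: "plane \<Rightarrow> real"
      using Ck_on_add[OF \<open>open V\<close> that(1)
          Ck_on_linear_comp[OF \<open>open V\<close> bounded_linear_minus[OF bounded_linear_ident] that(2)]] by simp
    have "Ck_on k V (\<lambda>y. E (g y))" unfolding E_def
      by (intro diff Ck_on_bilinear[OF _ bounded_bilinear_mult] abcd \<open>open V\<close>)
    then show ?case
      by (intro Ck_onI[OF \<open>open V\<close> der] Ck_on_divide Ck_on_Pair diff
          Ck_on_bilinear[OF _ bounded_bilinear_mult] abcd Ck_on_const \<open>open V\<close>) (auto simp: ne)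
  qed
  then show ?thesis using that *(1-7) unfolding smooth_on_def by blast
qed

text \<open>Differentiating under the integral sign gives another integral of the same kind, with
  integrand the derivative of \<open>H\<close> in direction \<open>(0, v)\<close>, and so the
  induction closes. The range is fixed to the unit interval; variable upper limits are brought to
  this form by scaling.\<close>

lemma Ck_on_param_integral:
  fixes H :: "real \<times> 'e::euclidean_space \<Rightarrow> 'c::euclidean_space"
  assumes "open W" "open U" "{0..1} \<times> U \<subseteq> W" "Ck_on k W H"
  shows "Ck_on k U (\<lambda>z. integral {0..1} (\<lambda>\<theta>. H (\<theta>, z)))"
  using assms(4)
proof (induction k arbitrary: H)
  have cont: "continuous_on (X \<times> cbox 0 1) (\<lambda>(x, t). G (t, x))" if "continuous_on W G" "X \<subseteq> U"
    for X and G :: "real \<times> 'e \<Rightarrow> 'c"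
  proof -
    have "continuous_on (X \<times> cbox 0 1) (\<lambda>z. G (snd z, fst z))"
      by (rule continuous_on_compose2[OF that(1)])
        (use assms(3) that(2) in \<open>auto intro!: continuous_intros simp: subset_iff\<close>)
    then show ?thesis by (simp add: case_prod_unfold)
  qed
  {
    case 0
    then show ?case
      using integral_continuous_on_param[of U 0 1 "\<lambda>z \<theta>. H (\<theta>, z)", OF cont] by simp
  next
    case (Suc k)
    let ?H' = "\<lambda>w. frechet_derivative H (at w)"
    have derH: "(H has_derivative ?H' w) (at w)" if "w \<in> W" for w
      using Ck_on_has_derivative[OF Suc.prems assms(1) that] .
    have cW: "continuous_on W (\<lambda>w. ?H' w v)" for v
    proof -
      have "Ck_on k W (\<lambda>w. ?H' w v)" using Suc.prems unfolding Ck_on.simps by blast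
      then show ?thesis by (rule Ck_on_imp_continuous_on)
    qed
    have derH2: "((\<lambda>x. H (t, x)) has_derivative (\<lambda>v. ?H' (t, x) (0, v))) (at x)" if "(t, x) \<in> W" for t x
    proof -
      have "((\<lambda>x. (t, x)) has_derivative (\<lambda>v. (0, v))) (at x)"
        by (auto intro!: derivative_eq_intros)
      from diff_chain_at[OF this derH[OF that]] show ?thesis by (simp add: o_def)
    qed
    have int: "(\<lambda>\<theta>. G (\<theta>, z)) integrable_on {0..1}" if "continuous_on W G" "z \<in> U"
      for z and G :: "real \<times> 'e \<Rightarrow> 'c"
    proof (rule integrable_continuous_interval, rule continuous_on_compose2[OF that(1)])
      show "continuous_on {0..1} (\<lambda>\<theta>. (\<theta>, z))" by (intro continuous_intros)
    qed (use assms(3) that in auto)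
    have "((\<lambda>z. integral {0..1} (\<lambda>\<theta>. H (\<theta>, z))) has_derivative
        (\<lambda>v. integral {0..1} (\<lambda>\<theta>. ?H' (\<theta>, z) (0, v)))) (at z)" if z: "z \<in> U" for z
    proof -
      \<comment> \<open>The ball is the convex parameter set that \<open>leibniz_rule\<close> asks
        for.\<close>
      obtain e where e: "e > 0" "ball z e \<subseteq> U" using assms(2) z open_contains_ball by blast
      define fx where "fx x t = Blinfun (\<lambda>v. ?H' (t, x) (0, v))" for x t
      have fx: "blinfun_apply (fx x t) = (\<lambda>v. ?H' (t, x) (0, v))" if "(t, x) \<in> W" for x t
        unfolding fx_def using derH2[OF that] has_derivative_bounded_linear bounded_linear_Blinfun_apply by blast
      have c: "continuous_on (ball z e \<times> cbox 0 1) (\<lambda>(x, t). fx x t)"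
      proof (rule continuous_on_blinfun_componentwise)
        fix i :: 'e
        show "continuous_on (ball z e \<times> cbox 0 1) (\<lambda>y. blinfun_apply (case y of (x, t) \<Rightarrow> fx x t) i)"
          by (rule continuous_on_eq[OF cont[OF cW[of "(0, i)"] e(2)]]) (use fx assms(3) e(2) in \<open>auto simp: subset_iff\<close>)
      qed
      have "((\<lambda>x. integral (cbox 0 1) (\<lambda>\<theta>. H (\<theta>, x))) has_derivative
          blinfun_apply (integral (cbox 0 1) (fx z))) (at z within ball z e)"
      proof (rule leibniz_rule[OF _ _ c])
        fix x t assume "x \<in> ball z e" "t \<in> cbox (0::real) 1"
        then have "(t, x) \<in> W" using assms(3) e by (auto simp: subset_iff)
        then show "((\<lambda>x. H (t, x)) has_derivative blinfun_apply (fx x t)) (at x within ball z e)"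
          using derH2 fx by (metis has_derivative_at_withinI)
      next
        fix x assume "x \<in> ball z e"
        then show "(\<lambda>\<theta>. H (\<theta>, x)) integrable_on cbox 0 1"
          using int[of H x] Ck_on.simps(1) e Suc.prems 
          by (auto simp: differentiable_imp_continuous_on)
      qed (use e in auto)
      moreover have "blinfun_apply (integral (cbox 0 1) (fx z)) v =
          integral {0..1} (\<lambda>\<theta>. ?H' (\<theta>, z) (0, v))" for v
      proof -
        have "continuous_on (cbox 0 1) (fx z)"
          using continuous_on_compose2[OF c, of "cbox 0 1" "\<lambda>t. (z, t)"] e(1)
          by (force intro!: continuous_intros)
        then have "fx z integrable_on cbox 0 1" by (rule integrable_continuous)
        then have "blinfun_apply (integral (cbox 0 1) (fx z)) v = integral (cbox 0 1) (\<lambda>t. blinfun_apply (fx z t) v)"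
          by (rule blinfun_apply_integral)
        also have "\<dots> = integral {0..1} (\<lambda>\<theta>. ?H' (\<theta>, z) (0, v))"
          by (auto intro!: integral_cong simp: fx assms(3)[THEN subsetD] z)
        finally show ?thesis .
      qed
      ultimately show ?thesis 
        using e by (simp add: at_within_open[of z "ball z e"] )
          (metis (no_types, lifting) ext)
    qed
    moreover have "Ck_on k U (\<lambda>z. integral {0..1} (\<lambda>\<theta>. ?H' (\<theta>, z) (0, v)))" for v
      by (rule Suc.IH) (use Suc.prems in simp)
    ultimately show ?case by (intro Ck_onI[OF assms(2)])
  }
qed

section \<open>Straightening a vector field in the plane\<close>

text \<open>By substitution \<open>x * integral {0..1} (\<lambda>\<theta>. h (\<theta> * x))\<close>
  is the integral of \<open>h\<close> from 0 to \<open>x\<close>. This form needs no case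
  distinction on the sign of \<open>x\<close>, and it fits
  \<open>Ck_on_param_integral\<close>.\<close>

lemma DERIV_scaled_integral:
  fixes h :: "real \<Rightarrow> real"
  assumes "continuous_on {-r<..<r} h" "\<bar>x\<bar> < r"
  shows "((\<lambda>x. x * integral {0..1} (\<lambda>\<theta>. h (\<theta> * x))) has_real_derivative h x) (at x)"
proof -
  obtain s where s: "\<bar>x\<bar> < s" "s < r" using assms(2) dense by blast
  have "continuous_on {-s..s} h" by (rule continuous_on_subset[OF assms(1)]) (use s in auto)
  then obtain g where g: "\<And>t. t \<in> {-s..s} \<Longrightarrow> (g has_vector_derivative h t) (at t within {-s..s})"
    by (rule antiderivative_continuous) blast
  have eq: "t * integral {0..1} (\<lambda>\<theta>. h (\<theta> * t)) = g t - g 0" if t: "t \<in> {-s..s}" for t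
  proof -
    have m: "\<theta> * t \<in> {-s..s}" if "\<theta> \<in> {0..1}" for \<theta>
    proof -
      have "\<bar>\<theta> * t\<bar> \<le> 1 * s" unfolding abs_mult using that t by (intro mult_mono) auto
      then show ?thesis by auto
    qed
    have "((\<lambda>\<theta>. t *\<^sub>R h (\<theta> * t)) has_integral (g (1 * t) - g (0 * t))) {0..1}"
    proof (rule fundamental_theorem_of_calculus)
      fix \<theta> :: real assume \<theta>: "\<theta> \<in> {0..1}"
      have "((\<lambda>\<theta>. \<theta> * t) has_vector_derivative t) (at \<theta> within {0..1})"
        by (auto intro!: derivative_eq_intros)
      moreover have "(g has_vector_derivative h (\<theta> * t)) (at (\<theta> * t) within (\<lambda>\<theta>. \<theta> * t) ` {0..1})"
        by (rule has_vector_derivative_within_subset[OF g[OF m[OF \<theta>]]]) (use m in auto)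
      ultimately show "((\<lambda>\<theta>. g (\<theta> * t)) has_vector_derivative t *\<^sub>R h (\<theta> * t)) (at \<theta> within {0..1})"
        using vector_diff_chain_within[of "\<lambda>\<theta>. \<theta> * t" t \<theta> "{0..1}" g "h (\<theta> * t)"] by (simp add: o_def)
    qed simp
    from integral_unique[OF this] show ?thesis by simp
  qed
  have "x \<in> {-s<..<s}" using s by auto
  then have "(g has_vector_derivative h x) (at x)"
    using has_vector_derivative_within_subset[OF g, of x "{-s<..<s}"]
    by (simp add: at_within_open[of x "{-s<..<s}"] subset_iff)
  then have "((\<lambda>t. g t - g 0) has_real_derivative h x) (at x)"
    by (auto intro!: derivative_eq_intros simp: has_real_derivative_iff_has_vector_derivative)
  then show ?thesis
    by (rule has_field_derivative_transform_within_open[of _ _ _ "{-s<..<s}"])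
      (use \<open>x \<in> {-s<..<s}\<close> eq in auto)
qed

text \<open>A 1-Lipschitz retraction of the line onto an interval. It extends data given on a square
  to the whole plane, so that the Picard operator acts on bounded continuous functions
  there.\<close>

definition clamp1 :: "real \<Rightarrow> real \<Rightarrow> real" where "clamp1 r x = max (-r) (min r x)"

lemma clamp1: "r > 0 \<Longrightarrow> \<bar>clamp1 r x\<bar> \<le> r" "\<bar>x\<bar> \<le> r \<Longrightarrow> clamp1 r x = x"
  "\<bar>clamp1 r x - clamp1 r y\<bar> \<le> \<bar>x - y\<bar>" "continuous_on UNIV (clamp1 r)"
proof -
  show "continuous_on UNIV (clamp1 r)" unfolding clamp1_def
    by (intro continuous_on_max continuous_on_min continuous_on_const continuous_on_id)
qed (auto simp: clamp1_def max_def min_def)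

text \<open>The Picard operator is applied to functions of the time and the initial value at once,
  so that its fixed point depends continuously on both.\<close>

lemma ode_continuous_solution:
  fixes F :: "plane \<Rightarrow> real"
  assumes e: "e > 0" and cF: "continuous_on ({-e..e} \<times> {-e..e}) F"
    and B: "\<And>x y. x \<in> {-e..e} \<Longrightarrow> y \<in> {-e..e} \<Longrightarrow> \<bar>F (x, y)\<bar> \<le> B"
    and L: "\<And>x y z. x \<in> {-e..e} \<Longrightarrow> y \<in> {-e..e} \<Longrightarrow> z \<in> {-e..e} \<Longrightarrow> \<bar>F (x, y) - F (x, z)\<bar> \<le> L * \<bar>y - z\<bar>"
  obtains r y where "0 < r" "r \<le> e / 2" "continuous_on UNIV y"
    "\<And>x a. \<bar>x\<bar> < r \<Longrightarrow> \<bar>a\<bar> < r \<Longrightarrow> \<bar>y (x, a)\<bar> \<le> e"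
    "\<And>x a. \<bar>x\<bar> < r \<Longrightarrow> \<bar>a\<bar> < r \<Longrightarrow>
       y (x, a) = a + x * integral {0..1} (\<lambda>\<theta>. F (\<theta> * x, y (\<theta> * x, a)))"
proof -
  define C where "C = \<bar>B\<bar> + \<bar>L\<bar> + 1"
  \<comment> \<open>Chosen so that \<open>r * C \<le> 1/2\<close> makes the Picard operator a
    contraction, while \<open>r * C \<le> e/2\<close> and \<open>r \<le> e/2\<close> keep its values
    in \<open>{-e..e}\<close>.\<close>
  define r where "r = min 1 e / (2 * C)"
  have C: "C \<ge> 1" "B \<le> C" "L \<le> C" by (auto simp: C_def)
  have r0: "0 < r" using e C by (simp add: r_def)
  have "r * C = min 1 e / 2" using C by (simp add: r_def)
  then have rC: "r * C \<le> e / 2" "r * C \<le> 1/2" by (auto simp: min_def)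
  have "r * 1 \<le> r * C" using r0 C by (intro mult_left_mono) auto
  then have re: "r \<le> e / 2" using rC by simp
  \<comment> \<open>Both arguments of \<open>F\<close> are clamped, so the integrand makes sense for
    every \<open>\<phi>\<close> and \<open>z\<close>. The fixed point stays within the bounds, and
    there the clamps drop out.\<close>
  define G where "G \<phi> z \<theta> = F (\<theta> * clamp1 r (fst z), clamp1 e (\<phi> (\<theta> * clamp1 r (fst z), snd z)))"
    for \<phi> :: "plane \<Rightarrow> real" and z :: plane and \<theta> :: real
  define P where "P \<phi> z = clamp1 r (snd z) + clamp1 r (fst z) * integral {0..1} (G \<phi> z)"
    for \<phi> :: "plane \<Rightarrow> real" and z :: plane
  have m: "\<theta> * clamp1 r x \<in> {-e..e}" if "\<theta> \<in> {0..1}" for \<theta> x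
  proof -
    have "\<bar>\<theta> * clamp1 r x\<bar> \<le> 1 * r" unfolding abs_mult using that clamp1(1)[OF r0] by (intro mult_mono) auto
    then show ?thesis using re e by auto
  qed
  have ce: "clamp1 e x \<in> {-e..e}" for x using clamp1(1)[OF e, of x] by auto
  have cG: "continuous_on (UNIV \<times> cbox 0 1) (\<lambda>(z, \<theta>). G \<phi> z \<theta>)" if "continuous_on UNIV \<phi>" for \<phi>
    unfolding G_def case_prod_unfold
    by (rule continuous_on_compose2[OF cF])
      (use m ce in \<open>auto intro!: continuous_intros continuous_on_compose2[OF that]
        continuous_on_compose2[OF clamp1(4)]\<close>)
  have cG1: "continuous_on {0..1} (G \<phi> z)" if "continuous_on UNIV \<phi>" for \<phi> z
  proof -
    have "continuous_on {0..1} (\<lambda>\<theta>. case (z, \<theta>) of (z, \<theta>) \<Rightarrow> G \<phi> z \<theta>)"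
      by (rule continuous_on_compose2[OF cG[OF that]]) (auto intro!: continuous_intros)
    then show ?thesis by simp
  qed
  have GB: "\<bar>integral {0..1} (G \<phi> z)\<bar> \<le> C" if "continuous_on UNIV \<phi>" for \<phi> z
  proof -
    have "norm (integral {0..1} (G \<phi> z)) \<le> C * (1 - 0)"
    proof (rule integral_bound[OF _ cG1[OF that]])
      show "norm (G \<phi> z \<theta>) \<le> C" if "\<theta> \<in> {0..1}" for \<theta>
        using B[OF m[OF that] ce] C(2) unfolding G_def real_norm_def by (rule order_trans)
    qed simp
    then show ?thesis by simp
  qed
  have b: "P \<phi> \<in> bcontfun" if "continuous_on UNIV \<phi>" for \<phi>
  proof (rule bcontfun_normI)
    show "continuous_on UNIV (P \<phi>)" unfolding P_def
      using integral_continuous_on_param[OF cG[OF that]]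
      by (auto intro!: continuous_intros continuous_on_compose2[OF clamp1(4)])
    have "\<bar>clamp1 r (fst z) * integral {0..1} (G \<phi> z)\<bar> \<le> r * C" for z
      unfolding abs_mult using GB[OF that] clamp1(1)[OF r0] r0 by (intro mult_mono) auto
    moreover have "\<bar>clamp1 r (snd z)\<bar> \<le> r" for z using clamp1(1)[OF r0] .
    ultimately show "norm (P \<phi> z) \<le> r + r * C" for z unfolding P_def real_norm_def
      by (meson abs_triangle_ineq add_mono order_trans)
  qed
  define T where "T \<phi> = Bcontfun (P (apply_bcontfun \<phi>))" for \<phi> :: "plane \<Rightarrow>\<^sub>C real"
  have T: "apply_bcontfun (T \<phi>) = P (apply_bcontfun \<phi>)" for \<phi>
    unfolding T_def by (rule Bcontfun_inverse[OF b]) simp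
  have lip: "dist (T \<phi>) (T \<psi>) \<le> 1/2 * dist \<phi> \<psi>" for \<phi> \<psi>
  proof (rule dist_bound)
    fix z :: plane
    have ci: "(G \<phi> z) integrable_on {0..1}" "(G \<psi> z) integrable_on {0..1}"
      by (intro integrable_continuous_interval cG1; simp)+
    have "\<bar>G \<phi> z \<theta> - G \<psi> z \<theta>\<bar> \<le> C * dist \<phi> \<psi>" if "\<theta> \<in> {0..1}" for \<theta>
    proof -
      let ?w = "(\<theta> * clamp1 r (fst z), snd z)"
      have "\<bar>G \<phi> z \<theta> - G \<psi> z \<theta>\<bar> \<le> L * \<bar>clamp1 e (\<phi> ?w) - clamp1 e (\<psi> ?w)\<bar>"
        unfolding G_def by (rule L[OF m[OF that] ce ce])
      also have "\<dots> \<le> C * \<bar>clamp1 e (\<phi> ?w) - clamp1 e (\<psi> ?w)\<bar>" using C by (intro mult_right_mono) auto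
      also have "\<dots> \<le> C * \<bar>\<phi> ?w - \<psi> ?w\<bar>" using C clamp1(3) by (intro mult_left_mono) auto
      also have "\<dots> \<le> C * dist \<phi> \<psi>" 
        using C dist_bounded[of \<phi> ?w \<psi>] by (intro mult_left_mono) (auto simp: dist_real_def)
      finally show ?thesis .
    qed
    then have "norm (integral {0..1} (\<lambda>\<theta>. G \<phi> z \<theta> - G \<psi> z \<theta>)) \<le> C * dist \<phi> \<psi> * (1 - 0)"
      by (intro integral_bound) (auto intro!: continuous_intros cG1)
    then have i: "\<bar>integral {0..1} (G \<phi> z) - integral {0..1} (G \<psi> z)\<bar> \<le> C * dist \<phi> \<psi>"
      using ci by (simp add: integral_diff)
    have "dist (T \<phi> z) (T \<psi> z) = \<bar>clamp1 r (fst z)\<bar> * \<bar>integral {0..1} (G \<phi> z) - integral {0..1} (G \<psi> z)\<bar>"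
      unfolding T P_def dist_real_def by (simp add: abs_mult[symmetric] algebra_simps)
    also have "\<dots> \<le> r * (C * dist \<phi> \<psi>)"
      using i clamp1(1)[OF r0] r0 by (intro mult_mono) auto
    also have "\<dots> \<le> 1/2 * dist \<phi> \<psi>" using mult_right_mono[OF rC(2), of "dist \<phi> \<psi>"] by (simp add: mult_ac)
    finally show "dist (T \<phi> z) (T \<psi> z) \<le> 1/2 * dist \<phi> \<psi>" .
  qed
  obtain \<phi> where \<phi>: "T \<phi> = \<phi>" using banach_fix_type[of "1/2" T] lip by auto
  have eq: "\<phi> z = P \<phi> z" for z using T[of \<phi>] \<phi> by simp
  have c\<phi>: "continuous_on UNIV (apply_bcontfun \<phi>)" by simp
  have le: "\<bar>\<phi> (x, a)\<bar> \<le> e" for x a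
  proof -
    have "\<bar>clamp1 r x * integral {0..1} (G \<phi> (x, a))\<bar> \<le> r * C"
      unfolding abs_mult using GB[OF c\<phi>] clamp1(1)[OF r0] r0 by (intro mult_mono) auto
    then show ?thesis using clamp1(1)[OF r0, of a] re rC(1) unfolding eq[of "(x, a)"] P_def
      by (simp add: abs_le_iff)
  qed
  have "\<phi> (x, a) = a + x * integral {0..1} (\<lambda>\<theta>. F (\<theta> * x, \<phi> (\<theta> * x, a)))" if "\<bar>x\<bar> < r" "\<bar>a\<bar> < r" for x a
  proof -
    have "clamp1 r x = x" "clamp1 r a = a" using that by (auto intro: clamp1(2))
    moreover have "G \<phi> (x, a) = (\<lambda>\<theta>. F (\<theta> * x, \<phi> (\<theta> * x, a)))"
      unfolding G_def by (simp add: clamp1(2)[OF le] \<open>clamp1 r x = x\<close>)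
    ultimately show ?thesis unfolding eq[of "(x, a)"] P_def by simp
  qed
  then show ?thesis using that[of r "apply_bcontfun \<phi>"] r0 re c\<phi> le by blast
qed

lemma segment_bound: "\<bar>y\<bar> \<le> e \<Longrightarrow> \<bar>z\<bar> \<le> e \<Longrightarrow> \<theta> \<in> {0..1} \<Longrightarrow> \<bar>z + \<theta> * (y - z)\<bar> \<le> (e::real)"
proof -
  assume a: "\<bar>y\<bar> \<le> e" "\<bar>z\<bar> \<le> e" "\<theta> \<in> {0..1}"
  have "z + \<theta> * (y - z) = (1 - \<theta>) * z + \<theta> * y" by (simp add: algebra_simps)
  also have "\<bar>\<dots>\<bar> \<le> (1 - \<theta>) * e + \<theta> * e"
    using a by (intro order_trans[OF abs_triangle_ineq] add_mono) (auto simp: abs_mult intro!: mult_left_mono)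
  also have "\<dots> = e" by (simp add: algebra_simps)
  finally show ?thesis .
qed

text \<open>\<open>y (x, a)\<close> is the solution at \<open>x\<close> of the scalar equation with
  slope \<open>F\<close> and value \<open>a\<close> at 0. Differentiability in \<open>a\<close>
  comes from an exact formula: the difference of two solutions is
  \<open>(a - b) * exp (E x a b)\<close>. Its limit is \<open>g\<close>, an exponential of an
  integral along the solution. If \<open>y\<close> is of order \<open>k\<close>, then so are
  \<open>g\<close> and the slope, that is, both partial derivatives of \<open>y\<close>.\<close>

lemma ode_smooth_solution:
  fixes F :: "plane \<Rightarrow> real"
  assumes V: "open V" "(0, 0) \<in> V" and F: "smooth_on V F"
  obtains r y g where "0 < r" "smooth_on ({-r<..<r} \<times> {-r<..<r}) y"
    "\<And>x a. \<bar>x\<bar> < r \<Longrightarrow> \<bar>a\<bar> < r \<Longrightarrow> (x, y (x, a)) \<in> V"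
    "\<And>a. \<bar>a\<bar> < r \<Longrightarrow> y (0, a) = a"
    "\<And>x a. \<bar>x\<bar> < r \<Longrightarrow> \<bar>a\<bar> < r \<Longrightarrow>
       (y has_derivative (\<lambda>v. fst v * F (x, y (x, a)) + snd v * g (x, a))) (at (x, a))"
    "\<And>x a. g (x, a) > (0::real)"
proof -
  obtain e0 where e0: "e0 > 0" "ball (0, 0) e0 \<subseteq> V" using V open_contains_ball by blast
  \<comment> \<open>A third, because a point of the closed square has norm at most
    \<open>2 * e\<close>, which must be below \<open>e0\<close>.\<close>
  define e where "e = e0 / 3"
  have e: "e > 0" using e0 by (simp add: e_def)
  have sub: "{-e..e} \<times> {-e..e} \<subseteq> V"
  proof
    fix z :: plane assume "z \<in> {-e..e} \<times> {-e..e}"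
    then have "norm z \<le> e + e" using norm_Pair_le[of "fst z" "snd z"] by (auto simp: abs_le_iff)
    then show "z \<in> V" using e0 by (auto simp: e_def dist_norm norm_minus_commute zero_prod_def[symmetric])
  qed
  have subV: "(x, y) \<in> V" if "\<bar>x\<bar> \<le> e" "\<bar>y\<bar> \<le> e" for x y using sub that by (auto simp: abs_le_iff)
  define Fy where "Fy z = frechet_derivative F (at z) (0, 1)" for z
  have Fys: "smooth_on V Fy" unfolding Fy_def by (rule smooth_on_frechet[OF F])
  have cF: "continuous_on ({-e..e} \<times> {-e..e}) F" and cFy: "continuous_on ({-e..e} \<times> {-e..e}) Fy"
    using smooth_on_imp_continuous_on F Fys continuous_on_subset sub by blast+
  have Fder: "((\<lambda>y. F (x, y)) has_real_derivative Fy (x, y)) (at y)" if "(x, y) \<in> V" for x y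
  proof -
    have 1: "((\<lambda>y. (x, y)) has_derivative (\<lambda>h. (0, h))) (at y)" by (auto intro!: derivative_eq_intros)
    have 2: "(F has_derivative frechet_derivative F (at (x, y))) (at (x, y))"
      using smooth_on_has_derivative[OF F V(1) that] .
    have "frechet_derivative F (at (x, y)) (0, h) = Fy (x, y) * h" for h
      using linear_plane_expand[OF has_derivative_linear[OF 2], of "(0, h)"] by (simp add: Fy_def)
    then have "frechet_derivative F (at (x, y)) \<circ> (\<lambda>h. (0, h)) = (*) (Fy (x, y))"
      by (auto simp: fun_eq_iff)
    then show ?thesis using diff_chain_at[OF 1 2] by (simp add: has_field_derivative_def o_def)
  qed
  have comp: "compact ({-e..e} \<times> {-e..e} :: plane set)" by (simp add: compact_Times)
  obtain B where B: "\<And>z. z \<in> {-e..e} \<times> {-e..e} \<Longrightarrow> \<bar>F z\<bar> \<le> B"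
    using compact_imp_bounded[OF compact_continuous_image[OF cF comp]] by (auto simp: bounded_iff)
  obtain L where L: "\<And>z. z \<in> {-e..e} \<times> {-e..e} \<Longrightarrow> \<bar>Fy z\<bar> \<le> L"
    using compact_imp_bounded[OF compact_continuous_image[OF cFy comp]] by (auto simp: bounded_iff)
  have lip: "\<bar>F (x, y) - F (x, z)\<bar> \<le> L * \<bar>y - z\<bar>"
    if "x \<in> {-e..e}" "y \<in> {-e..e}" "z \<in> {-e..e}" for x y z
  proof -
    have "norm (F (x, y) - F (x, z)) \<le> L * norm (y - z)"
    proof (rule field_differentiable_bound[of "{-e..e}"])
      show "((\<lambda>y. F (x, y)) has_real_derivative Fy (x, w)) (at w within {-e..e})" if "w \<in> {-e..e}" for w
        using that \<open>x \<in> {-e..e}\<close> sub by (intro has_field_derivative_at_within[OF Fder]) auto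
    qed (use that L in auto)
    then show ?thesis by simp
  qed
  obtain r y where r: "0 < r" "r \<le> e / 2" and cy: "continuous_on UNIV y"
    and yle: "\<And>x a. \<bar>x\<bar> < r \<Longrightarrow> \<bar>a\<bar> < r \<Longrightarrow> \<bar>y (x, a)\<bar> \<le> e"
    and yeq: "\<And>x a. \<bar>x\<bar> < r \<Longrightarrow> \<bar>a\<bar> < r \<Longrightarrow>
       y (x, a) = a + x * integral {0..1} (\<lambda>\<theta>. F (\<theta> * x, y (\<theta> * x, a)))"
    using ode_continuous_solution[OF e cF _ lip, of B] B by auto
  have le_e: "\<bar>x\<bar> \<le> e" if "\<bar>x\<bar> < r" for x using that r by linarith
  have yV: "(x, y (x, a)) \<in> V" if "\<bar>x\<bar> < r" "\<bar>a\<bar> < r" for x a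
    using subV[OF le_e[OF that(1)] yle[OF that]] .
  have cyx: "continuous_on A (\<lambda>x. y (x, a))" and cya: "continuous_on A (\<lambda>a. y (x, a))" for A a x
    by (rule continuous_on_compose2[OF cy], auto intro!: continuous_intros)+
  have y0: "y (0, a) = a" if "\<bar>a\<bar> < r" for a using yeq[of 0 a] that r by simp
  have yx: "((\<lambda>x. y (x, a)) has_real_derivative F (x, y (x, a))) (at x)" if xa: "\<bar>x\<bar> < r" "\<bar>a\<bar> < r" for x a
  proof -
    have "continuous_on {-r<..<r} (\<lambda>x. F (x, y (x, a)))"
    proof (rule continuous_on_compose2[OF cF])
      show "(\<lambda>x. (x, y (x, a))) ` {- r<..<r} \<subseteq> {- e..e} \<times> {- e..e}"
      proof (rule image_subsetI)
        fix t assume "t \<in> {-r<..<r}"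
        then have "\<bar>t\<bar> < r" by auto
        then show "(t, y (t, a)) \<in> {- e..e} \<times> {- e..e}"
          using le_e[of t] yle[of t a] xa(2) by (auto simp: abs_le_iff)
      qed
    qed (intro continuous_intros cyx)
    from DERIV_scaled_integral[OF this xa(1)]
    have "((\<lambda>x. a + x * integral {0..1} (\<lambda>\<theta>. F (\<theta> * x, y (\<theta> * x, a)))) has_real_derivative F (x, y (x, a))) (at x)"
      using DERIV_add[OF DERIV_const] by fastforce
    then show ?thesis
      by (rule has_field_derivative_transform_within_open[of _ _ _ "{-r<..<r}"])
        (use xa yeq in \<open>auto simp: abs_less_iff\<close>)
  qed
  \<comment> \<open>Hadamard's mean slope: the difference quotient of \<open>F\<close> in its second
    argument, written as an integral so that it is also defined and continuous at
    \<open>u = w\<close>.\<close>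
  define m where "m x u w = integral {0..1} (\<lambda>\<theta>. Fy (x, w + \<theta> * (u - w)))" for x u w
  have seg: "(x, w + \<theta> * (u - w)) \<in> {-e..e} \<times> {-e..e}"
    if "\<bar>x\<bar> \<le> e" "\<bar>u\<bar> \<le> e" "\<bar>w\<bar> \<le> e" "\<theta> \<in> {0..1}" for x u w \<theta>
    using segment_bound[OF that(2-4)] that(1) by (auto simp: abs_le_iff)
  have mF: "F (x, u) - F (x, w) = m x u w * (u - w)" if "\<bar>x\<bar> \<le> e" "\<bar>u\<bar> \<le> e" "\<bar>w\<bar> \<le> e" for x u w
  proof -
    have "((\<lambda>\<theta>. (u - w) *\<^sub>R Fy (x, w + \<theta> * (u - w))) has_integral
        (F (x, w + 1 * (u - w)) - F (x, w + 0 * (u - w)))) {0..1}"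
    proof (rule fundamental_theorem_of_calculus)
      fix \<theta> :: real assume \<theta>: "\<theta> \<in> {0..1}"
      have 1: "((\<lambda>\<theta>. w + \<theta> * (u - w)) has_real_derivative (u - w)) (at \<theta> within {0..1})"
        by (auto intro!: derivative_eq_intros)
      have "((\<lambda>y. F (x, y)) has_real_derivative Fy (x, w + \<theta> * (u - w))) (at (w + \<theta> * (u - w)))"
        by (rule Fder) (use seg[OF that \<theta>] sub in blast)
      from DERIV_chain2[OF this 1]
      show "((\<lambda>\<theta>. F (x, w + \<theta> * (u - w))) has_vector_derivative (u - w) *\<^sub>R Fy (x, w + \<theta> * (u - w))) (at \<theta> within {0..1})"
        by (simp add: has_real_derivative_iff_has_vector_derivative[symmetric] mult.commute)
    qed simp
    from integral_unique[OF this] show ?thesis unfolding m_def by (simp add: mult.commute)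
  qed
  define D where "D = {z :: real \<times> real \<times> real. \<bar>fst z\<bar> \<le> e \<and> \<bar>fst (snd z)\<bar> \<le> e \<and> \<bar>snd (snd z)\<bar> \<le> e}"
  have cm: "continuous_on D (\<lambda>z. m (fst z) (fst (snd z)) (snd (snd z)))"
  proof -
    have "continuous_on (D \<times> cbox 0 1)
        (\<lambda>w. Fy (fst (fst w), snd (snd (fst w)) + snd w * (fst (snd (fst w)) - snd (snd (fst w)))))"
    proof (rule continuous_on_compose2[OF cFy])
      show "(\<lambda>w. (fst (fst w), snd (snd (fst w)) + snd w * (fst (snd (fst w)) - snd (snd (fst w))))) `
          (D \<times> cbox 0 1) \<subseteq> {- e..e} \<times> {- e..e}"
      proof (rule image_subsetI)
        fix w :: "(real \<times> real \<times> real) \<times> real" assume "w \<in> D \<times> cbox 0 1"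
        then show "(fst (fst w), snd (snd (fst w)) + snd w * (fst (snd (fst w)) - snd (snd (fst w))))
          \<in> {- e..e} \<times> {- e..e}"
          by (intro seg) (auto simp: D_def)
      qed
    qed (intro continuous_intros)
    then have "continuous_on (D \<times> cbox 0 1)
        (\<lambda>(z, \<theta>). Fy (fst z, snd (snd z) + \<theta> * (fst (snd z) - snd (snd z))))"
      by (simp add: case_prod_unfold)
    from integral_continuous_on_param[OF this] show ?thesis unfolding m_def by simp
  qed
  define M where "M a b t = m t (y (t, a)) (y (t, b))" for a b t
  have cM: "continuous_on ({a. \<bar>a\<bar> < r} \<times> {-r<..<r}) (\<lambda>(a, t). M a b t)" if "\<bar>b\<bar> < r" for b
  proof -
    have 1: "continuous_on ({a. \<bar>a\<bar> < r} \<times> {-r<..<r}) (\<lambda>z. (snd z, y (snd z, fst z), y (snd z, b)))"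
      by (intro continuous_intros continuous_on_compose2[OF cy]) auto
    have 2: "(\<lambda>z. (snd z, y (snd z, fst z), y (snd z, b))) ` ({a. \<bar>a\<bar> < r} \<times> {-r<..<r}) \<subseteq> D"
      using le_e yle that by (auto simp: D_def abs_less_iff)
    show ?thesis using continuous_on_compose2[OF cm 1 2] by (simp add: M_def case_prod_unfold)
  qed
  have cM1: "continuous_on {-r<..<r} (M a b)" if "\<bar>a\<bar> < r" "\<bar>b\<bar> < r" for a b
  proof -
    have "continuous_on {-r<..<r} (\<lambda>t. case (a, t) of (a, t) \<Rightarrow> M a b t)"
      by (rule continuous_on_compose2[OF cM[OF that(2)]]) (use that in \<open>auto intro!: continuous_intros\<close>)
    then show ?thesis by simp
  qed
  define E where "E x a b = x * integral {0..1} (\<lambda>\<theta>. M a b (\<theta> * x))" for x a b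
  have tr: "\<theta> * x \<in> {-r<..<r}" if "\<bar>x\<bar> < r" "\<theta> \<in> {0..1}" for \<theta> x
  proof -
    have "\<bar>\<theta> * x\<bar> \<le> 1 * \<bar>x\<bar>" unfolding abs_mult using that by (intro mult_right_mono) auto
    then show ?thesis using that by (auto simp: abs_less_iff)
  qed
  have exact: "y (x, a) - y (x, b) = (a - b) * exp (E x a b)"
    if x: "\<bar>x\<bar> < r" and a: "\<bar>a\<bar> < r" and b: "\<bar>b\<bar> < r" for x a b
  proof -
    \<comment> \<open>The difference of two solutions satisfies a linear equation with coefficient
      \<open>M a b\<close>; multiplied by the integrating factor it is constant.\<close>
    define \<delta> where "\<delta> t = (y (t, a) - y (t, b)) * exp (- E t a b)" for t
    have "(\<delta> has_real_derivative 0) (at t)" if t: "t \<in> {-r<..<r}" for t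
    proof -
      have t': "\<bar>t\<bar> < r" using t by auto
      have "((\<lambda>t. E t a b) has_real_derivative M a b t) (at t)"
        unfolding E_def by (rule DERIV_scaled_integral[OF cM1[OF a b] t'])
      then have "(\<delta> has_real_derivative ((F (t, y (t, a)) - F (t, y (t, b))) * exp (- E t a b) +
          (y (t, a) - y (t, b)) * (exp (- E t a b) * (- M a b t)))) (at t)"
        unfolding \<delta>_def using yx[OF t' a] yx[OF t' b] by (auto intro!: derivative_eq_intros)
      moreover have "F (t, y (t, a)) - F (t, y (t, b)) = M a b t * (y (t, a) - y (t, b))"
        unfolding M_def using le_e[OF t'] yle t' a b by (intro mF) auto
      ultimately show ?thesis by (simp add: algebra_simps)
    qed
    then have eq: "\<delta> x = \<delta> 0" using DERIV_isconst3[of "-r" r x 0 \<delta>] r x by (auto simp: abs_less_iff)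
    have "\<delta> 0 = a - b" by (simp add: \<delta>_def E_def y0 a b)
    with eq have "(y (x, a) - y (x, b)) * exp (- E x a b) = a - b" by (simp add: \<delta>_def)
    then show ?thesis by (simp add: exp_minus field_simps)
  qed
  \<comment> \<open>The case \<open>a = b\<close> of the exponential in \<open>exact\<close>, where
    the mean slope becomes the partial derivative \<open>Fy\<close> along the solution.\<close>
  define g where "g z = exp (fst z * integral {0..1} (\<lambda>\<theta>. Fy (\<theta> * fst z, y (\<theta> * fst z, snd z))))" for z
  have gE: "g (x, a) = exp (E x a a)" for x a
    unfolding g_def E_def M_def m_def by simp
  \<comment> \<open>By \<open>exact\<close> the difference quotient in \<open>a\<close> is
    \<open>exp (E x a b)\<close>, so its limit is a matter of continuity in
    \<open>a\<close>.\<close>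
  have ya: "((\<lambda>a. y (x, a)) has_real_derivative g (x, b)) (at b)" if x: "\<bar>x\<bar> < r" and b: "\<bar>b\<bar> < r" for x b
  proof -
    have "continuous_on ({a. \<bar>a\<bar> < r} \<times> cbox 0 1) (\<lambda>(a, \<theta>). M a b (\<theta> * x))"
    proof -
      have "continuous_on ({a. \<bar>a\<bar> < r} \<times> cbox 0 1) (\<lambda>z. case (fst z, snd z * x) of (a, t) \<Rightarrow> M a b t)"
      proof (rule continuous_on_compose2[OF cM[OF b]])
        show "(\<lambda>z. (fst z, snd z * x)) ` ({a. \<bar>a\<bar> < r} \<times> cbox 0 1) \<subseteq> {a. \<bar>a\<bar> < r} \<times> {-r<..<r}"
        proof (rule image_subsetI)
          fix z :: plane assume "z \<in> {a. \<bar>a\<bar> < r} \<times> cbox 0 1"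
          then show "(fst z, snd z * x) \<in> {a. \<bar>a\<bar> < r} \<times> {-r<..<r}"
            using tr[OF x, of "snd z"] by auto
        qed
      qed (intro continuous_intros)
      then show ?thesis by (simp add: case_prod_unfold)
    qed
    from integral_continuous_on_param[OF this]
    have "continuous_on {a. \<bar>a\<bar> < r} (\<lambda>a. exp (E x a b))" unfolding E_def by (auto intro!: continuous_intros)
    moreover have op: "open {a. \<bar>a\<bar> < r}" by (simp add: open_Collect_less continuous_intros)
    ultimately have "((\<lambda>a. exp (E x a b)) \<longlongrightarrow> g (x, b)) (at b)"
      unfolding gE using b by (simp add: continuous_on_eq_continuous_at isCont_def)
    then have "((\<lambda>a. (y (x, a) - y (x, b)) / (a - b)) \<longlongrightarrow> g (x, b)) (at b)"
    proof (rule Lim_transform_within_open[OF _ op])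
      fix a assume "a \<in> {a. \<bar>a\<bar> < r}" "a \<noteq> b"
      then show "exp (E x a b) = (y (x, a) - y (x, b)) / (a - b)" using exact[OF x, of a b] b by simp
    qed (use b in auto)
    then show ?thesis by (simp add: has_field_derivative_iff)
  qed
  define R where "R = {-r<..<r} \<times> {-r<..<r}"
  have oR: "open R" by (simp add: R_def open_Times)
  define W where "W = {w :: real \<times> plane. (fst w * fst (snd w), snd (snd w)) \<in> R}"
  have "open W" unfolding W_def vimage_def[symmetric]
    by (intro open_vimage oR continuous_intros)
  have WR: "{0..1} \<times> R \<subseteq> W" using tr by (auto simp: W_def R_def abs_less_iff)
  have Ckg: "Ck_on k R g" if k: "Ck_on k R y" for k
  proof -
    let ?s = "\<lambda>w :: real \<times> plane. (fst w * fst (snd w), snd (snd w))"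
    have lin: "Ck_on k W h" if "bounded_linear h" for h :: "real \<times> plane \<Rightarrow> real"
      by (rule Ck_on_linear[OF \<open>open W\<close> that])
    have s1: "Ck_on k W (\<lambda>w. fst w * fst (snd w))"
      by (intro Ck_on_bilinear[OF \<open>open W\<close> bounded_bilinear_mult] lin bounded_linear_intros)
    have s: "Ck_on k W ?s"
      by (intro Ck_on_Pair \<open>open W\<close> s1 lin bounded_linear_intros)
    have ys: "Ck_on k W (\<lambda>w. y (?s w))"
      by (rule Ck_on_compose[OF \<open>open W\<close> oR s k]) (auto simp: W_def)
    have "Ck_on k W (\<lambda>w. Fy (fst w * fst (snd w), y (?s w)))"
      by (rule Ck_on_compose[OF \<open>open W\<close> V(1) Ck_on_Pair[OF \<open>open W\<close> s1 ys]])
        (use Fys yV in \<open>auto simp: smooth_on_def W_def R_def abs_less_iff\<close>)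
    from Ck_on_param_integral[OF \<open>open W\<close> oR WR this]
    have "Ck_on k R (\<lambda>z. fst z * integral {0..1} (\<lambda>\<theta>. Fy (\<theta> * fst z, y (\<theta> * fst z, snd z))))"
      by (intro Ck_on_bilinear[OF oR bounded_bilinear_mult] Ck_on_linear[OF oR bounded_linear_fst]) simp
    then show ?thesis unfolding g_def
      by (rule Ck_on_compose[OF oR open_UNIV _ Ck_on_exp]) simp
  qed
  have "Ck_on 0 R y" using continuous_on_subset[OF cy] by simp
  from Ckg[OF this] have cg: "continuous_on R g" by simp
  have yder: "(y has_derivative (\<lambda>v. fst v * F (x, y (x, a)) + snd v * g (x, a))) (at (x, a))"
    if x: "\<bar>x\<bar> < r" and a: "\<bar>a\<bar> < r" for x a
  proof -
    let ?I = "{-r<..<r}"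
    have I: "x \<in> ?I" "a \<in> ?I" using x a by auto
    have "((\<lambda>(x, a). y (x, a)) has_derivative
        (\<lambda>(tx, ta). tx * F (x, y (x, a)) + blinfun_apply (g (x, a) *\<^sub>R id_blinfun) ta)) (at (x, a) within ?I \<times> ?I)"
    proof (rule has_derivative_partialsI[where fy = "\<lambda>x a. g (x, a) *\<^sub>R id_blinfun"])
      show "((\<lambda>x. y (x, a)) has_derivative (\<lambda>tx. tx * F (x, y (x, a)))) (at x within ?I)"
        using has_field_derivative_at_within[OF yx[OF x a]]
        by (simp add: has_field_derivative_def mult.commute[of _ "F (x, y (x, a))"])
      show "((\<lambda>a. y (x', a)) has_derivative blinfun_apply (g (x', b) *\<^sub>R id_blinfun)) (at b within ?I)"
        if "x' \<in> ?I" "b \<in> ?I" for x' b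
      proof -
        have "blinfun_apply (g (x', b) *\<^sub>R id_blinfun) = (*) (g (x', b))"
          by (simp add: fun_eq_iff scaleR_blinfun.rep_eq)
        then show ?thesis using has_field_derivative_at_within[OF ya[of x' b], of ?I] that
          by (simp add: has_field_derivative_def abs_less_iff)
      qed
      have "continuous (at (x, a)) g" using cg oR I by (auto simp: continuous_on_eq_continuous_at R_def)
      then have "continuous (at (x, a) within ?I \<times> ?I) g" by (rule continuous_at_imp_continuous_at_within)
      then show "continuous (at (x, a) within ?I \<times> ?I) (\<lambda>(x, a). g (x, a) *\<^sub>R id_blinfun)"
        by (auto simp: case_prod_unfold intro!: continuous_intros)
    qed (use I in auto)
    then show ?thesis using oR I
      by (simp add: at_within_open[of _ "?I \<times> ?I"] R_def case_prod_unfold scaleR_blinfun.rep_eq mult.commute)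
  qed
  \<comment> \<open>Bootstrap: both partial derivatives are built from \<open>y\<close> by
    operations that preserve order \<open>k\<close>.\<close>
  have "Ck_on k R y" for k
  proof (induction k)
    case 0
    show ?case using continuous_on_subset[OF cy] by simp
  next
    case (Suc k)
    have Fs: "Ck_on k R (\<lambda>z. F (fst z, y z))"
      by (rule Ck_on_compose[OF oR V(1) Ck_on_Pair[OF oR Ck_on_linear[OF oR bounded_linear_fst] Suc]])
        (use F yV in \<open>auto simp: smooth_on_def R_def abs_less_iff\<close>)
    have "(y has_derivative (\<lambda>v. fst v * F (fst z, y z) + snd v * g z)) (at z)" if "z \<in> R" for z
      using that yder[of "fst z" "snd z"] by (auto simp: R_def abs_less_iff)
    moreover have "Ck_on k R (\<lambda>z. fst v * F (fst z, y z) + snd v * g z)" for v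
      by (intro Ck_on_add oR Ck_on_bilinear[OF oR bounded_bilinear_mult] Ck_on_const Fs Ckg Suc)
    ultimately show ?case by (rule Ck_onI[OF oR])
  qed
  then have "smooth_on ({-r<..<r} \<times> {-r<..<r}) y" by (simp add: smooth_on_def R_def)
  moreover have "g (x, a) > 0" for x a by (simp add: g_def)
  ultimately show ?thesis using that[of r y g] r(1) yV y0 yder by blast
qed

section \<open>Flow boxes of a planar vector field\<close>

abbreviation square :: "real \<Rightarrow> plane set" where "square e \<equiv> {-e<..<e} \<times> {-e<..<e}"

lemma open_square: "open (square e)" by (simp add: open_Times)

lemma square_in_open:
  assumes "open V" "(0, 0) \<in> V" obtains e where "0 < e" "square e \<subseteq> V"
proof -
  obtain d where d: "d > 0" "ball (0, 0) d \<subseteq> V" using assms open_contains_ball by blast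
  have "square (d/2) \<subseteq> V"
  proof
    fix z :: plane assume "z \<in> square (d/2)"
    then have "norm z < d" using norm_Pair_le[of "fst z" "snd z"] by (auto simp: abs_less_iff)
    then show "z \<in> V" using d by (auto simp: dist_norm norm_minus_commute zero_prod_def[symmetric])
  qed
  then show ?thesis using that[of "d/2"] d by auto
qed

lemma open_preimage_smooth:
  assumes "open S" "smooth_on S f" "open T" shows "open {x \<in> S. f x \<in> T}"
  using continuous_open_preimage[OF smooth_on_imp_continuous_on[OF assms(2)] assms(1,3)]
  by (simp add: vimage_def Int_def)

lemma frechet_compose:
  assumes "(f has_derivative f') (at x)" "(g has_derivative g') (at (f x))"
  shows "frechet_derivative (\<lambda>x. g (f x)) (at x) v = g' (f' v)"
proof -
  have "((\<lambda>x. g (f x)) has_derivative (g' \<circ> f')) (at x)"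
    using diff_chain_at[OF assms] by (simp add: o_def)
  from frechet_derivative_at[OF this] show ?thesis by (metis comp_apply)
qed

text \<open>An antiderivative in the first variable that is jointly smooth; it will measure travel
  time along integral curves.\<close>

lemma scaled_integral_smooth:
  fixes h :: "plane \<Rightarrow> real"
  assumes "smooth_on (square r) h"
  shows "smooth_on (square r) (\<lambda>z. fst z * integral {0..1} (\<lambda>\<theta>. h (\<theta> * fst z, snd z)))"
    and "z \<in> square r \<Longrightarrow>
      frechet_derivative (\<lambda>z. fst z * integral {0..1} (\<lambda>\<theta>. h (\<theta> * fst z, snd z))) (at z) (1, 0) = h z"
proof -
  let ?s = "\<lambda>w :: real \<times> plane. (fst w * fst (snd w), snd (snd w))"
  define W where "W = {w. ?s w \<in> square r}"
  have "open W" unfolding W_def vimage_def[symmetric]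
    by (intro open_vimage open_square continuous_intros)
  have tr: "\<theta> * x \<in> {-r<..<r}" if "\<bar>x\<bar> < r" "\<theta> \<in> {0..1}" for \<theta> x
  proof -
    have "\<bar>\<theta> * x\<bar> \<le> 1 * \<bar>x\<bar>" unfolding abs_mult using that by (intro mult_right_mono) auto
    then show ?thesis using that by (auto simp: abs_less_iff)
  qed
  have WR: "{0..1} \<times> square r \<subseteq> W" using tr by (auto simp: W_def abs_less_iff)
  have "smooth_on W ?s"
    by (intro smooth_on_Pair smooth_on_mult smooth_on_linear[OF \<open>open W\<close>] \<open>open W\<close> bounded_linear_intros)
  then have "smooth_on W (\<lambda>w. h (?s w))"
    by (rule smooth_on_compose[OF \<open>open W\<close> open_square _ assms]) (auto simp: W_def)
  then have "Ck_on k (square r) (\<lambda>z. integral {0..1} (\<lambda>\<theta>. h (\<theta> * fst z, snd z)))" for k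
    using Ck_on_param_integral[OF \<open>open W\<close> open_square WR, of k "\<lambda>w. h (?s w)"] by (simp add: smooth_on_def)
  then show sm: "smooth_on (square r) (\<lambda>z. fst z * integral {0..1} (\<lambda>\<theta>. h (\<theta> * fst z, snd z)))"
    by (intro smooth_on_mult smooth_on_linear[OF open_square bounded_linear_fst] open_square) (simp add: smooth_on_def)
  show "frechet_derivative (\<lambda>z. fst z * integral {0..1} (\<lambda>\<theta>. h (\<theta> * fst z, snd z))) (at z) (1, 0) = h z"
    if z: "z \<in> square r"
  proof -
    let ?T = "\<lambda>z. fst z * integral {0..1} (\<lambda>\<theta>. h (\<theta> * fst z, snd z))"
    obtain x a where xa: "z = (x, a)" "\<bar>x\<bar> < r" using z by (cases z) auto
    have "continuous_on {-r<..<r} (\<lambda>x. h (x, a))"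
      by (rule continuous_on_compose2[OF smooth_on_imp_continuous_on[OF assms]])
        (use z xa in \<open>auto intro!: continuous_intros\<close>)
    from DERIV_scaled_integral[OF this xa(2)]
    have 1: "((\<lambda>x. ?T (x, a)) has_derivative (*) (h (x, a))) (at x)"
      by (simp add: has_field_derivative_def)
    have 2: "((\<lambda>x. (x, a)) has_derivative (\<lambda>h. (h, 0))) (at x)" by (auto intro!: derivative_eq_intros)
    have "(?T has_derivative frechet_derivative ?T (at (x, a))) (at (x, a))"
      using smooth_on_has_derivative[OF sm open_square] z xa by blast
    from diff_chain_at[OF 2 this]
    have "((\<lambda>x. ?T (x, a)) has_derivative (\<lambda>h. frechet_derivative ?T (at (x, a)) (h, 0))) (at x)"
      by (simp add: o_def)
    from fun_cong[OF has_derivative_unique[OF this 1], of 1] show ?thesis using xa by simp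
  qed
qed

text \<open>A scalar equation suffices: in a frame aligned with \<open>X z0\<close>, integral curves
  near \<open>z0\<close> are graphs, and their slope \<open>F\<close> is a quotient of components of
  \<open>X\<close>. \<open>\<Phi>\<close> maps the horizontal position and the label of a graph to
  the point on it, and \<open>\<Theta>\<close> maps the same pair to the label and the travel time.
  The flow box is \<open>\<Phi>\<close> after the inverse of \<open>\<Theta>\<close>, so its second
  coordinate is time.\<close>

theorem flow_box_plane:
  fixes X :: "plane \<Rightarrow> plane"
  assumes V: "open V" "z0 \<in> V" and X: "smooth_on V X" "X z0 \<noteq> 0"
  obtains E G e U where "0 < e" "open U" "U \<subseteq> V" "smooth_on (square e) E" "smooth_on U G"
    "homeomorphism (square e) U E G" "E (0, 0) = z0"
    "\<And>b. b \<in> square e \<Longrightarrow> frechet_derivative E (at b) (0, 1) = X (E b)"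
proof -
  define w1 where "w1 = fst (X z0)"
  define w2 where "w2 = snd (X z0)"
  define n where "n = w1\<^sup>2 + w2\<^sup>2"
  have n: "n > 0" using X(2) by (auto simp: n_def w1_def w2_def sum_power2_gt_zero_iff prod_eq_iff)
  \<comment> \<open>Complex multiplication by \<open>w1 + i w2\<close> followed by the shift to
    \<open>z0\<close>: it carries the first axis to the direction of \<open>X z0\<close>.
    \<open>\<alpha>\<close> and \<open>\<beta>\<close> are the components of \<open>X\<close> in
    this frame, with \<open>\<alpha> = 1\<close> at the origin.\<close>
  define L where "L z = (fst z0 + fst z * w1 - snd z * w2, snd z0 + fst z * w2 + snd z * w1)" for z :: plane
  have Lfst: "bounded_linear (\<lambda>z::plane. fst z * c)" "bounded_linear (\<lambda>z::plane. snd z * c)" for c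
    by (auto intro!: bounded_linear_intros)
  have Ls: "smooth_on UNIV L" unfolding L_def
    by (intro smooth_on_Pair smooth_on_add smooth_on_diff smooth_on_const smooth_on_linear[OF _ Lfst(1)]
      smooth_on_linear[OF _ Lfst(2)] open_UNIV)
  define V1 where "V1 = {z \<in> UNIV. L z \<in> V}"
  have V1: "open V1" unfolding V1_def by (rule open_preimage_smooth[OF open_UNIV Ls V(1)])
  have XL: "smooth_on V1 (\<lambda>z. X (L z))"
    by (rule smooth_on_compose[OF V1 V(1) smooth_on_subset[OF Ls] X(1)]) (auto simp: V1_def)
  define \<alpha> where "\<alpha> z = (fst (X (L z)) * w1 + snd (X (L z)) * w2) / n" for z
  define \<beta> where "\<beta> z = (snd (X (L z)) * w1 - fst (X (L z)) * w2) / n" for z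
  have \<alpha>\<beta>: "smooth_on V1 \<alpha>" "smooth_on V1 \<beta>" unfolding \<alpha>_def \<beta>_def using n
    by (intro smooth_on_divide smooth_on_add smooth_on_diff smooth_on_mult smooth_on_fst smooth_on_snd
        smooth_on_const XL V1; simp)+
  have Xab: "X (L z) = (\<alpha> z * w1 - \<beta> z * w2, \<alpha> z * w2 + \<beta> z * w1)" for z
  proof -
    have "\<alpha> z * n = fst (X (L z)) * w1 + snd (X (L z)) * w2" "\<beta> z * n = snd (X (L z)) * w1 - fst (X (L z)) * w2"
      unfolding \<alpha>_def \<beta>_def using n by simp_all
    note ab = this
    have "fst (X (L z)) * n = (\<alpha> z * n) * w1 - (\<beta> z * n) * w2" "snd (X (L z)) * n = (\<alpha> z * n) * w2 + (\<beta> z * n) * w1"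
      unfolding ab by (simp_all add: n_def power2_eq_square algebra_simps)
    then have "fst (X (L z)) * n = (\<alpha> z * w1 - \<beta> z * w2) * n" "snd (X (L z)) * n = (\<alpha> z * w2 + \<beta> z * w1) * n"
      by (simp_all add: algebra_simps)
    then show ?thesis using n by (simp add: prod_eq_iff)
  qed
  have L0: "L (0, 0) = z0" by (simp add: L_def)
  have "fst (X z0) * w1 + snd (X z0) * w2 = n" by (simp add: w1_def w2_def n_def power2_eq_square)
  then have "\<alpha> (0, 0) = 1" using n unfolding \<alpha>_def L0 by simp
  define V2 where "V2 = {z \<in> V1. \<alpha> z \<in> {0<..}}"
  have V2: "open V2" "(0, 0) \<in> V2"
    using open_preimage_smooth[OF V1 \<alpha>\<beta>(1), of "{0<..}"] \<open>\<alpha> (0, 0) = 1\<close> V(2)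
    by (auto simp: V2_def V1_def L0)
  define F where "F z = \<beta> z / \<alpha> z" for z
  have V21: "V2 \<subseteq> V1" and \<alpha>0: "\<alpha> z > 0" if "z \<in> V2" for z using that by (auto simp: V2_def)
  have V21: "V2 \<subseteq> V1" by (auto simp: V2_def)
  have F: "smooth_on V2 F" unfolding F_def
    by (intro smooth_on_divide V2 smooth_on_subset[OF \<alpha>\<beta>(1) V21] smooth_on_subset[OF \<alpha>\<beta>(2) V21])
      (use \<alpha>0 in fastforce)
  obtain r y g where r: "0 < r" and y: "smooth_on (square r) y"
    and yV: "\<And>x a. \<bar>x\<bar> < r \<Longrightarrow> \<bar>a\<bar> < r \<Longrightarrow> (x, y (x, a)) \<in> V2"
    and y0: "\<And>a. \<bar>a\<bar> < r \<Longrightarrow> y (0, a) = a"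
    and yder: "\<And>x a. \<bar>x\<bar> < r \<Longrightarrow> \<bar>a\<bar> < r \<Longrightarrow>
       (y has_derivative (\<lambda>v. fst v * F (x, y (x, a)) + snd v * g (x, a))) (at (x, a))"
    and g: "\<And>x a. g (x, a) > (0::real)"
    by (rule ode_smooth_solution[OF V2 F]) blast
  have yV': "(fst z, y z) \<in> V2" if "z \<in> square r" for z
    using that yV[of "fst z" "snd z"] by (auto simp: abs_less_iff)
  have ys: "smooth_on (square r) (\<lambda>z. (fst z, y z))"
    by (intro smooth_on_Pair smooth_on_linear open_square bounded_linear_fst y)
  define \<Phi> where "\<Phi> z = L (fst z, y z)" for z
  have \<Phi>: "smooth_on (square r) \<Phi>" unfolding \<Phi>_def
    by (rule smooth_on_compose[OF open_square open_UNIV ys Ls]) simp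
  have \<Phi>V: "\<Phi> z \<in> V" if "z \<in> square r" for z using yV'[OF that] by (auto simp: \<Phi>_def V2_def V1_def)
  have \<Phi>der: "(\<Phi> has_derivative (\<lambda>v. let q = fst v * F (fst z, y z) + snd v * g z in
      (fst v * w1 - q * w2, fst v * w2 + q * w1))) (at z)" if z: "z \<in> square r" for z
  proof -
    have "(y has_derivative (\<lambda>v. fst v * F (fst z, y z) + snd v * g z)) (at z)"
      using yder[of "fst z" "snd z"] z by (auto simp: abs_less_iff)
    then show ?thesis unfolding \<Phi>_def L_def fst_conv snd_conv Let_def
      by (auto intro!: derivative_eq_intros)
  qed
  \<comment> \<open>Time per unit of horizontal motion, the reciprocal of the horizontal speed
    \<open>\<alpha>\<close>. Its integral \<open>\<tau>\<close> is the travel time from the vertical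
    axis.\<close>
  define h where "h z = 1 / \<alpha> (fst z, y z)" for z
  have h: "smooth_on (square r) h" unfolding h_def
    by (intro smooth_on_divide smooth_on_const open_square
        smooth_on_compose[OF open_square V2(1) ys smooth_on_subset[OF \<alpha>\<beta>(1) V21]])
      (use yV' \<alpha>0 in fastforce)+
  have h0: "h z > 0" if "z \<in> square r" for z using \<alpha>0[OF yV'[OF that]] by (simp add: h_def)
  define \<tau> where "\<tau> z = fst z * integral {0..1} (\<lambda>\<theta>. h (\<theta> * fst z, snd z))" for z
  have \<tau>: "smooth_on (square r) \<tau>" and \<tau>1: "\<And>z. z \<in> square r \<Longrightarrow> frechet_derivative \<tau> (at z) (1, 0) = h z"
    using scaled_integral_smooth[OF h] unfolding \<tau>_def[abs_def] by auto
  define \<Theta> where "\<Theta> z = (snd z, \<tau> z)" for z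
  have \<Theta>: "smooth_on (square r) \<Theta>" unfolding \<Theta>_def
    by (intro smooth_on_Pair smooth_on_linear open_square bounded_linear_snd \<tau>)
  have \<Theta>der: "(\<Theta> has_derivative (\<lambda>v. (snd v, frechet_derivative \<tau> (at z) v))) (at z)" if "z \<in> square r" for z
    unfolding \<Theta>_def using smooth_on_has_derivative[OF \<tau> open_square that]
    by (intro has_derivative_Pair bounded_linear_imp_has_derivative bounded_linear_snd)
  have z0: "(0, 0) \<in> square r" using r by simp
  have lin\<tau>: "frechet_derivative \<tau> (at (0, 0)) v = fst v * h (0, 0) + snd v * frechet_derivative \<tau> (at (0, 0)) (0, 1)" for v
    using linear_plane_expand[OF has_derivative_linear[OF smooth_on_has_derivative[OF \<tau> open_square z0]], of v]
      \<tau>1[OF z0] by simp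
  have "inj (frechet_derivative \<Theta> (at (0, 0)))"
    unfolding frechet_derivative_at[OF \<Theta>der[OF z0], symmetric]
  proof (rule injI)
    fix u v :: plane
    assume "(snd u, frechet_derivative \<tau> (at (0, 0)) u) = (snd v, frechet_derivative \<tau> (at (0, 0)) v)"
    then have "snd u = snd v" "fst u * h (0, 0) = fst v * h (0, 0)"
      unfolding lin\<tau>[of u] lin\<tau>[of v] by auto
    then show "u = v" using h0[OF z0] by (simp add: prod_eq_iff)
  qed
  then obtain U1 W1 g1 where 1: "open U1" "(0, 0) \<in> U1" "U1 \<subseteq> square r" "open W1" "\<Theta> (0, 0) \<in> W1"
    "homeomorphism U1 W1 \<Theta> g1" "smooth_on W1 g1" by (rule local_inverse_plane[OF open_square \<Theta> z0])
  have "inj (frechet_derivative \<Phi> (at (0, 0)))"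
    unfolding frechet_derivative_at[OF \<Phi>der[OF z0], symmetric]
  proof (rule injI)
    fix u v :: plane
    define q where "q v = fst v * F (fst (0, 0), y (0, 0)) + snd v * g (0, 0)" for v
    assume "(let q = fst u * F (fst (0, 0), y (0, 0)) + snd u * g (0, 0) in (fst u * w1 - q * w2, fst u * w2 + q * w1)) =
       (let q = fst v * F (fst (0, 0), y (0, 0)) + snd v * g (0, 0) in (fst v * w1 - q * w2, fst v * w2 + q * w1))"
    then have e: "fst u * w1 - q u * w2 = fst v * w1 - q v * w2" "fst u * w2 + q u * w1 = fst v * w2 + q v * w1"
      by (auto simp: q_def Let_def)
    have "(fst u - fst v) * n = w1 * (fst u * w1 - q u * w2 - (fst v * w1 - q v * w2)) +
        w2 * (fst u * w2 + q u * w1 - (fst v * w2 + q v * w1))"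
      by (simp add: n_def algebra_simps power2_eq_square)
    then have f: "fst u = fst v" using e n by simp
    have "(q u - q v) * n = w1 * (fst u * w2 + q u * w1 - (fst v * w2 + q v * w1)) -
        w2 * (fst u * w1 - q u * w2 - (fst v * w1 - q v * w2))"
      by (simp add: n_def algebra_simps power2_eq_square)
    then have "q u = q v" using e n by simp
    then show "u = v" using f g[of 0 0] by (auto simp: q_def prod_eq_iff)
  qed
  then obtain U2 W2 g2 where 2: "open U2" "(0, 0) \<in> U2" "U2 \<subseteq> square r" "open W2" "\<Phi> (0, 0) \<in> W2"
    "homeomorphism U2 W2 \<Phi> g2" "smooth_on W2 g2" by (rule local_inverse_plane[OF open_square \<Phi> z0])
  have \<Theta>0: "\<Theta> (0, 0) = (0, 0)" by (simp add: \<Theta>_def \<tau>_def)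
  have i1: "g1 (\<Theta> x) = x" "\<Theta> x \<in> W1" if "x \<in> U1" for x using 1(6) that by (auto simp: homeomorphism_def)
  have j1: "\<Theta> (g1 x) = x" "g1 x \<in> U1" if "x \<in> W1" for x using 1(6) that by (auto simp: homeomorphism_def)
  have i2: "g2 (\<Phi> x) = x" "\<Phi> x \<in> W2" if "x \<in> U2" for x using 2(6) that by (auto simp: homeomorphism_def)
  have j2: "\<Phi> (g2 x) = x" "g2 x \<in> U2" if "x \<in> W2" for x using 2(6) that by (auto simp: homeomorphism_def)
  \<comment> \<open>\<open>E = \<Phi> \<circ> g1\<close> is invertible only where \<open>g1\<close>
    lands in the domain on which \<open>\<Phi>\<close> was inverted.\<close>
  have "open {b \<in> W1. g1 b \<in> U2}" by (rule open_preimage_smooth[OF 1(4,7) 2(1)])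
  moreover have "(0, 0) \<in> {b \<in> W1. g1 b \<in> U2}" using i1[OF 1(2)] 2(2) by (simp add: \<Theta>0)
  ultimately obtain e where e: "0 < e" and sq: "square e \<subseteq> {b \<in> W1. g1 b \<in> U2}"
    using square_in_open by blast
  define E where "E b = \<Phi> (g1 b)" for b
  define G where "G z = \<Theta> (g2 z)" for z
  define U where "U = {z \<in> W2. g2 z \<in> {x \<in> U1. \<Theta> x \<in> square e}}"
  have oU: "open U" unfolding U_def
    by (intro open_preimage_smooth[OF 2(4,7)] open_preimage_smooth[OF 1(1)] smooth_on_subset[OF \<Theta> 1(3)] open_square)
  have E: "smooth_on (square e) E" unfolding E_def
    by (rule smooth_on_compose[OF open_square open_square smooth_on_subset[OF 1(7)] \<Phi>]) (use sq 2(3) in blast)+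
  have UW: "U \<subseteq> W2" by (auto simp: U_def)
  have G: "smooth_on U G" unfolding G_def
    by (rule smooth_on_compose[OF oU open_square smooth_on_subset[OF 2(7) UW] \<Theta>]) (use j2 2(3) UW in blast)
  have EU: "E b \<in> U" "G (E b) = b" if "b \<in> square e" for b
    using that sq i2[of "g1 b"] j1[of b] by (auto simp: U_def E_def G_def subset_iff)
  have GU: "G z \<in> square e" "E (G z) = z" if "z \<in> U" for z
    using that j2[of z] i1[of "g2 z"] by (auto simp: U_def E_def G_def)
  have hom: "homeomorphism (square e) U E G"
    by (rule homeomorphismI) (use EU GU E G smooth_on_imp_continuous_on in blast)+
  have UV: "U \<subseteq> V"
  proof
    fix z assume "z \<in> U"
    then have "g2 z \<in> U2" "\<Phi> (g2 z) = z" using j2[of z] UW by auto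
    then show "z \<in> V" using \<Phi>V[of "g2 z"] 2(3) by auto
  qed
  have E0: "E (0, 0) = z0"
    unfolding E_def using i1(1)[OF 1(2)] y0[of 0] r by (simp add: \<Theta>0 \<Phi>_def L0)
  have "frechet_derivative E (at b) (0, 1) = X (E b)" if b: "b \<in> square e" for b
  proof -
    define p where "p = g1 b"
    have p: "p \<in> U1" "p \<in> U2" "p \<in> square r" "\<Theta> p = b" using b sq j1[of b] 1(3) by (auto simp: p_def)
    have "(E has_derivative frechet_derivative E (at b)) (at (\<Theta> p))"
      using smooth_on_has_derivative[OF E open_square b] p(4) by simp
    from diff_chain_at[OF \<Theta>der[OF p(3)] this]
    have "((\<lambda>x. E (\<Theta> x)) has_derivative (\<lambda>v. frechet_derivative E (at b) (snd v, frechet_derivative \<tau> (at p) v))) (at p)"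
      by (simp add: o_def)
    then have e1: "(\<Phi> has_derivative (\<lambda>v. frechet_derivative E (at b) (snd v, frechet_derivative \<tau> (at p) v))) (at p)"
      by (rule has_derivative_transform_within_open[OF _ 1(1) p(1)]) (simp add: E_def i1)
    \<comment> \<open>Direction \<open>(1, 0)\<close> is motion along an integral curve:
      \<open>\<Phi>\<close> then moves by \<open>X\<close> divided by the horizontal speed, and
      \<open>\<Theta>\<close> by \<open>(0, h p)\<close>. Dividing by \<open>h p\<close> gives the
      derivative of \<open>E\<close> in direction \<open>(0, 1)\<close>.\<close>
    from fun_cong[OF has_derivative_unique[OF e1 \<Phi>der[OF p(3)]], of "(1, 0)"]
    have "frechet_derivative E (at b) (0, h p) = (w1 - F (fst p, y p) * w2, w2 + F (fst p, y p) * w1)"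
      using \<tau>1[OF p(3)] by (simp add: Let_def)
    moreover have "frechet_derivative E (at b) (0, h p) = h p *\<^sub>R frechet_derivative E (at b) (0, 1)"
      using linear_scale[OF has_derivative_linear[OF smooth_on_has_derivative[OF E open_square b]], of "h p" "(0, 1)"] by simp
    ultimately have eq: "h p *\<^sub>R frechet_derivative E (at b) (0, 1) = (w1 - F (fst p, y p) * w2, w2 + F (fst p, y p) * w1)"
      by simp
    have a: "\<alpha> (fst p, y p) > 0" using \<alpha>0 yV' p(3) by blast
    have "X (E b) = \<alpha> (fst p, y p) *\<^sub>R (w1 - F (fst p, y p) * w2, w2 + F (fst p, y p) * w1)"
      using Xab[of "(fst p, y p)"] a unfolding E_def p_def[symmetric] \<Phi>_def F_def
      by (simp add: algebra_simps)
    also have "\<dots> = frechet_derivative E (at b) (0, 1)" unfolding eq[symmetric] using a by (simp add: h_def)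
    finally show ?thesis by simp
  qed
  then show ?thesis using that[OF e oU UV E G hom E0] by blast
qed

section \<open>Paracompactness\<close>

text \<open>On one piece this is the argument that regular Lindelof spaces are paracompact: shrink
  the cover to \<open>V x \<subseteq> C x \<subseteq> U x\<close> with \<open>C x\<close> closed,
  pass to countably many \<open>V\<close>, and cut away the earlier \<open>C\<close>. Disjoint open
  pieces do not disturb each other's local finiteness.\<close>

lemma Lindelof_pieces_imp_paracompact:
  assumes reg: "regular_space X" and cov: "\<Union>\<P> = topspace X"
    and op: "\<And>P. P \<in> \<P> \<Longrightarrow> openin X P"
    and lin: "\<And>P. P \<in> \<P> \<Longrightarrow> Lindelof_space (subtopology X P)"
    and disj: "\<And>P P' x. P \<in> \<P> \<Longrightarrow> P' \<in> \<P> \<Longrightarrow> x \<in> P \<Longrightarrow> x \<in> P' \<Longrightarrow> P = P'"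
  shows "paracompact_space X"
  unfolding paracompact_space_def
proof (intro allI impI)
  fix \<U> assume \<U>: "(\<forall>U\<in>\<U>. openin X U) \<and> \<Union>\<U> = topspace X"
  have "\<exists>U V C. U \<in> \<U> \<and> openin X V \<and> closedin X C \<and> x \<in> V \<and> V \<subseteq> C \<and> C \<subseteq> U" if "x \<in> topspace X" for x
  proof -
    have "x \<in> \<Union>\<U>" using \<U> that by simp
    then obtain U where U: "U \<in> \<U>" "x \<in> U" "openin X U" using \<U> by auto
    have "neighbourhood_base_of (closedin X) X"
      using reg by (simp add: neighbourhood_base_of_closedin)
    then obtain V C where "openin X V" "closedin X C" "x \<in> V" "V \<subseteq> C" "C \<subseteq> U"
      using neighbourhood_base_of[of "closedin X" X, THEN iffD1, rule_format, of U x] U(2,3) by auto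
    with U(1) show ?thesis by (intro exI[of _ U] exI[of _ V] exI[of _ C]) simp
  qed
  then obtain U V C where UVC: "\<And>x. x \<in> topspace X \<Longrightarrow>
      U x \<in> \<U> \<and> openin X (V x) \<and> closedin X (C x) \<and> x \<in> V x \<and> V x \<subseteq> C x \<and> C x \<subseteq> U x"
    by metis
  have "\<exists>f :: nat \<Rightarrow> 'a. range f \<subseteq> topspace X \<and> P \<subseteq> (\<Union>n. V (f n))" if P: "P \<in> \<P>" "P \<noteq> {}" for P
  proof -
    have sub: "P \<subseteq> topspace X" using cov P by blast
    have "P \<subseteq> \<Union>(V ` P)" "\<forall>W\<in>V ` P. openin X W" using UVC sub by auto
    then obtain \<K> where \<K>: "countable \<K>" "\<K> \<subseteq> V ` P" "P \<subseteq> \<Union>\<K>"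
      using lin[OF P(1)] unfolding Lindelof_space_subtopology_subset[OF sub] by meson
    obtain K where K: "countable K" "K \<subseteq> P" "\<K> = V ` K" 
      using \<K>(1,2) by (metis countable_subset_image)
    have "K \<noteq> {}" using \<K>(3) K(3) P(2) by auto
    then have "range (from_nat_into K) = K" using K(1) by (simp add: range_from_nat_into)
    moreover have "(\<Union>n. V (from_nat_into K n)) = \<Union>(V ` range (from_nat_into K))" by auto
    ultimately show ?thesis using \<K>(3) K sub
      by (intro exI[of _ "from_nat_into K"]) simp
  qed
  then obtain f :: "'a set \<Rightarrow> nat \<Rightarrow> 'a" where f: "\<And>P. P \<in> \<P> \<Longrightarrow> P \<noteq> {} \<Longrightarrow>
      range (f P) \<subseteq> topspace X \<and> P \<subseteq> (\<Union>n. V (f P n))"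
    by metis
  have ft: "f P n \<in> topspace X" if "P \<in> \<P>" "P \<noteq> {}" for P n using f[OF that] by auto
  \<comment> \<open>A point of \<open>V (f P m)\<close> lies in \<open>C (f P m)\<close>, which is
    removed from all \<open>W P n\<close> with \<open>n > m\<close>. Hence that neighbourhood meets
    at most \<open>m + 1\<close> members.\<close>
  define W where "W P n = (P \<inter> U (f P n)) - (\<Union>m\<in>{..<n}. C (f P m))" for P n
  define \<V> where "\<V> = {W P n | P n. P \<in> \<P> \<and> P \<noteq> {}}"
  have W: "openin X (W P n)" if "P \<in> \<P>" "P \<noteq> {}" for P n
    unfolding W_def using UVC[OF ft[OF that]] op[OF that(1)] \<U>
    by (intro openin_diff openin_Int closedin_Union) auto
  have 1: "\<Union>\<V> = topspace X"
  proof
    show "\<Union>\<V> \<subseteq> topspace X" using openin_subset[OF W] unfolding \<V>_def by blast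
    show "topspace X \<subseteq> \<Union>\<V>"
    proof
      fix x assume "x \<in> topspace X"
      then obtain P where P: "P \<in> \<P>" "x \<in> P" using cov by blast
      then have ne: "P \<noteq> {}" by blast
      have ex: "\<exists>n. x \<in> U (f P n)" using f[OF P(1) ne] P(2) UVC[OF ft[OF P(1) ne]] by blast
      define n where "n = (LEAST n. x \<in> U (f P n))"
      have "x \<in> U (f P n)" unfolding n_def by (rule LeastI_ex[OF ex])
      moreover have "x \<notin> C (f P m)" if "m < n" for m
        using not_less_Least[of m "\<lambda>n. x \<in> U (f P n)"] that UVC[OF ft[OF P(1) ne]] unfolding n_def by blast
      ultimately have "x \<in> W P n" using P by (auto simp: W_def)
      then show "x \<in> \<Union>\<V>" using P ne by (auto simp: \<V>_def)
    qed
  qed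
  have 2: "\<exists>N. openin X N \<and> x \<in> N \<and> finite {S \<in> \<V>. S \<inter> N \<noteq> {}}" if x: "x \<in> topspace X" for x
  proof -
    obtain P where P: "P \<in> \<P>" "x \<in> P" using cov x by blast
    then have ne: "P \<noteq> {}" by blast
    obtain m where m: "x \<in> V (f P m)" using f[OF P(1) ne] P(2) by blast
    have "{S \<in> \<V>. S \<inter> (P \<inter> V (f P m)) \<noteq> {}} \<subseteq> W P ` {..m}"
    proof
      fix S assume "S \<in> {S \<in> \<V>. S \<inter> (P \<inter> V (f P m)) \<noteq> {}}"
      then obtain P' n z where S: "S = W P' n" "P' \<in> \<P>" "z \<in> W P' n" "z \<in> P" "z \<in> V (f P m)"
        by (auto simp: \<V>_def)
      then have "P' = P" using disj P(1) by (auto simp: W_def)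
      moreover have "n \<le> m"
      proof (rule ccontr)
        assume "\<not> n \<le> m"
        then have "z \<notin> C (f P m)" using S \<open>P' = P\<close> by (auto simp: W_def)
        then show False using S(5) UVC[OF ft[OF P(1) ne]] by blast
      qed
      ultimately show "S \<in> W P ` {..m}" using S by blast
    qed
    then have "finite {S \<in> \<V>. S \<inter> (P \<inter> V (f P m)) \<noteq> {}}" by (rule finite_subset) simp
    moreover have "openin X (P \<inter> V (f P m))" using op[OF P(1)] UVC[OF ft[OF P(1) ne]] by auto
    ultimately show ?thesis using P m by blast
  qed
  show "\<exists>\<V>. (\<forall>V\<in>\<V>. openin X V) \<and> \<Union>\<V> = topspace X \<and> (\<forall>V\<in>\<V>. \<exists>U\<in>\<U>. V \<subseteq> U) \<and> locally_finite_in X \<V>"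
  proof (intro exI[of _ \<V>] conjI)
    show "\<forall>V\<in>\<V>. openin X V" using W by (auto simp: \<V>_def)
    show "\<forall>V\<in>\<V>. \<exists>U\<in>\<U>. V \<subseteq> U"
    proof
      fix S assume "S \<in> \<V>"
      then obtain P n where "S = W P n" "P \<in> \<P>" "P \<noteq> {}" by (auto simp: \<V>_def)
      then show "\<exists>U\<in>\<U>. S \<subseteq> U" using UVC[OF ft, of P n] by (auto simp: W_def)
    qed
    show "locally_finite_in X \<V>" unfolding locally_finite_in_def using 1 2 by blast
  qed (rule 1)
qed

text \<open>In a locally finite cover by sets inside compact ones, each member meets only finitely
  many others. Chains of overlapping members therefore reach only countably many of them, and the
  unions over chain classes are the pieces.\<close>

lemma paracompact_Lindelof_pieces:
  assumes par: "paracompact_space X"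
    and loc: "\<And>x. x \<in> topspace X \<Longrightarrow> \<exists>U K. openin X U \<and> x \<in> U \<and> compactin X K \<and> U \<subseteq> K \<and>
      (\<forall>W\<subseteq>U. Lindelof_space (subtopology X W))"
  obtains \<P> where "\<Union>\<P> = topspace X" "\<And>P. P \<in> \<P> \<Longrightarrow> openin X P"
    "\<And>P. P \<in> \<P> \<Longrightarrow> Lindelof_space (subtopology X P)"
    "\<And>P P' x. P \<in> \<P> \<Longrightarrow> P' \<in> \<P> \<Longrightarrow> x \<in> P \<Longrightarrow> x \<in> P' \<Longrightarrow> P = P'"
proof -
  define \<U> where "\<U> = {U. openin X U \<and> (\<exists>K. compactin X K \<and> U \<subseteq> K) \<and> (\<forall>W\<subseteq>U. Lindelof_space (subtopology X W))}"
  have "\<Union>\<U> = topspace X"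
  proof
    show "\<Union>\<U> \<subseteq> topspace X" unfolding \<U>_def by (auto dest: openin_subset)
    show "topspace X \<subseteq> \<Union>\<U>" 
    proof
      fix x assume "x \<in> topspace X"
      from loc[OF this] obtain U K where "openin X U" "x \<in> U" "compactin X K" "U \<subseteq> K"
        "\<forall>W\<subseteq>U. Lindelof_space (subtopology X W)" by (elim exE conjE)
      then show "x \<in> \<Union>\<U>" unfolding \<U>_def by (intro UnionI[of U]) auto
    qed
  qed
  moreover have "\<forall>U\<in>\<U>. openin X U" by (simp add: \<U>_def)
  ultimately have "\<exists>\<V>. (\<forall>V\<in>\<V>. openin X V) \<and> \<Union>\<V> = topspace X \<and> (\<forall>V\<in>\<V>. \<exists>U\<in>\<U>. V \<subseteq> U) \<and> locally_finite_in X \<V>"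
    using par unfolding paracompact_space_def by simp
  then obtain \<V> where \<V>: "\<And>V. V \<in> \<V> \<Longrightarrow> openin X V" "\<Union>\<V> = topspace X"
      "\<And>V. V \<in> \<V> \<Longrightarrow> \<exists>U\<in>\<U>. V \<subseteq> U" "locally_finite_in X \<V>"
    by (elim exE conjE) (rule that; simp)
  define E where "E = {(V, W). V \<in> \<V> \<and> W \<in> \<V> \<and> V \<inter> W \<noteq> {}}"
  \<comment> \<open>Cover the compact set around \<open>V\<close> by finitely many open sets, each
    of which meets finitely many members.\<close>
  have fin: "finite (E `` {V})" if V: "V \<in> \<V>" for V
  proof -
    obtain K where K: "compactin X K" "V \<subseteq> K" using \<V>(3)[OF V] unfolding \<U>_def by blast
    define \<N> where "\<N> = {N. openin X N \<and> finite {W \<in> \<V>. W \<inter> N \<noteq> {}}}"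
    have "K \<subseteq> \<Union>\<N>"
    proof
      fix x assume "x \<in> K"
      then have "x \<in> topspace X" using K(1) compactin_subset_topspace by blast
      then show "x \<in> \<Union>\<N>" using \<V>(4) unfolding locally_finite_in_def \<N>_def by blast
    qed
    moreover have "\<And>N. N \<in> \<N> \<Longrightarrow> openin X N" by (simp add: \<N>_def)
    ultimately obtain \<F> where \<F>: "finite \<F>" "\<F> \<subseteq> \<N>" "K \<subseteq> \<Union>\<F>"
      using compactinD[OF K(1)] by metis
    have "E `` {V} \<subseteq> (\<Union>N\<in>\<F>. {W \<in> \<V>. W \<inter> N \<noteq> {}})"
      using K(2) \<F>(3) unfolding E_def by blast
    moreover have "finite (\<Union>N\<in>\<F>. {W \<in> \<V>. W \<inter> N \<noteq> {}})" using \<F> by (auto simp: \<N>_def)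
    ultimately show ?thesis by (rule finite_subset)
  qed
  have cou: "countable (E\<^sup>* `` {V})" for V
  proof (rule countable_rtrancl)
    fix Y :: "'a set set" assume Y: "countable Y"
    have "E `` Y = (\<Union>V\<in>Y \<inter> \<V>. E `` {V})" by (auto simp: E_def)
    moreover have "countable (Y \<inter> \<V>)" using Y by (rule countable_subset[rotated]) auto
    then have "countable (\<Union>V\<in>Y \<inter> \<V>. E `` {V})" by (rule countable_UN) (use fin countable_finite in blast)
    ultimately show "countable (E `` Y)" by simp
  qed simp
  have sub: "E\<^sup>* `` {V} \<subseteq> \<V>" if "V \<in> \<V>" for V
  proof
    fix W assume "W \<in> E\<^sup>* `` {V}"
    then have "(V, W) \<in> E\<^sup>*" by simp
    then show "W \<in> \<V>" by (induction rule: rtrancl_induct) (use that in \<open>auto simp: E_def\<close>)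
  qed
  have "sym E" by (auto simp: E_def sym_def)
  then have symE: "(W, V) \<in> E\<^sup>*" if "(V, W) \<in> E\<^sup>*" for V W using that sym_rtrancl symD by metis
  define \<P> where "\<P> = (\<lambda>V. \<Union>(E\<^sup>* `` {V})) ` \<V>"
  show ?thesis
  proof (rule that[of \<P>])
    show "\<Union>\<P> = topspace X"
    proof
      show "\<Union>\<P> \<subseteq> topspace X" using sub \<V>(2) unfolding \<P>_def by blast
      show "topspace X \<subseteq> \<Union>\<P>" unfolding \<V>(2)[symmetric] \<P>_def by blast
    qed
    fix P assume "P \<in> \<P>"
    then obtain V where V: "V \<in> \<V>" "P = \<Union>(E\<^sup>* `` {V})" by (auto simp: \<P>_def)
    show "openin X P" unfolding V(2) using sub[OF V(1)] \<V>(1) by blast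
    have "Lindelof_space (subtopology X W)" if "W \<in> E\<^sup>* `` {V}" for W
    proof -
      have "W \<in> \<V>" using that sub[OF V(1)] by blast
      then show ?thesis using \<V>(3) unfolding \<U>_def by blast
    qed
    then show "Lindelof_space (subtopology X P)" unfolding V(2) by (rule Lindelof_space_Union[OF cou])
    fix P' x assume P': "P' \<in> \<P>" "x \<in> P" "x \<in> P'"
    then obtain V' where V': "V' \<in> \<V>" "P' = \<Union>(E\<^sup>* `` {V'})" by (auto simp: \<P>_def)
    obtain W W' where W: "(V, W) \<in> E\<^sup>*" "(V', W') \<in> E\<^sup>*" "x \<in> W" "x \<in> W'"
      using P' V V' by blast
    then have "(W, W') \<in> E" using sub[OF V(1)] sub[OF V'(1)] by (auto simp: E_def)
    then have VV': "(V, V') \<in> E\<^sup>*" using W symE by (meson rtrancl_trans r_into_rtrancl)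
    then have "E\<^sup>* `` {V} = E\<^sup>* `` {V'}" using symE by (auto intro: rtrancl_trans)
    then show "P = P'" using V V' by simp
  qed
qed

lemma Lindelof_euclidean:
  "Lindelof_space (top_of_set (S :: 'a::second_countable_topology set))"
  unfolding Lindelof_space_def
  by (metis Lindelof_openin)

text \<open>Invariance of domain on the line. It stands in for transversality of the Cauchy surface,
  since the derivative of \<open>f\<close> may vanish.\<close>

lemma injective_real_neighbourhood:
  fixes f :: "real \<Rightarrow> real"
  assumes "e > 0" "continuous_on {-e<..<e} f" "inj_on f {-e<..<e}"
  obtains d where "d > 0" "{f 0 - d<..<f 0 + d} \<subseteq> f ` {-e<..<e}"
proof -
  have "open (f ` {-e<..<e})"
    using injective_eq_1d_open_map_UNIV[of "{-e<..<e}" f] assms(2,3)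
    by (auto simp: is_interval_convex_1)
  moreover have "f 0 \<in> f ` {-e<..<e}" using assms(1) by auto
  ultimately obtain d where d: "d > 0" "ball (f 0) d \<subseteq> f ` {-e<..<e}"
    using open_contains_ball by blast
  then show ?thesis using that[of d] by (auto simp: ball_eq_greaterThanLessThan)
qed

section \<open>Charts and smooth maps\<close>

lemma is_chartD:
  assumes "is_chart X c"
  shows "openin X (fst c)" "open (snd c ` fst c)" "inj_on (snd c) (fst c)" "snd c \<in> extensional (fst c)"
    "fst c \<subseteq> topspace X"
proof -
  show 1: "openin X (fst c)" "open (snd c ` fst c)" "snd c \<in> extensional (fst c)" using assms by (auto simp: is_chart_def)
  show "fst c \<subseteq> topspace X" using 1(1) openin_subset by blast
  then show "inj_on (snd c) (fst c)" using assms
    by (simp add: is_chart_def homeomorphic_eq_everything_map Int_absorb1)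
qed

lemma chart_inv:
  assumes "is_chart X c"
  shows "p \<in> fst c \<Longrightarrow> inv_chart c (snd c p) = p"
    "x \<in> snd c ` fst c \<Longrightarrow> snd c (inv_chart c x) = x" "x \<in> snd c ` fst c \<Longrightarrow> inv_chart c x \<in> fst c"
  using is_chartD(3)[OF assms] by (auto simp: inv_into_into f_inv_into_f)

lemma chart_open_image:
  assumes "is_chart X c" "openin X W" shows "open (snd c ` (W \<inter> fst c))"
proof -
  have "open_map (subtopology X (fst c)) (top_of_set (snd c ` fst c)) (snd c)"
    using assms(1) by (auto simp: is_chart_def homeomorphic_imp_open_map)
  then have "openin (top_of_set (snd c ` fst c)) (snd c ` (W \<inter> fst c))"
    using assms(2) unfolding open_map_def by (metis openin_subtopology)
  then show ?thesis using is_chartD(2)[OF assms(1)] openin_open_trans by blast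
qed

lemma chart_open_preimage:
  assumes "is_chart X c" "open B" shows "openin X {p \<in> fst c. snd c p \<in> B}"
proof -
  have "continuous_map (subtopology X (fst c)) (top_of_set (snd c ` fst c)) (snd c)"
    using assms(1) by (auto simp: is_chart_def homeomorphic_imp_continuous_map)
  then have "continuous_map (subtopology X (fst c)) euclidean (snd c)"
    by (rule continuous_map_into_fulltopology)
  from openin_continuous_map_preimage[OF this, of B]
  have "openin (subtopology X (fst c)) {p \<in> topspace (subtopology X (fst c)). snd c p \<in> B}"
    using assms(2) by simp
  then have "openin X {p \<in> topspace (subtopology X (fst c)). snd c p \<in> B}"
    using is_chartD(1)[OF assms(1)] by (rule openin_trans_full)
  then show ?thesis by (simp only: topspace_subtopology_subset[OF is_chartD(5)[OF assms(1)]])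
qed

lemma is_chartI:
  assumes U: "openin X U" and \<phi>: "\<phi> \<in> extensional U" "inj_on \<phi> U" "open (\<phi> ` U)"
    and pre: "\<And>B. open B \<Longrightarrow> openin X {p \<in> U. \<phi> p \<in> B}"
    and img: "\<And>W. openin X W \<Longrightarrow> W \<subseteq> U \<Longrightarrow> open (\<phi> ` W)"
  shows "is_chart X (U, \<phi>)"
proof -
  have sub: "U \<subseteq> topspace X" using U openin_subset by blast
  have tU: "topspace (subtopology X U) = U" using sub by auto
  have "homeomorphic_map (subtopology X U) (top_of_set (\<phi> ` U)) \<phi>"
  proof (rule bijective_open_imp_homeomorphic_map)
    show "continuous_map (subtopology X U) (top_of_set (\<phi> ` U)) \<phi>"
      unfolding continuous_map_in_subtopology tU
    proof
      show "continuous_map (subtopology X U) euclidean \<phi>"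
        unfolding continuous_map_def tU using pre U
        by (auto simp: openin_open_subtopology)
    qed auto
    show "open_map (subtopology X U) (top_of_set (\<phi> ` U)) \<phi>"
      unfolding open_map_def
    proof (intro allI impI)
      fix W assume "openin (subtopology X U) W"
      then have "openin X W" "W \<subseteq> U" using U by (auto simp: openin_open_subtopology)
      then show "openin (top_of_set (\<phi> ` U)) (\<phi> ` W)" using img \<phi>(3)
        by (auto simp: openin_open_eq)
    qed
  qed (unfold tU, auto simp: \<phi>(2))
  then show ?thesis using U \<phi> by (simp add: is_chart_def)
qed

lemma smooth_manifoldD:
  assumes "smooth_manifold M"
  shows "Hausdorff_space (mtop M)" "paracompact_space (mtop M)"
    "c \<in> atlas M \<Longrightarrow> is_chart (mtop M) c" "c \<in> atlas M \<Longrightarrow> d \<in> atlas M \<Longrightarrow> chart_compat c d"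
    "p \<in> points M \<Longrightarrow> \<exists>c\<in>atlas M. p \<in> fst c"
    "is_chart (mtop M) c \<Longrightarrow> (\<And>d. d \<in> atlas M \<Longrightarrow> chart_compat c d) \<Longrightarrow> c \<in> atlas M"
    "c \<in> atlas M \<Longrightarrow> fst c \<subseteq> points M"
proof -
  note * = assms[unfolded smooth_manifold_def]
  show "Hausdorff_space (mtop M)" "paracompact_space (mtop M)" using * by simp_all
  show ch: "is_chart (mtop M) c" if "c \<in> atlas M" for c using * that by simp
  show "chart_compat c d" if "c \<in> atlas M" "d \<in> atlas M" using * that by simp
  have "(\<Union>c\<in>atlas M. fst c) = points M" using * by simp
  then show "\<exists>c\<in>atlas M. p \<in> fst c" if "p \<in> points M" using that by (metis UN_E)
  show "c \<in> atlas M" if "is_chart (mtop M) c" "\<And>d. d \<in> atlas M \<Longrightarrow> chart_compat c d"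
  proof -
    have "\<forall>c. is_chart (mtop M) c \<and> (\<forall>d\<in>atlas M. chart_compat c d) \<longrightarrow> c \<in> atlas M"
      using * by (elim conjE)
    with that show ?thesis by (metis (no_types, lifting))
  qed
  show "fst c \<subseteq> points M" if "c \<in> atlas M" using is_chartD(5)[OF ch[OF that]] .
qed

lemma transition_smooth:
  assumes "smooth_manifold M" "c \<in> atlas M" "d \<in> atlas M"
  shows "smooth_on (snd c ` (fst c \<inter> fst d)) (local_rep c d (\<lambda>p. p))"
    "open (snd c ` (fst c \<inter> fst d))"
proof -
  show "smooth_on (snd c ` (fst c \<inter> fst d)) (local_rep c d (\<lambda>p. p))"
    using smooth_manifoldD(4)[OF assms] by (simp add: chart_compat_def)
  show "open (snd c ` (fst c \<inter> fst d))"
    using chart_open_image[OF smooth_manifoldD(3)[OF assms(1,2)] is_chartD(1)[OF smooth_manifoldD(3)[OF assms(1,3)]]]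
    by (simp add: Int_commute)
qed

lemma local_rep_apply: "is_chart X c \<Longrightarrow> p \<in> fst c \<Longrightarrow> local_rep c d f (snd c p) = snd d (f p)"
  by (simp add: local_rep_def chart_inv(1))

lemma inv_chart_eqI: "is_chart X c \<Longrightarrow> p \<in> fst c \<Longrightarrow> snd c p = x \<Longrightarrow> inv_chart c x = p"
  by (auto simp: chart_inv(1))

text \<open>Maximality of the atlas admits any smooth reparametrisation of a chart. Flow boxes enter
  the atlas of \<open>M\<close> in this way.\<close>

lemma transformed_chart:
  fixes M :: "('a, 'e::euclidean_space, 'z) manifold_scheme"
  assumes M: "smooth_manifold M" and c: "c \<in> atlas M" and W: "openin (mtop M) W" "W \<subseteq> fst c"
    and T: "open T" and G: "smooth_on (snd c ` W) G" and E: "smooth_on T E"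
    and hom: "homeomorphism (snd c ` W) T G E"
  shows "(W, restrict (G \<circ> snd c) W) \<in> atlas M"
proof (rule smooth_manifoldD(6)[OF M])
  let ?e = "(W, restrict (G \<circ> snd c) W)"
  note cc = smooth_manifoldD(3)[OF M c]
  have oW: "open (snd c ` W)" using chart_open_image[OF cc W(1)] W(2) by (simp add: Int_absorb2)
  have EG: "E (G x) = x" "G x \<in> T" if "x \<in> snd c ` W" for x using hom that by (auto simp: homeomorphism_def)
  have GE: "G (E y) = y" "E y \<in> snd c ` W" if "y \<in> T" for y using hom that by (auto simp: homeomorphism_def)
  show ch: "is_chart (mtop M) ?e"
  proof (rule is_chartI[OF W(1)])
    show "inj_on (restrict (G \<circ> snd c) W) W"
    proof (rule inj_onI)
      fix p q assume pq: "p \<in> W" "q \<in> W" "restrict (G \<circ> snd c) W p = restrict (G \<circ> snd c) W q"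
      then have "E (G (snd c p)) = E (G (snd c q))" by simp
      then have "snd c p = snd c q" using EG pq by simp
      then show "p = q" using is_chartD(3)[OF cc] pq(1,2) W(2) by (meson inj_onD subsetD)
    qed
    have "restrict (G \<circ> snd c) W ` W = T" using hom by (auto simp: homeomorphism_def image_comp[symmetric])
    then show "open (restrict (G \<circ> snd c) W ` W)" using T by simp
    show "openin (mtop M) {p \<in> W. restrict (G \<circ> snd c) W p \<in> B}" if B: "open B" for B
    proof -
      have "open {x \<in> snd c ` W. G x \<in> B}" by (rule open_preimage_smooth[OF oW G B])
      from openin_Int[OF W(1) chart_open_preimage[OF cc this]] 
      have "openin (mtop M) (W \<inter> {p \<in> fst c. snd c p \<in> {x \<in> snd c ` W. G x \<in> B}})" .
      moreover have "W \<inter> {p \<in> fst c. snd c p \<in> {x \<in> snd c ` W. G x \<in> B}} = {p \<in> W. restrict (G \<circ> snd c) W p \<in> B}"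
        using W(2) by auto
      ultimately show ?thesis by simp
    qed
    show "open (restrict (G \<circ> snd c) W ` V)" if V: "openin (mtop M) V" "V \<subseteq> W" for V
    proof -
      have "open (snd c ` V)" using chart_open_image[OF cc V(1)] V(2) W(2) by (metis Int_absorb2 order_trans)
      then have "open {y \<in> T. E y \<in> snd c ` V}" by (rule open_preimage_smooth[OF T E])
      moreover have "{y \<in> T. E y \<in> snd c ` V} = restrict (G \<circ> snd c) W ` V"
        using V(2) EG GE by (force simp: image_iff)
      ultimately show ?thesis by simp
    qed
  qed simp
  fix d assume d: "d \<in> atlas M"
  note dc = smooth_manifoldD(3)[OF M d]
  have inv: "inv_chart ?e (G (snd c p)) = p" if "p \<in> W" for p
    using inv_chart_eqI[OF ch, of p "G (snd c p)"] that by simp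
  let ?D = "snd ?e ` (W \<inter> fst d)"
  have oD: "open ?D" using chart_open_image[OF ch is_chartD(1)[OF dc]] by (simp add: Int_commute)
  have "?D \<subseteq> T" using EG by auto
  have "smooth_on ?D (\<lambda>y. local_rep c d (\<lambda>p. p) (E y))"
    by (rule smooth_on_compose[OF oD transition_smooth(2)[OF M c d] smooth_on_subset[OF E \<open>?D \<subseteq> T\<close>] transition_smooth(1)[OF M c d]])
      (use EG W(2) in auto)
  moreover have "local_rep c d (\<lambda>p. p) (E y) = local_rep ?e d (\<lambda>p. p) y" if y: "y \<in> ?D" for y
  proof -
    obtain p where p: "p \<in> W" "y = G (snd c p)" using y by auto
    then show ?thesis using EG[of "snd c p"] inv[OF p(1)] chart_inv(1)[OF cc] W(2) by (auto simp: local_rep_def)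
  qed
  ultimately have 1: "smooth_on ?D (local_rep ?e d (\<lambda>p. p))" by (rule smooth_on_eq[OF oD])
  let ?D' = "snd d ` (W \<inter> fst d)"
  have oD': "open ?D'" using chart_open_image[OF dc W(1)] .
  have sub: "?D' \<subseteq> snd d ` (fst d \<inter> fst c)" using W(2) by auto
  have "smooth_on ?D' (\<lambda>y. G (local_rep d c (\<lambda>p. p) y))"
    by (rule smooth_on_compose[OF oD' oW smooth_on_subset[OF transition_smooth(1)[OF M d c] sub] G])
      (use chart_inv(1)[OF dc] in \<open>auto simp: local_rep_def\<close>)
  moreover have "G (local_rep d c (\<lambda>p. p) y) = local_rep d ?e (\<lambda>p. p) y" if "y \<in> ?D'" for y
    using that chart_inv(1)[OF dc] by (auto simp: local_rep_def)
  ultimately have 2: "smooth_on ?D' (local_rep d ?e (\<lambda>p. p))" by (rule smooth_on_eq[OF oD'])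
  show "chart_compat ?e d" using 1 2 by (simp add: chart_compat_def)
qed

lemma restricted_chart:
  assumes "smooth_manifold M" "c \<in> atlas M" "openin (mtop M) W" "W \<subseteq> fst c"
  shows "(W, restrict (snd c) W) \<in> atlas M"
proof -
  have "open (snd c ` W)"
    using chart_open_image[OF smooth_manifoldD(3)[OF assms(1,2)] assms(3)] assms(4) by (simp add: Int_absorb2)
  from transformed_chart[OF assms this smooth_on_id[OF this] smooth_on_id[OF this]]
  show ?thesis by (simp add: homeomorphism_ident o_def)
qed

section \<open>Smooth maps and their differentials\<close>

lemma local_rep_domain_open:
  assumes "is_chart X c" "is_chart Y d" "openin X W" "continuous_map (subtopology X W) Y f"
  shows "openin X {p \<in> W \<inter> fst c. f p \<in> fst d}" "open (snd c ` {p \<in> W \<inter> fst c. f p \<in> fst d})"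
proof -
  have "openin (subtopology X W) {p \<in> topspace (subtopology X W). f p \<in> fst d}"
    using openin_continuous_map_preimage[OF assms(4) is_chartD(1)[OF assms(2)]] .
  then have "openin X {p \<in> topspace (subtopology X W). f p \<in> fst d}"
    using assms(3) openin_trans_full by blast
  then have "openin X (fst c \<inter> {p \<in> topspace (subtopology X W). f p \<in> fst d})"
    using is_chartD(1)[OF assms(1)] by blast
  moreover have "fst c \<inter> {p \<in> topspace (subtopology X W). f p \<in> fst d} = {p \<in> W \<inter> fst c. f p \<in> fst d}"
    using openin_subset[OF assms(3)] by auto
  ultimately show 1: "openin X {p \<in> W \<inter> fst c. f p \<in> fst d}" by simp
  have "{p \<in> W \<inter> fst c. f p \<in> fst d} \<inter> fst c = {p \<in> W \<inter> fst c. f p \<in> fst d}" by blast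
  then show "open (snd c ` {p \<in> W \<inter> fst c. f p \<in> fst d})"
    using chart_open_image[OF assms(1) 1] by simp
qed

lemma smooth_map_onD:
  assumes "smooth_map_on M W N f"
  shows "openin (mtop M) W" "continuous_map (subtopology (mtop M) W) (mtop N) f"
    "c \<in> atlas M \<Longrightarrow> d \<in> atlas N \<Longrightarrow>
      smooth_on (snd c ` {p \<in> W \<inter> fst c. f p \<in> fst d}) (local_rep c d f)"
    "p \<in> W \<Longrightarrow> f p \<in> points N"
proof -
  show 1: "openin (mtop M) W" "continuous_map (subtopology (mtop M) W) (mtop N) f"
    "c \<in> atlas M \<Longrightarrow> d \<in> atlas N \<Longrightarrow> smooth_on (snd c ` {p \<in> W \<inter> fst c. f p \<in> fst d}) (local_rep c d f)"
    using assms by (auto simp: smooth_map_on_def)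
  show "f p \<in> points N" if "p \<in> W" using 1(1,2) that openin_subset[OF 1(1)]
    by (auto simp: continuous_map_def Pi_iff)
qed

lemma smooth_map_on_id:
  assumes "smooth_manifold M" shows "smooth_map M M (\<lambda>p. p)"
proof -
  have "{p \<in> points M \<inter> fst c. p \<in> fst d} = fst c \<inter> fst d" if "c \<in> atlas M" for c d
    using smooth_manifoldD(7)[OF assms that] by auto
  then show ?thesis using transition_smooth(1)[OF assms] by (auto simp: smooth_map_on_def)
qed

lemma smooth_map_on_derivative:
  assumes "smooth_manifold M" "smooth_manifold N" "smooth_map_on M W N f"
    and "c \<in> atlas M" "d \<in> atlas N" "p \<in> W" "p \<in> fst c" "f p \<in> fst d"
  shows "(local_rep c d f has_derivative mdiff c d f p) (at (snd c p))"
  unfolding mdiff_def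
  by (rule smooth_on_has_derivative[OF smooth_map_onD(3)[OF assms(3-5)]
        local_rep_domain_open(2)[OF smooth_manifoldD(3)[OF assms(1,4)] smooth_manifoldD(3)[OF assms(2,5)]
          smooth_map_onD(1,2)[OF assms(3)]]])
    (use assms in auto)

lemma mdiff_linear:
  assumes "smooth_manifold M" "smooth_manifold N" "smooth_map_on M W N f"
    and "c \<in> atlas M" "d \<in> atlas N" "p \<in> W" "p \<in> fst c" "f p \<in> fst d"
  shows "linear (mdiff c d f p)"
  using smooth_map_on_derivative[OF assms] has_derivative_linear by blast

lemma mdiff_compose:
  assumes M: "smooth_manifold M" and N: "smooth_manifold N" and P: "smooth_manifold P"
    and f: "smooth_map_on M W N f" and g: "smooth_map_on N V P g"
    and c: "c \<in> atlas M" and d: "d \<in> atlas N" and e: "e \<in> atlas P"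
    and p: "p \<in> W" "p \<in> fst c" "f p \<in> V" "f p \<in> fst d" "g (f p) \<in> fst e"
  shows "mdiff c e (\<lambda>q. g (f q)) p v = mdiff d e g (f p) (mdiff c d f p v)"
    and "(local_rep c e (\<lambda>q. g (f q)) has_derivative mdiff c e (\<lambda>q. g (f q)) p) (at (snd c p))"
proof -
  note cc = smooth_manifoldD(3)[OF M c] and dc = smooth_manifoldD(3)[OF N d]
  have 1: "(local_rep c d f has_derivative mdiff c d f p) (at (snd c p))"
    by (rule smooth_map_on_derivative[OF M N f c d p(1,2,4)])
  have "(local_rep d e g has_derivative mdiff d e g (f p)) (at (snd d (f p)))"
    by (rule smooth_map_on_derivative[OF N P g d e p(3,4,5)])
  then have "(local_rep d e g has_derivative mdiff d e g (f p)) (at (local_rep c d f (snd c p)))"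
    by (simp add: local_rep_apply[OF cc p(2)])
  from diff_chain_at[OF 1 this]
  have "(local_rep d e g \<circ> local_rep c d f has_derivative mdiff d e g (f p) \<circ> mdiff c d f p) (at (snd c p))" .
  then have 2: "(local_rep c e (\<lambda>q. g (f q)) has_derivative mdiff d e g (f p) \<circ> mdiff c d f p) (at (snd c p))"
  proof (rule has_derivative_transform_within_open)
    show "open (snd c ` {p \<in> W \<inter> fst c. f p \<in> fst d})"
      by (rule local_rep_domain_open(2)[OF cc dc smooth_map_onD(1,2)[OF f]])
    show "snd c p \<in> snd c ` {p \<in> W \<inter> fst c. f p \<in> fst d}" using p by blast
    fix x assume "x \<in> snd c ` {p \<in> W \<inter> fst c. f p \<in> fst d}"
    then show "(local_rep d e g \<circ> local_rep c d f) x = local_rep c e (\<lambda>q. g (f q)) x"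
      using chart_inv(1)[OF cc] chart_inv(1)[OF dc] by (auto simp: local_rep_def)
  qed
  then show 3: "mdiff c e (\<lambda>q. g (f q)) p v = mdiff d e g (f p) (mdiff c d f p v)"
    unfolding mdiff_def[of c e] by (simp add: frechet_derivative_at[OF 2, symmetric])
  show "(local_rep c e (\<lambda>q. g (f q)) has_derivative mdiff c e (\<lambda>q. g (f q)) p) (at (snd c p))"
    unfolding mdiff_def[of c e] frechet_derivative_at[OF 2, symmetric] by (rule 2)
qed

lemma mdiff_id:
  assumes "smooth_manifold M" "c \<in> atlas M" "p \<in> fst c"
  shows "mdiff c c (\<lambda>q. q) p v = v"
proof -
  note cc = smooth_manifoldD(3)[OF assms(1,2)]
  have "(local_rep c c (\<lambda>q. q) has_derivative (\<lambda>v. v)) (at (snd c p))"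
    by (rule has_derivative_transform_within_open[OF has_derivative_ident is_chartD(2)[OF cc]])
      (use assms chart_inv[OF cc] in \<open>auto simp: local_rep_def\<close>)
  from frechet_derivative_at[OF this] show ?thesis unfolding mdiff_def by metis
qed

lemma mdiff_transition:
  assumes "smooth_manifold M" "c \<in> atlas M" "d \<in> atlas M" "e \<in> atlas M" "p \<in> fst c" "p \<in> fst d" "p \<in> fst e"
  shows "mdiff d e (\<lambda>q. q) p (mdiff c d (\<lambda>q. q) p v) = mdiff c e (\<lambda>q. q) p v"
  using mdiff_compose(1)[OF assms(1,1,1) smooth_map_on_id smooth_map_on_id assms(2-4), of p v] assms
    smooth_manifoldD(7)[OF assms(1,2)] by auto

lemma transition_linear:
  assumes "smooth_manifold M" "c \<in> atlas M" "d \<in> atlas M" "p \<in> fst c" "p \<in> fst d"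
  shows "linear (mdiff c d (\<lambda>q. q) p)"
  using mdiff_linear[OF assms(1,1) smooth_map_on_id[OF assms(1)] assms(2,3), of p] assms
    smooth_manifoldD(7)[OF assms(1,2)] by auto

lemma transition_inverse:
  assumes "smooth_manifold M" "c \<in> atlas M" "d \<in> atlas M" "p \<in> fst c" "p \<in> fst d"
  shows "mdiff d c (\<lambda>q. q) p (mdiff c d (\<lambda>q. q) p v) = v"
  using mdiff_transition[OF assms(1,2,3,2,4,5,4)] mdiff_id[OF assms(1,2,4)] by simp

lemma local_rep_change:
  fixes f :: "'a \<Rightarrow> 'b" and M :: "('a, 'e::euclidean_space, 'y) manifold_scheme"
    and N :: "('b, 'f::euclidean_space, 'z) manifold_scheme"
  assumes M: "smooth_manifold M" and N: "smooth_manifold N"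
    and c: "c \<in> atlas M" "c' \<in> atlas M" and d: "d \<in> atlas N" "d' \<in> atlas N"
    and W: "openin (mtop M) W" "continuous_map (subtopology (mtop M) W) (mtop N) f"
    and p: "p \<in> W" "p \<in> fst c" "p \<in> fst c'" "f p \<in> fst d" "f p \<in> fst d'"
    and U: "open U" "snd c p \<in> U" "smooth_on U (local_rep c d f)"
  shows "\<exists>U'. open U' \<and> snd c' p \<in> U' \<and> smooth_on U' (local_rep c' d' f)"
proof -
  note cc = smooth_manifoldD(3)[OF M c(1)] and cc' = smooth_manifoldD(3)[OF M c(2)]
  note dc = smooth_manifoldD(3)[OF N d(1)] and dc' = smooth_manifoldD(3)[OF N d(2)]
  define W' where "W' = {q \<in> W \<inter> fst c. f q \<in> fst d} \<inter> {q \<in> W \<inter> fst c'. f q \<in> fst d'} \<inter> {q \<in> fst c. snd c q \<in> U}"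
  have "openin (mtop M) W'" unfolding W'_def
    by (intro openin_Int local_rep_domain_open(1)[OF cc dc W] local_rep_domain_open(1)[OF cc' dc' W]
        chart_open_preimage[OF cc U(1)])
  have "W' \<inter> fst c' = W'" by (auto simp: W'_def)
  then have oU': "open (snd c' ` W')" using chart_open_image[OF cc' \<open>openin (mtop M) W'\<close>] by simp
  have sub: "snd c' ` W' \<subseteq> snd c' ` (fst c' \<inter> fst c)" by (auto simp: W'_def)
  have oV: "open (U \<inter> snd c ` {q \<in> W \<inter> fst c. f q \<in> fst d} \<inter> snd c ` W')"
  proof -
    have "W' \<inter> fst c = W'" by (auto simp: W'_def)
    then have "open (snd c ` W')" using chart_open_image[OF cc \<open>openin (mtop M) W'\<close>] by simp
    then show ?thesis using U(1) local_rep_domain_open(2)[OF cc dc W] by blast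
  qed
  let ?V = "snd c ` W'"
  have oV: "open ?V"
  proof -
    have "W' \<inter> fst c = W'" by (auto simp: W'_def)
    then show ?thesis using chart_open_image[OF cc \<open>openin (mtop M) W'\<close>] by simp
  qed
  have VU: "?V \<subseteq> U" by (auto simp: W'_def)
  have 1: "smooth_on (snd c' ` W') (\<lambda>x. local_rep c d f (local_rep c' c (\<lambda>p. p) x))"
    by (rule smooth_on_compose[OF oU' oV smooth_on_subset[OF transition_smooth(1)[OF M c(2,1)] sub] smooth_on_subset[OF U(3) VU]])
      (use chart_inv(1)[OF cc'] in \<open>auto simp: local_rep_def W'_def\<close>)
  have 2: "smooth_on (snd c' ` W') (\<lambda>x. local_rep d d' (\<lambda>p. p) (local_rep c d f (local_rep c' c (\<lambda>p. p) x)))"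
    by (rule smooth_on_compose[OF oU' transition_smooth(2)[OF N d] 1 transition_smooth(1)[OF N d]])
      (use chart_inv(1)[OF cc'] chart_inv(1)[OF cc] in \<open>auto simp: local_rep_def W'_def\<close>)
  have "local_rep d d' (\<lambda>p. p) (local_rep c d f (local_rep c' c (\<lambda>p. p) x)) = local_rep c' d' f x"
    if "x \<in> snd c' ` W'" for x
    using that chart_inv(1)[OF cc'] chart_inv(1)[OF cc] chart_inv(1)[OF dc] by (auto simp: local_rep_def W'_def)
  then have "smooth_on (snd c' ` W') (local_rep c' d' f)"
    using 2 smooth_on_cong[OF oU'] by (metis (no_types, lifting))
  moreover have "p \<in> W'" using p U by (auto simp: W'_def)
  ultimately show ?thesis using oU' by blast
qed

text \<open>By \<open>local_rep_change\<close> smoothness near a point does not depend on the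
  charts, so one pair of charts for each point may be chosen, while the definition quantifies over
  all pairs.\<close>

lemma smooth_map_on_localI:
  assumes M: "smooth_manifold M" and N: "smooth_manifold N"
    and W: "openin (mtop M) W" "continuous_map (subtopology (mtop M) W) (mtop N) f"
    and loc: "\<And>p. p \<in> W \<Longrightarrow> \<exists>c\<in>atlas M. \<exists>d\<in>atlas N. p \<in> fst c \<and> f p \<in> fst d \<and>
      (\<exists>U. open U \<and> snd c p \<in> U \<and> smooth_on U (local_rep c d f))"
  shows "smooth_map_on M W N f"
  unfolding smooth_map_on_def
proof (intro conjI W ballI)
  fix c d assume cd: "c \<in> atlas M" "d \<in> atlas N"
  show "smooth_on (snd c ` {p \<in> W \<inter> fst c. f p \<in> fst d}) (local_rep c d f)"
  proof (rule smooth_on_local)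
    fix x assume "x \<in> snd c ` {p \<in> W \<inter> fst c. f p \<in> fst d}"
    then obtain p where p: "p \<in> W" "p \<in> fst c" "f p \<in> fst d" "x = snd c p" by blast
    obtain c' d' U where *: "c' \<in> atlas M" "d' \<in> atlas N" "p \<in> fst c'" "f p \<in> fst d'" "open U" "snd c' p \<in> U"
      "smooth_on U (local_rep c' d' f)" using loc[OF p(1)] by blast
    show "\<exists>U. open U \<and> x \<in> U \<and> smooth_on U (local_rep c d f)" unfolding p(4)
      by (rule local_rep_change[OF M N *(1) cd(1) *(2) cd(2) W p(1) *(3) p(2) *(4) p(3) *(5-7)])
  qed
qed

lemma smooth_map_on_compose:
  assumes M: "smooth_manifold M" and N: "smooth_manifold N" and P: "smooth_manifold P"
    and f: "smooth_map_on M W N f" and g: "smooth_map_on N V P g" and sub: "f ` W \<subseteq> V"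
  shows "smooth_map_on M W P (\<lambda>q. g (f q))"
proof (rule smooth_map_on_localI[OF M P smooth_map_onD(1)[OF f]])
  have "continuous_map (subtopology (mtop M) W) (subtopology (mtop N) V) f"
    using smooth_map_onD(2)[OF f] sub by (auto simp: continuous_map_in_subtopology)
  from continuous_map_compose[OF this smooth_map_onD(2)[OF g]]
  show "continuous_map (subtopology (mtop M) W) (mtop P) (\<lambda>q. g (f q))" by (simp add: o_def)
  fix p assume p: "p \<in> W"
  have pM: "p \<in> points M" using openin_subset[OF smooth_map_onD(1)[OF f]] p by blast
  obtain c where c: "c \<in> atlas M" "p \<in> fst c" using smooth_manifoldD(5)[OF M pM] by blast
  obtain d where d: "d \<in> atlas N" "f p \<in> fst d" using smooth_manifoldD(5)[OF N smooth_map_onD(4)[OF f p]] by blast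
  have fpV: "f p \<in> V" using sub p by blast
  obtain e where e: "e \<in> atlas P" "g (f p) \<in> fst e" using smooth_manifoldD(5)[OF P smooth_map_onD(4)[OF g fpV]] by blast
  note cc = smooth_manifoldD(3)[OF M c(1)] and dc = smooth_manifoldD(3)[OF N d(1)] and ec = smooth_manifoldD(3)[OF P e(1)]
  let ?B = "snd d ` {p \<in> V \<inter> fst d. g p \<in> fst e}" and ?A = "snd c ` {p \<in> W \<inter> fst c. f p \<in> fst d}"
  note oB = local_rep_domain_open(2)[OF dc ec smooth_map_onD(1,2)[OF g]]
  note oA = local_rep_domain_open(2)[OF cc dc smooth_map_onD(1,2)[OF f]]
  let ?U = "{x \<in> ?A. local_rep c d f x \<in> ?B}"
  have oU: "open ?U" by (rule open_preimage_smooth[OF oA smooth_map_onD(3)[OF f c(1) d(1)] oB])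
  have "smooth_on ?U (\<lambda>x. local_rep d e g (local_rep c d f x))"
    by (rule smooth_on_compose[OF oU oB smooth_on_subset[OF smooth_map_onD(3)[OF f c(1) d(1)]] smooth_map_onD(3)[OF g d(1) e(1)]]) auto
  moreover have "local_rep d e g (local_rep c d f x) = local_rep c e (\<lambda>q. g (f q)) x" if x: "x \<in> ?U" for x
  proof -
    obtain p where "x = snd c p" "p \<in> fst c" "f p \<in> fst d" using x by blast
    then show ?thesis by (simp add: local_rep_apply[OF cc] local_rep_apply[OF dc])
  qed
  ultimately have "smooth_on ?U (local_rep c e (\<lambda>q. g (f q)))" by (rule smooth_on_eq[OF oU])
  moreover have "snd c p \<in> ?U" using p c d e fpV by (auto simp: local_rep_apply[OF cc c(2)])
  ultimately show "\<exists>c\<in>atlas M. \<exists>d\<in>atlas P. p \<in> fst c \<and> g (f p) \<in> fst d \<and>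
      (\<exists>U. open U \<and> snd c p \<in> U \<and> smooth_on U (local_rep c d (\<lambda>q. g (f q))))"
    using c e oU by blast
qed

section \<open>Lorentzian algebra in the plane\<close>

text \<open>In orthonormal coordinates \<open>(a, b)\<close> is timelike and \<open>(x, y)\<close>
  null. The two expressions are their metric product and, up to the factor of the volume form, their
  oriented area; as \<open>a\<close> dominates \<open>b\<close>, both signs are decided by
  \<open>a\<close>.\<close>

lemma cone_sign:
  fixes a b x y :: real
  assumes "b\<^sup>2 < a\<^sup>2" "y = x \<or> y = - x" "x \<noteq> 0"
  shows "- a * x + b * y < 0 \<longleftrightarrow> 0 < a * x" "0 < a * y - b * x \<longleftrightarrow> 0 < a * y" "a * y - b * x \<noteq> 0"
proof -
  have "\<bar>b\<bar> < \<bar>a\<bar>" using assms(1) by (metis abs_ge_zero power2_abs power2_less_imp_less)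
  then have s: "0 < a - b \<longleftrightarrow> 0 < a" "0 < a + b \<longleftrightarrow> 0 < a" "a - b < 0 \<longleftrightarrow> a < 0" "a + b < 0 \<longleftrightarrow> a < 0"
    "a - b \<noteq> 0" "a + b \<noteq> 0" by auto
  have 1: "0 < (a - b) * x \<longleftrightarrow> 0 < a * x" "(a + b) * x < 0 \<longleftrightarrow> a * x < 0" "0 < (a + b) * x \<longleftrightarrow> 0 < a * x"
    "(a - b) * x \<noteq> 0" "(a + b) * x \<noteq> 0"
    unfolding zero_less_mult_iff mult_less_0_iff using s assms(3) by auto
  show "- a * x + b * y < 0 \<longleftrightarrow> 0 < a * x" "0 < a * y - b * x \<longleftrightarrow> 0 < a * y" "a * y - b * x \<noteq> 0"
    using assms(2) 1 by (auto simp: algebra_simps)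
qed

lemma bilinear_linear: "bilinear g \<Longrightarrow> linear (g v)" "bilinear g \<Longrightarrow> linear (\<lambda>v. g v w)"
  by (simp_all only: bilinear_def)

text \<open>
  With \<open>(al, be)\<close> the covector \<open>g(A, -)\<close>, the vector \<open>(be, - al)\<close> is orthogonal to \<open>A\<close>; adding the right
  multiple of it makes \<open>A\<close> null and right-pointing, and \<open>n\<close> normalises to \<open>g(A, -) = -1\<close>.
\<close>

definition null_vec :: "(plane \<Rightarrow> plane \<Rightarrow> real) \<Rightarrow> (plane \<Rightarrow> plane \<Rightarrow> real) \<Rightarrow> plane \<Rightarrow> plane" where
  "null_vec g vol A =
     (let a = g (1, 0) (1, 0); b = g (1, 0) (0, 1); d = g (0, 1) (0, 1); w = vol (1, 0) (0, 1);
          al = a * fst A + b * snd A; be = b * fst A + d * snd A; n = - (al * fst A + be * snd A);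
          s = w / sqrt (w * w * (b * b - a * d))
      in ((fst A + s * be) / n, (snd A - s * al) / n))"

text \<open>A single tangent plane in components: pointwise facts about cones and null rays are
  proved here once, free of charts.\<close>

locale lorentz_plane =
  fixes g vol :: "plane \<Rightarrow> plane \<Rightarrow> real"
  assumes g_bil: "bilinear g" and O_bil: "bilinear vol" and g_sym: "g v w = g w v"
    and g_basis: "\<exists>e0 e1. g e0 e0 = -1 \<and> g e1 e1 = 1 \<and> g e0 e1 = 0"
    and O_alt: "vol v v = 0" and O_nz: "\<exists>v w. vol v w \<noteq> 0"
begin

lemma g_expand: "g v w = fst v * fst w * g (1, 0) (1, 0) +
    (fst v * snd w + snd v * fst w) * g (1, 0) (0, 1) + snd v * snd w * g (0, 1) (0, 1)"
proof -
  have "g v w = fst v * g (1, 0) w + snd v * g (0, 1) w"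
    using linear_plane_expand[OF bilinear_linear(2)[OF g_bil], of v w] by simp
  moreover have "g u w = fst w * g u (1, 0) + snd w * g u (0, 1)" for u
    using linear_plane_expand[OF bilinear_linear(1)[OF g_bil], of u w] by simp
  ultimately show ?thesis using g_sym[of "(0, 1)" "(1, 0)"] by (simp add: algebra_simps)
qed

lemma O_expand: "vol v w = (fst v * snd w - snd v * fst w) * vol (1, 0) (0, 1)"
proof -
  have L: "vol v w = fst v * vol (1, 0) w + snd v * vol (0, 1) w" for v w
    using linear_plane_expand[OF bilinear_linear(2)[OF O_bil], of v w] by simp
  have R: "vol u w = fst w * vol u (1, 0) + snd w * vol u (0, 1)" for u w
    using linear_plane_expand[OF bilinear_linear(1)[OF O_bil], of u w] by simp
  have "vol (1, 1) (1, 1) = vol (1, 0) (0, 1) + vol (0, 1) (1, 0)"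
    using L[of "(1, 1)" "(1, 1)"] R[of "(1, 0)" "(1, 1)"] R[of "(0, 1)" "(1, 1)"]
      O_alt[of "(1, 0)"] O_alt[of "(0, 1)"] by simp
  then have "vol (0, 1) (1, 0) = - vol (1, 0) (0, 1)" using O_alt[of "(1, 1)"] by simp
  then show ?thesis using L[of v w] R[of "(1, 0)" w] R[of "(0, 1)" w] O_alt[of "(1, 0)"] O_alt[of "(0, 1)"]
    by (simp add: algebra_simps)
qed

text \<open>\<open>\<alpha>\<close> and \<open>\<beta>\<close> are the coordinates in the basis
  \<open>e0\<close>, \<open>e1\<close> of \<open>g_basis\<close>, obtained by Cramer's rule, and
  \<open>\<omega>\<close> is \<open>vol e0 e1\<close>. The last clause expresses that they determine
  a vector, in the form used for proportional vectors.\<close>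

lemma coordinates:
  "\<exists>(\<omega>::real) (\<alpha> :: plane \<Rightarrow> real) (\<beta> :: plane \<Rightarrow> real). \<omega> \<noteq> 0 \<and> (\<forall>v w. g v w = - \<alpha> v * \<alpha> w + \<beta> v * \<beta> w) \<and>
      (\<forall>v w. vol v w = \<omega> * (\<alpha> v * \<beta> w - \<beta> v * \<alpha> w)) \<and>
      (\<forall>v w k. \<alpha> w = k * \<alpha> v \<longrightarrow> \<beta> w = k * \<beta> v \<longrightarrow> w = k *\<^sub>R v)"
proof -
  obtain e0 e1 where e: "g e0 e0 = -1" "g e1 e1 = 1" "g e0 e1 = 0" using g_basis by blast
  obtain x0 y0 x1 y1 where xy: "e0 = (x0, y0)" "e1 = (x1, y1)" by fastforce
  define D where "D = x0 * y1 - x1 * y0"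
  have lin: "g u (r *\<^sub>R v + s *\<^sub>R w) = r * g u v + s * g u w" for u v w r s
    using bilinear_linear(1)[OF g_bil, of u] by (simp add: linear_add linear_scale)
  have lin': "g (r *\<^sub>R v + s *\<^sub>R w) u = r * g v u + s * g w u" for u v w r s
    using lin[of u r v s w] g_sym by metis
  have linO: "vol (r *\<^sub>R v + s *\<^sub>R w) u = r * vol v u + s * vol w u" "vol u (r *\<^sub>R v + s *\<^sub>R w) = r * vol u v + s * vol u w"
    for u v w r s
    using bilinear_linear(1)[OF O_bil, of u] linear_add[OF bilinear_linear(2)[OF O_bil, of u]]
      linear_scale[OF bilinear_linear(2)[OF O_bil, of u]] by (simp_all add: linear_add linear_scale)
  have g0: "g u 0 = 0" for u using lin[of u 0 0 0 0] by simp
  \<comment> \<open>If the basis were dependent, pairing the two relations with \<open>e0\<close>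
    would give \<open>e1 = 0\<close>, against \<open>g e1 e1 = 1\<close>.\<close>
  have "D \<noteq> 0"
  proof
    assume "D = 0"
    then have z: "y1 *\<^sub>R e0 - y0 *\<^sub>R e1 = 0" "x1 *\<^sub>R e0 - x0 *\<^sub>R e1 = 0"
      by (simp_all add: xy D_def prod_eq_iff algebra_simps)
    have "y1 = 0" "x1 = 0"
      using lin[of e0 y1 e0 "- y0" e1] lin[of e0 x1 e0 "- x0" e1] by (simp_all add: z g0 e)
    then have "e1 = 0" by (simp add: xy zero_prod_def)
    then show False using e(2) g0 by simp
  qed
  define \<alpha> where "\<alpha> v = (fst v * y1 - snd v * x1) / D" for v :: plane
  define \<beta> where "\<beta> v = (x0 * snd v - y0 * fst v) / D" for v :: plane
  have v: "v = \<alpha> v *\<^sub>R e0 + \<beta> v *\<^sub>R e1" for v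
  proof -
    have "fst v * D = (fst v * y1 - snd v * x1) * x0 + (x0 * snd v - y0 * fst v) * x1"
      "snd v * D = (fst v * y1 - snd v * x1) * y0 + (x0 * snd v - y0 * fst v) * y1"
      by (simp_all add: D_def algebra_simps)
    then show ?thesis using \<open>D \<noteq> 0\<close>
      by (simp add: \<alpha>_def \<beta>_def xy prod_eq_iff add_divide_distrib[symmetric] eq_divide_eq)
  qed
  have gv: "g v w = - \<alpha> v * \<alpha> w + \<beta> v * \<beta> w" for v w
  proof -
    have "g v w = g (\<alpha> v *\<^sub>R e0 + \<beta> v *\<^sub>R e1) (\<alpha> w *\<^sub>R e0 + \<beta> w *\<^sub>R e1)" using v by metis
    then show ?thesis using e g_sym[of e1 e0] by (simp add: lin lin' algebra_simps)
  qed
  have Ov: "vol v w = vol e0 e1 * (\<alpha> v * \<beta> w - \<beta> v * \<alpha> w)" for v w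
  proof -
    have "vol v w = vol (\<alpha> v *\<^sub>R e0 + \<beta> v *\<^sub>R e1) (\<alpha> w *\<^sub>R e0 + \<beta> w *\<^sub>R e1)" using v by metis
    moreover have "vol e1 e0 = - vol e0 e1" using O_expand[of e0 e1] O_expand[of e1 e0] by (simp add: algebra_simps)
    ultimately show ?thesis by (simp add: linO O_alt algebra_simps)
  qed
  have "vol e0 e1 \<noteq> 0" using O_nz Ov by fastforce
  moreover have "w = k *\<^sub>R v" if "\<alpha> w = k * \<alpha> v" "\<beta> w = k * \<beta> v" for v w k
    using v[of w] v[of v] that by (metis scaleR_add_right scaleR_scaleR)
  ultimately show ?thesis using gv Ov by blast
qed

text \<open>This makes future- and right-pointing of a null vector independent of the timelike
  representative: all signs reduce by \<open>cone_sign\<close> to the sign of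
  \<open>\<alpha> A\<close>, and \<open>g A B < 0\<close> says that \<open>\<alpha> A\<close> and
  \<open>\<alpha> B\<close> have the same sign.\<close>

lemma same_cone:
  assumes "g A A < 0" "g B B < 0" "g A B < 0" "v \<noteq> 0" "g v v = 0"
  shows "g A v < 0 \<longleftrightarrow> g B v < 0" "vol A v > 0 \<longleftrightarrow> vol B v > 0"
proof -
  obtain \<omega> \<alpha> \<beta> where c0: "\<omega> \<noteq> 0 \<and> (\<forall>v w. g v w = - \<alpha> v * \<alpha> w + \<beta> v * \<beta> w) \<and>
      (\<forall>v w. vol v w = \<omega> * (\<alpha> v * \<beta> w - \<beta> v * \<alpha> w)) \<and>
      (\<forall>v w k. \<alpha> w = k * \<alpha> v \<longrightarrow> \<beta> w = k * \<beta> v \<longrightarrow> w = k *\<^sub>R v)"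
    using coordinates by blast
  note c = c0[THEN conjunct1] c0[THEN conjunct2, THEN conjunct1, rule_format]
    c0[THEN conjunct2, THEN conjunct2, THEN conjunct1, rule_format]
    c0[THEN conjunct2, THEN conjunct2, THEN conjunct2, rule_format]
  have A: "(\<beta> A)\<^sup>2 < (\<alpha> A)\<^sup>2" and B: "(\<beta> B)\<^sup>2 < (\<alpha> B)\<^sup>2" using assms by (simp_all add: c(2) power2_eq_square)
  have y: "\<beta> v = \<alpha> v \<or> \<beta> v = - \<alpha> v"
    using assms(5) by (simp add: c(2) flip: power2_eq_square) (simp add: power2_eq_iff[symmetric])
  have x: "\<alpha> v \<noteq> 0" using y c(4)[of v 0 v] assms(4) by auto
  have "\<bar>\<beta> A\<bar> < \<bar>\<alpha> A\<bar>" "\<bar>\<beta> B\<bar> < \<bar>\<alpha> B\<bar>"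
    using A B by (metis abs_ge_zero power2_abs power2_less_imp_less)+
  then have "\<bar>\<beta> A * \<beta> B\<bar> < \<bar>\<alpha> A * \<alpha> B\<bar>" unfolding abs_mult by (intro mult_strict_mono) auto
  then have AB: "0 < \<alpha> A * \<alpha> B" using assms(3) unfolding c(2) by auto
  show "g A v < 0 \<longleftrightarrow> g B v < 0"
    unfolding c(2) cone_sign(1)[OF A y x] cone_sign(1)[OF B y x] using AB by (auto simp: zero_less_mult_iff)
  have "0 < \<alpha> A * \<beta> v - \<beta> A * \<alpha> v \<longleftrightarrow> 0 < \<alpha> B * \<beta> v - \<beta> B * \<alpha> v"
    unfolding cone_sign(2)[OF A y x] cone_sign(2)[OF B y x] using AB by (auto simp: zero_less_mult_iff)
  then show "vol A v > 0 \<longleftrightarrow> vol B v > 0"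
    unfolding c(3) zero_less_mult_iff using cone_sign(3)[OF A y x] cone_sign(3)[OF B y x] by linarith
qed

text \<open>For timelike vectors the product of the \<open>\<alpha>\<close> components dominates
  that of the \<open>\<beta>\<close> components, so a negative metric product means equal signs of
  \<open>\<alpha>\<close>, a transitive condition.\<close>

lemma cone_trans:
  assumes "g A A < 0" "g B B < 0" "g C C < 0" "g A B < 0" "g A C < 0" shows "g B C < 0"
proof -
  obtain \<omega> \<alpha> \<beta> where c0: "\<omega> \<noteq> 0 \<and> (\<forall>v w. g v w = - \<alpha> v * \<alpha> w + \<beta> v * \<beta> w) \<and>
      (\<forall>v w. vol v w = \<omega> * (\<alpha> v * \<beta> w - \<beta> v * \<alpha> w)) \<and>
      (\<forall>v w k. \<alpha> w = k * \<alpha> v \<longrightarrow> \<beta> w = k * \<beta> v \<longrightarrow> w = k *\<^sub>R v)"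
    using coordinates by blast
  note c = c0[THEN conjunct1] c0[THEN conjunct2, THEN conjunct1, rule_format]
    c0[THEN conjunct2, THEN conjunct2, THEN conjunct1, rule_format]
    c0[THEN conjunct2, THEN conjunct2, THEN conjunct2, rule_format]
  have abs: "\<bar>\<beta> X\<bar> < \<bar>\<alpha> X\<bar>" if "g X X < 0" for X
  proof -
    have "(\<beta> X)\<^sup>2 < (\<alpha> X)\<^sup>2" using that by (simp add: c(2) power2_eq_square)
    then show ?thesis by (metis abs_ge_zero power2_abs power2_less_imp_less)
  qed
  have iff: "g X Y < 0 \<longleftrightarrow> 0 < \<alpha> X * \<alpha> Y" if "g X X < 0" "g Y Y < 0" for X Y
  proof -
    have "\<bar>\<beta> X * \<beta> Y\<bar> < \<bar>\<alpha> X * \<alpha> Y\<bar>" unfolding abs_mult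
      using abs[OF that(1)] abs[OF that(2)] by (intro mult_strict_mono) auto
    then show ?thesis unfolding c(2) by auto
  qed
  show ?thesis using iff[OF assms(1,2)] iff[OF assms(1,3)] iff[OF assms(2,3)] assms(4,5)
    by (auto simp: zero_less_mult_iff)
qed

text \<open>The null cone consists of four rays, and the two sign conditions single out one of
  them.\<close>

lemma null_ray:
  assumes "g A A < 0" "g v v = 0" "g w w = 0" "g A v < 0" "g A w < 0" "vol A v > 0" "vol A w > 0"
  shows "w = (g A w / g A v) *\<^sub>R v"
proof -
  obtain \<omega> \<alpha> \<beta> where c0: "\<omega> \<noteq> 0 \<and> (\<forall>v w. g v w = - \<alpha> v * \<alpha> w + \<beta> v * \<beta> w) \<and>
      (\<forall>v w. vol v w = \<omega> * (\<alpha> v * \<beta> w - \<beta> v * \<alpha> w)) \<and>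
      (\<forall>v w k. \<alpha> w = k * \<alpha> v \<longrightarrow> \<beta> w = k * \<beta> v \<longrightarrow> w = k *\<^sub>R v)"
    using coordinates by blast
  note c = c0[THEN conjunct1] c0[THEN conjunct2, THEN conjunct1, rule_format]
    c0[THEN conjunct2, THEN conjunct2, THEN conjunct1, rule_format]
    c0[THEN conjunct2, THEN conjunct2, THEN conjunct2, rule_format]
  have A: "(\<beta> A)\<^sup>2 < (\<alpha> A)\<^sup>2" using assms(1) by (simp add: c(2) power2_eq_square)
  have y: "\<beta> u = \<alpha> u \<or> \<beta> u = - \<alpha> u" if "g u u = 0" for u
    using that by (simp add: c(2) flip: power2_eq_square) (simp add: power2_eq_iff[symmetric])
  have x: "\<alpha> u \<noteq> 0" if "g u u = 0" "g A u < 0" for u using y[OF that(1)] that(2) by (auto simp: c(2))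
  have pos: "0 < \<alpha> A * \<alpha> u" "0 < \<omega> * (\<alpha> A * \<beta> u)" if u: "g u u = 0" "g A u < 0" "vol A u > 0" for u
  proof -
    note s = cone_sign[OF A y[OF u(1)] x[OF u(1,2)]]
    show "0 < \<alpha> A * \<alpha> u" using u(2) s(1) by (simp add: c(2))
    have "\<alpha> A * \<beta> u \<noteq> 0" using y[OF u(1)] x[OF u(1,2)] \<open>0 < \<alpha> A * \<alpha> u\<close> by auto
    then show "0 < \<omega> * (\<alpha> A * \<beta> u)" using u(3) s(2,3) unfolding c(3) zero_less_mult_iff[of \<omega>] by (smt (verit))
  qed
  \<comment> \<open>The sign of \<open>\<omega>\<close> decides, for both vectors alike, which of
    the lines \<open>\<beta> = \<alpha>\<close> and \<open>\<beta> = - \<alpha>\<close> they lie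
    on.\<close>
  have "\<exists>s. \<beta> v = s * \<alpha> v \<and> \<beta> w = s * \<alpha> w"
  proof (rule ccontr)
    assume no: "\<nexists>s. \<beta> v = s * \<alpha> v \<and> \<beta> w = s * \<alpha> w"
    then have no: "\<not> (\<beta> v = 1 * \<alpha> v \<and> \<beta> w = 1 * \<alpha> w)" "\<not> (\<beta> v = (-1) * \<alpha> v \<and> \<beta> w = (-1) * \<alpha> w)" by blast+
    have *: "\<beta> u = \<alpha> u \<and> 0 < \<omega> \<or> \<beta> u = - \<alpha> u \<and> \<omega> < 0" if "g u u = 0" "g A u < 0" "vol A u > 0" for u
      using y[OF that(1)] pos[OF that] by (auto simp: zero_less_mult_iff mult_less_0_iff)
    show False using *[OF assms(2,4,6)] *[OF assms(3,5,7)] no by auto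
  qed
  then obtain s where s: "\<beta> v = s * \<alpha> v" "\<beta> w = s * \<alpha> w" by blast
  have xv: "\<alpha> v \<noteq> 0" using x assms by blast
  have e: "g A v = (s * \<beta> A - \<alpha> A) * \<alpha> v" "g A w = (s * \<beta> A - \<alpha> A) * \<alpha> w"
    unfolding c(2) s by (simp_all add: algebra_simps)
  have "s * \<beta> A - \<alpha> A \<noteq> 0" using e(1) assms(4) by auto
  then have "g A w / g A v = \<alpha> w / \<alpha> v" unfolding e by simp
  moreover have "w = (\<alpha> w / \<alpha> v) *\<^sub>R v" by (rule c(4)) (use s xv in simp_all)
  ultimately show ?thesis by simp
qed

text \<open>Positivity of the radicand in \<open>null_vec\<close>: the Gram determinant of a
  Lorentzian form is minus the square of a coordinate determinant.\<close>

lemma discriminant_pos: "vol (1, 0) (0, 1) * vol (1, 0) (0, 1) * (g (1, 0) (0, 1) * g (1, 0) (0, 1) - g (1, 0) (1, 0) * g (0, 1) (0, 1)) > 0"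
proof -
  obtain \<omega> \<alpha> \<beta> where c0: "\<omega> \<noteq> 0 \<and> (\<forall>v w. g v w = - \<alpha> v * \<alpha> w + \<beta> v * \<beta> w) \<and>
      (\<forall>v w. vol v w = \<omega> * (\<alpha> v * \<beta> w - \<beta> v * \<alpha> w)) \<and>
      (\<forall>v w k. \<alpha> w = k * \<alpha> v \<longrightarrow> \<beta> w = k * \<beta> v \<longrightarrow> w = k *\<^sub>R v)"
    using coordinates by blast
  note c = c0[THEN conjunct1] c0[THEN conjunct2, THEN conjunct1, rule_format]
    c0[THEN conjunct2, THEN conjunct2, THEN conjunct1, rule_format]
    c0[THEN conjunct2, THEN conjunct2, THEN conjunct2, rule_format]
  have w: "vol (1, 0) (0, 1) \<noteq> 0" using O_nz O_expand by fastforce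
  let ?d = "\<alpha> (1, 0) * \<beta> (0, 1) - \<beta> (1, 0) * \<alpha> (0, 1)"
  have "?d \<noteq> 0" using w by (simp add: c(3))
  then have "0 < ?d * ?d" using not_real_square_gt_zero[of ?d] by blast
  also have "?d * ?d = g (1, 0) (0, 1) * g (1, 0) (0, 1) - g (1, 0) (1, 0) * g (0, 1) (0, 1)"
    unfolding c(2) by (simp add: algebra_simps)
  finally show ?thesis using w by (auto simp: zero_less_mult_iff)
qed

lemma null_vec:
  assumes "g A A < 0"
  shows "g (null_vec g vol A) (null_vec g vol A) = 0" "g A (null_vec g vol A) = -1" "vol A (null_vec g vol A) > 0"
proof -
  define a where "a = g (1, 0) (1, 0)"
  define b where "b = g (1, 0) (0, 1)"
  define d where "d = g (0, 1) (0, 1)"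
  define w where "w = vol (1, 0) (0, 1)"
  define t1 where "t1 = fst A"
  define t2 where "t2 = snd A"
  define al where "al = a * t1 + b * t2"
  define be where "be = b * t1 + d * t2"
  define n where "n = - (al * t1 + be * t2)"
  define s where "s = w / sqrt (w * w * (b * b - a * d))"
  have X: "null_vec g vol A = ((t1 + s * be) / n, (t2 - s * al) / n)"
    by (simp add: null_vec_def Let_def a_def b_def d_def w_def t1_def t2_def al_def be_def n_def s_def)
  have g: "g u v = fst u * fst v * a + (fst u * snd v + snd u * fst v) * b + snd u * snd v * d" for u v
    using g_expand[of u v] by (simp add: a_def b_def d_def)
  have vol: "vol u v = (fst u * snd v - snd u * fst v) * w" for u v using O_expand[of u v] by (simp add: w_def)
  have "g A A = - n" unfolding g t1_def[symmetric] t2_def[symmetric] n_def al_def be_def by (simp add: algebra_simps)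
  then have n: "n > 0" using assms by simp
  have wD: "w * w * (b * b - a * d) > 0" using discriminant_pos by (simp add: a_def b_def d_def w_def)
  then have w: "w \<noteq> 0" by auto
  have D: "b * b - a * d > 0" using wD by (simp add: zero_less_mult_iff)
  have "s * s = w * w / (w * w * (b * b - a * d))"
    unfolding s_def using wD by (simp add: real_sqrt_mult_self abs_of_pos flip: times_divide_times_eq)
  \<comment> \<open>The size of \<open>s\<close> solves the null condition; its sign, that of
    \<open>w\<close>, selects the right-pointing one of the two future null directions.\<close>
  then have ss: "s * s * (b * b - a * d) = 1" using w D by simp
  have ws: "w * s > 0" unfolding s_def using w wD by (simp add: zero_less_divide_iff zero_less_mult_iff) 
  have "g (null_vec g vol A) (null_vec g vol A) * (n * n) =
      (t1 + s * be) * (t1 + s * be) * a + 2 * ((t1 + s * be) * (t2 - s * al)) * b + (t2 - s * al) * (t2 - s * al) * d"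
    unfolding g X using n by (simp add: field_simps)
  also have "\<dots> = - n + n * (s * s * (b * b - a * d))"
    unfolding n_def al_def be_def by (simp add: algebra_simps)
  finally show "g (null_vec g vol A) (null_vec g vol A) = 0" using ss n by simp
  have "g A (null_vec g vol A) * n = t1 * (t1 + s * be) * a + (t1 * (t2 - s * al) + t2 * (t1 + s * be)) * b + t2 * (t2 - s * al) * d"
    unfolding g X t1_def[symmetric] t2_def[symmetric] using n by (simp add: field_simps)
  also have "\<dots> = - n" unfolding n_def al_def be_def by (simp add: algebra_simps)
  finally show "g A (null_vec g vol A) = -1" using n by (simp add: mult_eq_0_iff eq_neg_iff_add_eq_0 flip: distrib_right) (metis add_eq_0_iff mult_cancel_right2 mult_minus_left not_less_iff_gr_or_eq)
  have "vol A (null_vec g vol A) * n = (t1 * (t2 - s * al) - t2 * (t1 + s * be)) * w"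
    unfolding vol X t1_def[symmetric] t2_def[symmetric] using n by (simp add: field_simps)
  also have "\<dots> = n * (w * s)" unfolding n_def by (simp add: algebra_simps)
  finally show "vol A (null_vec g vol A) > 0" using n ws by simp
qed

end

section \<open>The right-moving null field\<close>

text \<open>Representatives of both orientations are fixed so that a null field can be written down
  explicitly; \<open>framed_spacetime_exists\<close> supplies them.\<close>

locale framed_spacetime =
  fixes M :: "'a spacetime" and T :: "('a, plane) vfield" and Om :: "('a, plane) tensor2"
  assumes spacetime: "oriented_spacetime M" and T_in: "T \<in> time_orientation M" and Om_in: "Om \<in> orientation M"

lemma framed_spacetime_exists:
  assumes "oriented_spacetime M" obtains T Om where "framed_spacetime M T Om"
proof -
  obtain Om where Om: "volume_form M Om" "orientation M = {\<Omega>'. volume_form M \<Omega>' \<and>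
               (\<forall>c\<in>atlas M. \<forall>p\<in>fst c. \<exists>k>0. \<forall>v w. \<Omega>' c p v w = k * Om c p v w)}"
    using assms by (auto simp: oriented_spacetime_def is_orientation_def)
  obtain T where T: "timelike_field M T" "time_orientation M = {T'. timelike_field M T' \<and>
               (\<forall>c\<in>atlas M. \<forall>p\<in>fst c. lmetric M c p (T c p) (T' c p) < 0)}"
    using assms by (auto simp: oriented_spacetime_def is_time_orientation_def)
  have "Om \<in> orientation M" unfolding Om(2) using Om(1) by (auto intro: exI[of _ 1])
  moreover have "T \<in> time_orientation M" unfolding T(2) using T(1) by (auto simp: timelike_field_def)
  ultimately show ?thesis using that[of T Om] assms by (simp add: framed_spacetime_def)
qed

context framed_spacetime
begin

abbreviation "g \<equiv> lmetric M"

lemma sm: "smooth_manifold M" and lm: "lorentzian_metric M"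
  using spacetime by (auto simp: oriented_spacetime_def)

lemma smooth_g: "smooth_tensor2 M g" using lm by (simp add: lorentzian_metric_def)

lemma orientation_volume: "Om' \<in> orientation M \<Longrightarrow> volume_form M Om'"
  using spacetime by (auto simp: oriented_spacetime_def is_orientation_def)

lemma time_orientation_timelike: "T' \<in> time_orientation M \<Longrightarrow> timelike_field M T'"
  using spacetime by (auto simp: oriented_spacetime_def is_time_orientation_def)

lemma lorentz:
  assumes "Om' \<in> orientation M" "c \<in> atlas M" "p \<in> fst c" shows "lorentz_plane (g c p) (Om' c p)"
proof
  show "bilinear (g c p)" using smooth_g assms by (auto simp: smooth_tensor2_def)
  have v: "smooth_tensor2 M Om'" "\<forall>c\<in>atlas M. \<forall>p\<in>fst c. (\<forall>v. Om' c p v v = 0) \<and> (\<exists>v w. Om' c p v w \<noteq> 0)"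
    using orientation_volume[OF assms(1)] unfolding volume_form_def by blast+
  show "bilinear (Om' c p)" using v(1) assms by (auto simp: smooth_tensor2_def)
  show "Om' c p v v = 0" for v using v(2) assms by blast
  show "\<exists>v w. Om' c p v w \<noteq> 0" using v(2) assms by blast
  have l: "\<forall>c\<in>atlas M. \<forall>p\<in>fst c. \<forall>v w. lmetric M c p v w = lmetric M c p w v"
    "\<forall>c\<in>atlas M. \<forall>p\<in>fst c. \<exists>e0 e1. lmetric M c p e0 e0 = -1 \<and> lmetric M c p e1 e1 = 1 \<and> lmetric M c p e0 e1 = 0"
    using lm unfolding lorentzian_metric_def by blast+
  show "g c p v w = g c p w v" for v w using l(1) assms by blast
  show "\<exists>e0 e1. g c p e0 e0 = -1 \<and> g c p e1 e1 = 1 \<and> g c p e0 e1 = 0" using l(2) assms by blast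
qed

lemma timelike:
  assumes "T' \<in> time_orientation M" "c \<in> atlas M" "p \<in> fst c" shows "g c p (T' c p) (T' c p) < 0"
  using time_orientation_timelike[OF assms(1)] assms unfolding timelike_field_def by blast

text \<open>Any member of the class may serve as reference, not only the field \<open>T0\<close>
  from which the class was formed: both \<open>T\<close> and \<open>T'\<close> share the cone of
  \<open>T0\<close>.\<close>

lemma timelike_cone:
  assumes "T' \<in> time_orientation M" "c \<in> atlas M" "p \<in> fst c" shows "g c p (T c p) (T' c p) < 0"
proof -
  interpret L: lorentz_plane "g c p" "Om c p" by (rule lorentz[OF Om_in assms(2,3)])
  obtain T0 where T0: "timelike_field M T0" "time_orientation M = {T'. timelike_field M T' \<and>
               (\<forall>c\<in>atlas M. \<forall>p\<in>fst c. lmetric M c p (T0 c p) (T' c p) < 0)}"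
    using spacetime by (auto simp: oriented_spacetime_def is_time_orientation_def)
  show ?thesis
  proof (rule L.cone_trans[OF _ timelike[OF T_in assms(2,3)] timelike[OF assms]])
    show "g c p (T0 c p) (T0 c p) < 0" using T0(1) assms unfolding timelike_field_def by blast
    show "g c p (T0 c p) (T c p) < 0" "g c p (T0 c p) (T' c p) < 0"
      using T0(2) T_in assms by blast+
  qed
qed

lemma orientation_scale:
  assumes "Om' \<in> orientation M" "c \<in> atlas M" "p \<in> fst c"
  obtains k where "k > 0" "\<And>v w. Om' c p v w = k * Om c p v w"
proof -
  obtain O0 where O0: "orientation M = {\<Omega>'. volume_form M \<Omega>' \<and>
               (\<forall>c\<in>atlas M. \<forall>p\<in>fst c. \<exists>k>0. \<forall>v w. \<Omega>' c p v w = k * O0 c p v w)}"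
    using spacetime by (auto simp: oriented_spacetime_def is_orientation_def)
  obtain k where k: "k > 0" "\<forall>v w. Om' c p v w = k * O0 c p v w" using assms unfolding O0 by blast
  obtain l where l: "l > 0" "\<forall>v w. Om c p v w = l * O0 c p v w" using Om_in assms(2,3) unfolding O0 by blast
  show ?thesis by (rule that[of "k / l"]) (use k l in auto)
qed

text \<open>The normalisation \<open>g(T, n) = -1\<close> picks one vector on each future
  right-pointing null ray and thereby gives a global field.\<close>

definition null_field :: "('a, plane) vfield" where
  "null_field c p = null_vec (g c p) (Om c p) (T c p)"

lemma null_field:
  assumes "c \<in> atlas M" "p \<in> fst c"
  shows "g c p (null_field c p) (null_field c p) = 0" "g c p (T c p) (null_field c p) = -1"
    "Om c p (T c p) (null_field c p) > 0"
  using lorentz_plane.null_vec[OF lorentz[OF Om_in assms] timelike[OF T_in assms]] unfolding null_field_def by auto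

lemma future_right_null_iff:
  assumes "c \<in> atlas M" "p \<in> fst c"
  shows "future_right_null M c p v \<longleftrightarrow> g c p v v = 0 \<and> g c p (T c p) v < 0 \<and> Om c p (T c p) v > 0"
proof -
  interpret L: lorentz_plane "g c p" "Om c p" by (rule lorentz[OF Om_in assms])
  have sc: "(g c p (T c p) v < 0) = (g c p (T' c p) v < 0)" "(Om c p (T c p) v > 0) = (Om c p (T' c p) v > 0)"
    if "T' \<in> time_orientation M" "v \<noteq> 0" "g c p v v = 0" for T'
    using L.same_cone[OF timelike[OF T_in assms] timelike[OF that(1) assms] timelike_cone[OF that(1) assms] that(2,3)] by auto
  have sO: "(0 < Om' c p u v) = (0 < Om c p u v)" if "Om' \<in> orientation M" for Om' u
    using orientation_scale[OF that assms] by (metis zero_less_mult_iff less_asym)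
  have "g c p (T c p) 0 = 0" using linear_0[OF bilinear_linear(1)[OF L.g_bil]] .
  then have "v \<noteq> 0" if "g c p (T c p) v < 0" using that by auto
  then show ?thesis
    unfolding future_right_null_def null_vector_def future_directed_def right_pointing_def
    using sc sO T_in Om_in by blast
qed

lemma future_right_null_ray:
  assumes "c \<in> atlas M" "p \<in> fst c"
  shows "future_right_null M c p v \<longleftrightarrow> (\<exists>k>0. v = k *\<^sub>R null_field c p)"
proof -
  interpret L: lorentz_plane "g c p" "Om c p" by (rule lorentz[OF Om_in assms])
  have sc: "g c p u (k *\<^sub>R w) = k * g c p u w" "g c p (k *\<^sub>R w) u = k * g c p w u"
    "Om c p u (k *\<^sub>R w) = k * Om c p u w" for u w k
    using linear_scale[OF bilinear_linear(1)[OF L.g_bil]] linear_scale[OF bilinear_linear(2)[OF L.g_bil]]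
      linear_scale[OF bilinear_linear(1)[OF L.O_bil]] by auto
  show ?thesis unfolding future_right_null_iff[OF assms]
  proof
    assume v: "g c p v v = 0 \<and> g c p (T c p) v < 0 \<and> Om c p (T c p) v > 0"
    have "v = (g c p (T c p) v / g c p (T c p) (null_field c p)) *\<^sub>R null_field c p"
      by (rule L.null_ray[OF timelike[OF T_in assms]]) (use v null_field[OF assms] in auto)
    then show "\<exists>k>0. v = k *\<^sub>R null_field c p" using v null_field(2)[OF assms]
      by (intro exI[of _ "- g c p (T c p) v"]) simp
  next
    assume "\<exists>k>0. v = k *\<^sub>R null_field c p"
    then show "g c p v v = 0 \<and> g c p (T c p) v < 0 \<and> Om c p (T c p) v > 0"
      using null_field[OF assms] by (auto simp: sc)
  qed
qed

lemma vector_field_transform: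
  assumes "smooth_vector_field_on M W Y" "c \<in> atlas M" "d \<in> atlas M" "p \<in> W" "p \<in> fst c" "p \<in> fst d"
  shows "mdiff c d (\<lambda>q. q) p (Y c p) = Y d p"
  using assms unfolding smooth_vector_field_on_def by (metis IntI)

lemma tensor_transform:
  assumes "smooth_tensor2 M t" "c \<in> atlas M" "d \<in> atlas M" "p \<in> fst c" "p \<in> fst d"
  shows "t d p (mdiff c d (\<lambda>q. q) p v) (mdiff c d (\<lambda>q. q) p w) = t c p v w"
  using assms unfolding smooth_tensor2_def by (metis IntI)

lemma T_smooth: "smooth_vector_field_on M (points M) T"
  using time_orientation_timelike[OF T_in] by (simp add: timelike_field_def)

lemma Om_smooth: "smooth_tensor2 M Om"
  using orientation_volume[OF Om_in] by (simp add: volume_form_def)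

text \<open>The formula in \<open>null_vec\<close> is not visibly covariant. Covariance follows from
  uniqueness: the transformed vector lies on the same null ray and has the same
  normalisation.\<close>

lemma null_field_transform:
  assumes "c \<in> atlas M" "d \<in> atlas M" "p \<in> fst c" "p \<in> fst d"
  shows "mdiff c d (\<lambda>q. q) p (null_field c p) = null_field d p"
proof -
  let ?D = "mdiff c d (\<lambda>q. q) p"
  interpret L: lorentz_plane "g d p" "Om d p" by (rule lorentz[OF Om_in assms(2,4)])
  have p: "p \<in> points M" using smooth_manifoldD(7)[OF sm assms(1)] assms(3) by blast
  have TT: "?D (T c p) = T d p" by (rule vector_field_transform[OF T_smooth assms(1,2) p assms(3,4)])
  note gt = tensor_transform[OF smooth_g assms] and Ot = tensor_transform[OF Om_smooth assms]
  have "g d p (?D (null_field c p)) (?D (null_field c p)) = 0" "g d p (T d p) (?D (null_field c p)) = -1"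
    "Om d p (T d p) (?D (null_field c p)) > 0"
    unfolding TT[symmetric] gt Ot using null_field[OF assms(1,3)] by auto
  then show ?thesis
    using L.null_ray[OF timelike[OF T_in assms(2,4)], of "null_field d p" "?D (null_field c p)"] null_field[OF assms(2,4)]
    by simp
qed

lemma tensor_component_smooth:
  "smooth_tensor2 M t \<Longrightarrow> c \<in> atlas M \<Longrightarrow> smooth_on (snd c ` fst c) (\<lambda>x. t c (inv_chart c x) v w)"
  unfolding smooth_tensor2_def by blast

lemma vector_field_smooth:
  assumes "smooth_vector_field_on M (points M) Y" "c \<in> atlas M"
  shows "smooth_on (snd c ` fst c) (\<lambda>x. Y c (inv_chart c x))"
proof -
  have "points M \<inter> fst c = fst c" using smooth_manifoldD(7)[OF sm assms(2)] by blast
  moreover have "smooth_on (snd c ` (points M \<inter> fst c)) (\<lambda>x. Y c (inv_chart c x))"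
    using assms by (simp add: smooth_vector_field_on_def)
  ultimately show ?thesis by simp
qed

text \<open>Smoothness is read off the explicit formula: the radicand is positive by
  \<open>discriminant_pos\<close>, and the denominator \<open>n\<close> is \<open>- g(T, T)\<close>,
  which is nonzero.\<close>

lemma null_field_smooth: "smooth_vector_field_on M (points M) null_field"
  unfolding smooth_vector_field_on_def
proof (intro conjI ballI)
  show "null_field d p = mdiff c d (\<lambda>q. q) p (null_field c p)"
    if "c \<in> atlas M" "d \<in> atlas M" "p \<in> points M \<inter> fst c \<inter> fst d" for c d p
    using null_field_transform[OF that(1,2)] that(3) by simp
  fix c assume c: "c \<in> atlas M"
  let ?S = "snd c ` fst c"
  note cc = smooth_manifoldD(3)[OF sm c]
  have S: "open ?S" using is_chartD(2)[OF cc] .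
  have "points M \<inter> fst c = fst c" using smooth_manifoldD(7)[OF sm c] by blast
  define a where "a x = g c (inv_chart c x) (1, 0) (1, 0)" for x
  define b where "b x = g c (inv_chart c x) (1, 0) (0, 1)" for x
  define d where "d x = g c (inv_chart c x) (0, 1) (0, 1)" for x
  define w where "w x = Om c (inv_chart c x) (1, 0) (0, 1)" for x
  define t where "t x = T c (inv_chart c x)" for x
  have sm1: "smooth_on ?S a" "smooth_on ?S b" "smooth_on ?S d" "smooth_on ?S w" "smooth_on ?S t"
    unfolding a_def b_def d_def w_def t_def
    by (intro tensor_component_smooth smooth_g Om_smooth c vector_field_smooth T_smooth)+
  define al where "al x = a x * fst (t x) + b x * snd (t x)" for x
  define be where "be x = b x * fst (t x) + d x * snd (t x)" for x
  define n where "n x = - (al x * fst (t x) + be x * snd (t x))" for x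
  define s where "s x = w x / sqrt (w x * w x * (b x * b x - a x * d x))" for x
  have al: "smooth_on ?S al" and be: "smooth_on ?S be" unfolding al_def be_def
    by (intro smooth_on_add smooth_on_mult smooth_on_fst smooth_on_snd sm1 S)+
  have ns: "smooth_on ?S n" unfolding n_def
    by (intro smooth_on_minus smooth_on_add smooth_on_mult smooth_on_fst smooth_on_snd sm1 al be S)
  have disc: "w x * w x * (b x * b x - a x * d x) > 0" if "x \<in> ?S" for x
    unfolding a_def b_def d_def w_def
    using lorentz_plane.discriminant_pos[OF lorentz[OF Om_in c chart_inv(3)[OF cc that]]] .
  have ss: "smooth_on ?S s" unfolding s_def
    by (intro smooth_on_divide smooth_on_sqrt smooth_on_mult smooth_on_diff sm1 S)
      (use disc in force)+
  have n0: "n x \<noteq> 0" if "x \<in> ?S" for x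
  proof -
    interpret L: lorentz_plane "g c (inv_chart c x)" "Om c (inv_chart c x)"
      by (rule lorentz[OF Om_in c chart_inv(3)[OF cc that]])
    have "g c (inv_chart c x) (t x) (t x) = - n x"
      using L.g_expand[of "t x" "t x"] by (simp add: n_def al_def be_def a_def b_def d_def algebra_simps)
    then show ?thesis using timelike[OF T_in c chart_inv(3)[OF cc that]] by (auto simp: t_def)
  qed
  have eq: "null_field c (inv_chart c x) = ((fst (t x) + s x * be x) / n x, (snd (t x) - s x * al x) / n x)" for x
    by (simp add: null_field_def null_vec_def Let_def a_def b_def d_def w_def t_def al_def be_def n_def s_def)
  have "smooth_on ?S (\<lambda>x. null_field c (inv_chart c x))" unfolding eq
    by (intro smooth_on_Pair smooth_on_divide smooth_on_add smooth_on_diff smooth_on_mult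
        smooth_on_fst smooth_on_snd sm1 al be ns ss S n0)
  then show "smooth_on (snd c ` (points M \<inter> fst c)) (\<lambda>x. null_field c (inv_chart c x))"
    using \<open>points M \<inter> fst c = fst c\<close> by simp
qed

text \<open>A flow box: leaves are vertical in it. The centred square as image makes every vertical
  slice (a plaque) an interval, hence part of a single leaf.\<close>

definition straight :: "('a, plane) chart \<Rightarrow> bool" where
  "straight c \<longleftrightarrow> c \<in> atlas M \<and> (\<exists>e>0. snd c ` fst c = square e) \<and> (\<forall>q\<in>fst c. null_field c q = (0, 1))"

lemma null_field_nonzero:
  assumes "c \<in> atlas M" "p \<in> fst c" shows "null_field c p \<noteq> 0"
proof
  assume 0: "null_field c p = 0"
  interpret L: lorentz_plane "g c p" "Om c p" by (rule lorentz[OF Om_in assms])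
  show False using null_field(2)[OF assms] linear_0[OF bilinear_linear(1)[OF L.g_bil]] 0 by simp
qed

lemma straight_exists:
  assumes W: "openin (mtop M) W" "p \<in> W"
  obtains c where "straight c" "p \<in> fst c" "fst c \<subseteq> W" "snd c p = (0, 0)"
proof -
  have "p \<in> points M" using W openin_subset by blast
  then obtain c0 where c0: "c0 \<in> atlas M" "p \<in> fst c0" using smooth_manifoldD(5)[OF sm] by blast
  note cc0 = smooth_manifoldD(3)[OF sm c0(1)]
  define X where "X x = null_field c0 (inv_chart c0 x)" for x
  let ?V = "snd c0 ` (W \<inter> fst c0)"
  have oV: "open ?V" by (rule chart_open_image[OF cc0 W(1)])
  have "?V \<subseteq> snd c0 ` fst c0" by blast
  then have X: "smooth_on ?V X" unfolding X_def
    using smooth_on_subset[OF vector_field_smooth[OF null_field_smooth c0(1)]] by blast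
  have "X (snd c0 p) \<noteq> 0" unfolding X_def chart_inv(1)[OF cc0 c0(2)] by (rule null_field_nonzero[OF c0])
  note X0 = this
  have pV: "snd c0 p \<in> ?V" using W(2) c0(2) by blast
  obtain e U E G where
    E: "0 < e" "open U" "U \<subseteq> ?V" "smooth_on (square e) E" "smooth_on U G" "homeomorphism (square e) U E G"
      "E (0, 0) = snd c0 p" "\<And>b. b \<in> square e \<Longrightarrow> frechet_derivative E (at b) (0, 1) = X (E b)"
    by (rule flow_box_plane[OF oV pV X X0]) blast
  define W1 where "W1 = W \<inter> {q \<in> fst c0. snd c0 q \<in> U}"
  have W1: "openin (mtop M) W1" "W1 \<subseteq> fst c0" "W1 \<subseteq> W" unfolding W1_def
    using openin_Int[OF W(1) chart_open_preimage[OF cc0 E(2)]] by auto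
  have im: "snd c0 ` W1 = U"
  proof
    show "snd c0 ` W1 \<subseteq> U" by (auto simp: W1_def)
    show "U \<subseteq> snd c0 ` W1"
    proof
      fix x assume x: "x \<in> U"
      then obtain q where "q \<in> W \<inter> fst c0" "x = snd c0 q" using E(3) by blast
      then show "x \<in> snd c0 ` W1" using x by (auto simp: W1_def)
    qed
  qed
  define c where "c = (W1, restrict (G \<circ> snd c0) W1)"
  have hom: "homeomorphism (snd c0 ` W1) (square e) G E" unfolding im using E(6) by (rule homeomorphism_symD)
  have c: "c \<in> atlas M" unfolding c_def
    by (rule transformed_chart[OF sm c0(1) W1(1,2) open_square _ E(4) hom]) (simp add: im E(5))
  note cc = smooth_manifoldD(3)[OF sm c]
  have sc: "snd c q = G (snd c0 q)" if "q \<in> fst c" for q using that by (simp add: c_def)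
  have img: "snd c ` fst c = square e"
  proof -
    have "snd c ` fst c = G ` (snd c0 ` W1)" by (simp add: c_def image_image)
    then show ?thesis using hom by (simp add: homeomorphism_def)
  qed
  \<comment> \<open>The flow box map is the transition back to \<open>c0\<close>, so its derivative
    in direction \<open>(0, 1)\<close> is the change of components of the null field.\<close>
  have E_rep: "local_rep c c0 (\<lambda>q. q) b = E b" if b: "b \<in> square e" for b
  proof -
    obtain q where q: "q \<in> fst c" "b = snd c q" using b img by blast
    then have "snd c0 q \<in> U" by (auto simp: c_def W1_def)
    then have "E b = snd c0 q" using q E(6) by (simp add: sc homeomorphism_def)
    then show ?thesis using local_rep_apply[OF cc q(1)] q(2) by simp
  qed
  have "null_field c q = (0, 1)" if q: "q \<in> fst c" for q
  proof -
    have q0: "q \<in> fst c0" using q W1(2) by (auto simp: c_def)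
    have b: "snd c q \<in> square e" using q img by blast
    have "(local_rep c c0 (\<lambda>q. q) has_derivative frechet_derivative E (at (snd c q))) (at (snd c q))"
      by (rule has_derivative_transform_within_open[OF smooth_on_has_derivative[OF E(4) open_square b] open_square b])
        (rule E_rep[symmetric])
    from frechet_derivative_at[OF this] have "mdiff c c0 (\<lambda>q. q) q (0, 1) = frechet_derivative E (at (snd c q)) (0, 1)"
      unfolding mdiff_def by simp
    also have "\<dots> = null_field c0 q"
      unfolding E(8)[OF b] X_def E_rep[OF b, symmetric] local_rep_apply[OF cc q] chart_inv(1)[OF cc0 q0] ..
    finally have "mdiff c0 c (\<lambda>q. q) q (null_field c0 q) = (0, 1)"
      using transition_inverse[OF sm c c0(1) q q0, of "(0, 1)"] by simp
    then show ?thesis using null_field_transform[OF c0(1) c q0 q] by simp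
  qed
  then have st: "straight c" unfolding straight_def using c E(1) img by blast
  have "E ` square e = U" "(0, 0) \<in> square e" using E(1,6) by (simp_all add: homeomorphism_def)
  then have pU: "snd c0 p \<in> U" using E(7) by (metis imageI)
  then have p: "p \<in> fst c" using W(2) c0(2) by (simp add: c_def W1_def)
  have "snd c p = G (E (0, 0))" using sc[OF p] E(7) by simp
  also have "\<dots> = (0, 0)" using E(1,6) by (auto simp: homeomorphism_def)
  finally show ?thesis using that[OF st p] W1(3) by (simp add: c_def)
qed

end

section \<open>Flow lines of the null field\<close>

context framed_spacetime
begin

lemma straightD:
  assumes "straight c"
  shows "c \<in> atlas M" "is_chart (mtop M) c" "fst c \<subseteq> points M" "\<And>q. q \<in> fst c \<Longrightarrow> null_field c q = (0, 1)"
  using assms smooth_manifoldD(3,7)[OF sm] by (auto simp: straight_def)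

lemma straight_square:
  assumes "straight c" obtains e where "e > 0" "snd c ` fst c = square e"
  using assms by (auto simp: straight_def)

text \<open>An integral curve of the null field expressed without derivatives: near \<open>t\<close>
  it is a vertical translation at unit speed. In a straight chart this gives existence and
  uniqueness at once.\<close>

definition follows :: "('a, plane) chart \<Rightarrow> (real \<Rightarrow> 'a) \<Rightarrow> real \<Rightarrow> bool" where
  "follows c \<gamma> t \<longleftrightarrow> \<gamma> t \<in> fst c \<and>
     (\<exists>d>0. \<forall>s. \<bar>s - t\<bar> < d \<longrightarrow> \<gamma> s \<in> fst c \<and> snd c (\<gamma> s) = snd c (\<gamma> t) + (0, s - t))"

lemma followsI:
  assumes "\<gamma> t \<in> fst c" "d > 0" "\<And>s. \<bar>s - t\<bar> < d \<Longrightarrow> \<gamma> s \<in> fst c \<and> snd c (\<gamma> s) = snd c (\<gamma> t) + (0, s - t)"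
  shows "follows c \<gamma> t"
  unfolding follows_def using assms by blast

definition flow_line :: "real set \<Rightarrow> (real \<Rightarrow> 'a) \<Rightarrow> bool" where
  "flow_line I \<gamma> \<longleftrightarrow> open I \<and> is_interval I \<and> (\<forall>t\<in>I. \<exists>c. straight c \<and> follows c \<gamma> t)"

text \<open>Both charts give the null field the components \<open>(0, 1)\<close>, so the transition
  map minus vertical translation has zero derivative along a vertical line and is constant
  there.\<close>

lemma straight_transition:
  assumes c: "straight c" and d: "straight d" and q: "q \<in> fst c" "q \<in> fst d"
  shows "\<exists>\<delta>>0. \<forall>s. \<bar>s\<bar> < \<delta> \<longrightarrow>
    (\<exists>q'\<in>fst c \<inter> fst d. snd c q' = snd c q + (0, s) \<and> snd d q' = snd d q + (0, s))"
proof -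
  note cD = straightD[OF c] and dD = straightD[OF d]
  let ?S = "snd c ` (fst c \<inter> fst d)" and ?P = "local_rep c d (\<lambda>p. p)"
  note sS = transition_smooth[OF sm cD(1) dD(1)]
  have zS: "snd c q \<in> ?S" using q by blast
  obtain \<delta> where \<delta>: "\<delta> > 0" "ball (snd c q) \<delta> \<subseteq> ?S" using open_contains_ball[THEN iffD1, OF sS(2)] zS by blast
  have inS: "snd c q + (0, s) \<in> ?S" if "\<bar>s\<bar> < \<delta>" for s
  proof -
    have "dist (snd c q) (snd c q + (0, s)) < \<delta>" using that by (simp add: dist_norm norm_Pair)
    then show ?thesis using \<delta>(2) by auto
  qed
  define h where "h s = ?P (snd c q + (0, s)) - (0, s)" for s
  have der: "(h has_vector_derivative 0) (at s)" if s: "\<bar>s\<bar> < \<delta>" for s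
  proof -
    obtain r where r: "r \<in> fst c" "r \<in> fst d" "snd c q + (0, s) = snd c r" using inS[OF s] by blast
    have 1: "((\<lambda>s. snd c q + (0, s)) has_derivative (\<lambda>k. (0, k))) (at s)" by (auto intro!: derivative_eq_intros)
    have D: "(?P has_derivative mdiff c d (\<lambda>q. q) r) (at (snd c q + (0, s)))"
      unfolding r(3) mdiff_def by (rule smooth_on_has_derivative[OF sS]) (use r in blast)
    from diff_chain_at[OF 1 D]
    have 2: "((\<lambda>s. ?P (snd c q + (0, s))) has_derivative (\<lambda>k. mdiff c d (\<lambda>q. q) r (0, k))) (at s)" by (simp add: o_def)
    have "mdiff c d (\<lambda>q. q) r (0, k) = (0, k)" for k
    proof -
      have "mdiff c d (\<lambda>q. q) r (0, 1) = (0, 1)"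
        using null_field_transform[OF cD(1) dD(1) r(1,2)] cD(4)[OF r(1)] dD(4)[OF r(2)] by simp
      moreover have "mdiff c d (\<lambda>q. q) r (0, k) = k *\<^sub>R mdiff c d (\<lambda>q. q) r (0, 1)"
        using linear_scale[OF has_derivative_linear[OF D], of k "(0, 1)"] by simp
      ultimately show ?thesis by simp
    qed
    with 2 have "((\<lambda>s. ?P (snd c q + (0, s))) has_derivative (\<lambda>k. (0, k))) (at s)" by simp
    moreover have "((\<lambda>s. (0, s)) has_derivative (\<lambda>k. (0, k))) (at s)" by (auto intro!: derivative_eq_intros)
    ultimately have "((\<lambda>s. ?P (snd c q + (0, s)) - (0, s)) has_derivative (\<lambda>k. (0, k) - (0, k))) (at s)"
      by (rule has_derivative_diff)
    then show ?thesis unfolding has_vector_derivative_def h_def[abs_def] by simp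
  qed
  have ex: "\<exists>q'\<in>fst c \<inter> fst d. snd c q' = snd c q + (0, s) \<and> snd d q' = snd d q + (0, s)" if s: "\<bar>s\<bar> < \<delta>" for s
  proof -
    have "h s = h 0"
    proof -
      have "(h has_derivative (\<lambda>h. 0)) (at x within {-\<delta><..<\<delta>})" if "x \<in> {-\<delta><..<\<delta>}" for x
        using der[of x] that has_derivative_at_withinI by (force simp: has_vector_derivative_def)
      then obtain k where k: "\<forall>x\<in>{-\<delta><..<\<delta>}. h x = k"
        using has_derivative_zero_constant[of "{-\<delta><..<\<delta>}" h] by auto
      have "s \<in> {-\<delta><..<\<delta>}" "0 \<in> {-\<delta><..<\<delta>}" using s \<delta>(1) by auto
      with k show ?thesis by metis
    qed
    moreover obtain r where r: "r \<in> fst c" "r \<in> fst d" "snd c q + (0, s) = snd c r" using inS[OF s] by blast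
    have "?P (snd c r) = snd d r" "?P (snd c q) = snd d q"
      using local_rep_apply[OF cD(2) r(1), of d "\<lambda>p. p"] local_rep_apply[OF cD(2) q(1), of d "\<lambda>p. p"] by auto
    ultimately have "snd d r - (0, s) = snd d q" unfolding h_def r(3) by (simp add: zero_prod_def[symmetric])
    then have "snd d r = snd d q + (0, s)" by (simp add: diff_eq_eq)
    with r show ?thesis by (intro bexI[of _ r]) auto
  qed
  then show ?thesis using \<delta>(1) by blast
qed

lemma open_real_nbhd: "open S \<Longrightarrow> t \<in> S \<Longrightarrow> \<exists>d>0. \<forall>s::real. \<bar>s - t\<bar> < d \<longrightarrow> s \<in> S"
  by (simp add: open_dist dist_real_def)

lemma follows_change:
  assumes "straight c" "straight d" "follows c \<gamma> t" "\<gamma> t \<in> fst d"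
  shows "follows d \<gamma> t"
proof -
  obtain r where r: "r > 0" "\<And>s. \<bar>s - t\<bar> < r \<Longrightarrow> \<gamma> s \<in> fst c \<and> snd c (\<gamma> s) = snd c (\<gamma> t) + (0, s - t)"
    and ct: "\<gamma> t \<in> fst c"
    using assms(3) unfolding follows_def by blast
  obtain \<delta> where \<delta>: "\<delta> > 0" "\<And>s. \<bar>s\<bar> < \<delta> \<Longrightarrow> \<exists>q'\<in>fst c \<inter> fst d. snd c q' = snd c (\<gamma> t) + (0, s) \<and> snd d q' = snd d (\<gamma> t) + (0, s)"
    using straight_transition[OF assms(1,2) ct assms(4)] by blast
  have "\<gamma> s \<in> fst d \<and> snd d (\<gamma> s) = snd d (\<gamma> t) + (0, s - t)" if s: "\<bar>s - t\<bar> < min r \<delta>" for s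
  proof -
    obtain q' where q': "q' \<in> fst c" "q' \<in> fst d" "snd c q' = snd c (\<gamma> t) + (0, s - t)" "snd d q' = snd d (\<gamma> t) + (0, s - t)"
      using \<delta>(2)[of "s - t"] s by auto
    have g: "\<gamma> s \<in> fst c" "snd c (\<gamma> s) = snd c q'" using r(2)[of s] s q'(3) by auto
    then have "\<gamma> s = q'" using is_chartD(3)[OF straightD(2)[OF assms(1)]] q'(1) by (auto dest: inj_onD)
    then show ?thesis using q' by simp
  qed
  moreover have "min r \<delta> > 0" using r(1) \<delta>(1) by simp
  ultimately show ?thesis unfolding follows_def using assms(4) by blast
qed

lemma flow_line_follows:
  assumes "flow_line I \<gamma>" "t \<in> I" "straight d" "\<gamma> t \<in> fst d" shows "follows d \<gamma> t"
  using assms follows_change unfolding flow_line_def by blast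

lemma flow_line_points: "flow_line I \<gamma> \<Longrightarrow> t \<in> I \<Longrightarrow> \<gamma> t \<in> points M"
  unfolding flow_line_def follows_def using straightD(3) by blast

lemma follows_open:
  assumes "straight c" "follows c \<gamma> t" "openin (mtop M) U" "\<gamma> t \<in> U"
  shows "\<exists>d>0. \<forall>s. \<bar>s - t\<bar> < d \<longrightarrow> \<gamma> s \<in> U"
proof -
  obtain r where r: "r > 0" "\<And>s. \<bar>s - t\<bar> < r \<Longrightarrow> \<gamma> s \<in> fst c \<and> snd c (\<gamma> s) = snd c (\<gamma> t) + (0, s - t)"
    and ct: "\<gamma> t \<in> fst c"
    using assms(2) unfolding follows_def by blast
  note cc = straightD(2)[OF assms(1)]
  have "open (snd c ` (U \<inter> fst c))" by (rule chart_open_image[OF cc assms(3)])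
  moreover have "snd c (\<gamma> t) \<in> snd c ` (U \<inter> fst c)" using assms(4) ct by blast
  ultimately obtain \<delta> where \<delta>: "\<delta> > 0" "ball (snd c (\<gamma> t)) \<delta> \<subseteq> snd c ` (U \<inter> fst c)" using open_contains_ball by blast
  have "\<gamma> s \<in> U" if s: "\<bar>s - t\<bar> < min r \<delta>" for s
  proof -
    have "dist (snd c (\<gamma> t)) (snd c (\<gamma> s)) < \<delta>" using r(2)[of s] s by (simp add: dist_norm norm_Pair abs_minus_commute)
    then obtain q where q: "q \<in> U" "q \<in> fst c" "snd c (\<gamma> s) = snd c q" using \<delta>(2) by auto
    then have "\<gamma> s = q" using is_chartD(3)[OF cc] r(2)[of s] s by (auto dest: inj_onD)
    then show ?thesis using q by simp
  qed
  moreover have "min r \<delta> > 0" using r(1) \<delta>(1) by simp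
  ultimately show ?thesis by blast
qed

lemma flow_line_open:
  assumes "flow_line I \<gamma>" "t \<in> I" "openin (mtop M) U" "\<gamma> t \<in> U"
  shows "\<exists>d>0. \<forall>s. \<bar>s - t\<bar> < d \<longrightarrow> s \<in> I \<and> \<gamma> s \<in> U"
proof -
  obtain c where c: "straight c" "follows c \<gamma> t" using assms(1,2) unfolding flow_line_def by blast
  obtain d where d: "d > 0" "\<And>s. \<bar>s - t\<bar> < d \<Longrightarrow> \<gamma> s \<in> U" using follows_open[OF c assms(3,4)] by blast
  have "open I" using assms(1) by (simp add: flow_line_def)
  then obtain r where r: "r > 0" "\<And>s. \<bar>s - t\<bar> < r \<Longrightarrow> s \<in> I"
    using assms(2) unfolding open_dist dist_real_def by blast
  show ?thesis by (rule exI[of _ "min d r"]) (use d r in auto)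
qed

lemma flow_germ:
  assumes "flow_line I \<gamma>" "flow_line I' \<gamma>'" "t \<in> I" "t \<in> I'" "\<gamma> t = \<gamma>' t"
  shows "\<exists>d>0. \<forall>s. \<bar>s - t\<bar> < d \<longrightarrow> s \<in> I \<and> s \<in> I' \<and> \<gamma> s = \<gamma>' s"
proof -
  obtain c where c: "straight c" "follows c \<gamma> t" using assms(1,3) unfolding flow_line_def by blast
  have "\<gamma>' t \<in> fst c" using c(2) assms(5) by (simp add: follows_def)
  then have c': "follows c \<gamma>' t" using flow_line_follows[OF assms(2,4) c(1)] by blast
  obtain r where r: "r > 0" "\<And>s. \<bar>s - t\<bar> < r \<Longrightarrow> \<gamma> s \<in> fst c \<and> snd c (\<gamma> s) = snd c (\<gamma> t) + (0, s - t)"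
    using c(2) unfolding follows_def by blast
  obtain r' where r': "r' > 0" "\<And>s. \<bar>s - t\<bar> < r' \<Longrightarrow> \<gamma>' s \<in> fst c \<and> snd c (\<gamma>' s) = snd c (\<gamma>' t) + (0, s - t)"
    using c' unfolding follows_def by blast
  obtain d where d: "d > 0" "\<And>s. \<bar>s - t\<bar> < d \<Longrightarrow> s \<in> I"
    using assms(1,3) unfolding flow_line_def open_dist dist_real_def by blast
  obtain d' where d': "d' > 0" "\<And>s. \<bar>s - t\<bar> < d' \<Longrightarrow> s \<in> I'"
    using assms(2,4) unfolding flow_line_def open_dist dist_real_def by blast
  have "\<gamma> s = \<gamma>' s" if "\<bar>s - t\<bar> < r" "\<bar>s - t\<bar> < r'" for s
    using r(2)[OF that(1)] r'(2)[OF that(2)] assms(5)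
      inj_onD[OF is_chartD(3)[OF straightD(2)[OF c(1)]], of "\<gamma> s" "\<gamma>' s"] by simp
  then show ?thesis
    by (intro exI[of _ "min (min r r') (min d d')"]) (use r(1) r'(1) d d' in auto)
qed

text \<open>Passages from local to global along a curve are instances of this, mostly with a
  relation that compares truth values at two parameters.\<close>

lemma connected_relation_real:
  fixes S :: "real set"
  assumes "connected S" "a \<in> S" "b \<in> S"
    and "\<And>x y. R x y \<Longrightarrow> R y x" "\<And>x y z. R x y \<Longrightarrow> R y z \<Longrightarrow> R x z"
    and loc: "\<And>a. a \<in> S \<Longrightarrow> \<exists>d>0. \<forall>x\<in>S. \<bar>x - a\<bar> < d \<longrightarrow> R a x"
  shows "R a b"
proof (rule connected_equivalence_relation[OF assms(1-3)])
  fix a assume "a \<in> S"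
  then obtain d where d: "d > 0" "\<forall>x\<in>S. \<bar>x - a\<bar> < d \<longrightarrow> R a x" using loc by blast
  show "\<exists>T. openin (top_of_set S) T \<and> a \<in> T \<and> (\<forall>x\<in>T. R a x)"
    by (rule exI[of _ "S \<inter> ball a d"])
      (use d \<open>a \<in> S\<close> in \<open>auto simp: openin_open_Int dist_real_def abs_minus_commute\<close>)
qed (use assms in blast)+

text \<open>Agreement spreads by \<open>flow_germ\<close>, disagreement by the Hausdorff property.
  Comparing truth values treats both in one connectedness argument.\<close>

lemma flow_line_unique:
  assumes "flow_line I \<gamma>" "flow_line I' \<gamma>'" "t0 \<in> I" "t0 \<in> I'" "\<gamma> t0 = \<gamma>' t0" "t \<in> I" "t \<in> I'"
  shows "\<gamma> t = \<gamma>' t"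
proof -
  have con: "connected (I \<inter> I')"
    using assms(1,2) by (simp add: flow_line_def is_interval_Int is_interval_connected)
  have "(\<gamma> t0 = \<gamma>' t0) = (\<gamma> t = \<gamma>' t)"
  proof (rule connected_relation_real[OF con, where R = "\<lambda>s s'. (\<gamma> s = \<gamma>' s) = (\<gamma> s' = \<gamma>' s')"])
    fix a assume a: "a \<in> I \<inter> I'"
    show "\<exists>d>0. \<forall>x\<in>I \<inter> I'. \<bar>x - a\<bar> < d \<longrightarrow> (\<gamma> a = \<gamma>' a) = (\<gamma> x = \<gamma>' x)"
    proof (cases "\<gamma> a = \<gamma>' a")
      case True
      then show ?thesis using flow_germ[OF assms(1,2), of a] a by blast
    next
      case False
      have "\<gamma> a \<in> points M" "\<gamma>' a \<in> points M" using flow_line_points assms(1,2) a by blast+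
      then obtain U V where UV: "openin (mtop M) U" "openin (mtop M) V" "\<gamma> a \<in> U" "\<gamma>' a \<in> V" "disjnt U V"
        using smooth_manifoldD(1)[OF sm] False unfolding Hausdorff_space_def by metis
      obtain d where d: "d > 0" "\<And>s. \<bar>s - a\<bar> < d \<Longrightarrow> \<gamma> s \<in> U" using flow_line_open[OF assms(1) _ UV(1,3)] a by blast
      obtain d' where d': "d' > 0" "\<And>s. \<bar>s - a\<bar> < d' \<Longrightarrow> \<gamma>' s \<in> V" using flow_line_open[OF assms(2) _ UV(2,4)] a by blast
      have "\<gamma> x \<noteq> \<gamma>' x" if "\<bar>x - a\<bar> < min d d'" for x
        using d(2)[of x] d'(2)[of x] that UV(5) by (auto simp: disjnt_iff)
      moreover have "min d d' > 0" using d d' by simp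
      ultimately show ?thesis using False by blast
    qed
  qed (use assms in auto)
  then show ?thesis using assms(5) by simp
qed

lemma follows_eventually_cong:
  assumes "follows c \<gamma> t" "d > 0" "\<And>s. \<bar>s - t\<bar> < d \<Longrightarrow> \<gamma>' s = \<gamma> s"
  shows "follows c \<gamma>' t"
proof -
  obtain r where r: "r > 0" "\<And>s. \<bar>s - t\<bar> < r \<Longrightarrow> \<gamma> s \<in> fst c \<and> snd c (\<gamma> s) = snd c (\<gamma> t) + (0, s - t)"
    using assms(1) unfolding follows_def by blast
  have "\<gamma>' t = \<gamma> t" using assms(2,3) by simp
  show ?thesis
  proof (rule followsI)
    show "\<gamma>' t \<in> fst c" using \<open>\<gamma>' t = \<gamma> t\<close> assms(1) by (simp add: follows_def)
    show "min d r > 0" using assms(2) r(1) by simp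
    show "\<gamma>' s \<in> fst c \<and> snd c (\<gamma>' s) = snd c (\<gamma>' t) + (0, s - t)" if "\<bar>s - t\<bar> < min d r" for s
      using r(2)[of s] assms(3)[of s] that \<open>\<gamma>' t = \<gamma> t\<close> by simp
  qed
qed

lemma flow_line_shift:
  assumes "flow_line I \<gamma>" shows "flow_line {s. s + a \<in> I} (\<lambda>s. \<gamma> (s + a))"
  unfolding flow_line_def
proof (intro conjI ballI)
  have "open ((\<lambda>s. s + a) -` I)"
    by (rule open_vimage) (use assms in \<open>auto simp: flow_line_def intro!: continuous_intros\<close>)
  then show "open {s. s + a \<in> I}" by (simp add: vimage_def)
  show "is_interval {s. s + a \<in> I}"
    using assms unfolding flow_line_def is_interval_1 by (metis add_le_cancel_right mem_Collect_eq)
  fix t assume "t \<in> {s. s + a \<in> I}"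
  then obtain c where c: "straight c" "follows c \<gamma> (t + a)" using assms unfolding flow_line_def by blast
  obtain r where r: "r > 0" "\<And>s. \<bar>s - (t + a)\<bar> < r \<Longrightarrow> \<gamma> s \<in> fst c \<and> snd c (\<gamma> s) = snd c (\<gamma> (t + a)) + (0, s - (t + a))"
    using c(2) unfolding follows_def by blast
  have "\<gamma> (s + a) \<in> fst c \<and> snd c (\<gamma> (s + a)) = snd c (\<gamma> (t + a)) + (0, s - t)" if "\<bar>s - t\<bar> < r" for s
    using r(2)[of "s + a"] that by simp
  moreover have "\<gamma> (t + a) \<in> fst c" using c(2) by (simp add: follows_def)
  ultimately have "follows c (\<lambda>s. \<gamma> (s + a)) t" using followsI[of "\<lambda>s. \<gamma> (s + a)" t c r] r(1) by blast
  then show "\<exists>c. straight c \<and> follows c (\<lambda>s. \<gamma> (s + a)) t" using c(1) by blast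
qed

lemma flow_line_glue:
  assumes "flow_line I \<gamma>" "flow_line I' \<gamma>'" "t0 \<in> I" "t0 \<in> I'" "\<gamma> t0 = \<gamma>' t0"
  shows "flow_line (I \<union> I') (\<lambda>t. if t \<in> I then \<gamma> t else \<gamma>' t)"
  unfolding flow_line_def
proof (intro conjI ballI)
  let ?\<delta> = "\<lambda>t. if t \<in> I then \<gamma> t else \<gamma>' t"
  show "open (I \<union> I')" using assms by (auto simp: flow_line_def)
  show "is_interval (I \<union> I')"
    using assms connected_Un[of I I'] by (auto simp: flow_line_def is_interval_connected_1)
  fix t assume "t \<in> I \<union> I'"
  then consider "t \<in> I" | "t \<in> I'" by blast
  then show "\<exists>c. straight c \<and> follows c ?\<delta> t"
  proof cases
    case 1
    then obtain c where c: "straight c" "follows c \<gamma> t" using assms(1) unfolding flow_line_def by blast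
    obtain d where "d > 0" "\<And>s. \<bar>s - t\<bar> < d \<Longrightarrow> s \<in> I"
      using assms(1) 1 unfolding flow_line_def open_dist dist_real_def by blast
    then have "follows c ?\<delta> t" using follows_eventually_cong[OF c(2), of d ?\<delta>] by presburger
    then show ?thesis using c(1) by blast
  next
    case 2
    then obtain c where c: "straight c" "follows c \<gamma>' t" using assms(2) unfolding flow_line_def by blast
    obtain d where d: "d > 0" "\<And>s. \<bar>s - t\<bar> < d \<Longrightarrow> s \<in> I'"
      using assms(2) 2 unfolding flow_line_def open_dist dist_real_def by blast
    have "?\<delta> s = \<gamma>' s" if "\<bar>s - t\<bar> < d" for s
      using flow_line_unique[OF assms, of s] d(2)[OF that] by simp
    then have "follows c ?\<delta> t" by (rule follows_eventually_cong[OF c(2) d(1)])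
    then show ?thesis using c(1) by blast
  qed
qed

text \<open>The graph of the partial flow: \<open>q\<close> is the point reached from
  \<open>p\<close> in time \<open>t\<close>, negative times included. As a relation it needs no
  maximal curve, and the group laws come from shifting and gluing.\<close>

definition reach :: "'a \<Rightarrow> real \<Rightarrow> 'a \<Rightarrow> bool" where
  "reach p t q \<longleftrightarrow> (\<exists>I \<gamma>. flow_line I \<gamma> \<and> 0 \<in> I \<and> t \<in> I \<and> \<gamma> 0 = p \<and> \<gamma> t = q)"

lemma reach_unique: "reach p t q \<Longrightarrow> reach p t q' \<Longrightarrow> q = q'"
  unfolding reach_def
proof (elim exE conjE)
  fix I \<gamma> I' \<gamma>'
  assume "flow_line I \<gamma>" "0 \<in> I" "t \<in> I" "\<gamma> 0 = p" "\<gamma> t = q" "flow_line I' \<gamma>'" "0 \<in> I'" "t \<in> I'" "\<gamma>' 0 = p" "\<gamma>' t = q'"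
  then show "q = q'" using flow_line_unique[of I \<gamma> I' \<gamma>' 0 t] by simp
qed

lemma reach_points: "reach p t q \<Longrightarrow> p \<in> points M \<and> q \<in> points M"
  unfolding reach_def using flow_line_points by blast

lemma reach_sym: assumes "reach p t q" shows "reach q (- t) p"
proof -
  obtain I \<gamma> where *: "flow_line I \<gamma>" "0 \<in> I" "t \<in> I" "\<gamma> 0 = p" "\<gamma> t = q" using assms unfolding reach_def by blast
  show ?thesis unfolding reach_def
    by (rule exI[of _ "{s. s + t \<in> I}"], rule exI[of _ "\<lambda>s. \<gamma> (s + t)"]) (use * flow_line_shift in auto)
qed

lemma reach_trans: assumes "reach p t q" "reach q s r" shows "reach p (t + s) r"
proof -
  obtain I \<gamma> where 1: "flow_line I \<gamma>" "0 \<in> I" "t \<in> I" "\<gamma> 0 = p" "\<gamma> t = q" using assms(1) unfolding reach_def by blast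
  obtain I' \<gamma>' where 2: "flow_line I' \<gamma>'" "0 \<in> I'" "s \<in> I'" "\<gamma>' 0 = q" "\<gamma>' s = r" using assms(2) unfolding reach_def by blast
  let ?I = "{u. u + (- t) \<in> I'}" and ?g = "\<lambda>u. \<gamma>' (u + (- t))"
  have 3: "flow_line ?I ?g" by (rule flow_line_shift[OF 2(1)])
  have m: "t \<in> ?I" "t + s \<in> ?I" "\<gamma> t = ?g t" using 1 2 by auto
  have "(if t + s \<in> I then \<gamma> (t + s) else ?g (t + s)) = r"
    using flow_line_unique[OF 1(1) 3 1(3) m(1,3), of "t + s"] m(2) 2(5) by simp
  then show ?thesis unfolding reach_def
    by (intro exI[of _ "I \<union> ?I"] exI[of _ "\<lambda>u. if u \<in> I then \<gamma> u else ?g u"] conjI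
        flow_line_glue[OF 1(1) 3 1(3) m(1,3)]) (use 1 m in auto)
qed

lemma plaque_flow_line:
  assumes c: "straight c" "p \<in> fst c" and e: "snd c ` fst c = square e"
  defines "I \<equiv> {s. snd (snd c p) + s \<in> {-e<..<e}}"
  defines "\<gamma> \<equiv> \<lambda>s. inv_chart c (snd c p + (0, s))"
  shows "flow_line I \<gamma>" "0 \<in> I" "\<gamma> 0 = p"
    "\<And>s. s \<in> I \<Longrightarrow> \<gamma> s \<in> fst c \<and> snd c (\<gamma> s) = snd c p + (0, s)"
proof -
  note cc = straightD(2)[OF c(1)]
  have p: "snd c p \<in> square e" using c(2) e by blast
  show \<gamma>: "\<gamma> s \<in> fst c \<and> snd c (\<gamma> s) = snd c p + (0, s)" if "s \<in> I" for s
  proof -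
    have "snd c p + (0, s) \<in> snd c ` fst c" unfolding e using that p by (auto simp: I_def mem_Times_iff)
    then show ?thesis unfolding \<gamma>_def using chart_inv(2,3)[OF cc] by blast
  qed
  show "0 \<in> I" using p by (auto simp: I_def mem_Times_iff)
  show "\<gamma> 0 = p" unfolding \<gamma>_def using chart_inv(1)[OF cc c(2)] by (simp add: zero_prod_def[symmetric])
  have Ieq: "I = {-e - snd (snd c p)<..<e - snd (snd c p)}" by (auto simp: I_def)
  show "flow_line I \<gamma>" unfolding flow_line_def
  proof (intro conjI ballI)
    show "open I" "is_interval I" unfolding Ieq by auto
    fix t assume t: "t \<in> I"
    have "open I" unfolding Ieq by auto
    then obtain d where d: "d > 0" "\<And>s. \<bar>s - t\<bar> < d \<Longrightarrow> s \<in> I" using t unfolding open_dist dist_real_def by blast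
    have "follows c \<gamma> t"
    proof (rule followsI[OF _ d(1)])
      show "\<gamma> s \<in> fst c \<and> snd c (\<gamma> s) = snd c (\<gamma> t) + (0, s - t)" if "\<bar>s - t\<bar> < d" for s
        using \<gamma>[OF t] \<gamma>[OF d(2)[OF that]] by (simp add: prod_eq_iff)
    qed (use \<gamma>[OF t] in blast)
    then show "\<exists>c. straight c \<and> follows c \<gamma> t" using c(1) by blast
  qed
qed

text \<open>Vertical motion stays within the square, so the flow time between two points of a plaque
  is their difference in height.\<close>

lemma plaque_reach:
  assumes "straight c" "p \<in> fst c" "q \<in> fst c" "fst (snd c p) = fst (snd c q)"
  shows "reach p (snd (snd c q) - snd (snd c p)) q"
proof -
  obtain e where "e > 0" and e: "snd c ` fst c = square e" by (rule straight_square[OF assms(1)])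
  note fl = plaque_flow_line[OF assms(1,2) e]
  let ?s = "snd (snd c q) - snd (snd c p)"
  have "snd c q \<in> square e" using assms(3) e by blast
  then have s: "?s \<in> {s. snd (snd c p) + s \<in> {-e<..<e}}" by (auto simp: mem_Times_iff)
  have "snd c p + (0, ?s) = snd c q" using assms(4) by (simp add: prod_eq_iff)
  then have "inv_chart c (snd c p + (0, ?s)) = q" using chart_inv(1)[OF straightD(2)[OF assms(1)] assms(3)] by simp
  then show ?thesis unfolding reach_def using fl(1-3) s by blast
qed

lemma reach_refl: assumes "p \<in> points M" shows "reach p 0 p"
proof -
  have "openin (mtop M) (points M)" by simp
  then obtain c where "straight c" "p \<in> fst c" by (rule straight_exists[OF _ assms]) 
  from plaque_reach[OF this this(2)] show ?thesis by simp
qed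

text \<open>Induction along a leaf: an orbit is covered by plaques that overlap along the curve, so
  a leafwise property need only be transported within one straight chart.\<close>

lemma leaf_induct:
  assumes "reach p t q"
    and step: "\<And>c x y. straight c \<Longrightarrow> x \<in> fst c \<Longrightarrow> y \<in> fst c \<Longrightarrow> fst (snd c x) = fst (snd c y) \<Longrightarrow> P x \<Longrightarrow> P y"
    and "P p"
  shows "P q"
proof -
  obtain I \<gamma> where *: "flow_line I \<gamma>" "0 \<in> I" "t \<in> I" "\<gamma> 0 = p" "\<gamma> t = q" using assms(1) unfolding reach_def by blast
  have con: "connected I" using *(1) by (simp add: flow_line_def is_interval_connected)
  have "P (\<gamma> 0) = P (\<gamma> t)"
  proof (rule connected_relation_real[OF con *(2,3), where R = "\<lambda>s s'. P (\<gamma> s) = P (\<gamma> s')"])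
    fix a assume "a \<in> I"
    then obtain c where c: "straight c" "follows c \<gamma> a" using *(1) unfolding flow_line_def by blast
    obtain r where r: "r > 0" "\<And>s. \<bar>s - a\<bar> < r \<Longrightarrow> \<gamma> s \<in> fst c \<and> snd c (\<gamma> s) = snd c (\<gamma> a) + (0, s - a)"
      and ca: "\<gamma> a \<in> fst c" using c(2) unfolding follows_def by blast
    have "P (\<gamma> a) = P (\<gamma> x)" if "\<bar>x - a\<bar> < r" for x
    proof -
      have "\<gamma> x \<in> fst c" "fst (snd c (\<gamma> x)) = fst (snd c (\<gamma> a))" using r(2)[OF that] by auto
      then show ?thesis using step[OF c(1) ca, of "\<gamma> x"] step[OF c(1) _ ca, of "\<gamma> x"] by auto
    qed
    then show "\<exists>d>0. \<forall>x\<in>I. \<bar>x - a\<bar> < d \<longrightarrow> P (\<gamma> a) = P (\<gamma> x)" using r(1) by blast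
  qed auto
  then show ?thesis using * assms(3) by simp
qed

subsection \<open>Flow lines are right-moving curves\<close>

text \<open>The factor \<open>k\<close> rescales time, since \<open>chi\<close> wants curves on the
  unit interval. The representative \<open>h\<close> lives on an open neighbourhood of
  \<open>t\<close>, which also serves end points of the interval.\<close>

lemma flow_line_coordinates:
  assumes fl: "flow_line I \<gamma>" and t: "k * t \<in> I" and c: "c \<in> atlas M" "\<gamma> (k * t) \<in> fst c"
  obtains J h where "open J" "t \<in> J" "smooth_on J h" "\<And>s. s \<in> J \<Longrightarrow> \<gamma> (k * s) \<in> fst c \<and> snd c (\<gamma> (k * s)) = h s"
    "(h has_vector_derivative k *\<^sub>R null_field c (\<gamma> (k * t))) (at t)"
proof -
  obtain d where d: "straight d" "follows d \<gamma> (k * t)" using fl t unfolding flow_line_def by blast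
  note dD = straightD[OF d(1)]
  let ?q = "\<gamma> (k * t)"
  have qd: "?q \<in> fst d" using d(2) by (simp add: follows_def)
  obtain r where r: "r > 0" "\<And>s. \<bar>s - k * t\<bar> < r \<Longrightarrow> \<gamma> s \<in> fst d \<and> snd d (\<gamma> s) = snd d ?q + (0, s - k * t)"
    using d(2) unfolding follows_def by blast
  obtain r2 where r2: "r2 > 0" "\<And>s. \<bar>s - k * t\<bar> < r2 \<Longrightarrow> \<gamma> s \<in> fst c"
    using flow_line_open[OF fl t is_chartD(1)[OF smooth_manifoldD(3)[OF sm c(1)]] c(2)] by blast
  let ?S = "snd d ` (fst d \<inter> fst c)"
  note S = transition_smooth[OF sm dD(1) c(1)]
  let ?l = "\<lambda>s. snd d ?q + (0, k * s - k * t)"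
  define h where "h s = local_rep d c (\<lambda>p. p) (?l s)" for s
  have l: "smooth_on UNIV ?l"
    by (intro smooth_on_add smooth_on_const smooth_on_Pair smooth_on_diff open_UNIV smooth_on_mult smooth_on_id)
  \<comment> \<open>The radius ensures \<open>\<bar>k * s - k * t\<bar> < min r r2\<close>; the
    added 1 avoids a zero denominator when \<open>k = 0\<close>.\<close>
  define J where "J = {s \<in> UNIV. ?l s \<in> ?S} \<inter> ball t (min r r2 / (\<bar>k\<bar> + 1))"
  have "open {s \<in> UNIV. ?l s \<in> ?S}" by (rule open_preimage_smooth[OF open_UNIV l S(2)])
  then have J: "open J" unfolding J_def by auto
  have "?l t = snd d ?q" by (simp add: zero_prod_def[symmetric])
  then have tJ: "t \<in> J" using qd c(2) r(1) r2(1) unfolding J_def by auto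
  have hs: "smooth_on J h" unfolding h_def
    by (rule smooth_on_compose[OF J S(2) smooth_on_subset[OF l] S(1)]) (auto simp: J_def)
  have eq: "\<gamma> (k * s) \<in> fst c \<and> snd c (\<gamma> (k * s)) = h s" if s: "s \<in> J" for s
  proof -
    have "\<bar>k * s - k * t\<bar> = \<bar>k\<bar> * \<bar>s - t\<bar>" by (simp add: abs_mult[symmetric] algebra_simps)
    also have "\<dots> \<le> (\<bar>k\<bar> + 1) * \<bar>s - t\<bar>" by (intro mult_right_mono) auto
    also have "\<dots> < min r r2"
      using s by (simp add: J_def dist_real_def abs_minus_commute pos_less_divide_eq mult.commute)
    finally have "\<bar>k * s - k * t\<bar> < r" "\<bar>k * s - k * t\<bar> < r2" by auto
    then show ?thesis using r(2)[of "k * s"] r2(2)[of "k * s"] chart_inv(1)[OF dD(2), of "\<gamma> (k * s)"]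
      by (auto simp: h_def local_rep_def)
  qed
  have "(?l has_derivative (\<lambda>u. (0, k * u))) (at t)" by (auto intro!: derivative_eq_intros)
  moreover have D: "(local_rep d c (\<lambda>p. p) has_derivative mdiff d c (\<lambda>q. q) ?q) (at (?l t))"
    unfolding \<open>?l t = snd d ?q\<close> mdiff_def by (rule smooth_on_has_derivative[OF S]) (use qd c(2) in blast)
  ultimately have 1: "(h has_derivative (\<lambda>u. mdiff d c (\<lambda>q. q) ?q (0, k * u))) (at t)"
    unfolding h_def[abs_def] using diff_chain_at by (fastforce simp: o_def)
  have "mdiff d c (\<lambda>q. q) ?q (0, k * u) = u *\<^sub>R k *\<^sub>R null_field c ?q" for u
  proof -
    have "mdiff d c (\<lambda>q. q) ?q (0, 1) = null_field c ?q"
      using null_field_transform[OF dD(1) c(1) qd c(2)] dD(4)[OF qd] by simp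
    moreover have "mdiff d c (\<lambda>q. q) ?q (0, k * u) = (k * u) *\<^sub>R mdiff d c (\<lambda>q. q) ?q (0, 1)"
      using linear_scale[OF has_derivative_linear[OF D], of "k * u" "(0, 1)"] by simp
    ultimately show ?thesis by (simp add: mult.commute)
  qed
  with 1 have "(h has_vector_derivative k *\<^sub>R null_field c ?q) (at t)" by (simp add: has_vector_derivative_def)
  then show ?thesis using that J tJ hs eq by blast
qed

lemma flow_line_right_moving:
  assumes fl: "flow_line I \<gamma>" and k: "k > 0" and J: "proper_interval J" "\<And>s. s \<in> J \<Longrightarrow> k * s \<in> I"
  shows "right_moving_curve M J (\<lambda>s. \<gamma> (k * s))"
  unfolding right_moving_curve_def
proof (intro conjI J(1))
  show "smooth_curve M J (\<lambda>s. \<gamma> (k * s))" unfolding smooth_curve_def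
  proof (intro conjI ballI impI)
    show "(\<lambda>s. \<gamma> (k * s)) ` J \<subseteq> points M" using flow_line_points[OF fl] J(2) by blast
    fix t c assume t: "t \<in> J" "c \<in> atlas M" "\<gamma> (k * t) \<in> fst c"
    obtain U h where "open U" "t \<in> U" "smooth_on U h" "\<And>s. s \<in> U \<Longrightarrow> \<gamma> (k * s) \<in> fst c \<and> snd c (\<gamma> (k * s)) = h s"
      by (rule flow_line_coordinates[OF fl J(2)[OF t(1)] t(2,3)]) blast
    then show "\<exists>U h. open U \<and> t \<in> U \<and> (\<lambda>s. \<gamma> (k * s)) ` (J \<inter> U) \<subseteq> fst c \<and> smooth_on U h \<and>
        (\<forall>s\<in>J \<inter> U. snd c (\<gamma> (k * s)) = h s)"
      by (intro exI[of _ U] exI[of _ h]) auto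
  qed
  show "velocity_everywhere M (future_right_null M) J (\<lambda>s. \<gamma> (k * s))" unfolding velocity_everywhere_def
  proof (intro ballI impI)
    fix t c assume t: "t \<in> interior J" "c \<in> atlas M" "\<gamma> (k * t) \<in> fst c"
    then have "t \<in> J" using interior_subset by blast
    obtain U h where U: "open U" "t \<in> U" "\<And>s. s \<in> U \<Longrightarrow> \<gamma> (k * s) \<in> fst c \<and> snd c (\<gamma> (k * s)) = h s"
      "(h has_vector_derivative k *\<^sub>R null_field c (\<gamma> (k * t))) (at t)"
      by (rule flow_line_coordinates[OF fl J(2)[OF \<open>t \<in> J\<close>] t(2,3)]) blast
    have "(snd c \<circ> (\<lambda>s. \<gamma> (k * s)) has_vector_derivative k *\<^sub>R null_field c (\<gamma> (k * t))) (at t)"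
      by (rule has_vector_derivative_transform_within_open[OF U(4,1,2)]) (simp add: U(3))
    from vector_derivative_at[OF this]
    show "future_right_null M c (\<gamma> (k * t)) (vector_derivative (snd c \<circ> (\<lambda>s. \<gamma> (k * s))) (at t))"
      unfolding future_right_null_ray[OF t(2,3)] using k by auto
  qed
qed

text \<open>The velocity is a multiple of \<open>(0, 1)\<close> in a straight chart, so the
  horizontal coordinate is locally constant and the curve runs inside a plaque. Reparametrisation is
  thereby avoided: only the endpoints matter.\<close>

lemma right_moving_reach:
  assumes \<gamma>: "right_moving_curve M {0..1} \<gamma>"
  shows "\<exists>t. reach (\<gamma> 0) t (\<gamma> 1)"
proof -
  have sc: "smooth_curve M {0..1} \<gamma>" and ve: "velocity_everywhere M (future_right_null M) {0..1} \<gamma>"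
    using \<gamma> by (auto simp: right_moving_curve_def)
  have con: "connected {0..1::real}" by simp
  show ?thesis
  proof (rule connected_relation_real[OF con, where R = "\<lambda>s s'. \<exists>t. reach (\<gamma> s) t (\<gamma> s')"])
    fix a :: real assume a: "a \<in> {0..1}"
    then have "\<gamma> a \<in> points M" using sc by (auto simp: smooth_curve_def)
    then obtain c where c: "straight c" "\<gamma> a \<in> fst c" using straight_exists[OF openin_topspace] by blast
    note cD = straightD[OF c(1)]
    obtain J h where J: "open J" "a \<in> J" "\<gamma> ` ({0..1} \<inter> J) \<subseteq> fst c" "smooth_on J h" "\<And>s. s \<in> {0..1} \<inter> J \<Longrightarrow> snd c (\<gamma> s) = h s"
    proof -
      have "\<forall>t\<in>{0..1}. \<forall>c\<in>atlas M. \<gamma> t \<in> fst c \<longrightarrow> (\<exists>J h. open J \<and> t \<in> J \<and> \<gamma> ` ({0..1} \<inter> J) \<subseteq> fst c \<and>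
          smooth_on J h \<and> (\<forall>s\<in>{0..1} \<inter> J. snd c (\<gamma> s) = h s))"
        using sc unfolding smooth_curve_def by (rule conjunct2)
      from this[rule_format, OF a cD(1) c(2)] show ?thesis using that by (elim exE conjE) auto
    qed
    obtain r where r: "r > 0" "ball a r \<subseteq> J" using open_contains_ball[THEN iffD1, OF J(1)] J(2) by blast
    let ?K = "{0..1} \<inter> ball a r"
    have "fst (h x) = fst (h a)" if x: "x \<in> ?K" for x
    \<comment> \<open>The velocity condition speaks of interior parameters only; the end points 0
      and 1 form the exceptional set, where continuity is enough.\<close>
    proof (rule has_derivative_zero_unique_strong_convex[where S = ?K and K = "{0, 1}" and c = a
          and f = "\<lambda>x. fst (h x)"])
      show "continuous_on ?K (\<lambda>x. fst (h x))"
      proof (rule continuous_on_fst[OF continuous_on_subset[OF smooth_on_imp_continuous_on[OF J(4)]]])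
        show "?K \<subseteq> J" using r(2) by blast
      qed
      fix y assume y: "y \<in> ?K - {0, 1}"
      then have yJ: "y \<in> J" and y01: "y \<in> {0<..<1}" using r(2) by auto
      let ?V = "J \<inter> {0<..<1}"
      have hd: "(h has_derivative frechet_derivative h (at y)) (at y)" by (rule smooth_on_has_derivative[OF J(4,1) yJ])
      have "frechet_derivative h (at y) = (\<lambda>u. u *\<^sub>R frechet_derivative h (at y) 1)"
      proof
        show "frechet_derivative h (at y) u = u *\<^sub>R frechet_derivative h (at y) 1" for u
          using linear_scale[OF has_derivative_linear[OF hd], of u 1] by simp
      qed
      from has_derivative_eq_rhs[OF hd this]
      have hv: "(h has_vector_derivative frechet_derivative h (at y) 1) (at y)"
        unfolding has_vector_derivative_def .
      have "(snd c \<circ> \<gamma> has_vector_derivative frechet_derivative h (at y) 1) (at y)"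
        by (rule has_vector_derivative_transform_within_open[OF hv, of ?V]) (use J yJ y01 in auto)
      from vector_derivative_at[OF this]
      have v: "vector_derivative (snd c \<circ> \<gamma>) (at y) = frechet_derivative h (at y) 1" .
      have yc: "\<gamma> y \<in> fst c" using J(3) yJ y01 by auto
      have "future_right_null M c (\<gamma> y) (vector_derivative (snd c \<circ> \<gamma>) (at y))"
        using ve y01 yc cD(1) unfolding velocity_everywhere_def by simp
      then obtain k where "frechet_derivative h (at y) 1 = k *\<^sub>R null_field c (\<gamma> y)"
        unfolding v future_right_null_ray[OF cD(1) yc] by blast
      then have 0: "fst (frechet_derivative h (at y) 1) = 0" using cD(4)[OF yc] by simp
      have "((\<lambda>x. fst (h x)) has_vector_derivative fst (frechet_derivative h (at y) 1)) (at y)"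
        by (rule bounded_linear.has_vector_derivative[OF bounded_linear_fst hv])
      then show "((\<lambda>x. fst (h x)) has_derivative (\<lambda>h. 0)) (at y within ?K)"
        unfolding 0 has_vector_derivative_def using has_derivative_at_withinI by force
    qed (use x a r in \<open>auto intro: convex_Int\<close>)
    note const = this
    have "\<exists>t. reach (\<gamma> a) t (\<gamma> x)" if x: "x \<in> {0..1}" "\<bar>x - a\<bar> < r" for x
    proof -
      have xK: "x \<in> ?K" using x by (simp add: dist_real_def abs_minus_commute)
      then have xJ: "x \<in> {0..1} \<inter> J" using r(2) by blast
      have "a \<in> {0..1} \<inter> J" using a J(2) by blast
      then have "fst (snd c (\<gamma> a)) = fst (snd c (\<gamma> x))" using const[OF xK] J(5)[OF xJ] J(5)[of a] by simp
      moreover have "\<gamma> x \<in> fst c" using J(3) xJ by blast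
      ultimately show ?thesis using plaque_reach[OF c] by blast
    qed
    then show "\<exists>d>0. \<forall>x\<in>{0..1}. \<bar>x - a\<bar> < d \<longrightarrow> (\<exists>t. reach (\<gamma> a) t (\<gamma> x))" using r(1) by blast
  qed (use reach_sym reach_trans in \<open>auto, blast+\<close>)
qed

text \<open>The sign of the flow time decides between \<open>chi M\<close> and its converse, and
  time zero is the reflexive case. Rescaling by \<open>t\<close> brings the curve to the unit
  interval.\<close>

lemma schi_iff: "(p, q) \<in> schi M \<longleftrightarrow> (\<exists>t. reach p t q)"
proof
  have *: "\<exists>t. reach p t q" if pq: "(p, q) \<in> chi M" for p q
    using pq reach_refl right_moving_reach by (auto simp: chi_def)
  show "\<exists>t. reach p t q" if pq: "(p, q) \<in> schi M"
  proof -
    consider "(p, q) \<in> chi M" | "(q, p) \<in> chi M" using pq by (auto simp: schi_def)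
    then show ?thesis
    proof cases
      case 2
      from *[OF this] obtain t where "reach q t p" by blast
      from reach_sym[OF this] show ?thesis by blast
    qed (rule *)
  qed
  have pos: "(p, q) \<in> chi M" if pq: "reach p t q" "t \<ge> 0" for p q t
  proof (cases "t = 0")
    case True
    then show ?thesis using reach_unique[OF pq(1), of p] reach_refl reach_points[OF pq(1)] by (auto simp: chi_def)
  next
    case False
    then have t: "t > 0" using pq by simp
    obtain I \<gamma> where *: "flow_line I \<gamma>" "0 \<in> I" "t \<in> I" "\<gamma> 0 = p" "\<gamma> t = q" using pq(1) unfolding reach_def by blast
    have "proper_interval {0..1::real}" by (simp add: proper_interval_def is_interval_cc)
    moreover have "t * s \<in> I" if "s \<in> {0..1}" for s
    proof -
      have "is_interval I" using *(1) by (simp add: flow_line_def)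
      moreover have "0 \<le> t * s" "t * s \<le> t" using that t by (auto intro: mult_left_le)
      ultimately show ?thesis using *(2,3) unfolding is_interval_1 by blast
    qed
    ultimately have "right_moving_curve M {0..1} (\<lambda>s. \<gamma> (t * s))" by (rule flow_line_right_moving[OF *(1) t])
    then show ?thesis using * reach_points[OF pq(1)] unfolding chi_def by fastforce
  qed
  show "(p, q) \<in> schi M" if ex: "\<exists>t. reach p t q"
  proof -
    obtain t where t: "reach p t q" using ex by blast
    show ?thesis
    proof (cases "t \<ge> 0")
      case True
      then show ?thesis using pos[OF t] by (simp add: schi_def)
    next
      case False
      then show ?thesis using pos[OF reach_sym[OF t]] by (simp add: schi_def)
    qed
  qed
qed

lemma schi_equiv: "equiv (points M) (schi M)"
proof (rule equivI)
  show "schi M \<subseteq> points M \<times> points M" using schi_iff reach_points by auto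
  show "refl_on (points M) (schi M)" using schi_iff reach_refl reach_points by (auto intro!: refl_onI)
  show "sym (schi M)"
  proof (rule symI)
    fix x y assume "(x, y) \<in> schi M"
    then obtain t where "reach x t y" unfolding schi_iff by blast
    then show "(y, x) \<in> schi M" unfolding schi_iff using reach_sym by blast
  qed
  show "trans (schi M)"
  proof (rule transI)
    fix x y z assume "(x, y) \<in> schi M" "(y, z) \<in> schi M"
    then obtain t s where "reach x t y" "reach y s z" unfolding schi_iff by blast
    then show "(x, z) \<in> schi M" unfolding schi_iff using reach_trans by blast
  qed
qed

subsection \<open>Maximal flow lines\<close>

definition flow_dom :: "'a \<Rightarrow> real set" where "flow_dom p = {t. \<exists>q. reach p t q}"
definition flow :: "'a \<Rightarrow> real \<Rightarrow> 'a" where "flow p t = (THE q. reach p t q)"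

lemma flow_eqI: "reach p t q \<Longrightarrow> flow p t = q"
  unfolding flow_def using reach_unique by blast

lemma flow_reach: "t \<in> flow_dom p \<Longrightarrow> reach p t (flow p t)"
  unfolding flow_dom_def using flow_eqI by auto

text \<open>By uniqueness all flow lines through \<open>p\<close> agree where they overlap, so their
  union is again a flow line, the maximal one.\<close>

lemma flow_line_flow: "flow_line (flow_dom p) (flow p)"
proof -
  have sub: "I \<subseteq> flow_dom p" "\<And>t. t \<in> I \<Longrightarrow> flow p t = \<gamma> t" if "flow_line I \<gamma>" "0 \<in> I" "\<gamma> 0 = p" for I \<gamma>
  proof -
    have "reach p t (\<gamma> t)" if "t \<in> I" for t
      unfolding reach_def using that \<open>flow_line I \<gamma>\<close> \<open>0 \<in> I\<close> \<open>\<gamma> 0 = p\<close> by blast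
    then show "I \<subseteq> flow_dom p" "\<And>t. t \<in> I \<Longrightarrow> flow p t = \<gamma> t" using flow_eqI by (auto simp: flow_dom_def)
  qed
  have ex: "\<exists>I \<gamma>. flow_line I \<gamma> \<and> 0 \<in> I \<and> t \<in> I \<and> \<gamma> 0 = p" if "t \<in> flow_dom p" for t
    using that unfolding flow_dom_def reach_def by blast
  have nbd: "\<exists>I \<gamma> d. flow_line I \<gamma> \<and> 0 \<in> I \<and> t \<in> I \<and> \<gamma> 0 = p \<and> d > 0 \<and> (\<forall>s. \<bar>s - t\<bar> < d \<longrightarrow> s \<in> I)"
    if t: "t \<in> flow_dom p" for t
  proof -
    obtain I \<gamma> where I: "flow_line I \<gamma>" "0 \<in> I" "t \<in> I" "\<gamma> 0 = p" using ex[OF t] by blast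
    then obtain d where "d > 0" "\<forall>s. \<bar>s - t\<bar> < d \<longrightarrow> s \<in> I"
      unfolding flow_line_def open_dist dist_real_def by blast
    with I show ?thesis by blast
  qed
  show ?thesis unfolding flow_line_def
  proof (intro conjI ballI)
    show "open (flow_dom p)" unfolding open_dist dist_real_def
      using nbd sub(1) by (metis subsetD)
    show "is_interval (flow_dom p)" unfolding is_interval_1
    proof (intro ballI allI impI)
      fix a b x assume ab: "a \<in> flow_dom p" "b \<in> flow_dom p" "a \<le> x \<and> x \<le> b"
      obtain I \<gamma> where I: "flow_line I \<gamma>" "0 \<in> I" "a \<in> I" "\<gamma> 0 = p" using ex[OF ab(1)] by blast
      obtain I' \<gamma>' where I': "flow_line I' \<gamma>'" "0 \<in> I'" "b \<in> I'" "\<gamma>' 0 = p" using ex[OF ab(2)] by blast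
      have "x \<in> I \<or> x \<in> I'"
        using I(1-3) I'(1-3) ab(3) unfolding flow_line_def is_interval_1 by (meson linear)
      then show "x \<in> flow_dom p" using sub(1)[OF I(1,2,4)] sub(1)[OF I'(1,2,4)] by blast
    qed
    fix t assume "t \<in> flow_dom p"
    then obtain I \<gamma> d where I: "flow_line I \<gamma>" "0 \<in> I" "t \<in> I" "\<gamma> 0 = p" "d > 0" "\<forall>s. \<bar>s - t\<bar> < d \<longrightarrow> s \<in> I"
      using nbd by blast
    obtain c where c: "straight c" "follows c \<gamma> t" using I(1,3) unfolding flow_line_def by blast
    have "follows c (flow p) t"
      by (rule follows_eventually_cong[OF c(2) I(5)]) (use sub(2)[OF I(1,2,4)] I(6) in blast)
    then show "\<exists>c. straight c \<and> follows c (flow p) t" using c(1) by blast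
  qed
qed

text \<open>Near a limit point the flow line would run through a straight chart from bottom to top, hence leave
  every smaller neighbourhood of that point again.\<close>

lemma flow_no_limit:
  assumes sg: "\<sigma> = 1 \<or> \<sigma> = -1" and q: "q \<in> points M"
  shows "\<exists>U. openin (mtop M) U \<and> q \<in> U \<and>
    (\<forall>b\<in>flow_dom p. \<exists>t\<in>flow_dom p. \<sigma> * b \<le> \<sigma> * t \<and> flow p t \<notin> U)"
proof -
  obtain c where c: "straight c" "q \<in> fst c" "snd c q = (0, 0)" using straight_exists[OF openin_topspace q] by blast
  note cc = straightD(2)[OF c(1)]
  obtain e where e: "e > 0" "snd c ` fst c = square e" by (rule straight_square[OF c(1)])
  \<comment> \<open>From any point of the half square the flow continues inside the chart to height
    \<open>\<sigma> * (3 / 4 * e)\<close>, which lies outside \<open>U\<close>. The sign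
    \<open>\<sigma>\<close> selects the end of the curve.\<close>
  define U where "U = {x \<in> fst c. snd c x \<in> square (e / 2)}"
  have U: "openin (mtop M) U" unfolding U_def by (rule chart_open_preimage[OF cc open_square])
  have qU: "q \<in> U" using c e by (simp add: U_def)
  have "\<exists>t\<in>flow_dom p. \<sigma> * b \<le> \<sigma> * t \<and> flow p t \<notin> U" if b: "b \<in> flow_dom p" for b
  proof (cases "flow p b \<in> U")
    case False
    then show ?thesis using b by blast
  next
    case True
    let ?x = "flow p b"
    have x: "?x \<in> fst c" "snd c ?x \<in> square (e / 2)" using True by (auto simp: U_def)
    have "(fst (snd c ?x), \<sigma> * (3 / 4 * e)) \<in> square e" using x(2) sg e(1) by (auto simp: mem_Times_iff)
    then have "(fst (snd c ?x), \<sigma> * (3 / 4 * e)) \<in> snd c ` fst c" by (simp only: e(2))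
    then obtain y where y: "y \<in> fst c" "snd c y = (fst (snd c ?x), \<sigma> * (3 / 4 * e))" by (elim imageE) simp
    have r: "reach ?x (\<sigma> * (3 / 4 * e) - snd (snd c ?x)) y" using plaque_reach[OF c(1) x(1) y(1)] y(2) by simp
    let ?t = "b + (\<sigma> * (3 / 4 * e) - snd (snd c ?x))"
    have t: "reach p ?t y" by (rule reach_trans[OF flow_reach[OF b] r])
    have "y \<notin> U" using y sg e(1) by (auto simp: U_def)
    moreover have "\<sigma> * b \<le> \<sigma> * ?t" using sg x(2) by (auto simp: mem_Times_iff)
    ultimately show ?thesis using t flow_eqI[OF t] by (intro bexI[of _ ?t]) (auto simp: flow_dom_def)
  qed
  then show ?thesis using U qU by blast
qed

lemma flow_inextendable:
  assumes p: "p \<in> points M" shows "inextendable M (flow_dom p) (flow p)"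
proof -
  have 0: "0 \<in> flow_dom p" using reach_refl[OF p] by (auto simp: flow_dom_def)
  have op: "open (flow_dom p)" and iv: "is_interval (flow_dom p)" using flow_line_flow by (auto simp: flow_line_def)
  \<comment> \<open>A filter statement at the right end is turned into one about all parameters
    beyond some \<open>b\<close>, for bounded and unbounded domains alike; in the bounded case
    openness keeps the supremum out of the domain.\<close>
  have R: "\<exists>b\<in>flow_dom p. \<forall>t\<in>flow_dom p. b \<le> t \<longrightarrow> P t" if ev: "eventually P (to_right_end (flow_dom p))" for P
  proof (cases "bdd_above (flow_dom p)")
    case True
    let ?m = "Sup (flow_dom p)"
    have lt: "t < ?m" if t: "t \<in> flow_dom p" for t
    proof -
      obtain d where d: "d > 0" "\<forall>s. \<bar>s - t\<bar> < d \<longrightarrow> s \<in> flow_dom p" using open_real_nbhd[OF op t] by blast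
      have "\<bar>(t + d / 2) - t\<bar> < d" using d(1) by simp
      with d(2) have "t + d / 2 \<in> flow_dom p" by blast
      then have "t + d / 2 \<le> ?m" using True by (rule cSup_upper)
      then show ?thesis using d(1) by simp
    qed
    obtain a where a: "a < ?m" "\<And>t. a < t \<Longrightarrow> t < ?m \<Longrightarrow> P t"
      using ev True unfolding to_right_end_def by (auto simp: eventually_at_left_field)
    obtain b where b: "b \<in> flow_dom p" "a < b" using less_cSup_iff[of "flow_dom p" a] 0 True a(1) by blast
    then show ?thesis using a lt by (intro bexI[of _ b]) auto
  next
    case False
    have "\<exists>a. \<forall>t\<ge>a. P t" using ev False unfolding to_right_end_def by (simp add: eventually_at_top_linorder)
    then obtain a where a: "\<And>t. a \<le> t \<Longrightarrow> P t" by blast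
    obtain b where "b \<in> flow_dom p" "a \<le> b" using False unfolding bdd_above_def by (meson linear)
    then show ?thesis using a by (intro bexI[of _ b]) auto
  qed
  have L: "\<exists>b\<in>flow_dom p. \<forall>t\<in>flow_dom p. t \<le> b \<longrightarrow> P t" if ev: "eventually P (to_left_end (flow_dom p))" for P
  proof (cases "bdd_below (flow_dom p)")
    case True
    let ?m = "Inf (flow_dom p)"
    have lt: "?m < t" if t: "t \<in> flow_dom p" for t
    proof -
      obtain d where d: "d > 0" "\<forall>s. \<bar>s - t\<bar> < d \<longrightarrow> s \<in> flow_dom p" using open_real_nbhd[OF op t] by blast
      have "\<bar>(t - d / 2) - t\<bar> < d" using d(1) by simp
      with d(2) have "t - d / 2 \<in> flow_dom p" by blast
      then have "?m \<le> t - d / 2" using True by (rule cInf_lower)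
      then show ?thesis using d(1) by simp
    qed
    obtain a where a: "?m < a" "\<And>t. ?m < t \<Longrightarrow> t < a \<Longrightarrow> P t"
      using ev True unfolding to_left_end_def by (auto simp: eventually_at_right_field)
    obtain b where b: "b \<in> flow_dom p" "b < a" using cInf_less_iff[of "flow_dom p" a] 0 True a(1) by blast
    then show ?thesis using a lt by (intro bexI[of _ b]) auto
  next
    case False
    have "\<exists>a. \<forall>t\<le>a. P t" using ev False unfolding to_left_end_def by (simp add: eventually_at_bot_linorder)
    then obtain a where a: "\<And>t. t \<le> a \<Longrightarrow> P t" by blast
    obtain b where "b \<in> flow_dom p" "b \<le> a" using False unfolding bdd_below_def by (meson linear)
    then show ?thesis using a by (intro bexI[of _ b]) auto
  qed
  show ?thesis unfolding inextendable_def
  proof (intro conjI notI; elim exE)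
    fix q assume q: "limitin (mtop M) (flow p) q (to_left_end (flow_dom p))"
    then have "q \<in> points M" by (simp add: limitin_def)
    obtain U where U: "openin (mtop M) U" "q \<in> U" "\<forall>b\<in>flow_dom p. \<exists>t\<in>flow_dom p. (-1) * b \<le> (-1) * t \<and> flow p t \<notin> U"
      using flow_no_limit[of "-1", OF _ \<open>q \<in> points M\<close>, of p] by auto
    have "eventually (\<lambda>t. flow p t \<in> U) (to_left_end (flow_dom p))" using q U(1,2) by (simp add: limitin_def)
    from L[OF this] show False using U(3) by auto
  next
    fix q assume q: "limitin (mtop M) (flow p) q (to_right_end (flow_dom p))"
    then have "q \<in> points M" by (simp add: limitin_def)
    obtain U where U: "openin (mtop M) U" "q \<in> U" "\<forall>b\<in>flow_dom p. \<exists>t\<in>flow_dom p. 1 * b \<le> 1 * t \<and> flow p t \<notin> U"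
      using flow_no_limit[of 1, OF _ \<open>q \<in> points M\<close>, of p] by auto
    have "eventually (\<lambda>t. flow p t \<in> U) (to_right_end (flow_dom p))" using q U(1,2) by (simp add: limitin_def)
    from R[OF this] show False using U(3) by auto
  qed
qed

text \<open>The Cauchy property counts parameters of the maximal flow line. It becomes a statement
  about points because every point equivalent to \<open>p\<close> is \<open>flow p s\<close> for
  some \<open>s\<close>.\<close>

lemma cauchy_surface_meets:
  assumes S: "chi_cauchy_surface M S" and p: "p \<in> points M"
  shows "\<exists>!q. q \<in> S \<and> (p, q) \<in> schi M"
proof -
  have 0: "0 \<in> flow_dom p" using reach_refl[OF p] by (auto simp: flow_dom_def)
  have "open (flow_dom p)" "is_interval (flow_dom p)" using flow_line_flow by (auto simp: flow_line_def)
  then have "proper_interval (flow_dom p)" using 0 by (auto simp: proper_interval_def interior_open)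
  from flow_line_right_moving[OF flow_line_flow, of 1, OF _ this]
  have "right_chiral_curve M (flow_dom p) (flow p)" by (simp add: right_moving_curve_def right_chiral_curve_def)
  then have ex1: "\<exists>!t. t \<in> flow_dom p \<and> flow p t \<in> S"
    using S flow_inextendable[OF p] unfolding chi_cauchy_surface_def by blast
  then obtain t where t: "t \<in> flow_dom p" "flow p t \<in> S" by blast
  show ?thesis
  proof (rule ex1I[of _ "flow p t"])
    show "flow p t \<in> S \<and> (p, flow p t) \<in> schi M" using t flow_reach schi_iff by blast
    fix q assume q: "q \<in> S \<and> (p, q) \<in> schi M"
    then obtain s where s: "reach p s q" using schi_iff by blast
    then have "s \<in> flow_dom p" "flow p s = q" using flow_eqI by (auto simp: flow_dom_def)
    then show "q = flow p t" using ex1 t q by blast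
  qed
qed

end

section \<open>The leaf space\<close>

context framed_spacetime
begin

abbreviation "proj \<equiv> chi_proj M"
abbreviation "leaves \<equiv> points M // schi M"

lemma proj_eq_iff: "p \<in> points M \<Longrightarrow> q \<in> points M \<Longrightarrow> proj p = proj q \<longleftrightarrow> (p, q) \<in> schi M"
  unfolding chi_proj_def using eq_equiv_class_iff[OF schi_equiv] by blast

lemma proj_eqI: "(p, q) \<in> schi M \<Longrightarrow> proj p = proj q"
  unfolding chi_proj_def by (rule equiv_class_eq[OF schi_equiv])

lemma proj_in: "p \<in> points M \<Longrightarrow> proj p \<in> leaves"
  unfolding chi_proj_def by (rule quotientI)

lemma leaf_rep: "x \<in> leaves \<Longrightarrow> \<exists>p\<in>points M. x = proj p"
  unfolding chi_proj_def by (auto elim: quotientE)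

lemma proj_reach: "reach p t q \<Longrightarrow> proj p = proj q"
  using proj_eqI schi_iff by blast

lemma proj_eq_reach: "p \<in> points M \<Longrightarrow> q \<in> points M \<Longrightarrow> proj p = proj q \<Longrightarrow> \<exists>t. reach p t q"
  using proj_eq_iff schi_iff by blast

lemma proj_plaque:
  "straight c \<Longrightarrow> p \<in> fst c \<Longrightarrow> q \<in> fst c \<Longrightarrow> fst (snd c p) = fst (snd c q) \<Longrightarrow> proj p = proj q"
  by (rule proj_reach[OF plaque_reach])

text \<open>A leaf is the image of an interval, so a partition of \<open>M\<close> into two open
  sets cannot split it. This makes the pieces of \<open>M\<close> saturated in
  \<open>qtop_paracompact\<close>.\<close>

lemma leaf_connected:
  assumes "p \<in> points M" "q \<in> points M" "proj p = proj q"
    and "openin (mtop M) A" "openin (mtop M) B" "points M \<subseteq> A \<union> B" "A \<inter> B = {}" "p \<in> A"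
  shows "q \<in> A"
proof -
  obtain I \<gamma> t where *: "flow_line I \<gamma>" "0 \<in> I" "t \<in> I" "\<gamma> 0 = p" "\<gamma> t = q"
    using proj_eq_reach[OF assms(1-3)] unfolding reach_def by blast
  have con: "connected I" using *(1) by (simp add: flow_line_def is_interval_connected)
  have "(\<gamma> 0 \<in> A) = (\<gamma> t \<in> A)"
  proof (rule connected_relation_real[OF con *(2,3), where R = "\<lambda>s s'. (\<gamma> s \<in> A) = (\<gamma> s' \<in> A)"])
    fix a assume a: "a \<in> I"
    then have "\<gamma> a \<in> A \<or> \<gamma> a \<in> B" using flow_line_points[OF *(1)] assms(6) by blast
    then show "\<exists>d>0. \<forall>x\<in>I. \<bar>x - a\<bar> < d \<longrightarrow> (\<gamma> a \<in> A) = (\<gamma> x \<in> A)"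
    proof
      assume aA: "\<gamma> a \<in> A"
      then show ?thesis using flow_line_open[OF *(1) a assms(4) aA] by blast
    next
      assume aB: "\<gamma> a \<in> B"
      obtain d where "d > 0" "\<And>s. \<bar>s - a\<bar> < d \<Longrightarrow> \<gamma> s \<in> B" using flow_line_open[OF *(1) a assms(5) aB] by blast
      then show ?thesis using aB assms(7) by blast
    qed
  qed auto
  then show ?thesis using * assms(8) by simp
qed

section \<open>The quotient topology and the openness of the projection\<close>

definition qtop :: "'a set topology" where
  "qtop = topology (\<lambda>U. U \<subseteq> leaves \<and> openin (mtop M) {p \<in> points M. proj p \<in> U})"

lemma openin_qtop: "openin qtop U \<longleftrightarrow> U \<subseteq> leaves \<and> openin (mtop M) {p \<in> points M. proj p \<in> U}"
proof -
  have "istopology (\<lambda>U. U \<subseteq> leaves \<and> openin (mtop M) {p \<in> points M. proj p \<in> U})"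
    unfolding istopology_def
  proof (intro conjI allI impI)
    fix S T assume ST: "S \<subseteq> leaves \<and> openin (mtop M) {p \<in> points M. proj p \<in> S}"
      "T \<subseteq> leaves \<and> openin (mtop M) {p \<in> points M. proj p \<in> T}"
    have "{p \<in> points M. proj p \<in> S \<inter> T} = {p \<in> points M. proj p \<in> S} \<inter> {p \<in> points M. proj p \<in> T}" by blast
    then show "openin (mtop M) {p \<in> points M. proj p \<in> S \<inter> T}" using ST by auto
    show "S \<inter> T \<subseteq> leaves" using ST by blast
  next
    fix \<K> assume K: "\<forall>K\<in>\<K>. K \<subseteq> leaves \<and> openin (mtop M) {p \<in> points M. proj p \<in> K}"
    then show "\<Union>\<K> \<subseteq> leaves" by blast
    have "{p \<in> points M. proj p \<in> \<Union>\<K>} = (\<Union>K\<in>\<K>. {p \<in> points M. proj p \<in> K})" by blast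
    then show "openin (mtop M) {p \<in> points M. proj p \<in> \<Union>\<K>}" using K by auto
  qed
  then show ?thesis unfolding qtop_def using topology_inverse' by (metis (no_types, lifting))
qed

lemma topspace_qtop: "topspace qtop = leaves"
proof -
  have "{p \<in> points M. proj p \<in> leaves} = points M" using proj_in by blast
  then have "openin qtop leaves" unfolding openin_qtop by simp
  moreover have "topspace qtop \<subseteq> leaves" using openin_topspace[of qtop] unfolding openin_qtop by blast
  ultimately show ?thesis using openin_subset by blast
qed

lemma proj_continuous: "continuous_map (mtop M) qtop proj"
  unfolding continuous_map_def topspace_qtop using proj_in openin_qtop by auto

text \<open>Slides a neighbourhood along a plaque: the positions whose horizontal coordinate occurs
  in \<open>N\<close> at the height of \<open>x\<close> form an open set of full vertical
  strips.\<close>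

lemma plaque_nbhd:
  assumes c: "straight c" and xy: "x \<in> fst c" "y \<in> fst c" "fst (snd c x) = fst (snd c y)"
    and N: "openin (mtop M) N" "x \<in> N"
  shows "\<exists>N'. openin (mtop M) N' \<and> y \<in> N' \<and> N' \<subseteq> fst c \<and> (\<forall>z\<in>N'. \<exists>w\<in>N \<inter> fst c. fst (snd c w) = fst (snd c z))"
proof -
  note cc = straightD(2)[OF c]
  define \<tau> where "\<tau> = snd (snd c x)"
  let ?B = "snd c ` (N \<inter> fst c)"
  have oB: "open ?B" by (rule chart_open_image[OF cc N(1)])
  have l: "smooth_on UNIV (\<lambda>v::plane. (fst v, \<tau>))"
    by (intro smooth_on_Pair smooth_on_const open_UNIV smooth_on_linear bounded_linear_fst)
  have oC: "open {v \<in> (UNIV :: plane set). (fst v, \<tau>) \<in> ?B}" by (rule open_preimage_smooth[OF open_UNIV l oB])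
  let ?N' = "{z \<in> fst c. snd c z \<in> {v \<in> (UNIV :: plane set). (fst v, \<tau>) \<in> ?B}}"
  have "openin (mtop M) ?N'" by (rule chart_open_preimage[OF cc oC])
  moreover have "(fst (snd c y), \<tau>) = snd c x" using xy(3) by (simp add: \<tau>_def prod_eq_iff)
  then have "y \<in> ?N'" using xy(1,2) N(2) by auto
  moreover have "\<exists>w\<in>N \<inter> fst c. fst (snd c w) = fst (snd c z)" if z: "z \<in> ?N'" for z
  proof -
    have "(fst (snd c z), \<tau>) \<in> ?B" using z by simp
    then obtain w where "w \<in> N \<inter> fst c" "(fst (snd c z), \<tau>) = snd c w" by blast
    then show ?thesis by (metis fst_conv)
  qed
  ultimately show ?thesis by blast
qed

text \<open>To be shown is that the saturation of \<open>W\<close> is open. Having a neighbourhood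
  inside it passes from points of \<open>W\<close> along their leaves by
  \<open>plaque_nbhd\<close>.\<close>

lemma proj_open:
  assumes W: "openin (mtop M) W" shows "openin qtop (proj ` W)"
  unfolding openin_qtop
proof
  have WM: "W \<subseteq> points M" using W openin_subset by blast
  then show "proj ` W \<subseteq> leaves" using proj_in by blast
  let ?A = "{p \<in> points M. proj p \<in> proj ` W}"
  have "\<exists>N. openin (mtop M) N \<and> q \<in> N \<and> N \<subseteq> ?A" if q: "q \<in> ?A" for q
  proof -
    obtain p where p: "p \<in> W" "proj p = proj q" using q by auto
    obtain t where "reach p t q" using proj_eq_reach[OF _ _ p(2)] p(1) WM q by blast
    then show ?thesis
    proof (rule leaf_induct[where P = "\<lambda>x. \<exists>N. openin (mtop M) N \<and> x \<in> N \<and> N \<subseteq> ?A"])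
      have "W \<subseteq> ?A" using WM by auto
      then show "\<exists>N. openin (mtop M) N \<and> p \<in> N \<and> N \<subseteq> ?A" using W p(1) by blast
      fix c x y assume c: "straight c" "x \<in> fst c" "y \<in> fst c" "fst (snd c x) = fst (snd c y)"
        and ex: "\<exists>N. openin (mtop M) N \<and> x \<in> N \<and> N \<subseteq> ?A"
      then obtain N where N: "openin (mtop M) N" "x \<in> N" "N \<subseteq> ?A" by blast
      obtain N' where N': "openin (mtop M) N'" "y \<in> N'" "N' \<subseteq> fst c"
        "\<And>z. z \<in> N' \<Longrightarrow> \<exists>w\<in>N \<inter> fst c. fst (snd c w) = fst (snd c z)"
        using plaque_nbhd[OF c N(1,2)] by blast
      have "N' \<subseteq> ?A"
      proof
        fix z assume z: "z \<in> N'"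
        obtain w where w: "w \<in> N" "w \<in> fst c" "fst (snd c w) = fst (snd c z)" using N'(4)[OF z] by blast
        have zc: "z \<in> fst c" using N'(3) z by blast
        have "proj w = proj z" by (rule proj_plaque[OF c(1) w(2) zc w(3)])
        moreover have "proj w \<in> proj ` W" using w(1) N(3) by blast
        ultimately show "z \<in> ?A" using zc straightD(3)[OF c(1)] by auto
      qed
      then show "\<exists>N. openin (mtop M) N \<and> y \<in> N \<and> N \<subseteq> ?A" using N' by blast
    qed
  qed
  then show "openin (mtop M) ?A" by (subst openin_subopen) blast
qed

lemma straight_subchart:
  assumes c: "straight c" and e: "snd c ` fst c = square e" and d: "0 < d" "d \<le> e"
  defines "W \<equiv> {z \<in> fst c. snd c z \<in> square d}"
  shows "straight (W, restrict (snd c) W)"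
proof -
  note cD = straightD[OF c]
  have W: "openin (mtop M) W" "W \<subseteq> fst c" unfolding W_def using chart_open_preimage[OF cD(2) open_square] by auto
  have ch: "(W, restrict (snd c) W) \<in> atlas M" by (rule restricted_chart[OF sm cD(1) W])
  have sub: "square d \<subseteq> square e" using d by auto
  have im: "restrict (snd c) W ` W = square d"
  proof
    show "restrict (snd c) W ` W \<subseteq> square d" by (auto simp: W_def)
    show "square d \<subseteq> restrict (snd c) W ` W"
    proof
      fix v assume v: "v \<in> square d"
      then have "v \<in> snd c ` fst c" using sub unfolding e by blast
      then obtain z where "z \<in> fst c" "v = snd c z" by blast
      then show "v \<in> restrict (snd c) W ` W" using v by (intro image_eqI[of _ _ z]) (auto simp: W_def)
    qed
  qed
  have "null_field (W, restrict (snd c) W) q = (0, 1)" if q: "q \<in> W" for q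
  proof -
    have qc: "q \<in> fst c" using W(2) q by blast
    have "(local_rep c (W, restrict (snd c) W) (\<lambda>q. q) has_derivative (\<lambda>v. v)) (at (snd c q))"
    proof (rule has_derivative_transform_within_open[OF has_derivative_ident])
      show "open (snd c ` (W \<inter> fst c))" by (rule chart_open_image[OF cD(2) W(1)])
      show "snd c q \<in> snd c ` (W \<inter> fst c)" using q qc by blast
      show "x = local_rep c (W, restrict (snd c) W) (\<lambda>q. q) x" if "x \<in> snd c ` (W \<inter> fst c)" for x
        using that by (auto simp: local_rep_apply[OF cD(2)])
    qed
    from frechet_derivative_at[OF this] have "mdiff c (W, restrict (snd c) W) (\<lambda>q. q) q v = v" for v
      unfolding mdiff_def by metis
    then show ?thesis using null_field_transform[OF cD(1) ch qc] q cD(4)[OF qc] by simp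
  qed
  then show ?thesis unfolding straight_def using ch im d(1) by auto
qed

end

section \<open>Separation, adapted charts and paracompactness from a Cauchy surface\<close>

locale initial_spacetime = framed_spacetime +
  fixes S :: "'a set"
  assumes S: "chi_cauchy_surface M S"
begin

lemma S_points: "S \<subseteq> points M" and S_embedded:
  "s \<in> S \<Longrightarrow> \<exists>c\<in>atlas M. s \<in> fst c \<and> snd c ` (S \<inter> fst c) = snd c ` fst c \<inter> {x. snd x = 0}"
  using S by (auto simp: chi_cauchy_surface_def embedded_curve_def)

lemma S_unique: "s \<in> S \<Longrightarrow> s' \<in> S \<Longrightarrow> proj s = proj s' \<Longrightarrow> s = s'"
  using cauchy_surface_meets[OF S, of s] S_points proj_eq_iff schi_iff reach_refl by (metis subsetD)

lemma S_ex: "x \<in> leaves \<Longrightarrow> \<exists>s\<in>S. x = proj s"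
  using cauchy_surface_meets[OF S] leaf_rep proj_eqI by metis

text \<open>In a straight chart around a point of the Cauchy surface the transverse coordinate is injective
  along the surface, hence every nearby plaque meets the surface.\<close>

lemma surface_meets_plaques:
  assumes s: "s \<in> S" and W: "openin (mtop M) W" "s \<in> W"
  obtains c d where "straight c" "s \<in> fst c" "snd c s = (0, 0)" "fst c \<subseteq> W" "d > 0"
    "\<And>z. z \<in> fst c \<Longrightarrow> \<bar>fst (snd c z)\<bar> < d \<Longrightarrow> \<exists>s'\<in>S \<inter> fst c. fst (snd c s') = fst (snd c z)"
proof -
  obtain k where k: "k \<in> atlas M" "s \<in> fst k" "snd k ` (S \<inter> fst k) = snd k ` fst k \<inter> {x. snd x = 0}"
    using S_embedded[OF s] by blast
  note kc = smooth_manifoldD(3)[OF sm k(1)]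
  have "openin (mtop M) (W \<inter> fst k)" using W(1) is_chartD(1)[OF kc] by blast
  moreover have "s \<in> W \<inter> fst k" using W(2) k(2) by blast
  ultimately obtain c where c: "straight c" "s \<in> fst c" "fst c \<subseteq> W \<inter> fst k" "snd c s = (0, 0)" by (rule straight_exists)
  note cD = straightD[OF c(1)]
  have "snd k s \<in> snd k ` (S \<inter> fst k)" using s k(2) by blast
  then have "snd (snd k s) = 0" using k(3) by simp
  then obtain a where a: "snd k s = (a, 0)" by (metis prod.collapse)
  let ?K = "snd k ` (fst k \<inter> fst c)"
  have oK: "open ?K" and sK: "smooth_on ?K (local_rep k c (\<lambda>p. p))"
    using transition_smooth[OF sm k(1) cD(1)] by auto
  have "(a, 0) \<in> ?K" using a k(2) c(2) by (metis IntI imageI)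
  then obtain e where e: "e > 0" "ball (a, 0) e \<subseteq> ?K" using oK open_contains_ball by blast
  \<comment> \<open>The surface near \<open>s\<close> as a curve: in the slice chart
    \<open>k\<close> it is the part with vanishing second coordinate, and \<open>r\<close> is the
    displacement from \<open>s\<close>.\<close>
  define \<sigma> where "\<sigma> r = inv_chart k (a + r, 0)" for r
  have inK: "(a + r, 0) \<in> ?K" if "\<bar>r\<bar> < e" for r
    using e(2) that by (auto simp: dist_norm norm_Pair subset_iff)
  have \<sigma>: "\<sigma> r \<in> S" "\<sigma> r \<in> fst c" "snd k (\<sigma> r) = (a + r, 0)" if r: "\<bar>r\<bar> < e" for r
  proof -
    obtain z where z: "z \<in> fst k" "z \<in> fst c" "snd k z = (a + r, 0)" using inK[OF r] by force
    then have "(a + r, 0) \<in> snd k ` fst k \<inter> {x. snd x = 0}" by force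
    then obtain z' where z': "z' \<in> S" "z' \<in> fst k" "snd k z' = (a + r, 0)" unfolding k(3)[symmetric] by force
    have "z' = z" using is_chartD(3)[OF kc] z z' by (metis inj_onD)
    moreover have "\<sigma> r = z" unfolding \<sigma>_def using inv_chart_eqI[OF kc z(1,3)] .
    ultimately show "\<sigma> r \<in> S" "\<sigma> r \<in> fst c" "snd k (\<sigma> r) = (a + r, 0)" using z z' by auto
  qed
  define f where "f r = fst (snd c (\<sigma> r))" for r
  have "continuous_on {-e<..<e} (\<lambda>r. fst (local_rep k c (\<lambda>p. p) (a + r, 0)))"
    by (rule continuous_on_fst[OF continuous_on_compose2[OF smooth_on_imp_continuous_on[OF sK]]])
      (use inK in \<open>auto intro!: continuous_intros\<close>)
  then have cf: "continuous_on {-e<..<e} f" by (simp add: f_def \<sigma>_def local_rep_def)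
  have inj: "inj_on f {-e<..<e}"
  proof (rule inj_onI)
    fix r r' assume r: "r \<in> {-e<..<e}" "r' \<in> {-e<..<e}" "f r = f r'"
    then have lt: "\<bar>r\<bar> < e" "\<bar>r'\<bar> < e" by auto
    have "proj (\<sigma> r) = proj (\<sigma> r')"
      using proj_plaque[OF c(1) \<sigma>(2)[OF lt(1)] \<sigma>(2)[OF lt(2)]] r(3) by (simp add: f_def)
    then have "\<sigma> r = \<sigma> r'" using S_unique \<sigma>(1) lt by blast
    then have "(a + r, 0::real) = (a + r', 0)" using \<sigma>(3) lt by metis
    then show "r = r'" by simp
  qed
  \<comment> \<open>Continuity and injectivity are all that is available here: the derivative of
    \<open>f\<close> may vanish where the surface is tangent to the null field.\<close>
  obtain d where d: "d > 0" "{f 0 - d<..<f 0 + d} \<subseteq> f ` {-e<..<e}"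
    by (rule injective_real_neighbourhood[OF e(1) cf inj])
  have "\<sigma> 0 = s" unfolding \<sigma>_def using inv_chart_eqI[OF kc k(2)] a by simp
  then have f0: "f 0 = 0" using c(4) by (simp add: f_def)
  have "\<exists>s'\<in>S \<inter> fst c. fst (snd c s') = fst (snd c z)" if z: "z \<in> fst c" "\<bar>fst (snd c z)\<bar> < d" for z
  proof -
    have "fst (snd c z) \<in> {f 0 - d<..<f 0 + d}" using z(2) f0 by auto
    then obtain r where "r \<in> {-e<..<e}" "fst (snd c z) = f r" using d(2) by blast
    then show ?thesis using \<sigma>(1,2)[of r] by (auto simp: f_def)
  qed
  then show ?thesis using that[OF c(1,2,4)] c(3) d(1) by blast
qed

text \<open>Together with \<open>S_unique\<close> and \<open>S_ex\<close> this makes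
  \<open>proj\<close> an open bijection from \<open>S\<close> to the leaves, which transports
  disjoint neighbourhoods and so gives the Hausdorff property.\<close>

lemma surface_open:
  assumes W: "openin (mtop M) W" shows "openin qtop (proj ` (S \<inter> W))"
proof -
  have "\<exists>N. openin qtop N \<and> x \<in> N \<and> N \<subseteq> proj ` (S \<inter> W)" if x: "x \<in> proj ` (S \<inter> W)" for x
  proof -
    obtain s where s: "s \<in> S" "s \<in> W" "x = proj s" using x by blast
    obtain c d where c: "straight c" "s \<in> fst c" "snd c s = (0, 0)" "fst c \<subseteq> W" "d > 0"
      "\<And>z. z \<in> fst c \<Longrightarrow> \<bar>fst (snd c z)\<bar> < d \<Longrightarrow> \<exists>s'\<in>S \<inter> fst c. fst (snd c s') = fst (snd c z)"
      by (rule surface_meets_plaques[OF s(1) W s(2)]) blast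
    let ?N = "{z \<in> fst c. snd c z \<in> {-d<..<d} \<times> UNIV}"
    have "openin (mtop M) ?N"
      by (rule chart_open_preimage[OF straightD(2)[OF c(1)]]) (simp add: open_Times)
    then have "openin qtop (proj ` ?N)" by (rule proj_open)
    moreover have "x \<in> proj ` ?N" using s(3) c(2,3,5) by auto
    moreover have "proj ` ?N \<subseteq> proj ` (S \<inter> W)"
    proof (rule image_subsetI)
      fix z assume z: "z \<in> ?N"
      then have zc: "z \<in> fst c" "\<bar>fst (snd c z)\<bar> < d" by (auto simp: mem_Times_iff)
      obtain s' where s': "s' \<in> S" "s' \<in> fst c" "fst (snd c s') = fst (snd c z)" using c(6)[OF zc] by blast
      have "proj z = proj s'" by (rule proj_plaque[OF c(1) zc(1) s'(2) s'(3)[symmetric]])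
      then show "proj z \<in> proj ` (S \<inter> W)" using s'(1,2) c(4) by blast
    qed
    ultimately show ?thesis by (intro exI[of _ "proj ` ?N"] conjI)
  qed
  then show ?thesis by (subst openin_subopen) blast
qed

lemma qtop_Hausdorff: "Hausdorff_space qtop"
  unfolding Hausdorff_space_def topspace_qtop
proof (intro allI impI)
  fix x y assume xy: "x \<in> leaves \<and> y \<in> leaves \<and> x \<noteq> y"
  obtain s t where s: "s \<in> S" "x = proj s" and t: "t \<in> S" "y = proj t" using S_ex xy by metis
  have "s \<noteq> t" using s t xy by blast
  moreover have "s \<in> points M" "t \<in> points M" using s t S_points by blast+
  ultimately obtain U V where UV: "openin (mtop M) U" "openin (mtop M) V" "s \<in> U" "t \<in> V" "disjnt U V"
    using smooth_manifoldD(1)[OF sm] unfolding Hausdorff_space_def by metis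
  have "disjnt (proj ` (S \<inter> U)) (proj ` (S \<inter> V))"
    unfolding disjnt_iff
  proof (intro allI notI, elim conjE imageE)
    fix z u v assume "z = proj u" "u \<in> S \<inter> U" "z = proj v" "v \<in> S \<inter> V"
    moreover from this have "u = v" using S_unique by simp
    ultimately show False using UV(5) by (auto simp: disjnt_iff)
  qed
  then show "\<exists>U V. openin qtop U \<and> openin qtop V \<and> x \<in> U \<and> y \<in> V \<and> disjnt U V"
    using surface_open[OF UV(1)] surface_open[OF UV(2)] s t UV(3,4) by blast
qed

text \<open>No leaf returns to the chart in a second plaque, so the horizontal coordinate descends
  to an injective function on leaves.\<close>

definition adapted :: "('a, plane) chart \<Rightarrow> bool" where
  "adapted c \<longleftrightarrow> straight c \<and> (\<forall>p\<in>fst c. \<forall>q\<in>fst c. proj p = proj q \<longrightarrow> fst (snd c p) = fst (snd c q))"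

text \<open>In a thin enough chart every plaque meets the surface within \<open>c\<close>. Two
  plaques of one leaf then do so at the same point, so they have equal horizontal
  coordinate.\<close>

lemma adapted_exists:
  assumes "x \<in> leaves" obtains c s where "adapted c" "s \<in> fst c" "x = proj s"
proof -
  obtain s where s: "s \<in> S" "x = proj s" using S_ex[OF assms] by blast
  have sM: "s \<in> points M" using s(1) S_points by blast
  obtain c d where c: "straight c" "s \<in> fst c" "snd c s = (0, 0)" "d > 0"
      "\<And>z. z \<in> fst c \<Longrightarrow> \<bar>fst (snd c z)\<bar> < d \<Longrightarrow> \<exists>s'\<in>S \<inter> fst c. fst (snd c s') = fst (snd c z)"
    by (rule surface_meets_plaques[OF s(1) openin_topspace sM]) blast
  obtain e where e: "e > 0" "snd c ` fst c = square e" by (rule straight_square[OF c(1)])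
  \<comment> \<open>\<open>d\<close> bounds the plaques known to meet the surface; the minimum with
    \<open>e\<close> keeps the new square inside the old one, so that the restricted chart is again
    straight.\<close>
  define W where "W = {z \<in> fst c. snd c z \<in> square (min d e)}"
  have st: "straight (W, restrict (snd c) W)"
    unfolding W_def by (rule straight_subchart[OF c(1) e(2)]) (use c(4) e(1) in auto)
  have "fst (snd c p) = fst (snd c q)" if pq: "p \<in> W" "q \<in> W" "proj p = proj q" for p q
  proof -
    have p: "p \<in> fst c" "\<bar>fst (snd c p)\<bar> < d" and q: "q \<in> fst c" "\<bar>fst (snd c q)\<bar> < d"
      using pq by (auto simp: W_def mem_Times_iff)
    obtain p' where p': "p' \<in> S" "p' \<in> fst c" "fst (snd c p') = fst (snd c p)" using c(5)[OF p] by blast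
    obtain q' where q': "q' \<in> S" "q' \<in> fst c" "fst (snd c q') = fst (snd c q)" using c(5)[OF q] by blast
    have "proj p' = proj q'"
      using proj_plaque[OF c(1) p'(2) p(1) p'(3)] proj_plaque[OF c(1) q'(2) q(1) q'(3)] pq(3) by simp
    then have "p' = q'" using S_unique p'(1) q'(1) by blast
    then show ?thesis using p'(3) q'(3) by simp
  qed
  note u = this
  have "adapted (W, restrict (snd c) W)" unfolding adapted_def
  proof (intro conjI st ballI impI)
    fix p q assume "p \<in> fst (W, restrict (snd c) W)" "q \<in> fst (W, restrict (snd c) W)" "proj p = proj q"
    then show "fst (snd (W, restrict (snd c) W) p) = fst (snd (W, restrict (snd c) W) q)" using u[of p q] by simp
  qed
  moreover have "s \<in> W" using c(2,3,4) e(1) by (simp add: W_def)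
  ultimately show ?thesis using that s(2) by (metis fst_conv)
qed

end

lemma chart_inv_continuous:
  assumes "is_chart X c" "B \<subseteq> snd c ` fst c"
  shows "continuous_map (top_of_set B) X (inv_chart c)"
  unfolding continuous_map_def
proof (intro conjI allI impI)
  show "inv_chart c \<in> topspace (top_of_set B) \<rightarrow> topspace X"
    using chart_inv(3)[OF assms(1)] is_chartD(5)[OF assms(1)] assms(2) by (auto simp: subset_iff)
  fix U assume "openin X U"
  then have "open (snd c ` (U \<inter> fst c))" by (rule chart_open_image[OF assms(1)])
  moreover have "{x \<in> topspace (top_of_set B). inv_chart c x \<in> U} = B \<inter> snd c ` (U \<inter> fst c)"
  proof (rule Set.set_eqI)
    fix x
    show "x \<in> {x \<in> topspace (top_of_set B). inv_chart c x \<in> U} \<longleftrightarrow> x \<in> B \<inter> snd c ` (U \<inter> fst c)"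
    proof (cases "x \<in> B")
      case True
      then obtain p where p: "p \<in> fst c" "x = snd c p" using assms(2) by blast
      then have "inv_chart c x = p" using chart_inv(1)[OF assms(1)] by simp
      moreover have "snd c p \<in> snd c ` (U \<inter> fst c) \<longleftrightarrow> p \<in> U"
        using p(1) inj_onD[OF is_chartD(3)[OF assms(1)], of p] by blast
      ultimately show ?thesis using True p(2) by simp
    qed simp
  qed
  ultimately show "openin (top_of_set B) {x \<in> topspace (top_of_set B). inv_chart c x \<in> U}" by auto
qed

lemma chart_Lindelof:
  fixes c :: "('a, 'e::euclidean_space) chart"
  assumes "is_chart X c" "W \<subseteq> fst c"
  shows "Lindelof_space (subtopology X W)"
proof (rule Lindelof_space_continuous_map_image[OF Lindelof_euclidean[of "snd c ` W"]])
  have im: "inv_chart c ` (snd c ` W) = W"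
    using chart_inv(1)[OF assms(1)] assms(2) by (force simp: image_image)
  have "snd c ` W \<subseteq> snd c ` fst c" using assms(2) by blast
  from chart_inv_continuous[OF assms(1) this]
  show "continuous_map (top_of_set (snd c ` W)) (subtopology X W) (inv_chart c)"
    unfolding continuous_map_in_subtopology using im by auto
  show "inv_chart c ` topspace (top_of_set (snd c ` W)) = topspace (subtopology X W)"
    using im is_chartD(5)[OF assms(1)] assms(2) by auto
qed

context framed_spacetime
begin

text \<open>Half of the square in a straight chart provides the local hypothesis of
  \<open>paracompact_Lindelof_pieces\<close>, and local compactness along the way.\<close>

lemma compact_nbhd:
  assumes "p \<in> points M"
  shows "\<exists>U K. openin (mtop M) U \<and> p \<in> U \<and> compactin (mtop M) K \<and> U \<subseteq> K \<and>
      (\<forall>W\<subseteq>U. Lindelof_space (subtopology (mtop M) W))"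
proof -
  obtain c where c: "straight c" "p \<in> fst c" "snd c p = (0, 0)" using straight_exists[OF openin_topspace assms] by metis
  note cc = straightD(2)[OF c(1)]
  obtain e where e: "e > 0" "snd c ` fst c = square e" by (rule straight_square[OF c(1)])
  let ?B = "{-(e/2)..e/2} \<times> {-(e/2)..e/2}"
  have B: "?B \<subseteq> snd c ` fst c" unfolding e(2) using e(1) by auto
  have cB: "compact ?B" by (intro compact_Times compact_Icc)
  have "compactin (top_of_set ?B) ?B" using cB by (simp add: compactin_subtopology)
  then have K: "compactin (mtop M) (inv_chart c ` ?B)"
    by (rule image_compactin[OF _ chart_inv_continuous[OF cc B]])
  let ?U = "{z \<in> fst c. snd c z \<in> square (e / 2)}"
  have U: "openin (mtop M) ?U" by (rule chart_open_preimage[OF cc open_square])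
  have "?U \<subseteq> inv_chart c ` ?B"
  proof
    fix z assume z: "z \<in> ?U"
    then have "snd c z \<in> ?B" by (auto simp: mem_Times_iff)
    then show "z \<in> inv_chart c ` ?B" using chart_inv(1)[OF cc, of z] z by (intro image_eqI[of _ _ "snd c z"]) auto
  qed
  moreover have "\<forall>W\<subseteq>?U. Lindelof_space (subtopology (mtop M) W)" using chart_Lindelof[OF cc] by blast
  moreover have "p \<in> ?U" using c e(1) by simp
  ultimately show ?thesis using U K by (intro exI[of _ ?U] exI[of _ "inv_chart c ` ?B"] conjI)
qed

end

context initial_spacetime
begin

text \<open>The disjoint open pieces of \<open>M\<close> are saturated because leaves are connected,
  so their images are again disjoint, open and Lindelof. Regularity comes from local compactness,
  passed down by the open projection, and the Hausdorff property.\<close>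

lemma qtop_paracompact: "paracompact_space qtop"
proof -
  have "locally_compact_space (mtop M)"
    unfolding locally_compact_space_def
  proof
    fix p assume "p \<in> points M"
    from compact_nbhd[OF this]
    show "\<exists>U K. openin (mtop M) U \<and> compactin (mtop M) K \<and> p \<in> U \<and> U \<subseteq> K" by (elim exE conjE) (intro exI conjI)
  qed
  moreover have "open_map (mtop M) qtop proj" using proj_open by (simp add: open_map_def)
  moreover have "proj ` points M = topspace qtop" unfolding topspace_qtop using proj_in leaf_rep by auto
  ultimately have "locally_compact_space qtop"
    using locally_compact_space_continuous_open_map_image[OF proj_continuous] by blast
  then have reg: "regular_space qtop"
    using locally_compact_Hausdorff_imp_regular_space qtop_Hausdorff by blast
  obtain \<P> where P: "\<Union>\<P> = points M" "\<And>P. P \<in> \<P> \<Longrightarrow> openin (mtop M) P"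
    "\<And>P. P \<in> \<P> \<Longrightarrow> Lindelof_space (subtopology (mtop M) P)"
    "\<And>P P' x. P \<in> \<P> \<Longrightarrow> P' \<in> \<P> \<Longrightarrow> x \<in> P \<Longrightarrow> x \<in> P' \<Longrightarrow> P = P'"
    by (rule paracompact_Lindelof_pieces[OF smooth_manifoldD(2)[OF sm] compact_nbhd]) blast+
  have sub: "P \<subseteq> points M" if "P \<in> \<P>" for P using P(1) that by blast
  show ?thesis
  proof (rule Lindelof_pieces_imp_paracompact[OF reg, where \<P> = "(`) proj ` \<P>"])
    have "\<Union>((`) proj ` \<P>) = proj ` \<Union>\<P>" by blast
    then show "\<Union>((`) proj ` \<P>) = topspace qtop" using P(1) \<open>proj ` points M = topspace qtop\<close> by simp
    fix R assume "R \<in> (`) proj ` \<P>"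
    then obtain P where PP: "P \<in> \<P>" "R = proj ` P" by blast
    show "openin qtop R" unfolding PP(2) by (rule proj_open[OF P(2)[OF PP(1)]])
    have "continuous_map (subtopology (mtop M) P) (subtopology qtop R) proj"
      using proj_continuous PP(2) by (auto simp: continuous_map_in_subtopology continuous_map_from_subtopology)
    moreover have "proj ` topspace (subtopology (mtop M) P) = topspace (subtopology qtop R)"
      using sub[OF PP(1)] PP(2) proj_in by (auto simp: topspace_qtop)
    ultimately show "Lindelof_space (subtopology qtop R)"
      using Lindelof_space_continuous_map_image[OF P(3)[OF PP(1)]] by blast
    fix R' x assume R': "R' \<in> (`) proj ` \<P>" "x \<in> R" "x \<in> R'"
    then obtain P' where PP': "P' \<in> \<P>" "R' = proj ` P'" by blast
    obtain p p' where p: "p \<in> P" "p' \<in> P'" "proj p = proj p'" using R' PP PP' by auto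
    have "p' \<in> P"
    proof (rule leaf_connected[OF _ _ p(3), where A = P and B = "\<Union>(\<P> - {P})"])
      show "p \<in> points M" "p' \<in> points M" using p sub PP(1) PP'(1) by blast+
      show "openin (mtop M) P" "openin (mtop M) (\<Union>(\<P> - {P}))" using P(2) PP(1) by auto
      show "points M \<subseteq> P \<union> \<Union>(\<P> - {P})" using P(1) by blast
      show "P \<inter> \<Union>(\<P> - {P}) = {}" using P(4)[OF PP(1)] by blast
      show "p \<in> P" by (rule p(1))
    qed
    then have "P = P'" using P(4)[OF PP(1) PP'(1)] p(2) by blast
    then show "R = R'" using PP PP' by simp
  qed
qed

end

section \<open>The smooth structure of the leaf space\<close>

text \<open>A null line is its own orthogonal complement. In \<open>mdiff_proj_form\<close> this
  relates the kernel of the differential of the projection to the metric.\<close>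

lemma (in lorentz_plane) null_orthogonal:
  assumes "g n n = 0" "n \<noteq> 0" "g n w = 0" shows "\<exists>k. w = k *\<^sub>R n"
proof -
  obtain \<omega> \<alpha> \<beta> where c0: "\<omega> \<noteq> 0 \<and> (\<forall>v w. g v w = - \<alpha> v * \<alpha> w + \<beta> v * \<beta> w) \<and>
      (\<forall>v w. vol v w = \<omega> * (\<alpha> v * \<beta> w - \<beta> v * \<alpha> w)) \<and>
      (\<forall>v w k. \<alpha> w = k * \<alpha> v \<longrightarrow> \<beta> w = k * \<beta> v \<longrightarrow> w = k *\<^sub>R v)"
    using coordinates by blast
  note c = c0[THEN conjunct2, THEN conjunct1, rule_format]
    c0[THEN conjunct2, THEN conjunct2, THEN conjunct2, rule_format]
  have y: "\<beta> n = \<alpha> n \<or> \<beta> n = - \<alpha> n"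
    using assms(1) by (simp add: c(1) flip: power2_eq_square) (simp add: power2_eq_iff[symmetric])
  have x: "\<alpha> n \<noteq> 0"
  proof
    assume 0: "\<alpha> n = 0"
    then have "\<beta> n = 0" using y by auto
    then have "n = 0 *\<^sub>R n" using 0 by (intro c(2)) auto
    then show False using assms(2) by simp
  qed
  have "\<beta> n * \<beta> w = \<alpha> n * \<alpha> w" using assms(3) by (simp add: c(1))
  then have "\<alpha> n * (\<beta> w - \<alpha> w) = 0 \<and> \<beta> n = \<alpha> n \<or> \<alpha> n * (\<beta> w + \<alpha> w) = 0 \<and> \<beta> n = - \<alpha> n"
    using y by (auto simp: algebra_simps)
  then have "\<beta> w = \<alpha> w \<and> \<beta> n = \<alpha> n \<or> \<beta> w = - \<alpha> w \<and> \<beta> n = - \<alpha> n" using x by auto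
  then have "\<alpha> w = (\<alpha> w / \<alpha> n) * \<alpha> n \<and> \<beta> w = (\<alpha> w / \<alpha> n) * \<beta> n" using x by auto
  then show ?thesis using c(2) by blast
qed

lemma real_linear_apply: "linear f \<Longrightarrow> f v = v * f (1::real)" for f :: "real \<Rightarrow> real"
  using linear_scale[of f v 1] by simp

lemma surj_linear_real:
  fixes f :: "'a::real_vector \<Rightarrow> real" assumes "linear f" shows "surj f \<longleftrightarrow> (\<exists>v. f v \<noteq> 0)"
proof
  assume "surj f"
  then show "\<exists>v. f v \<noteq> 0" by (metis surjE zero_neq_one)
next
  assume "\<exists>v. f v \<noteq> 0"
  then obtain v where v: "f v \<noteq> 0" by blast
  have "f ((y / f v) *\<^sub>R v) = y" for y using linear_scale[OF assms] v by simp
  then show "surj f" by (rule surjI)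
qed

text \<open>A local notion is needed because functions such as \<open>snd d \<circ> proj\<close> are
  meaningful only where \<open>proj\<close> lands in the chart; it can be moved between charts and
  along plaques.\<close>

definition smooth_near :: "('a, 'e::euclidean_space) chart \<Rightarrow> ('a \<Rightarrow> real) \<Rightarrow> 'a \<Rightarrow> bool" where
  "smooth_near c F p \<longleftrightarrow>
     (\<exists>U. open U \<and> snd c p \<in> U \<and> U \<subseteq> snd c ` fst c \<and> smooth_on U (F \<circ> inv_chart c))"

lemma smooth_near_derivative:
  "smooth_near c F p \<Longrightarrow>
    ((F \<circ> inv_chart c) has_derivative frechet_derivative (F \<circ> inv_chart c) (at (snd c p))) (at (snd c p))"
  unfolding smooth_near_def using smooth_on_has_derivative by blast

lemma smooth_near_change:
  assumes M: "smooth_manifold M" and c: "c \<in> atlas M" "c' \<in> atlas M" and p: "p \<in> fst c" "p \<in> fst c'"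
    and F: "smooth_near c F p"
  shows "smooth_near c' F p"
    "frechet_derivative (F \<circ> inv_chart c') (at (snd c' p)) v =
      frechet_derivative (F \<circ> inv_chart c) (at (snd c p)) (mdiff c' c (\<lambda>q. q) p v)"
proof -
  obtain U where U: "open U" "snd c p \<in> U" "U \<subseteq> snd c ` fst c" "smooth_on U (F \<circ> inv_chart c)"
    using F unfolding smooth_near_def by blast
  note cc = smooth_manifoldD(3)[OF M c(1)] and cc' = smooth_manifoldD(3)[OF M c(2)]
  let ?S = "snd c' ` (fst c' \<inter> fst c)" and ?l = "local_rep c' c (\<lambda>p. p)"
  note S = transition_smooth[OF M c(2,1)]
  let ?U' = "{x \<in> ?S. ?l x \<in> U}"
  have oU': "open ?U'" by (rule open_preimage_smooth[OF S(2,1) U(1)])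
  have pS: "snd c' p \<in> ?S" using p by blast
  have lp: "?l (snd c' p) = snd c p" by (rule local_rep_apply[OF cc' p(2)])
  have eq: "(F \<circ> inv_chart c) (?l x) = (F \<circ> inv_chart c') x" if x: "x \<in> ?U'" for x
  proof -
    obtain q where "q \<in> fst c'" "q \<in> fst c" "x = snd c' q" using x by blast
    then show ?thesis using chart_inv(1)[OF cc] chart_inv(1)[OF cc'] by (simp add: local_rep_def)
  qed
  have "smooth_on ?U' (\<lambda>x. (F \<circ> inv_chart c) (?l x))"
    by (rule smooth_on_compose[OF oU' U(1) smooth_on_subset[OF S(1)] U(4)]) auto
  then have "smooth_on ?U' (F \<circ> inv_chart c')" by (rule smooth_on_eq[OF oU']) (rule eq)
  moreover have pU': "snd c' p \<in> ?U'" using pS lp U(2) by simp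
  ultimately show "smooth_near c' F p" unfolding smooth_near_def using oU' by blast
  have D1: "(?l has_derivative mdiff c' c (\<lambda>q. q) p) (at (snd c' p))"
    unfolding mdiff_def by (rule smooth_on_has_derivative[OF S pS])
  have "((F \<circ> inv_chart c) has_derivative frechet_derivative (F \<circ> inv_chart c) (at (snd c p))) (at (?l (snd c' p)))"
    unfolding lp by (rule smooth_near_derivative[OF F])
  from diff_chain_at[OF D1 this]
  have "((\<lambda>x. (F \<circ> inv_chart c) (?l x)) has_derivative
      frechet_derivative (F \<circ> inv_chart c) (at (snd c p)) \<circ> mdiff c' c (\<lambda>q. q) p) (at (snd c' p))" by (simp only: o_def)
  then have "((F \<circ> inv_chart c') has_derivative
      frechet_derivative (F \<circ> inv_chart c) (at (snd c p)) \<circ> mdiff c' c (\<lambda>q. q) p) (at (snd c' p))"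
    by (rule has_derivative_transform_within_open[OF _ oU' pU']) (rule eq)
  from frechet_derivative_at[OF this] show "frechet_derivative (F \<circ> inv_chart c') (at (snd c' p)) v =
      frechet_derivative (F \<circ> inv_chart c) (at (snd c p)) (mdiff c' c (\<lambda>q. q) p v)" by (metis comp_apply)
qed

text \<open>The submersion condition for a real function at one point: smooth nearby, with nonzero
  differential at \<open>p\<close>.\<close>

definition regular_near :: "('a, 'e::euclidean_space) chart \<Rightarrow> ('a \<Rightarrow> real) \<Rightarrow> 'a \<Rightarrow> bool" where
  "regular_near c F p \<longleftrightarrow> smooth_near c F p \<and> (\<exists>v. frechet_derivative (F \<circ> inv_chart c) (at (snd c p)) v \<noteq> 0)"

lemma regular_near_change:
  assumes M: "smooth_manifold M" and c: "c \<in> atlas M" "c' \<in> atlas M" and p: "p \<in> fst c" "p \<in> fst c'"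
    and F: "regular_near c F p"
  shows "regular_near c' F p"
proof -
  have s: "smooth_near c F p" using F by (simp add: regular_near_def)
  obtain v where v: "frechet_derivative (F \<circ> inv_chart c) (at (snd c p)) v \<noteq> 0"
    using F by (auto simp: regular_near_def)
  have "frechet_derivative (F \<circ> inv_chart c') (at (snd c' p)) (mdiff c c' (\<lambda>q. q) p v) \<noteq> 0"
    unfolding smooth_near_change(2)[OF M c p s] transition_inverse[OF M c p] by (rule v)
  then show ?thesis unfolding regular_near_def using smooth_near_change(1)[OF M c p s] by blast
qed

section \<open>Functions pulled back from the leaf space\<close>

context framed_spacetime
begin

lemma plaque_constant:
  assumes c: "straight c" and z: "z \<in> snd c ` fst c" "z' \<in> snd c ` fst c" "fst z = fst z'"
  shows "(f \<circ> proj \<circ> inv_chart c) z = (f \<circ> proj \<circ> inv_chart c) z'"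
proof -
  note cc = straightD(2)[OF c]
  have "proj (inv_chart c z) = proj (inv_chart c z')"
    by (rule proj_plaque[OF c]) (use chart_inv[OF cc] z in auto)
  then show ?thesis by simp
qed

text \<open>A pulled-back function is constant on vertical lines, so its differential kills
  \<open>(0, 1)\<close>.\<close>

lemma leaf_function_derivative:
  assumes c: "straight c" "p \<in> fst c" and F: "smooth_near c (f \<circ> proj) p"
  defines "D \<equiv> frechet_derivative (f \<circ> proj \<circ> inv_chart c) (at (snd c p))"
  shows "D v = fst v * D (1, 0)"
proof -
  note cc = straightD(2)[OF c(1)]
  let ?G = "f \<circ> proj \<circ> inv_chart c"
  have D: "(?G has_derivative D) (at (snd c p))" unfolding D_def by (rule smooth_near_derivative[OF F])
  have 1: "((\<lambda>s. snd c p + (0, s)) has_derivative (\<lambda>k. (0, k))) (at 0)" by (auto intro!: derivative_eq_intros)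
  have "(?G has_derivative D) (at (snd c p + (0, 0)))" using D by (simp add: zero_prod_def[symmetric])
  from diff_chain_at[OF 1 this]
  have 2: "((\<lambda>s. ?G (snd c p + (0, s))) has_derivative (\<lambda>k. D (0, k))) (at 0)" by (simp only: o_def)
  have "open (snd c ` fst c)" by (rule is_chartD(2)[OF cc])
  moreover have pc: "snd c p \<in> snd c ` fst c" using c(2) by blast
  ultimately obtain e where e: "e > 0" "ball (snd c p) e \<subseteq> snd c ` fst c" using open_contains_ball by blast
  have "((\<lambda>s. ?G (snd c p)) has_derivative (\<lambda>k. D (0, k))) (at 0)"
  proof (rule has_derivative_transform_within_open[OF 2, of "{-e<..<e}"])
    fix s assume "s \<in> {-e<..<e}"
    then have "snd c p + (0, s) \<in> ball (snd c p) e" by (auto simp: dist_norm norm_Pair)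
    then show "?G (snd c p + (0, s)) = ?G (snd c p)" using e(2) pc by (intro plaque_constant[OF c(1)]) auto
  qed (use e in auto)
  moreover have "((\<lambda>s. ?G (snd c p)) has_derivative (\<lambda>k. 0)) (at 0)" by simp
  ultimately have "(\<lambda>k. D (0, k)) = (\<lambda>k. 0)" by (rule has_derivative_unique)
  then have "D (0, 1) = 0" by metis
  then show ?thesis using linear_plane_expand[OF has_derivative_linear[OF D], of v] by simp
qed

text \<open>The map \<open>\<rho>\<close> moves points vertically to the height of \<open>x\<close>.
  A pulled-back function does not notice this, so near \<open>y\<close> it equals its composition
  with \<open>\<rho>\<close>, which inherits smoothness and derivative from
  \<open>x\<close>.\<close>

lemma leaf_function_plaque:
  assumes c: "straight c" and xy: "x \<in> fst c" "y \<in> fst c" "fst (snd c x) = fst (snd c y)"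
    and F: "smooth_near c (f \<circ> proj) x"
  shows "smooth_near c (f \<circ> proj) y"
    "frechet_derivative (f \<circ> proj \<circ> inv_chart c) (at (snd c y)) v =
     frechet_derivative (f \<circ> proj \<circ> inv_chart c) (at (snd c x)) v"
proof -
  note cc = straightD(2)[OF c]
  let ?G = "f \<circ> proj \<circ> inv_chart c"
  obtain U where U: "open U" "snd c x \<in> U" "U \<subseteq> snd c ` fst c" "smooth_on U ?G"
    using F unfolding smooth_near_def by (auto simp: comp_assoc)
  define \<rho> where "\<rho> z = (fst z, snd (snd c x))" for z :: plane
  have \<rho>: "smooth_on UNIV \<rho>" unfolding \<rho>_def
    by (intro smooth_on_Pair smooth_on_const open_UNIV smooth_on_linear bounded_linear_fst)
  let ?U' = "{z \<in> snd c ` fst c. \<rho> z \<in> U}"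
  have oU': "open ?U'" by (rule open_preimage_smooth[OF is_chartD(2)[OF cc] smooth_on_subset[OF \<rho>] U(1)]) simp
  have \<rho>y: "\<rho> (snd c y) = snd c x" using xy(3) by (simp add: \<rho>_def prod_eq_iff)
  have yU': "snd c y \<in> ?U'" using \<rho>y U(2) xy(2) by simp
  have eq: "?G (\<rho> z) = ?G z" if "z \<in> ?U'" for z
    by (rule plaque_constant[OF c]) (use that U(3) in \<open>auto simp: \<rho>_def\<close>)
  have "smooth_on ?U' (\<lambda>z. ?G (\<rho> z))"
    by (rule smooth_on_compose[OF oU' U(1) smooth_on_subset[OF \<rho>] U(4)]) auto
  then have "smooth_on ?U' ?G" by (rule smooth_on_eq[OF oU']) (rule eq)
  then show sy: "smooth_near c (f \<circ> proj) y" unfolding smooth_near_def using oU' yU' by blast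
  have 1: "(\<rho> has_derivative (\<lambda>v. (fst v, 0))) (at (snd c y))" unfolding \<rho>_def
    by (auto intro!: derivative_eq_intros)
  have "(?G has_derivative frechet_derivative ?G (at (snd c x))) (at (\<rho> (snd c y)))"
    unfolding \<rho>y by (rule smooth_near_derivative[OF F])
  from diff_chain_at[OF 1 this]
  have "((\<lambda>z. ?G (\<rho> z)) has_derivative (\<lambda>v. frechet_derivative ?G (at (snd c x)) (fst v, 0))) (at (snd c y))"
    by (simp only: o_def)
  then have "(?G has_derivative (\<lambda>v. frechet_derivative ?G (at (snd c x)) (fst v, 0))) (at (snd c y))"
    by (rule has_derivative_transform_within_open[OF _ oU' yU']) (rule eq)
  from fun_cong[OF frechet_derivative_at[OF this], of v]
  have "frechet_derivative ?G (at (snd c y)) v = frechet_derivative ?G (at (snd c x)) (fst v, 0)" by simp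
  also have "\<dots> = frechet_derivative ?G (at (snd c x)) v"
    using leaf_function_derivative[OF c xy(1) F, of "(fst v, 0)"] leaf_function_derivative[OF c xy(1) F, of v] by simp
  finally show "frechet_derivative ?G (at (snd c y)) v = frechet_derivative ?G (at (snd c x)) v" .
qed

text \<open>A smooth local section of \<open>proj\<close> over \<open>d\<close>: along the
  horizontal line through \<open>p\<close> the function \<open>snd d \<circ> proj\<close> has
  nonzero derivative, and \<open>g\<close> inverts it. The topology \<open>Y\<close> is left general
  so that the lemma also applies to competing quotient structures.\<close>

lemma leaf_chart_inverse:
  fixes d :: "('a set, real) chart"
  assumes d: "is_chart Y d" "continuous_map (mtop M) Y proj" and c: "straight c" "p \<in> fst c"
    and dp: "proj p \<in> fst d" and reg: "regular_near c (snd d \<circ> proj) p"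
  obtains B g where "open B" "snd d (proj p) \<in> B" "smooth_on B g" "B \<subseteq> snd d ` fst d"
    "\<And>r. r \<in> B \<Longrightarrow> (g r, snd (snd c p)) \<in> snd c ` fst c"
    "\<And>r. r \<in> B \<Longrightarrow> proj (inv_chart c (g r, snd (snd c p))) = inv_chart d r"
    "g (snd d (proj p)) = fst (snd c p)"
proof -
  note cc = straightD(2)[OF c(1)]
  let ?G = "snd d \<circ> proj \<circ> inv_chart c"
  define \<tau> where "\<tau> = snd (snd c p)"
  define u where "u = fst (snd c p)"
  have s: "smooth_near c (snd d \<circ> proj) p" using reg by (simp add: regular_near_def)
  obtain U where U: "open U" "snd c p \<in> U" "U \<subseteq> snd c ` fst c" "smooth_on U ?G"
    using s unfolding smooth_near_def by (auto simp: comp_assoc)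
  let ?N = "{q \<in> points M. proj q \<in> fst d}"
  have "openin (mtop M) ?N" using openin_continuous_map_preimage[OF d(2) is_chartD(1)[OF d(1)]] .
  then have oN: "open (snd c ` (?N \<inter> fst c))" by (rule chart_open_image[OF cc])
  let ?V = "U \<inter> snd c ` (?N \<inter> fst c)"
  have oV: "open ?V" using U(1) oN by blast
  have l: "smooth_on UNIV (\<lambda>u::real. (u, \<tau>))" by (intro smooth_on_Pair smooth_on_const smooth_on_id open_UNIV)
  let ?W = "{u \<in> UNIV. (u, \<tau>) \<in> ?V}"
  have oW: "open ?W" by (rule open_preimage_smooth[OF open_UNIV l oV])
  define A where "A u = ?G (u, \<tau>)" for u
  have A: "smooth_on ?W A" unfolding A_def
    by (rule smooth_on_compose[OF oW U(1) smooth_on_subset[OF l] U(4)]) auto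
  have z: "(u, \<tau>) = snd c p" by (simp add: u_def \<tau>_def)
  have uW: "u \<in> ?W" using z U(2) c(2) dp cc is_chartD(5)[OF cc] by auto
  have D: "(?G has_derivative frechet_derivative ?G (at (snd c p))) (at (u, \<tau>))"
    unfolding z using smooth_near_derivative[OF s] .
  have "((\<lambda>u. (u, \<tau>)) has_derivative (\<lambda>k. (k, 0))) (at u)" by (auto intro!: derivative_eq_intros)
  from frechet_compose[OF this D] have A1: "frechet_derivative A (at u) 1 = frechet_derivative ?G (at (snd c p)) (1, 0)"
    unfolding A_def by simp
  obtain v where "frechet_derivative ?G (at (snd c p)) v \<noteq> 0"
    using reg unfolding regular_near_def by (auto simp: comp_assoc)
  then have "frechet_derivative ?G (at (snd c p)) (1, 0) \<noteq> 0"
    using leaf_function_derivative[OF c s, of v] by auto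
  then have "frechet_derivative A (at u) 1 \<noteq> 0" using A1 by simp
  then obtain U1 B g where *: "open U1" "u \<in> U1" "U1 \<subseteq> ?W" "open B" "A u \<in> B" "homeomorphism U1 B A g" "smooth_on B g"
    by (rule local_inverse_real[OF oW A uW])
  have Au: "A u = snd d (proj p)" unfolding A_def z using chart_inv(1)[OF cc c(2)] by simp
  have B: "(g r, \<tau>) \<in> snd c ` fst c \<and> r \<in> snd d ` fst d \<and> proj (inv_chart c (g r, \<tau>)) = inv_chart d r" if r: "r \<in> B" for r
  proof -
    have "g r \<in> ?W" "A (g r) = r" using *(3,6) r by (auto simp: homeomorphism_def)
    then obtain q where q: "q \<in> fst c" "proj q \<in> fst d" "(g r, \<tau>) = snd c q" by blast
    then have "inv_chart c (g r, \<tau>) = q" using chart_inv(1)[OF cc] by simp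
    moreover from this have "snd d (proj q) = r" using \<open>A (g r) = r\<close> by (simp add: A_def)
    ultimately show ?thesis using q inv_chart_eqI[OF d(1) q(2), of r] by auto
  qed
  have "g (snd d (proj p)) = u" using *(2,6) Au by (auto simp: homeomorphism_def)
  then show ?thesis using that[of B g] * B Au unfolding \<tau>_def u_def by auto
qed

text \<open>Composing the pullback of \<open>f\<close> with the section from
  \<open>leaf_chart_inverse\<close> recovers \<open>f\<close> in the chart \<open>d\<close>.
  Smoothness therefore descends, and the chain rule gives the derivative.\<close>

lemma leaf_function_factor:
  fixes d :: "('a set, real) chart"
  assumes d: "is_chart Y d" "continuous_map (mtop M) Y proj" and c: "straight c" "p \<in> fst c"
    and dp: "proj p \<in> fst d" and reg: "regular_near c (snd d \<circ> proj) p"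
    and f: "smooth_near c (f \<circ> proj) p"
  shows "\<exists>B. open B \<and> snd d (proj p) \<in> B \<and> smooth_on B (f \<circ> inv_chart d)"
    "frechet_derivative (f \<circ> proj \<circ> inv_chart c) (at (snd c p)) v =
      frechet_derivative (f \<circ> inv_chart d) (at (snd d (proj p))) 1 *
      frechet_derivative (snd d \<circ> proj \<circ> inv_chart c) (at (snd c p)) v"
proof -
  note cc = straightD(2)[OF c(1)]
  define \<tau> where "\<tau> = snd (snd c p)"
  obtain B g where B: "open B" "snd d (proj p) \<in> B" "smooth_on B g" "B \<subseteq> snd d ` fst d"
    "\<forall>r\<in>B. (g r, \<tau>) \<in> snd c ` fst c"
    "\<forall>r\<in>B. proj (inv_chart c (g r, \<tau>)) = inv_chart d r"
    "g (snd d (proj p)) = fst (snd c p)"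
    unfolding \<tau>_def by (rule leaf_chart_inverse[OF d c dp reg]) blast
  obtain U where U: "open U" "snd c p \<in> U" "U \<subseteq> snd c ` fst c" "smooth_on U (f \<circ> proj \<circ> inv_chart c)"
    using f unfolding smooth_near_def by (auto simp: comp_assoc)
  have gs: "smooth_on B (\<lambda>r. (g r, \<tau>))" by (intro smooth_on_Pair B smooth_on_const)
  let ?B' = "{r \<in> B. (g r, \<tau>) \<in> U}"
  have oB': "open ?B'" by (rule open_preimage_smooth[OF B(1) gs U(1)])
  have pB': "snd d (proj p) \<in> ?B'" using B(2,7) U(2) by (simp add: \<tau>_def)
  have "smooth_on ?B' (\<lambda>r. (f \<circ> proj \<circ> inv_chart c) (g r, \<tau>))"
    by (rule smooth_on_compose[OF oB' U(1) smooth_on_subset[OF gs] U(4)]) auto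
  then have sB: "smooth_on ?B' (f \<circ> inv_chart d)" by (rule smooth_on_eq[OF oB']) (use B(6) in simp)
  then show "\<exists>B. open B \<and> snd d (proj p) \<in> B \<and> smooth_on B (f \<circ> inv_chart d)" using oB' pB' by blast
  let ?N = "{q \<in> points M. proj q \<in> fst d}"
  have "openin (mtop M) ?N" using openin_continuous_map_preimage[OF d(2) is_chartD(1)[OF d(1)]] .
  then have oN: "open (snd c ` (?N \<inter> fst c))" by (rule chart_open_image[OF cc])
  have s: "smooth_near c (snd d \<circ> proj) p" using reg by (simp add: regular_near_def)
  let ?G = "snd d \<circ> proj \<circ> inv_chart c"
  have Gp: "?G (snd c p) = snd d (proj p)" using chart_inv(1)[OF cc c(2)] by simp
  have 1: "(?G has_derivative frechet_derivative ?G (at (snd c p))) (at (snd c p))" by (rule smooth_near_derivative[OF s])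
  have 2: "((f \<circ> inv_chart d) has_derivative frechet_derivative (f \<circ> inv_chart d) (at (snd d (proj p)))) (at (?G (snd c p)))"
    unfolding Gp by (rule smooth_on_has_derivative[OF sB oB' pB'])
  have lin: "linear (frechet_derivative (f \<circ> inv_chart d) (at (snd d (proj p))))" by (rule has_derivative_linear[OF 2])
  from diff_chain_at[OF 1 2]
  have "((f \<circ> proj \<circ> inv_chart c) has_derivative
      frechet_derivative (f \<circ> inv_chart d) (at (snd d (proj p))) \<circ> frechet_derivative ?G (at (snd c p))) (at (snd c p))"
  proof (rule has_derivative_transform_within_open[OF _ oN])
    show "snd c p \<in> snd c ` (?N \<inter> fst c)" using c(2) dp is_chartD(5)[OF cc] by blast
    fix x assume "x \<in> snd c ` (?N \<inter> fst c)"
    then obtain q where "q \<in> fst c" "proj q \<in> fst d" "x = snd c q" by blast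
    then show "((f \<circ> inv_chart d) \<circ> ?G) x = (f \<circ> proj \<circ> inv_chart c) x"
      using chart_inv(1)[OF cc] chart_inv(1)[OF d(1)] by simp
  qed
  from fun_cong[OF frechet_derivative_at[OF this], of v]
  show "frechet_derivative (f \<circ> proj \<circ> inv_chart c) (at (snd c p)) v =
      frechet_derivative (f \<circ> inv_chart d) (at (snd d (proj p))) 1 *
      frechet_derivative (snd d \<circ> proj \<circ> inv_chart c) (at (snd c p)) v"
    using real_linear_apply[OF lin, of "frechet_derivative ?G (at (snd c p)) v"] by (simp add: mult.commute)
qed

text \<open>The smooth structure is described by pullbacks, not by a choice of transversals, and is
  thus maximal and unique from the outset. One straight chart per point is enough by
  \<open>regular_near_change\<close>.\<close>

definition qatlas :: "('a set, real) chart set" where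
  "qatlas = {d. is_chart qtop d \<and>
     (\<forall>p\<in>points M. proj p \<in> fst d \<longrightarrow> (\<exists>c. straight c \<and> p \<in> fst c \<and> regular_near c (snd d \<circ> proj) p))}"

definition qman :: "'a set oriented_curve" where
  "qman = \<lparr>mtop = qtop, atlas = qatlas, pos_charts = {d \<in> qatlas.
       right_chiral_form_on M {p \<in> points M. chi_proj M p \<in> fst d} (\<lambda>c p. mdiff c d (chi_proj M) p)}\<rparr>"

lemma qatlas_regular:
  assumes "d \<in> qatlas" "c \<in> atlas M" "p \<in> fst c" "proj p \<in> fst d"
  shows "regular_near c (snd d \<circ> proj) p"
proof -
  have "p \<in> points M" using smooth_manifoldD(7)[OF sm assms(2)] assms(3) by blast
  then obtain c' where "straight c'" "p \<in> fst c'" "regular_near c' (snd d \<circ> proj) p"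
    using assms unfolding qatlas_def by blast
  then show ?thesis using regular_near_change[OF sm straightD(1) assms(2)] assms(3) by blast
qed

lemma qatlas_chart: "d \<in> qatlas \<Longrightarrow> is_chart qtop d"
  by (simp add: qatlas_def)

lemma mdiff_proj: "mdiff c d proj p = frechet_derivative (snd d \<circ> proj \<circ> inv_chart c) (at (snd c p))"
  by (simp add: mdiff_def local_rep_def comp_assoc)

lemma straight_at: assumes "p \<in> points M" obtains c where "straight c" "p \<in> fst c"
  using straight_exists[OF openin_topspace assms] by metis

text \<open>The transition map is \<open>snd d'\<close> read in the chart \<open>d\<close>; its
  pullback is smooth, so \<open>leaf_function_factor\<close> applies.\<close>

lemma qatlas_transition:
  assumes "d \<in> qatlas" "d' \<in> qatlas"
  shows "smooth_on (snd d ` (fst d \<inter> fst d')) (local_rep d d' (\<lambda>p. p))"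
proof (rule smooth_on_local)
  fix r assume "r \<in> snd d ` (fst d \<inter> fst d')"
  then obtain x where x: "x \<in> fst d" "x \<in> fst d'" "r = snd d x" by blast
  have "x \<in> leaves" using x(1) is_chartD(5)[OF qatlas_chart[OF assms(1)]] topspace_qtop by blast
  then obtain p where p: "p \<in> points M" "x = proj p" using leaf_rep by blast
  obtain c where c: "straight c" "p \<in> fst c" using straight_at[OF p(1)] .
  have "regular_near c (snd d \<circ> proj) p" "regular_near c (snd d' \<circ> proj) p"
    using qatlas_regular assms c straightD(1) x(1,2) p(2) by blast+
  then show "\<exists>U. open U \<and> r \<in> U \<and> smooth_on U (local_rep d d' (\<lambda>p. p))"
    using leaf_function_factor(1)[OF qatlas_chart[OF assms(1)] proj_continuous c, of "snd d'"] x p(2)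
    unfolding local_rep_def regular_near_def by (simp add: o_def)
qed

end

context initial_spacetime
begin

lemma adapted_chart:
  assumes c: "adapted c" and \<sigma>: "\<sigma> = 1 \<or> \<sigma> = (-1::real)"
  obtains d where "d \<in> qatlas" "fst d = proj ` fst c" "\<And>q. q \<in> fst c \<Longrightarrow> snd d (proj q) = \<sigma> * fst (snd c q)"
proof -
  have st: "straight c" using c by (simp only: adapted_def)
  have ad: "\<And>p q. p \<in> fst c \<Longrightarrow> q \<in> fst c \<Longrightarrow> proj p = proj q \<Longrightarrow> fst (snd c p) = fst (snd c q)"
    using c unfolding adapted_def by blast
  note cD = straightD[OF st]
  define U where "U = proj ` fst c"
  define \<phi> where "\<phi> = (\<lambda>x\<in>U. \<sigma> * fst (snd c (SOME q. q \<in> fst c \<and> proj q = x)))"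
  have \<phi>: "\<phi> (proj q) = \<sigma> * fst (snd c q)" if q: "q \<in> fst c" for q
  proof -
    let ?s = "SOME q'. q' \<in> fst c \<and> proj q' = proj q"
    have "?s \<in> fst c \<and> proj ?s = proj q" by (rule someI[of _ q]) (use q in simp)
    then have "fst (snd c ?s) = fst (snd c q)" using ad q by blast
    then show ?thesis using q by (simp add: \<phi>_def U_def)
  qed
  have \<sigma>2: "\<sigma> * \<sigma> = 1" "\<sigma> \<noteq> 0" using \<sigma> by auto
  have mul: "smooth_on UNIV (\<lambda>z::plane. \<sigma> * fst z)"
    by (intro smooth_on_mult smooth_on_const open_UNIV smooth_on_linear bounded_linear_fst)
  have op: "open (\<phi> ` proj ` W)" if W: "openin (mtop M) W" "W \<subseteq> fst c" for W
  proof -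
    have "open (snd c ` (W \<inter> fst c))" by (rule chart_open_image[OF cD(2) W(1)])
    then have oW: "open (snd c ` W)" using W(2) by (simp add: Int_absorb2)
    have "open (fst ` snd c ` W)" using oW by (rule open_image_fst)
    moreover have "\<phi> ` proj ` W = (\<lambda>x. \<sigma> * x) ` fst ` snd c ` W" using \<phi> W(2) by (force simp: image_image)
    ultimately show ?thesis using \<sigma>2(2) open_scaling[of \<sigma> "fst ` snd c ` W"] by simp
  qed
  have Uo: "openin qtop U" unfolding U_def by (rule proj_open[OF is_chartD(1)[OF cD(2)]])
  have "is_chart qtop (U, \<phi>)"
  proof (rule is_chartI[OF Uo])
    show "\<phi> \<in> extensional U" by (simp add: \<phi>_def)
    show "inj_on \<phi> U"
    proof (rule inj_onI)
      fix x y assume xy: "x \<in> U" "y \<in> U" "\<phi> x = \<phi> y"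
      then obtain p q where pq: "p \<in> fst c" "q \<in> fst c" "x = proj p" "y = proj q" unfolding U_def by blast
      then have "\<sigma> * fst (snd c p) = \<sigma> * fst (snd c q)" using xy(3) \<phi> by metis
      then have "fst (snd c p) = fst (snd c q)" using \<sigma>2(2) by simp
      then show "x = y" using proj_plaque[OF st pq(1,2)] pq by simp
    qed
    show "open (\<phi> ` U)" unfolding U_def by (rule op[OF is_chartD(1)[OF cD(2)]]) simp
    show "openin qtop {x \<in> U. \<phi> x \<in> B}" if B: "open B" for B
    proof -
      have "open {z \<in> (UNIV :: plane set). \<sigma> * fst z \<in> B}" by (rule open_preimage_smooth[OF open_UNIV mul B])
      then have "openin (mtop M) {q \<in> fst c. snd c q \<in> {z \<in> (UNIV :: plane set). \<sigma> * fst z \<in> B}}"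
        by (rule chart_open_preimage[OF cD(2)])
      from proj_open[OF this] have "openin qtop (proj ` {q \<in> fst c. snd c q \<in> {z \<in> (UNIV :: plane set). \<sigma> * fst z \<in> B}})" .
      moreover have "proj ` {q \<in> fst c. snd c q \<in> {z \<in> (UNIV :: plane set). \<sigma> * fst z \<in> B}} = {x \<in> U. \<phi> x \<in> B}"
        using \<phi> by (auto simp: U_def)
      ultimately show ?thesis by simp
    qed
    show "open (\<phi> ` V)" if V: "openin qtop V" "V \<subseteq> U" for V
    proof -
      have "openin (mtop M) ({p \<in> points M. proj p \<in> V} \<inter> fst c)"
        using V(1) is_chartD(1)[OF cD(2)] unfolding openin_qtop by blast
      then have "open (\<phi> ` proj ` ({p \<in> points M. proj p \<in> V} \<inter> fst c))" by (rule op) blast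
      moreover have "proj ` ({p \<in> points M. proj p \<in> V} \<inter> fst c) = V" using V(2) cD(3) by (auto simp: U_def)
      ultimately show ?thesis by simp
    qed
  qed
  moreover have "\<exists>k. straight k \<and> p \<in> fst k \<and> regular_near k (\<phi> \<circ> proj) p" if p: "p \<in> points M" "proj p \<in> U" for p
  proof -
    obtain q where q: "q \<in> fst c" "proj q = proj p" using p(2) unfolding U_def by auto
    have qM: "q \<in> points M" using q(1) cD(3) by blast
    have sq: "smooth_on (snd c ` fst c) (\<phi> \<circ> proj \<circ> inv_chart c)"
      by (rule smooth_on_eq[OF is_chartD(2)[OF cD(2)] smooth_on_subset[OF mul]])
        (use \<phi> chart_inv[OF cD(2)] in auto)
    have near: "smooth_near c (\<phi> \<circ> proj) q" unfolding smooth_near_def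
      using sq is_chartD(2)[OF cD(2)] q(1) by (intro exI[of _ "snd c ` fst c"]) auto
    have "(\<phi> \<circ> proj \<circ> inv_chart c has_derivative (\<lambda>v. \<sigma> * fst v)) (at (snd c q))"
    proof (rule has_derivative_transform_within_open[OF _ is_chartD(2)[OF cD(2)]])
      show "((\<lambda>z. \<sigma> * fst z) has_derivative (\<lambda>v. \<sigma> * fst v)) (at (snd c q))" by (auto intro!: derivative_eq_intros)
    qed (use q \<phi> chart_inv[OF cD(2)] in auto)
    from fun_cong[OF frechet_derivative_at[OF this], of "(1, 0)"]
    have "frechet_derivative (\<phi> \<circ> proj \<circ> inv_chart c) (at (snd c q)) (1, 0) \<noteq> 0" using \<sigma>2(2) by simp
    then have reg: "regular_near c (\<phi> \<circ> proj) q" unfolding regular_near_def using near by blast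
    \<comment> \<open>The leaf of \<open>p\<close> passes through \<open>c\<close>, but
      \<open>p\<close> itself may lie elsewhere; regularity at \<open>q\<close> is carried to
      \<open>p\<close> along the leaf.\<close>
    obtain t where "reach q t p" using proj_eq_reach[OF qM p(1) q(2)] by blast
    then have "\<exists>k. straight k \<and> p \<in> fst k \<and> regular_near k (\<phi> \<circ> proj) p"
    proof (rule leaf_induct[where P = "\<lambda>x. \<exists>k. straight k \<and> x \<in> fst k \<and> regular_near k (\<phi> \<circ> proj) x"])
      show "\<exists>k. straight k \<and> q \<in> fst k \<and> regular_near k (\<phi> \<circ> proj) q" using st q(1) reg by blast
      fix k x y assume k: "straight k" "x \<in> fst k" "y \<in> fst k" "fst (snd k x) = fst (snd k y)"
        and "\<exists>k. straight k \<and> x \<in> fst k \<and> regular_near k (\<phi> \<circ> proj) x"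
      then have r: "regular_near k (\<phi> \<circ> proj) x" using regular_near_change[OF sm straightD(1) straightD(1)] by blast
      then have "regular_near k (\<phi> \<circ> proj) y" using leaf_function_plaque[OF k] unfolding regular_near_def by metis
      then show "\<exists>k. straight k \<and> y \<in> fst k \<and> regular_near k (\<phi> \<circ> proj) y" using k by blast
    qed
    then show ?thesis .
  qed
  ultimately have "(U, \<phi>) \<in> qatlas" unfolding qatlas_def by simp
  then show ?thesis using that[of "(U, \<phi>)"] \<phi> by (simp add: U_def)
qed

lemma qatlas_cover: "(\<Union>d\<in>qatlas. fst d) = leaves"
proof
  show "(\<Union>d\<in>qatlas. fst d) \<subseteq> leaves" using is_chartD(5)[OF qatlas_chart] topspace_qtop by blast
  show "leaves \<subseteq> (\<Union>d\<in>qatlas. fst d)"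
  proof
    fix x assume "x \<in> leaves"
    then obtain c s where c: "adapted c" "s \<in> fst c" "x = proj s" by (rule adapted_exists)
    obtain d where "d \<in> qatlas" "fst d = proj ` fst c" by (rule adapted_chart[OF c(1), of 1]) simp
    then show "x \<in> (\<Union>d\<in>qatlas. fst d)" using c(2,3) by blast
  qed
qed

lemma qman_simps: "mtop qman = qtop" "atlas qman = qatlas" "points qman = leaves"
  by (simp_all add: qman_def topspace_qtop)

text \<open>Locally \<open>snd e \<circ> proj\<close> is \<open>snd d \<circ> proj\<close> followed
  by the transition from \<open>d\<close> to \<open>e\<close>. The transition has a smooth inverse,
  hence nonzero derivative, and regularity passes from \<open>d\<close> to \<open>e\<close>.\<close>

lemma qatlas_maximal:
  assumes e: "is_chart qtop e" and compat: "\<And>d. d \<in> qatlas \<Longrightarrow> chart_compat e d"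
  shows "e \<in> qatlas"
  unfolding qatlas_def
proof (intro CollectI conjI e ballI impI)
  fix p assume p: "p \<in> points M" "proj p \<in> fst e"
  obtain d where d: "d \<in> qatlas" "proj p \<in> fst d" using qatlas_cover proj_in[OF p(1)] by blast
  note dc = qatlas_chart[OF d(1)]
  obtain c where c: "straight c" "p \<in> fst c" using straight_at[OF p(1)] .
  note cc = straightD(2)[OF c(1)]
  have reg: "regular_near c (snd d \<circ> proj) p" by (rule qatlas_regular[OF d(1) straightD(1)[OF c(1)] c(2) d(2)])
  then have s: "smooth_near c (snd d \<circ> proj) p" by (simp add: regular_near_def)
  obtain U where U: "open U" "snd c p \<in> U" "U \<subseteq> snd c ` fst c" "smooth_on U (snd d \<circ> proj \<circ> inv_chart c)"
    using s unfolding smooth_near_def by (auto simp: comp_assoc)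
  let ?L = "local_rep d e (\<lambda>p. p)" and ?L' = "local_rep e d (\<lambda>p. p)"
  let ?S = "snd d ` (fst e \<inter> fst d)" and ?S' = "snd e ` (fst e \<inter> fst d)"
  have L: "smooth_on ?S ?L" "smooth_on ?S' ?L'"
    using compat[OF d(1)] by (auto simp: chart_compat_def Int_commute)
  have oS: "open ?S" "open ?S'"
    using chart_open_image[OF dc is_chartD(1)[OF e]] chart_open_image[OF e is_chartD(1)[OF dc]]
    by (simp_all add: Int_commute)
  let ?N = "{q \<in> points M. proj q \<in> fst e \<inter> fst d}"
  have "openin qtop (fst e \<inter> fst d)" using is_chartD(1)[OF e] is_chartD(1)[OF dc] by blast
  then have N: "openin (mtop M) ?N" unfolding openin_qtop by blast
  let ?U' = "U \<inter> snd c ` (?N \<inter> fst c)"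
  have oU': "open ?U'" using U(1) chart_open_image[OF cc N] by blast
  have pU': "snd c p \<in> ?U'" using U(2) p d(2) c(2) by blast
  have m: "(snd d \<circ> proj \<circ> inv_chart c) z \<in> ?S \<and>
      ?L ((snd d \<circ> proj \<circ> inv_chart c) z) = (snd e \<circ> proj \<circ> inv_chart c) z" if z: "z \<in> ?U'" for z
  proof -
    obtain q where q: "q \<in> fst c" "proj q \<in> fst e" "proj q \<in> fst d" "z = snd c q" using z by blast
    then show ?thesis using chart_inv(1)[OF cc] local_rep_apply[OF dc, of "proj q" e "\<lambda>p. p"] by auto
  qed
  have "smooth_on ?U' (\<lambda>z. ?L ((snd d \<circ> proj \<circ> inv_chart c) z))"
    by (rule smooth_on_compose[OF oU' oS(1) smooth_on_subset[OF U(4)] L(1)]) (use m in auto)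
  then have "smooth_on ?U' (snd e \<circ> proj \<circ> inv_chart c)" by (rule smooth_on_eq[OF oU']) (use m in blast)
  then have se: "smooth_near c (snd e \<circ> proj) p" unfolding smooth_near_def using oU' pU' U(3) by blast
  let ?r = "snd d (proj p)"
  have rS: "?r \<in> ?S" "?L ?r = snd e (proj p)" "?L ?r \<in> ?S'"
    using p(2) d(2) local_rep_apply[OF dc d(2), of e "\<lambda>p. p"] by auto
  have D: "(?L has_derivative frechet_derivative ?L (at ?r)) (at ?r)" by (rule smooth_on_has_derivative[OF L(1) oS(1) rS(1)])
  have D': "(?L' has_derivative frechet_derivative ?L' (at (?L ?r))) (at (?L ?r))"
    by (rule smooth_on_has_derivative[OF L(2) oS(2) rS(3)])
  have "((\<lambda>r. r) has_derivative frechet_derivative ?L' (at (?L ?r)) \<circ> frechet_derivative ?L (at ?r)) (at ?r)"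
  proof (rule has_derivative_transform_within_open[OF diff_chain_at[OF D D'] oS(1) rS(1)])
    fix x assume "x \<in> ?S"
    then show "(?L' \<circ> ?L) x = x" using chart_inv(1)[OF dc] chart_inv(1)[OF e] by (auto simp: local_rep_def)
  qed
  from has_derivative_unique[OF this has_derivative_ident]
  have id: "frechet_derivative ?L' (at (?L ?r)) (frechet_derivative ?L (at ?r) 1) = 1" by (metis comp_apply)
  have L1: "frechet_derivative ?L (at ?r) 1 \<noteq> 0"
  proof
    assume "frechet_derivative ?L (at ?r) 1 = 0"
    then show False using id linear_0[OF has_derivative_linear[OF D']] by simp
  qed
  have G: "(snd d \<circ> proj \<circ> inv_chart c has_derivative frechet_derivative (snd d \<circ> proj \<circ> inv_chart c) (at (snd c p))) (at (snd c p))"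
    by (rule smooth_near_derivative[OF s])
  have "(?L has_derivative frechet_derivative ?L (at ?r)) (at ((snd d \<circ> proj \<circ> inv_chart c) (snd c p)))"
    using D chart_inv(1)[OF cc c(2)] by simp
  from diff_chain_at[OF G this]
  have "(snd e \<circ> proj \<circ> inv_chart c has_derivative
      frechet_derivative ?L (at ?r) \<circ> frechet_derivative (snd d \<circ> proj \<circ> inv_chart c) (at (snd c p))) (at (snd c p))"
    by (rule has_derivative_transform_within_open[OF _ oU' pU']) (use m in \<open>simp only: o_apply\<close>)
  from fun_cong[OF frechet_derivative_at[OF this]]
  have De: "frechet_derivative (snd e \<circ> proj \<circ> inv_chart c) (at (snd c p)) v =
      frechet_derivative (snd d \<circ> proj \<circ> inv_chart c) (at (snd c p)) v * frechet_derivative ?L (at ?r) 1" for v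
    using real_linear_apply[OF has_derivative_linear[OF D]] by (metis comp_apply)
  obtain v where "frechet_derivative (snd d \<circ> proj \<circ> inv_chart c) (at (snd c p)) v \<noteq> 0"
    using reg by (auto simp: regular_near_def comp_assoc)
  then have "frechet_derivative (snd e \<circ> proj \<circ> inv_chart c) (at (snd c p)) v \<noteq> 0" unfolding De using L1 by simp
  then show "\<exists>c. straight c \<and> p \<in> fst c \<and> regular_near c (snd e \<circ> proj) p"
    using c se unfolding regular_near_def by blast
qed

lemma sm_q: "smooth_manifold qman"
  unfolding smooth_manifold_def qman_simps
proof (intro conjI ballI allI impI)
  show "chart_compat c d" if "c \<in> qatlas" "d \<in> qatlas" for c d
    using qatlas_transition[OF that] qatlas_transition[OF that(2,1)] by (simp add: chart_compat_def Int_commute)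
  show "c \<in> qatlas" if "is_chart qtop c \<and> (\<forall>d\<in>qatlas. chart_compat c d)" for c
    using qatlas_maximal that by blast
qed (use qtop_Hausdorff qtop_paracompact qatlas_chart qatlas_cover topspace_qtop in auto)

lemma proj_smooth: "smooth_map M qman proj"
  unfolding smooth_map_on_def qman_simps
proof (intro conjI ballI)
  fix c d assume cd: "c \<in> atlas M" "d \<in> qatlas"
  show "smooth_on (snd c ` {p \<in> points M \<inter> fst c. proj p \<in> fst d}) (local_rep c d proj)"
  proof (rule smooth_on_local)
    fix x assume "x \<in> snd c ` {p \<in> points M \<inter> fst c. proj p \<in> fst d}"
    then obtain p where p: "p \<in> fst c" "proj p \<in> fst d" "x = snd c p" by blast
    have "smooth_near c (snd d \<circ> proj) p" using qatlas_regular[OF cd(2,1) p(1,2)] by (simp add: regular_near_def)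
    then show "\<exists>U. open U \<and> x \<in> U \<and> smooth_on U (local_rep c d proj)"
      unfolding smooth_near_def local_rep_def p(3) by (auto simp: comp_assoc)
  qed
qed (use proj_continuous in auto)

lemma proj_submersion: "submersion M qman proj"
  unfolding submersion_def qman_simps
proof (intro conjI ballI impI)
  show "smooth_map M qman proj" by (rule proj_smooth)
  fix c d p assume *: "c \<in> atlas M" "d \<in> qatlas" "p \<in> fst c" "proj p \<in> fst d"
  have "p \<in> points M" using smooth_manifoldD(7)[OF sm *(1)] *(3) by blast
  then have "linear (mdiff c d proj p)"
    by (intro mdiff_linear[OF sm sm_q proj_smooth]) (use * in \<open>simp_all add: qman_simps\<close>)
  then show "surj (mdiff c d proj p)"
    using qatlas_regular[OF *(2,1,3,4)] surj_linear_real[of "mdiff c d proj p"]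
    unfolding mdiff_proj regular_near_def by blast
qed

text \<open>For a competing structure the local sections of \<open>leaf_chart_inverse\<close> show
  that \<open>proj\<close> is open, so its topology is the quotient topology. The submersion
  condition puts its charts into \<open>qatlas\<close>, and maximality of its atlas gives the
  converse.\<close>

lemma quotient_unique:
  assumes X: "smooth_manifold X" and pX: "points X = leaves" and sub: "submersion M X proj"
  shows "mtop X = qtop" "atlas X = qatlas"
proof -
  have smX: "smooth_map M X proj" using sub by (simp add: submersion_def)
  have cont: "continuous_map (mtop M) (mtop X) proj" using smooth_map_onD(2)[OF smX] by simp
  have reg: "regular_near c (snd d \<circ> proj) p" if *: "c \<in> atlas M" "d \<in> atlas X" "p \<in> fst c" "proj p \<in> fst d" for c d p
  proof -
    have "p \<in> points M" using smooth_manifoldD(7)[OF sm *(1)] *(3) by blast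
    let ?U = "snd c ` {p \<in> points M \<inter> fst c. proj p \<in> fst d}"
    have "open ?U" by (rule local_rep_domain_open(2)[OF smooth_manifoldD(3)[OF sm *(1)] smooth_manifoldD(3)[OF X *(2)] smooth_map_onD(1,2)[OF smX]])
    moreover have "snd c p \<in> ?U" using * \<open>p \<in> points M\<close> by blast
    moreover have "smooth_on ?U (snd d \<circ> proj \<circ> inv_chart c)"
      using smooth_map_onD(3)[OF smX *(1,2)] by (simp add: local_rep_def comp_assoc)
    ultimately have s: "smooth_near c (snd d \<circ> proj) p" unfolding smooth_near_def by (intro exI[of _ ?U]) auto
    have "surj (mdiff c d proj p)" using sub * unfolding submersion_def by blast
    moreover have "linear (mdiff c d proj p)" unfolding mdiff_proj by (rule has_derivative_linear[OF smooth_near_derivative[OF s]])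
    ultimately have "\<exists>v. mdiff c d proj p v \<noteq> 0" using surj_linear_real by blast
    then show ?thesis unfolding regular_near_def using s by (simp add: mdiff_proj)
  qed
  have open_proj: "openin (mtop X) (proj ` W)" if W: "openin (mtop M) W" for W
  proof -
    have "\<exists>N. openin (mtop X) N \<and> x \<in> N \<and> N \<subseteq> proj ` W" if x: "x \<in> proj ` W" for x
    proof -
      obtain p where p: "p \<in> W" "x = proj p" using x by blast
      have pM: "p \<in> points M" using p(1) W openin_subset by blast
      obtain c where c: "straight c" "p \<in> fst c" "fst c \<subseteq> W" by (rule straight_exists[OF W p(1)])
      have "proj p \<in> points X" unfolding pX by (rule proj_in[OF pM])
      then obtain d where d: "d \<in> atlas X" "proj p \<in> fst d" using smooth_manifoldD(5)[OF X] by blast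
      note dc = smooth_manifoldD(3)[OF X d(1)]
      obtain B g where B: "open B" "snd d (proj p) \<in> B" "B \<subseteq> snd d ` fst d"
        "\<forall>r\<in>B. (g r, snd (snd c p)) \<in> snd c ` fst c"
        "\<forall>r\<in>B. proj (inv_chart c (g r, snd (snd c p))) = inv_chart d r"
        by (rule leaf_chart_inverse[OF dc cont c(1,2) d(2) reg[OF straightD(1)[OF c(1)] d(1) c(2) d(2)]]) blast
      let ?N = "{y \<in> fst d. snd d y \<in> B}"
      have "openin (mtop X) ?N" by (rule chart_open_preimage[OF dc B(1)])
      moreover have "x \<in> ?N" using B(2) d(2) p(2) by simp
      moreover have "?N \<subseteq> proj ` W"
      proof
        fix y assume y: "y \<in> ?N"
        then have "y = proj (inv_chart c (g (snd d y), snd (snd c p)))" using B(5) chart_inv(1)[OF dc] by auto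
        moreover have "inv_chart c (g (snd d y), snd (snd c p)) \<in> fst c"
          using B(4) y chart_inv(3)[OF straightD(2)[OF c(1)]] by auto
        ultimately show "y \<in> proj ` W" using c(3) by blast
      qed
      ultimately show ?thesis by (intro exI[of _ ?N] conjI)
    qed
    then show ?thesis by (subst openin_subopen) blast
  qed
  show top: "mtop X = qtop"
  proof (rule topology_eq[THEN iffD2], intro allI iffI)
    fix U assume U: "openin (mtop X) U"
    have "U \<subseteq> leaves" using openin_subset[OF U] pX by simp
    moreover have "openin (mtop M) {p \<in> points M. proj p \<in> U}" using openin_continuous_map_preimage[OF cont U] .
    ultimately show "openin qtop U" unfolding openin_qtop by blast
  next
    fix U assume U: "openin qtop U"
    then have "openin (mtop X) (proj ` {p \<in> points M. proj p \<in> U})" unfolding openin_qtop using open_proj by blast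
    moreover have "proj ` {p \<in> points M. proj p \<in> U} = U" using U leaf_rep unfolding openin_qtop by blast
    ultimately show "openin (mtop X) U" by simp
  qed
  have 1: "atlas X \<subseteq> qatlas"
  proof
    fix d assume d: "d \<in> atlas X"
    have "\<exists>c. straight c \<and> p \<in> fst c \<and> regular_near c (snd d \<circ> proj) p" if p: "p \<in> points M" "proj p \<in> fst d" for p
    proof -
      obtain c where c: "straight c" "p \<in> fst c" using straight_at[OF p(1)] .
      then show ?thesis using reg[OF straightD(1)[OF c(1)] d c(2) p(2)] by blast
    qed
    then show "d \<in> qatlas" unfolding qatlas_def using smooth_manifoldD(3)[OF X d] top by simp
  qed
  moreover have "qatlas \<subseteq> atlas X"
  proof
    fix e assume e: "e \<in> qatlas"
    show "e \<in> atlas X"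
    proof (rule smooth_manifoldD(6)[OF X])
      show "is_chart (mtop X) e" unfolding top by (rule qatlas_chart[OF e])
      fix d assume "d \<in> atlas X"
      then have "d \<in> qatlas" using 1 by blast
      then show "chart_compat e d"
        using qatlas_transition[OF e, of d] qatlas_transition[OF _ e, of d] by (simp add: chart_compat_def Int_commute)
    qed
  qed
  ultimately show "atlas X = qatlas" by blast
qed

end

section \<open>The orientation of the leaf space\<close>

context framed_spacetime
begin

lemma proj_near:
  assumes "d \<in> qatlas" "c \<in> atlas M" "p \<in> fst c" "proj p \<in> fst d"
  shows "smooth_near c (snd d \<circ> proj) p"
  using qatlas_regular[OF assms] by (simp add: regular_near_def)

lemma mdiff_proj_linear:
  assumes "d \<in> qatlas" "c \<in> atlas M" "p \<in> fst c" "proj p \<in> fst d"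
  shows "linear (mdiff c d proj p)"
  unfolding mdiff_proj by (rule has_derivative_linear[OF smooth_near_derivative[OF proj_near[OF assms]]])

lemma mdiff_proj_change:
  assumes "d \<in> qatlas" "c \<in> atlas M" "k \<in> atlas M" "p \<in> fst c" "p \<in> fst k" "proj p \<in> fst d"
  shows "mdiff c d proj p v = mdiff k d proj p (mdiff c k (\<lambda>q. q) p v)"
  unfolding mdiff_proj by (rule smooth_near_change(2)[OF sm assms(3,2,5,4) proj_near[OF assms(1,3,5,6)]])

lemma mdiff_proj_straight:
  assumes "d \<in> qatlas" "straight k" "p \<in> fst k" "proj p \<in> fst d"
  shows "mdiff k d proj p v = fst v * mdiff k d proj p (1, 0)"
  unfolding mdiff_proj
  by (rule leaf_function_derivative[OF assms(2,3) proj_near[OF assms(1) straightD(1)[OF assms(2)] assms(3,4)]])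

lemma mdiff_proj_null:
  assumes "d \<in> qatlas" "c \<in> atlas M" "p \<in> fst c" "proj p \<in> fst d"
  shows "mdiff c d proj p (null_field c p) = 0"
proof -
  have "p \<in> points M" using smooth_manifoldD(7)[OF sm assms(2)] assms(3) by blast
  then obtain k where k: "straight k" "p \<in> fst k" by (rule straight_at)
  have "mdiff c k (\<lambda>q. q) p (null_field c p) = (0, 1)"
    using null_field_transform[OF assms(2) straightD(1)[OF k(1)] assms(3) k(2)] straightD(4)[OF k] by simp
  then show ?thesis
    using mdiff_proj_change[OF assms(1,2) straightD(1)[OF k(1)] assms(3) k(2) assms(4), of "null_field c p"]
      mdiff_proj_straight[OF assms(1) k assms(4), of "(0, 1)"] by simp
qed

text \<open>Both sides are linear forms that vanish on the null field and agree on \<open>T\<close>.\<close>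

lemma mdiff_proj_form:
  assumes "d \<in> qatlas" "c \<in> atlas M" "p \<in> fst c" "proj p \<in> fst d"
  shows "mdiff c d proj p v = - mdiff c d proj p (T c p) * g c p (null_field c p) v"
proof -
  interpret L: lorentz_plane "g c p" "Om c p" by (rule lorentz[OF Om_in assms(2,3)])
  let ?n = "null_field c p" and ?l = "mdiff c d proj p"
  note lin = mdiff_proj_linear[OF assms] and n = null_field[OF assms(2,3)]
  define w where "w = v + g c p ?n v *\<^sub>R T c p"
  have "g c p ?n w = g c p ?n v + g c p ?n v * g c p ?n (T c p)"
    unfolding w_def using bilinear_linear(1)[OF L.g_bil] by (simp add: linear_add linear_scale)
  then have "g c p ?n w = 0" using n(2) L.g_sym[of ?n "T c p"] by simp
  then obtain k where "w = k *\<^sub>R ?n" using L.null_orthogonal[OF n(1) null_field_nonzero[OF assms(2,3)]] by blast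
  then have "?l w = 0" using lin mdiff_proj_null[OF assms] by (simp add: linear_scale)
  then have "?l v + ?l (T c p) * g c p ?n v = 0"
    unfolding w_def using lin by (simp add: linear_add linear_scale mult.commute)
  then show ?thesis by simp
qed

lemma mdiff_proj_T_nonzero:
  assumes "d \<in> qatlas" "c \<in> atlas M" "p \<in> fst c" "proj p \<in> fst d"
  shows "mdiff c d proj p (T c p) \<noteq> 0"
proof
  assume "mdiff c d proj p (T c p) = 0"
  then have "mdiff c d proj p v = 0" for v using mdiff_proj_form[OF assms, of v] by simp
  moreover obtain v where "mdiff c d proj p v \<noteq> 0"
    using qatlas_regular[OF assms] unfolding regular_near_def mdiff_proj by blast
  ultimately show False by simp
qed

lemma mdiff_proj_T_change:
  assumes "d \<in> qatlas" "c \<in> atlas M" "k \<in> atlas M" "p \<in> fst c" "p \<in> fst k" "proj p \<in> fst d"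
  shows "mdiff c d proj p (T c p) = mdiff k d proj p (T k p)"
proof -
  have "p \<in> points M" using smooth_manifoldD(7)[OF sm assms(2)] assms(4) by blast
  then show ?thesis
    using mdiff_proj_change[OF assms, of "T c p"] vector_field_transform[OF T_smooth assms(2,3) _ assms(4,5)] by simp
qed

text \<open>In signature \<open>(-+)\<close> a form \<open>g(X, -)\<close> with \<open>X\<close>
  future-directed null is negative on future-directed timelike vectors; this explains the
  sign.\<close>

definition positive :: "('a set, real) chart \<Rightarrow> bool" where
  "positive d \<longleftrightarrow> (\<forall>p\<in>points M. \<forall>c\<in>atlas M. p \<in> fst c \<longrightarrow> proj p \<in> fst d \<longrightarrow> mdiff c d proj p (T c p) < 0)"

lemma right_chiral_form_iff:
  assumes d: "d \<in> qatlas"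
  shows "right_chiral_form_on M {p \<in> points M. proj p \<in> fst d} (\<lambda>c p. mdiff c d proj p) \<longleftrightarrow> positive d"
proof
  assume "right_chiral_form_on M {p \<in> points M. proj p \<in> fst d} (\<lambda>c p. mdiff c d proj p)"
  then obtain X where X: "\<And>c p v. c \<in> atlas M \<Longrightarrow> p \<in> {p \<in> points M. proj p \<in> fst d} \<inter> fst c \<Longrightarrow>
      mdiff c d proj p v = g c p (X c p) v \<and> future_right_null M c p (X c p)"
    unfolding right_chiral_form_on_def by blast
  show "positive d" unfolding positive_def
  proof (intro ballI impI)
    fix p c assume *: "p \<in> points M" "c \<in> atlas M" "p \<in> fst c" "proj p \<in> fst d"
    interpret L: lorentz_plane "g c p" "Om c p" by (rule lorentz[OF Om_in *(2,3)])
    have "mdiff c d proj p (T c p) = g c p (X c p) (T c p)" "future_right_null M c p (X c p)"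
      using X[OF *(2), of p] * by auto
    then show "mdiff c d proj p (T c p) < 0"
      using L.g_sym[of "X c p" "T c p"] unfolding future_right_null_iff[OF *(2,3)] by simp
  qed
next
  assume pos: "positive d"
  let ?W = "{p \<in> points M. proj p \<in> fst d}"
  \<comment> \<open>\<open>mdiff_proj_form\<close> dictates this field: the differential of the
    coordinate is \<open>g(X, -)\<close>, and positivity of \<open>d\<close> makes \<open>X\<close>
    a positive multiple of the null field.\<close>
  define X where "X c p = (- mdiff c d proj p (T c p)) *\<^sub>R null_field c p" for c p
  note dc = qatlas_chart[OF d]
  have oW: "openin (mtop M) ?W" using is_chartD(1)[OF dc] unfolding openin_qtop by blast
  show "right_chiral_form_on M ?W (\<lambda>c p. mdiff c d proj p)"
    unfolding right_chiral_form_on_def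
  proof (intro exI[of _ X] conjI ballI allI)
    show "smooth_vector_field_on M ?W X" unfolding smooth_vector_field_on_def
    proof (intro conjI ballI)
      fix c assume c: "c \<in> atlas M"
      note cc = smooth_manifoldD(3)[OF sm c]
      let ?S = "snd c ` (?W \<inter> fst c)"
      have oS: "open ?S" by (rule chart_open_image[OF cc oW])
      have sub: "?S \<subseteq> snd c ` fst c" by blast
      have G: "smooth_on ?S (snd d \<circ> proj \<circ> inv_chart c)"
      proof (rule smooth_on_local)
        fix x assume "x \<in> ?S"
        then obtain p where p: "p \<in> fst c" "proj p \<in> fst d" "x = snd c p" by blast
        show "\<exists>U. open U \<and> x \<in> U \<and> smooth_on U (snd d \<circ> proj \<circ> inv_chart c)"
          using proj_near[OF d c p(1,2)] unfolding smooth_near_def p(3) by blast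
      qed
      have "smooth_on ?S (\<lambda>x. frechet_derivative (snd d \<circ> proj \<circ> inv_chart c) (at x) (T c (inv_chart c x)))"
        by (rule smooth_on_frechet_apply[OF oS G smooth_on_subset[OF vector_field_smooth[OF T_smooth c] sub]])
      then have "smooth_on ?S (\<lambda>x. (- frechet_derivative (snd d \<circ> proj \<circ> inv_chart c) (at x) (T c (inv_chart c x))) *\<^sub>R
          null_field c (inv_chart c x))"
        by (intro smooth_on_scaleR smooth_on_minus oS smooth_on_subset[OF vector_field_smooth[OF null_field_smooth c] sub])
      then show "smooth_on ?S (\<lambda>x. X c (inv_chart c x))"
      proof (rule smooth_on_eq[OF oS])
        fix x assume "x \<in> ?S"
        then have "snd c (inv_chart c x) = x" using chart_inv(2)[OF cc] by blast
        then show "(- frechet_derivative (snd d \<circ> proj \<circ> inv_chart c) (at x) (T c (inv_chart c x))) *\<^sub>R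
            null_field c (inv_chart c x) = X c (inv_chart c x)"
          by (simp add: X_def mdiff_proj)
      qed
    next
      fix c k p assume c: "c \<in> atlas M" "k \<in> atlas M" and p: "p \<in> ?W \<inter> fst c \<inter> fst k"
      then have *: "p \<in> fst c" "p \<in> fst k" "proj p \<in> fst d" by auto
      show "X k p = mdiff c k (\<lambda>q. q) p (X c p)"
        unfolding X_def mdiff_proj_T_change[OF d c *] linear_scale[OF transition_linear[OF sm c *(1,2)]]
          null_field_transform[OF c *(1,2)] ..
    qed
    fix c p assume c: "c \<in> atlas M" and "p \<in> ?W \<inter> fst c"
    then have p: "p \<in> points M" "p \<in> fst c" "proj p \<in> fst d" by auto
    interpret L: lorentz_plane "g c p" "Om c p" by (rule lorentz[OF Om_in c p(2)])
    show "mdiff c d proj p v = g c p (X c p) v" for v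
      unfolding X_def linear_scale[OF bilinear_linear(2)[OF L.g_bil]] real_scaleR_def
      by (rule mdiff_proj_form[OF d c p(2,3)])
    show "future_right_null M c p (X c p)"
      unfolding future_right_null_ray[OF c p(2)] X_def using pos c p unfolding positive_def
      by (intro exI[of _ "- mdiff c d proj p (T c p)"]) auto
  qed
qed

text \<open>A vertical vector is null, so \<open>T\<close> is nowhere vertical; the square is
  connected and the horizontal component keeps its sign.\<close>

lemma T_transverse_sign:
  assumes "straight c" shows "(\<forall>q\<in>fst c. fst (T c q) < 0) \<or> (\<forall>q\<in>fst c. fst (T c q) > 0)"
proof -
  note cD = straightD[OF assms]
  obtain e where e: "e > 0" "snd c ` fst c = square e" by (rule straight_square[OF assms])
  define f where "f z = fst (T c (inv_chart c z))" for z
  have "continuous_on (square e) (\<lambda>z. T c (inv_chart c z))"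
    using smooth_on_imp_continuous_on[OF vector_field_smooth[OF T_smooth cD(1)]] e(2) by simp
  then have "continuous_on (square e) f" unfolding f_def by (rule continuous_on_fst)
  moreover have "connected (square e)" by (intro connected_Times) auto
  ultimately have iv: "is_interval (f ` square e)"
    using connected_continuous_image is_interval_connected_1 by blast
  have nz: "fst (T c q) \<noteq> 0" if q: "q \<in> fst c" for q
  proof
    interpret L: lorentz_plane "g c q" "Om c q" by (rule lorentz[OF Om_in cD(1) q])
    assume "fst (T c q) = 0"
    then have "T c q = snd (T c q) *\<^sub>R null_field c q" using cD(4)[OF q] by (simp add: prod_eq_iff)
    then have "g c q (T c q) (T c q) = snd (T c q) * (snd (T c q) * g c q (null_field c q) (null_field c q))"
      using linear_scale[OF bilinear_linear(1)[OF L.g_bil]] linear_scale[OF bilinear_linear(2)[OF L.g_bil]]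
      by (metis real_scaleR_def)
    then show False using null_field(1)[OF cD(1) q] timelike[OF T_in cD(1) q] by simp
  qed
  have im: "fst (T c q) \<in> f ` square e" if "q \<in> fst c" for q
    unfolding e(2)[symmetric] f_def using chart_inv(1)[OF cD(2) that] that by (intro image_eqI[of _ _ "snd c q"]) auto
  show ?thesis
  proof (rule ccontr)
    assume "\<not> ?thesis"
    then obtain q q' where q: "q \<in> fst c" "q' \<in> fst c" "0 \<le> fst (T c q)" "fst (T c q') \<le> 0" by (meson not_less)
    then have "0 \<in> f ` square e" using mem_is_interval_1_I[OF iv im im, of q' q 0] by blast
    then obtain z where "z \<in> snd c ` fst c" "f z = 0" using e(2) by auto
    then show False using nz chart_inv(3)[OF cD(2)] by (auto simp: f_def)
  qed
qed

lemma qatlas_transition_derivative: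
  assumes d: "d \<in> qatlas" "d' \<in> qatlas" and c: "straight c" "p \<in> fst c" and p: "proj p \<in> fst d" "proj p \<in> fst d'"
  shows "mdiff c d' proj p v = mdiff d d' (\<lambda>q. q) (proj p) 1 * mdiff c d proj p v"
proof -
  have "mdiff d d' (\<lambda>q. q) (proj p) = frechet_derivative (snd d' \<circ> inv_chart d) (at (snd d (proj p)))"
    by (simp add: mdiff_def local_rep_def o_def)
  then show ?thesis unfolding mdiff_proj
    using leaf_function_factor(2)[OF qatlas_chart[OF d(1)] proj_continuous c p(1)
      qatlas_regular[OF d(1) straightD(1)[OF c(1)] c(2) p(1)] proj_near[OF d(2) straightD(1)[OF c(1)] c(2) p(2)]]
    by simp
qed

end

context initial_spacetime
begin

text \<open>The sign \<open>\<sigma>\<close> is fitted to \<open>T\<close> on the adapted chart, but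
  \<open>positive\<close> concerns all points over its image. The sign travels along leaves: within
  a plaque the horizontal derivative of \<open>proj\<close> is constant and \<open>T\<close> does
  not change sides.\<close>

lemma positive_cover:
  assumes "x \<in> leaves" obtains d where "d \<in> qatlas" "positive d" "x \<in> fst d"
proof -
  obtain c s where c: "adapted c" "s \<in> fst c" "x = proj s" using assms by (rule adapted_exists)
  have st: "straight c" using c(1) by (simp only: adapted_def)
  note cD = straightD[OF st]
  define \<sigma> :: real where "\<sigma> = (if \<forall>q\<in>fst c. fst (T c q) < 0 then 1 else -1)"
  have \<sigma>: "\<sigma> = 1 \<or> \<sigma> = -1" by (simp add: \<sigma>_def)
  have \<sigma>T: "\<sigma> * fst (T c q) < 0" if q: "q \<in> fst c" for q
  proof (cases "\<forall>q\<in>fst c. fst (T c q) < 0")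
    case True
    then show ?thesis using q by (simp add: \<sigma>_def)
  next
    case False
    then have "\<forall>q\<in>fst c. fst (T c q) > 0" using T_transverse_sign[OF st] by blast
    then show ?thesis using False q by (simp add: \<sigma>_def)
  qed
  obtain d where d: "d \<in> qatlas" "fst d = proj ` fst c" "\<And>q. q \<in> fst c \<Longrightarrow> snd d (proj q) = \<sigma> * fst (snd c q)"
    by (rule adapted_chart[OF c(1) \<sigma>]) blast
  have base: "mdiff c d proj q (T c q) < 0" if q: "q \<in> fst c" for q
  proof -
    have "(local_rep c d proj has_derivative (\<lambda>v. \<sigma> * fst v)) (at (snd c q))"
    proof (rule has_derivative_transform_within_open[OF _ is_chartD(2)[OF cD(2)]])
      show "((\<lambda>z. \<sigma> * fst z) has_derivative (\<lambda>v. \<sigma> * fst v)) (at (snd c q))" by (auto intro!: derivative_eq_intros)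
      show "snd c q \<in> snd c ` fst c" using q by blast
      fix x assume "x \<in> snd c ` fst c"
      then show "\<sigma> * fst x = local_rep c d proj x" using d(3) chart_inv(1)[OF cD(2)] by (auto simp: local_rep_def)
    qed
    from fun_cong[OF frechet_derivative_at[OF this], of "T c q"]
    show ?thesis using \<sigma>T[OF q] by (simp add: mdiff_def)
  qed
  have "positive d" unfolding positive_def
  proof (intro ballI impI)
    fix p k assume p: "p \<in> points M" and k: "k \<in> atlas M" "p \<in> fst k" and pd: "proj p \<in> fst d"
    obtain q where q: "q \<in> fst c" "proj q = proj p" using pd unfolding d(2) by auto
    have qM: "q \<in> points M" using q(1) cD(3) by blast
    obtain t where "reach q t p" using proj_eq_reach[OF qM p q(2)] by blast
    then have "proj p \<in> fst d \<and> (\<exists>k. straight k \<and> p \<in> fst k \<and> mdiff k d proj p (T k p) < 0)"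
    proof (rule leaf_induct[where P = "\<lambda>x. proj x \<in> fst d \<and> (\<exists>k. straight k \<and> x \<in> fst k \<and> mdiff k d proj x (T k x) < 0)"])
      show "proj q \<in> fst d \<and> (\<exists>k. straight k \<and> q \<in> fst k \<and> mdiff k d proj q (T k q) < 0)"
        using st q base d(2) by blast
      fix k x y assume k: "straight k" "x \<in> fst k" "y \<in> fst k" "fst (snd k x) = fst (snd k y)"
        and "proj x \<in> fst d \<and> (\<exists>k. straight k \<and> x \<in> fst k \<and> mdiff k d proj x (T k x) < 0)"
      then obtain k' where x: "proj x \<in> fst d" "straight k'" "x \<in> fst k'" "mdiff k' d proj x (T k' x) < 0" by blast
      note kD = straightD[OF k(1)]
      have y: "proj y \<in> fst d" using proj_plaque[OF k] x(1) by simp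
      have "mdiff k d proj x (T k x) < 0"
        using mdiff_proj_T_change[OF d(1) kD(1) straightD(1)[OF x(2)] k(2) x(3,1)] x(4) by simp
      then have "fst (T k x) * mdiff k d proj x (1, 0) < 0"
        using mdiff_proj_straight[OF d(1) k(1,2) x(1), of "T k x"] by simp
      moreover have "mdiff k d proj y (1, 0) = mdiff k d proj x (1, 0)"
        unfolding mdiff_proj by (rule leaf_function_plaque(2)[OF k proj_near[OF d(1) kD(1) k(2) x(1)]])
      ultimately have "fst (T k y) * mdiff k d proj y (1, 0) < 0"
        using T_transverse_sign[OF k(1)] k(2,3) unfolding mult_less_0_iff by (metis less_asym)
      then have "mdiff k d proj y (T k y) < 0" using mdiff_proj_straight[OF d(1) k(1,3) y, of "T k y"] by simp
      then show "proj y \<in> fst d \<and> (\<exists>k. straight k \<and> y \<in> fst k \<and> mdiff k d proj y (T k y) < 0)"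
        using k y by blast
    qed
    then obtain k' where k': "straight k'" "p \<in> fst k'" "mdiff k' d proj p (T k' p) < 0" by blast
    then show "mdiff k d proj p (T k p) < 0"
      using mdiff_proj_T_change[OF d(1) k(1) straightD(1)[OF k'(1)] k(2) k'(2) pd] by simp
  qed
  moreover have "x \<in> fst d" using c(2,3) d(2) by blast
  ultimately show ?thesis using that d(1) by blast
qed

lemma qman_pos: "pos_charts qman = {d \<in> qatlas. positive d}"
  unfolding qman_def using right_chiral_form_iff by auto

lemma qman_oriented: "oriented_1manifold qman"
  unfolding oriented_1manifold_def qman_simps qman_pos topspace_qtop
proof (intro conjI sm_q ballI impI)
  show "(\<Union>c\<in>{d \<in> qatlas. positive d}. fst c) = leaves"
  proof
    show "(\<Union>c\<in>{d \<in> qatlas. positive d}. fst c) \<subseteq> leaves" using qatlas_cover by blast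
    show "leaves \<subseteq> (\<Union>c\<in>{d \<in> qatlas. positive d}. fst c)" using positive_cover by blast
  qed
next
  fix d d' x assume d: "d \<in> {d \<in> qatlas. positive d}" "d' \<in> {d \<in> qatlas. positive d}" and x: "x \<in> fst d \<inter> fst d'"
  have "x \<in> leaves" using x d(1) qatlas_cover by blast
  then obtain p where p: "p \<in> points M" "x = proj p" using leaf_rep by blast
  obtain c where c: "straight c" "p \<in> fst c" using straight_at[OF p(1)] .
  have neg: "mdiff c d proj p (T c p) < 0" "mdiff c d' proj p (T c p) < 0"
    using d x p c straightD(1)[OF c(1)] unfolding positive_def by auto
  have "mdiff c d' proj p (T c p) = mdiff d d' (\<lambda>q. q) x 1 * mdiff c d proj p (T c p)"
    using qatlas_transition_derivative[OF _ _ c, of d d' "T c p"] d x p by simp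
  then have "mdiff d d' (\<lambda>q. q) x 1 * mdiff c d proj p (T c p) < 0" using neg(2) by simp
  then show "0 < mdiff d d' (\<lambda>q. q) x 1" using neg(1) by (auto simp: mult_less_0_iff)
next
  fix d assume d: "d \<in> qatlas"
    and pos: "\<forall>d'\<in>{d \<in> qatlas. positive d}. \<forall>x\<in>fst d \<inter> fst d'. 0 < mdiff d d' (\<lambda>q. q) x 1"
  have "positive d" unfolding positive_def
  proof (intro ballI impI)
    fix p k assume p: "p \<in> points M" and k: "k \<in> atlas M" "p \<in> fst k" and pd: "proj p \<in> fst d"
    obtain d' where d': "d' \<in> qatlas" "positive d'" "proj p \<in> fst d'" by (rule positive_cover[OF proj_in[OF p]])
    obtain c where c: "straight c" "p \<in> fst c" using straight_at[OF p] .
    have "mdiff c d' proj p (T c p) = mdiff d d' (\<lambda>q. q) (proj p) 1 * mdiff c d proj p (T c p)"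
      by (rule qatlas_transition_derivative[OF d d'(1) c pd d'(3)])
    moreover have "mdiff c d' proj p (T c p) < 0" using d' p c straightD(1)[OF c(1)] unfolding positive_def by blast
    moreover have "0 < mdiff d d' (\<lambda>q. q) (proj p) 1" using pos d' pd by blast
    ultimately have "mdiff c d proj p (T c p) < 0" by (auto simp: mult_less_0_iff)
    then show "mdiff k d proj p (T k p) < 0"
      using mdiff_proj_T_change[OF d k(1) straightD(1)[OF c(1)] k(2) c(2) pd] by simp
  qed
  then show "d \<in> {d \<in> qatlas. positive d}" using d by simp
qed auto

text \<open>This makes the definite description in \<open>chi_Q\<close> proper and gives it an
  explicit value.\<close>

lemma is_chi_quotient_iff: "is_chi_quotient M X \<longleftrightarrow> X = qman"
proof
  show "is_chi_quotient M X" if "X = qman"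
    unfolding that is_chi_quotient_def
    using qman_oriented proj_submersion qman_simps by (simp add: qman_def)
  assume X: "is_chi_quotient M X"
  then have "smooth_manifold X" "points X = leaves" "submersion M X proj"
    by (auto simp: is_chi_quotient_def oriented_1manifold_def)
  from quotient_unique[OF this] have "mtop X = qtop" "atlas X = qatlas" .
  moreover from this have "pos_charts X = pos_charts qman" using X by (simp add: is_chi_quotient_def qman_def)
  ultimately show "X = qman" using qman_simps(1,2) by (simp add: oriented_curve.equality)
qed

lemma fobj_chi_Q: "fobj chi_Q M = qman"
proof -
  have "(THE X. is_chi_quotient M X) = qman" unfolding is_chi_quotient_iff by simp
  then show ?thesis by (simp add: chi_Q_def)
qed

end

section \<open>Embeddings of one-dimensional manifolds\<close>

lemma smooth_map_on_cong:
  assumes M: "smooth_manifold M" and N: "smooth_manifold N" and f: "smooth_map_on M W N f"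
    and eq: "\<And>p. p \<in> W \<Longrightarrow> f p = f' p"
  shows "smooth_map_on M W N f'"
  unfolding smooth_map_on_def
proof (intro conjI ballI)
  note fD = smooth_map_onD[OF f]
  show "openin (mtop M) W" by (rule fD(1))
  show "continuous_map (subtopology (mtop M) W) (mtop N) f'"
    by (rule continuous_map_eq[OF fD(2)]) (use eq in auto)
  fix c d assume cd: "c \<in> atlas M" "d \<in> atlas N"
  note cc = smooth_manifoldD(3)[OF M cd(1)] and dc = smooth_manifoldD(3)[OF N cd(2)]
  have set: "{p \<in> W \<inter> fst c. f' p \<in> fst d} = {p \<in> W \<inter> fst c. f p \<in> fst d}" using eq by auto
  show "smooth_on (snd c ` {p \<in> W \<inter> fst c. f' p \<in> fst d}) (local_rep c d f')"
    unfolding set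
    by (rule smooth_on_eq[OF local_rep_domain_open(2)[OF cc dc fD(1,2)] fD(3)[OF cd]])
      (use eq chart_inv(1)[OF cc] in \<open>auto simp: local_rep_def\<close>)
qed

lemma mdiff_cong:
  assumes M: "smooth_manifold M" and N: "smooth_manifold N" and f: "smooth_map_on M W N f"
    and c: "c \<in> atlas M" "d \<in> atlas N" and p: "p \<in> W" "p \<in> fst c" "f p \<in> fst d"
    and eq: "\<And>p. p \<in> W \<Longrightarrow> f p = f' p"
  shows "mdiff c d f' p = mdiff c d f p"
proof -
  note cc = smooth_manifoldD(3)[OF M c(1)]
  have "(local_rep c d f' has_derivative mdiff c d f p) (at (snd c p))"
  proof (rule has_derivative_transform_within_open[OF smooth_map_on_derivative[OF M N f c p]])
    show "open (snd c ` (W \<inter> fst c))" by (rule chart_open_image[OF cc smooth_map_onD(1)[OF f]])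
    show "snd c p \<in> snd c ` (W \<inter> fst c)" using p by blast
    show "local_rep c d f x = local_rep c d f' x" if "x \<in> snd c ` (W \<inter> fst c)" for x
      using that eq chart_inv(1)[OF cc] by (auto simp: local_rep_def)
  qed
  from frechet_derivative_at[OF this] show ?thesis by (simp add: mdiff_def)
qed

text \<open>Around each image point the one-dimensional inverse function theorem yields a smooth
  expression \<open>G\<close> for the global inverse. Hence \<open>k\<close> is open, and the whole
  of \<open>points X\<close> can serve as the neighbourhood in \<open>local_diffeo\<close>.\<close>

lemma curve_embedding:
  fixes X :: "('a, real, 'y) manifold_scheme" and Y :: "('b, real, 'z) manifold_scheme"
  assumes X: "smooth_manifold X" and Y: "smooth_manifold Y" and k: "smooth_map X Y k" and inj: "inj_on k (points X)"
    and nz: "\<And>a d x. a \<in> atlas X \<Longrightarrow> d \<in> atlas Y \<Longrightarrow> x \<in> fst a \<Longrightarrow> k x \<in> fst d \<Longrightarrow> mdiff a d k x 1 \<noteq> 0"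
  shows "local_diffeo X Y k" "smooth_map_on Y (k ` points X) X (inv_into (points X) k)"
proof -
  note kD = smooth_map_onD[OF k]
  let ?g = "inv_into (points X) k"
  have g: "?g (k x) = x" if "x \<in> points X" for x using inj that by simp
  have loc: "\<exists>V G. open V \<and> snd d (k x) \<in> V \<and> V \<subseteq> snd d ` fst d \<and> smooth_on V G \<and>
      (\<forall>r\<in>V. inv_chart d r \<in> k ` W \<and> snd a (?g (inv_chart d r)) = G r)"
    if a: "a \<in> atlas X" "x \<in> fst a" and d: "d \<in> atlas Y" "k x \<in> fst d" and W: "openin (mtop X) W" "x \<in> W" for a d x W
  proof -
    note ac = smooth_manifoldD(3)[OF X a(1)] and dc = smooth_manifoldD(3)[OF Y d(1)]
    let ?D = "{x \<in> points X \<inter> fst a. k x \<in> fst d}" and ?F = "local_rep a d k"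
    have oD: "openin (mtop X) ?D" by (rule local_rep_domain_open(1)[OF ac dc kD(1,2)])
    let ?O = "snd a ` (?D \<inter> W \<inter> fst a)"
    have oO: "open ?O" by (rule chart_open_image[OF ac openin_Int[OF oD W(1)]])
    have F: "smooth_on ?O ?F" by (rule smooth_on_subset[OF kD(3)[OF a(1) d(1)]]) blast
    have "x \<in> points X" using a is_chartD(5)[OF ac] by blast
    then have xO: "snd a x \<in> ?O" using a d W by blast
    have "frechet_derivative ?F (at (snd a x)) 1 \<noteq> 0" using nz[OF a(1) d(1) a(2) d(2)] by (simp add: mdiff_def)
    then obtain U V G where *: "open U" "snd a x \<in> U" "U \<subseteq> ?O" "open V" "?F (snd a x) \<in> V" "homeomorphism U V ?F G" "smooth_on V G"
      by (rule local_inverse_real[OF oO F xO])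
    have V: "r \<in> snd d ` fst d \<and> inv_chart d r \<in> k ` W \<and> snd a (?g (inv_chart d r)) = G r" if r: "r \<in> V" for r
    proof -
      have "G r \<in> ?O" "?F (G r) = r" using * r by (auto simp: homeomorphism_def)
      then obtain y where y: "y \<in> points X" "y \<in> fst a" "y \<in> W" "k y \<in> fst d" "G r = snd a y" by blast
      have "snd d (k y) = r" using \<open>?F (G r) = r\<close> local_rep_apply[OF ac y(2), of d k] y(5) by simp
      then have "inv_chart d r = k y" using inv_chart_eqI[OF dc y(4)] by simp
      then show ?thesis using y g[OF y(1)] \<open>snd d (k y) = r\<close> by auto
    qed
    have "snd d (k x) \<in> V" using *(5) local_rep_apply[OF ac a(2), of d k] by simp
    then show ?thesis using V * by (intro exI[of _ V] exI[of _ G]) blast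
  qed
  have kopen: "openin (mtop Y) (k ` W)" if W: "openin (mtop X) W" for W
  proof (subst openin_subopen, intro ballI)
    fix y assume "y \<in> k ` W"
    then obtain x where x: "x \<in> W" "y = k x" by blast
    have "x \<in> points X" using x(1) W openin_subset by blast
    then obtain a where a: "a \<in> atlas X" "x \<in> fst a" using smooth_manifoldD(5)[OF X] by blast
    obtain d where d: "d \<in> atlas Y" "k x \<in> fst d" using smooth_manifoldD(5)[OF Y kD(4)[OF \<open>x \<in> points X\<close>]] by blast
    note dc = smooth_manifoldD(3)[OF Y d(1)]
    obtain V G where V: "open V" "snd d (k x) \<in> V" "\<forall>r\<in>V. inv_chart d r \<in> k ` W \<and> snd a (?g (inv_chart d r)) = G r"
      using loc[OF a d W x(1)] by blast
    have "openin (mtop Y) {y \<in> fst d. snd d y \<in> V}" by (rule chart_open_preimage[OF dc V(1)])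
    moreover have "{y \<in> fst d. snd d y \<in> V} \<subseteq> k ` W"
    proof
      fix z assume z: "z \<in> {y \<in> fst d. snd d y \<in> V}"
      then have "inv_chart d (snd d z) \<in> k ` W" using V(3) by blast
      then show "z \<in> k ` W" using chart_inv(1)[OF dc, of z] z by simp
    qed
    ultimately show "\<exists>T. openin (mtop Y) T \<and> y \<in> T \<and> T \<subseteq> k ` W" using V(2) d(2) x(2) by blast
  qed
  have oX: "openin (mtop X) (points X)" by simp
  show sg: "smooth_map_on Y (k ` points X) X ?g"
  proof (rule smooth_map_on_localI[OF Y X kopen[OF oX]])
    have sub: "k ` points X \<subseteq> points Y" using kD(4) by blast
    show "continuous_map (subtopology (mtop Y) (k ` points X)) (mtop X) ?g"
      unfolding continuous_map_def
    proof (intro conjI allI impI)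
      show "?g \<in> topspace (subtopology (mtop Y) (k ` points X)) \<rightarrow> points X" using g by auto
      fix W assume W: "openin (mtop X) W"
      have "{y \<in> topspace (subtopology (mtop Y) (k ` points X)). ?g y \<in> W} = k ` W"
        using g sub openin_subset[OF W] by auto
      then show "openin (subtopology (mtop Y) (k ` points X)) {y \<in> topspace (subtopology (mtop Y) (k ` points X)). ?g y \<in> W}"
        using kopen[OF W] openin_subset[OF W] kopen[OF oX] by (simp add: openin_open_subtopology image_mono)
    qed
    fix y assume "y \<in> k ` points X"
    then obtain x where x: "x \<in> points X" "y = k x" by blast
    obtain a where a: "a \<in> atlas X" "x \<in> fst a" using smooth_manifoldD(5)[OF X x(1)] by blast
    obtain d where d: "d \<in> atlas Y" "k x \<in> fst d" using smooth_manifoldD(5)[OF Y kD(4)[OF x(1)]] by blast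
    obtain V G where V: "open V" "snd d (k x) \<in> V" "smooth_on V G"
      "\<forall>r\<in>V. inv_chart d r \<in> k ` points X \<and> snd a (?g (inv_chart d r)) = G r"
      using loc[OF a d oX x(1)] by blast
    have "smooth_on V (local_rep d a ?g)" by (rule smooth_on_eq[OF V(1,3)]) (use V(4) in \<open>simp add: local_rep_def\<close>)
    then show "\<exists>c\<in>atlas Y. \<exists>d\<in>atlas X. y \<in> fst c \<and> ?g y \<in> fst d \<and>
        (\<exists>U. open U \<and> snd c y \<in> U \<and> smooth_on U (local_rep c d ?g))"
      using a d V(1,2) x g[OF x(1)] by (intro bexI[of _ d] bexI[of _ a]) auto
  qed
  show "local_diffeo X Y k" unfolding local_diffeo_def
    using k sg kopen[OF oX] inj oX by blast
qed

lemma curve_iso: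
  assumes X: "oriented_1manifold X" and Y: "oriented_1manifold Y" and k: "smooth_map X Y k" and inj: "inj_on k (points X)"
    and nz: "\<And>a d x. a \<in> atlas X \<Longrightarrow> d \<in> atlas Y \<Longrightarrow> x \<in> fst a \<Longrightarrow> k x \<in> fst d \<Longrightarrow> mdiff a d k x 1 \<noteq> 0"
    and pos: "\<And>a d x. a \<in> pos_charts X \<Longrightarrow> d \<in> pos_charts Y \<Longrightarrow> x \<in> fst a \<Longrightarrow> k x \<in> fst d \<Longrightarrow> mdiff a d k x 1 > 0"
    and ext: "k \<in> extensional (points X)"
  shows "k \<in> Hom Emb1 X Y" "k ` points X = points Y \<Longrightarrow> is_iso Emb1 X Y k"
proof -
  have sX: "smooth_manifold X" and sY: "smooth_manifold Y" and pX: "pos_charts X \<subseteq> atlas X" and pY: "pos_charts Y \<subseteq> atlas Y"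
    using X Y by (auto simp: oriented_1manifold_def)
  note emb = curve_embedding[OF sX sY k inj nz]
  show kH: "k \<in> Hom Emb1 X Y" using emb(1) inj pos ext by (simp add: Emb1_def preserves_orientation1_def)
  assume surj: "k ` points X = points Y"
  define g where "g = restrict (inv_into (points X) k) (points Y)"
  have gk: "g (k x) = x" if "x \<in> points X" for x using inj that surj by (auto simp: g_def)
  have kg: "k (g y) = y" "g y \<in> points X" if "y \<in> points Y" for y
    using that surj by (auto simp: g_def f_inv_into_f inv_into_into)
  have g: "smooth_map Y X g"
    by (rule smooth_map_on_cong[OF sY sX emb(2)[unfolded surj]]) (simp_all add: g_def)
  have ginj: "inj_on g (points Y)" by (rule inj_on_inverseI[of _ k]) (rule kg(1))
  \<comment> \<open>The derivative of \<open>g \<circ> k = id\<close>. It shows that the derivative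
    of \<open>g\<close> is nonzero and positive wherever that of \<open>k\<close> is positive, so
    the inverse is a morphism as well.\<close>
  have chain: "mdiff d a g y 1 * mdiff a d k (g y) 1 = 1"
    if *: "d \<in> atlas Y" "a \<in> atlas X" "y \<in> fst d" "g y \<in> fst a" for d a y
  proof -
    have y: "y \<in> points Y" using smooth_manifoldD(7)[OF sY *(1)] *(3) by blast
    let ?x = "g y"
    have 1: "mdiff a a (\<lambda>q. g (k q)) ?x 1 = mdiff d a g y (mdiff a d k ?x 1)"
      using mdiff_compose(1)[OF sX sY sX k g *(2,1,2), of ?x 1] kg[OF y] y * by simp
    have "mdiff a a (\<lambda>q. g (k q)) ?x = mdiff a a (\<lambda>q. q) ?x"
      by (rule mdiff_cong[OF sX sX smooth_map_on_id[OF sX] *(2,2)]) (use kg[OF y] * gk in auto)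
    then have "mdiff a a (\<lambda>q. g (k q)) ?x 1 = 1" using mdiff_id[OF sX *(2,4)] by simp
    moreover have "linear (mdiff d a g y)" by (rule mdiff_linear[OF sY sX g *(1,2) y *(3,4)])
    ultimately show ?thesis using 1 real_linear_apply[of "mdiff d a g y" "mdiff a d k ?x 1"] by (simp add: mult.commute)
  qed
  have gnz: "mdiff d a g y 1 \<noteq> 0" if "d \<in> atlas Y" "a \<in> atlas X" "y \<in> fst d" "g y \<in> fst a" for d a y
    using chain[OF that] by auto
  have gpos: "mdiff d a g y 1 > 0" if *: "d \<in> pos_charts Y" "a \<in> pos_charts X" "y \<in> fst d" "g y \<in> fst a" for d a y
  proof -
    have ** : "d \<in> atlas Y" "a \<in> atlas X" using * pX pY by auto
    have "y \<in> points Y" using smooth_manifoldD(7)[OF sY **(1)] *(3) by blast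
    then have "mdiff a d k (g y) 1 > 0" using pos[OF *(2,1,4)] kg *(3) by simp
    then show ?thesis using chain[OF ** *(3,4)] by (metis zero_less_mult_pos2 zero_less_one)
  qed
  have gH: "g \<in> Hom Emb1 Y X"
    using curve_embedding(1)[OF sY sX g ginj gnz] ginj gpos
    by (simp add: Emb1_def preserves_orientation1_def g_def)
  have "compose (points X) g k = restrict (\<lambda>p. p) (points X)" using gk by (auto simp: compose_def restrict_def)
  moreover have "compose (points Y) k g = restrict (\<lambda>p. p) (points Y)" using kg by (auto simp: compose_def restrict_def)
  ultimately show "is_iso Emb1 X Y k" unfolding is_iso_def using kH gH
    by (intro conjI bexI[of _ g]) (simp_all add: Emb1_def)
qed

section \<open>Open subspacetimes\<close>

lemma is_chart_subtopology:
  assumes "openin X W" shows "is_chart (subtopology X W) c \<longleftrightarrow> is_chart X c \<and> fst c \<subseteq> W"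
proof (cases "fst c \<subseteq> W")
  case True
  then have "W \<inter> fst c = fst c" by blast
  then have "subtopology (subtopology X W) (fst c) = subtopology X (fst c)" by (simp add: subtopology_subtopology)
  moreover have "openin (subtopology X W) (fst c) \<longleftrightarrow> openin X (fst c)"
    using openin_open_subtopology[OF assms] True by blast
  ultimately show ?thesis using True by (simp add: is_chart_def)
next
  case False
  then have "\<not> openin (subtopology X W) (fst c)" using openin_open_subtopology[OF assms] by blast
  then show ?thesis using False by (simp add: is_chart_def)
qed

text \<open>Paracompactness does not pass to arbitrary subspaces. Inside a chart domain
  \<open>W\<close> is Lindelof, which restores it for the sub-spacetime.\<close>

locale open_subspacetime = framed_spacetime +
  fixes W :: "'a set" and c0 :: "('a, plane) chart"
  assumes W: "openin (mtop M) W" and c0: "c0 \<in> atlas M" "W \<subseteq> fst c0"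
begin

text \<open>The empty orientations of \<open>base\<close> are dummies: \<open>volume_form\<close> and \<open>timelike_field\<close> ignore them.\<close>

definition base :: "'a spacetime" where
  "base = \<lparr>mtop = subtopology (mtop M) W, atlas = {c \<in> atlas M. fst c \<subseteq> W},
     lmetric = (\<lambda>c p. if c \<in> atlas M \<and> fst c \<subseteq> W \<and> p \<in> fst c then lmetric M c p else (\<lambda>v w. 0)),
     orientation = {}, time_orientation = {}\<rparr>"

definition sub :: "'a spacetime" where
  "sub = base\<lparr>
     orientation := {\<Omega>'. volume_form base \<Omega>' \<and>
               (\<forall>c\<in>atlas base. \<forall>p\<in>fst c. \<exists>k>0. \<forall>v w. \<Omega>' c p v w = k * Om c p v w)},
     time_orientation := {T'. timelike_field base T' \<and>
               (\<forall>c\<in>atlas base. \<forall>p\<in>fst c. lmetric base c p (T c p) (T' c p) < 0)}\<rparr>"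

lemma sub_simps: "mtop sub = subtopology (mtop M) W" "atlas sub = {c \<in> atlas M. fst c \<subseteq> W}"
  "lmetric sub = lmetric base" "mtop base = mtop sub" "atlas base = atlas sub"
  by (simp_all add: sub_def base_def)

lemma sub_points: "points sub = W"
  using openin_subset[OF W] by (auto simp: sub_simps)

lemma sub_metric: "c \<in> atlas sub \<Longrightarrow> p \<in> fst c \<Longrightarrow> lmetric sub c p = g c p"
  by (auto simp: sub_simps base_def)

lemma sub_volume: "volume_form base = volume_form sub" and sub_timelike: "timelike_field base = timelike_field sub"
  by (simp_all add: fun_eq_iff volume_form_def timelike_field_def smooth_tensor2_def smooth_vector_field_on_def sub_simps)

lemma sub_orientation: "orientation sub = {\<Omega>'. volume_form sub \<Omega>' \<and>
    (\<forall>c\<in>atlas sub. \<forall>p\<in>fst c. \<exists>k>0. \<forall>v w. \<Omega>' c p v w = k * Om c p v w)}"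
  and sub_time_orientation: "time_orientation sub = {T'. timelike_field sub T' \<and>
    (\<forall>c\<in>atlas sub. \<forall>p\<in>fst c. lmetric sub c p (T c p) (T' c p) < 0)}"
  unfolding sub_volume[symmetric] sub_timelike[symmetric] by (simp_all add: sub_def base_def)

lemma sub_manifold: "smooth_manifold sub"
  unfolding smooth_manifold_def
proof (intro conjI ballI allI impI)
  have H: "Hausdorff_space (mtop M)" by (rule smooth_manifoldD(1)[OF sm])
  then show "Hausdorff_space (mtop sub)" unfolding sub_simps by (rule Hausdorff_space_subtopology)
  have "locally_compact_space (mtop M)" unfolding locally_compact_space_def
  proof
    fix p assume "p \<in> points M"
    from compact_nbhd[OF this]
    show "\<exists>U K. openin (mtop M) U \<and> compactin (mtop M) K \<and> p \<in> U \<and> U \<subseteq> K" by (elim exE conjE) (intro exI conjI)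
  qed
  then have reg: "regular_space (mtop sub)" unfolding sub_simps
    using locally_compact_Hausdorff_imp_regular_space H regular_space_subtopology by blast
  show "paracompact_space (mtop sub)"
  proof (rule Lindelof_pieces_imp_paracompact[OF reg, where \<P> = "{W}"])
    show "\<Union>{W} = points sub" by (simp add: sub_points)
    have "openin (mtop sub) (points sub)" by (rule openin_topspace)
    then show "openin (mtop sub) P" if "P \<in> {W}" for P using that sub_points by simp
    have "Lindelof_space (subtopology (mtop M) W)" by (rule chart_Lindelof[OF smooth_manifoldD(3)[OF sm c0(1)] c0(2)])
    then show "Lindelof_space (subtopology (mtop sub) P)" if "P \<in> {W}" for P
      using that by (simp add: sub_simps subtopology_subtopology)
  qed auto
  show "is_chart (mtop sub) c" if "c \<in> atlas sub" for c
  proof -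
    have "c \<in> atlas M" "fst c \<subseteq> W" using that by (auto simp: sub_simps)
    then show ?thesis unfolding sub_simps(1) is_chart_subtopology[OF W] using smooth_manifoldD(3)[OF sm] by blast
  qed
  show "chart_compat c d" if "c \<in> atlas sub" "d \<in> atlas sub" for c d
    using that smooth_manifoldD(4)[OF sm] by (simp add: sub_simps)
  have cut: "(W \<inter> fst d, restrict (snd d) (W \<inter> fst d)) \<in> atlas sub" if d: "d \<in> atlas M" for d
  proof -
    have "openin (mtop M) (W \<inter> fst d)" using W is_chartD(1)[OF smooth_manifoldD(3)[OF sm d]] by blast
    then show ?thesis using restricted_chart[OF sm d] by (simp add: sub_simps)
  qed
  show "(\<Union>c\<in>atlas sub. fst c) = points sub"
  proof
    show "(\<Union>c\<in>atlas sub. fst c) \<subseteq> points sub" unfolding sub_points by (auto simp: sub_simps)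
    show "points sub \<subseteq> (\<Union>c\<in>atlas sub. fst c)"
    proof
      fix p assume "p \<in> points sub"
      then have p: "p \<in> W" by (simp add: sub_points)
      then have "p \<in> points M" using openin_subset[OF W] by blast
      then obtain d where "d \<in> atlas M" "p \<in> fst d" using smooth_manifoldD(5)[OF sm] by blast
      then show "p \<in> (\<Union>c\<in>atlas sub. fst c)" using cut p by (intro UN_I[of "(W \<inter> fst d, restrict (snd d) (W \<inter> fst d))"]) auto
    qed
  qed
  fix c assume "is_chart (mtop sub) c \<and> (\<forall>d\<in>atlas sub. chart_compat c d)"
  then have c: "is_chart (mtop M) c" "fst c \<subseteq> W" "\<And>d. d \<in> atlas sub \<Longrightarrow> chart_compat c d"
    unfolding sub_simps(1) is_chart_subtopology[OF W] by blast+
  have "c \<in> atlas M"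
  proof (rule smooth_manifoldD(6)[OF sm c(1)])
    fix d assume d: "d \<in> atlas M"
    note dc = smooth_manifoldD(3)[OF sm d]
    let ?d = "(W \<inter> fst d, restrict (snd d) (W \<inter> fst d))"
    \<comment> \<open>As \<open>fst c\<close> lies in \<open>W\<close>, its overlap with
      \<open>d\<close> is its overlap with the cut-down chart, and the local representatives agree
      there.\<close>
    have comp: "chart_compat c ?d" by (rule c(3)[OF cut[OF d]])
    have ch: "is_chart (mtop M) ?d" using smooth_manifoldD(3)[OF sm] cut[OF d] by (simp add: sub_simps)
    have set: "fst c \<inter> fst ?d = fst c \<inter> fst d" using c(2) by auto
    have img: "snd ?d ` (fst c \<inter> fst d) = snd d ` (fst c \<inter> fst d)" using c(2) by (intro image_cong) auto
    have o1: "open (snd c ` (fst c \<inter> fst d))" "open (snd d ` (fst c \<inter> fst d))"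
      using chart_open_image[OF c(1) is_chartD(1)[OF dc]] chart_open_image[OF dc is_chartD(1)[OF c(1)]]
      by (simp_all add: Int_commute)
    have s: "smooth_on (snd c ` (fst c \<inter> fst d)) (local_rep c ?d (\<lambda>p. p))"
      "smooth_on (snd d ` (fst c \<inter> fst d)) (local_rep ?d c (\<lambda>p. p))"
      using comp unfolding chart_compat_def set img by blast+
    have "smooth_on (snd c ` (fst c \<inter> fst d)) (local_rep c d (\<lambda>p. p))"
      by (rule smooth_on_eq[OF o1(1) s(1)]) (use c(2) chart_inv(1)[OF c(1)] in \<open>auto simp: local_rep_def\<close>)
    moreover have "smooth_on (snd d ` (fst c \<inter> fst d)) (local_rep d c (\<lambda>p. p))"
    proof (rule smooth_on_eq[OF o1(2) s(2)])
      fix x assume "x \<in> snd d ` (fst c \<inter> fst d)"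
      then obtain p where p: "p \<in> fst c" "p \<in> fst d" "x = snd d p" by blast
      have "p \<in> fst ?d" "snd ?d p = x" using p c(2) by auto
      then have "inv_chart ?d x = p" by (rule inv_chart_eqI[OF ch])
      then show "local_rep ?d c (\<lambda>p. p) x = local_rep d c (\<lambda>p. p) x"
        using inv_chart_eqI[OF dc p(2)] p(3) by (simp add: local_rep_def)
    qed
    ultimately show "chart_compat c d" by (simp add: chart_compat_def)
  qed
  then show "c \<in> atlas sub" using c(2) by (simp add: sub_simps)
qed

lemma sub_tensor:
  assumes t: "smooth_tensor2 M t" and eq: "\<And>c p. c \<in> atlas sub \<Longrightarrow> p \<in> fst c \<Longrightarrow> t' c p = t c p"
  shows "smooth_tensor2 sub t'"
  unfolding smooth_tensor2_def
proof (intro conjI ballI allI)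
  fix c assume c: "c \<in> atlas sub"
  then have cM: "c \<in> atlas M" by (simp add: sub_simps)
  note cc = smooth_manifoldD(3)[OF sm cM]
  have bil: "\<forall>c\<in>atlas M. \<forall>p\<in>fst c. bilinear (t c p)" using t unfolding smooth_tensor2_def by blast
  show "bilinear (t' c p)" if "p \<in> fst c" for p using bil cM that eq[OF c that] by simp
  show "smooth_on (snd c ` fst c) (\<lambda>x. t' c (inv_chart c x) v w)" for v w
    by (rule smooth_on_eq[OF is_chartD(2)[OF cc] tensor_component_smooth[OF t cM, of v w]])
      (use eq[OF c] chart_inv(3)[OF cc] in auto)
  fix d p v w assume d: "d \<in> atlas sub" and p: "p \<in> fst c \<inter> fst d"
  have dM: "d \<in> atlas M" using d by (simp add: sub_simps)
  show "t' c p v w = t' d p (mdiff c d (\<lambda>q. q) p v) (mdiff c d (\<lambda>q. q) p w)"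
    using tensor_transform[OF t cM dM, of p v w] p eq[OF c, of p] eq[OF d, of p] by simp
qed

lemma sub_spacetime: "oriented_spacetime sub"
  unfolding oriented_spacetime_def
proof (intro conjI sub_manifold)
  have at: "c \<in> atlas M" if "c \<in> atlas sub" for c using that by (simp add: sub_simps)
  have l: "\<forall>c\<in>atlas M. \<forall>p\<in>fst c. \<forall>v w. g c p v w = g c p w v"
    "\<forall>c\<in>atlas M. \<forall>p\<in>fst c. \<exists>e0 e1. g c p e0 e0 = -1 \<and> g c p e1 e1 = 1 \<and> g c p e0 e1 = 0"
    using lm unfolding lorentzian_metric_def by blast+
  show "lorentzian_metric sub" unfolding lorentzian_metric_def
  proof (intro conjI)
    show "smooth_tensor2 sub (lmetric sub)" by (rule sub_tensor[OF smooth_g sub_metric])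
    show "\<forall>c\<in>atlas sub. \<forall>p\<in>fst c. \<forall>v w. lmetric sub c p v w = lmetric sub c p w v"
      using l(1) at sub_metric by simp
    show "\<forall>c\<in>atlas sub. \<forall>p\<in>fst c. \<exists>e0 e1. lmetric sub c p e0 e0 = -1 \<and> lmetric sub c p e1 e1 = 1 \<and> lmetric sub c p e0 e1 = 0"
      using l(2) at sub_metric by simp
    show "\<forall>c p. c \<notin> atlas sub \<or> p \<notin> fst c \<longrightarrow> lmetric sub c p = (\<lambda>v w. 0)"
      by (auto simp: sub_simps base_def)
  qed
  have vol: "\<forall>c\<in>atlas M. \<forall>p\<in>fst c. (\<forall>v. Om c p v v = 0) \<and> (\<exists>v w. Om c p v w \<noteq> 0)"
    using orientation_volume[OF Om_in] unfolding volume_form_def by blast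
  have "volume_form sub Om" unfolding volume_form_def
    using sub_tensor[OF Om_smooth, of Om] vol at by blast
  then show "is_orientation sub (orientation sub)" unfolding is_orientation_def sub_orientation by blast
  have "timelike_field sub T" unfolding timelike_field_def smooth_vector_field_on_def
  proof (intro conjI ballI)
    fix c assume c: "c \<in> atlas sub"
    have "points sub \<inter> fst c = fst c" using c unfolding sub_points by (auto simp: sub_simps)
    then show "smooth_on (snd c ` (points sub \<inter> fst c)) (\<lambda>x. T c (inv_chart c x))"
      using vector_field_smooth[OF T_smooth at[OF c]] by simp
    show "lmetric sub c p (T c p) (T c p) < 0" if "p \<in> fst c" for p
      using sub_metric[OF c that] timelike[OF T_in at[OF c] that] by simp
    fix d p assume d: "d \<in> atlas sub" and p: "p \<in> points sub \<inter> fst c \<inter> fst d"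
    have "p \<in> points M" using p openin_subset[OF W] sub_points by blast
    then show "T d p = mdiff c d (\<lambda>q. q) p (T c p)"
      using vector_field_transform[OF T_smooth at[OF c] at[OF d], of p] p by simp
  qed
  then show "is_time_orientation sub (time_orientation sub)"
    unfolding is_time_orientation_def sub_time_orientation by blast
qed

abbreviation "incl \<equiv> restrict (\<lambda>p. p) W"

lemma incl_smooth: "smooth_map sub M incl"
proof -
  have "smooth_map sub M (\<lambda>p. p)"
  proof (rule smooth_map_on_localI[OF sub_manifold sm])
    show "continuous_map (subtopology (mtop sub) (points sub)) (mtop M) (\<lambda>p. p)"
      unfolding sub_simps by (simp add: continuous_map_from_subtopology)
    fix p assume "p \<in> points sub"
    then obtain c where c: "c \<in> atlas sub" "p \<in> fst c" using smooth_manifoldD(5)[OF sub_manifold] by blast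
    then have cM: "c \<in> atlas M" by (simp add: sub_simps)
    note T = transition_smooth[OF sm cM cM]
    show "\<exists>c\<in>atlas sub. \<exists>d\<in>atlas M. p \<in> fst c \<and> p \<in> fst d \<and>
        (\<exists>U. open U \<and> snd c p \<in> U \<and> smooth_on U (local_rep c d (\<lambda>p. p)))"
      using c cM T by (intro bexI[of _ c]) auto
  qed simp
  then show ?thesis by (rule smooth_map_on_cong[OF sub_manifold sm]) (simp add: sub_points)
qed

lemma incl_mdiff:
  assumes "c \<in> atlas sub" "d \<in> atlas M" "p \<in> fst c" "p \<in> fst d"
  shows "mdiff c d incl p = mdiff c d (\<lambda>q. q) p"
proof -
  have p: "p \<in> points sub" using smooth_manifoldD(7)[OF sub_manifold assms(1)] assms(3) by blast
  have "mdiff c d (\<lambda>q. q) p = mdiff c d incl p"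
    by (rule mdiff_cong[OF sub_manifold sm incl_smooth assms(1,2) p assms(3)])
      (use p assms(4) sub_points in auto)
  then show ?thesis by simp
qed

lemma incl_conf: "incl \<in> Hom Conf sub M"
proof -
  have at: "c \<in> atlas M" if "c \<in> atlas sub" for c using that by (simp add: sub_simps)
  have ip: "incl p = p" if "c \<in> atlas sub" "p \<in> fst c" for c p using that by (auto simp: sub_simps)
  have tt: "t d (incl p) (mdiff c d incl p v) (mdiff c d incl p w) = t c p v w"
    if *: "smooth_tensor2 M t" "c \<in> atlas sub" "d \<in> atlas M" "p \<in> fst c" "incl p \<in> fst d" for t c d p v w
    using tensor_transform[OF *(1) at[OF *(2)] *(3,4), of v w] incl_mdiff[OF *(2-4)] ip[OF *(2,4)] *(5) by simp
  have "conformal_map sub M incl" unfolding conformal_map_def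
  proof (intro conjI incl_smooth exI[of _ "\<lambda>_. 0"] ballI impI allI)
    show "smooth_function sub (\<lambda>_. 0)" unfolding smooth_function_def
      using is_chartD(2)[OF smooth_manifoldD(3)[OF sub_manifold]] smooth_on_const by (auto simp: o_def)
    fix c d p v w assume "c \<in> atlas sub" "d \<in> atlas M" "p \<in> fst c" "incl p \<in> fst d"
    then show "g d (incl p) (mdiff c d incl p v) (mdiff c d incl p w) = exp 0 * lmetric sub c p v w"
      using tt[OF smooth_g] sub_metric by simp
  qed
  moreover have "preserves_orientation sub M incl" unfolding preserves_orientation_def
  proof (intro ballI impI)
    fix \<Omega> \<Omega>' c d p assume *: "\<Omega> \<in> orientation sub" "\<Omega>' \<in> orientation M" "c \<in> atlas sub" "d \<in> atlas M" "p \<in> fst c" "incl p \<in> fst d"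
    obtain k where k: "k > 0" "\<And>v w. \<Omega> c p v w = k * Om c p v w" using * unfolding sub_orientation by blast
    obtain l where l: "l > 0" "\<And>v w. \<Omega>' c p v w = l * Om c p v w" using orientation_scale[OF *(2) at[OF *(3)] *(5)] by metis
    have "smooth_tensor2 M \<Omega>'" using orientation_volume[OF *(2)] by (simp add: volume_form_def)
    from tt[OF this *(3-6)]
    show "\<exists>k>0. \<forall>v w. \<Omega>' d (incl p) (mdiff c d incl p v) (mdiff c d incl p w) = k * \<Omega> c p v w"
      using k l by (intro exI[of _ "l / k"]) simp
  qed
  moreover have "preserves_time_orientation sub M incl" unfolding preserves_time_orientation_def
  proof (intro ballI impI)
    fix T1 T2 c d p assume *: "T1 \<in> time_orientation sub" "T2 \<in> time_orientation M" "c \<in> atlas sub" "d \<in> atlas M" "p \<in> fst c" "incl p \<in> fst d"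
    note cM = at[OF *(3)] and pp = ip[OF *(3,5)]
    interpret L: lorentz_plane "g c p" "Om c p" by (rule lorentz[OF Om_in cM *(5)])
    have "\<forall>c\<in>atlas sub. \<forall>p\<in>fst c. lmetric sub c p (T c p) (T1 c p) < 0"
      "\<forall>c\<in>atlas sub. \<forall>p\<in>fst c. lmetric sub c p (T1 c p) (T1 c p) < 0"
      using *(1) unfolding sub_time_orientation timelike_field_def by blast+
    then have "lmetric sub c p (T c p) (T1 c p) < 0" "lmetric sub c p (T1 c p) (T1 c p) < 0"
      using *(3,5) by blast+
    then have "g c p (T c p) (T1 c p) < 0" "g c p (T1 c p) (T1 c p) < 0"
      unfolding sub_metric[OF *(3,5)] .
    then have lt: "g c p (T2 c p) (T1 c p) < 0"
      using L.cone_trans[OF timelike[OF T_in cM *(5)] timelike[OF *(2) cM *(5)] _ timelike_cone[OF *(2) cM *(5)]] by blast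
    have pM: "p \<in> points M" using smooth_manifoldD(7)[OF sm cM] *(5) by blast
    have "smooth_vector_field_on M (points M) T2" using time_orientation_timelike[OF *(2)] by (simp add: timelike_field_def)
    from vector_field_transform[OF this cM *(4) pM *(5)]
    have "T2 d p = mdiff c d (\<lambda>q. q) p (T2 c p)" using *(6) pp by simp
    then show "g d (incl p) (T2 d (incl p)) (mdiff c d incl p (T1 c p)) < 0"
      using tt[OF smooth_g *(3-6), of "T2 c p" "T1 c p"] lt incl_mdiff[OF *(3,4,5)] *(6) pp by simp
  qed
  ultimately show ?thesis by (simp add: Conf_def sub_points)
qed

end

section \<open>Chiral morphisms descend to the leaf spaces\<close>

locale chiral_morphism =
  A: initial_spacetime M T Om S + B: initial_spacetime N T' Om' S'
  for M :: "'a spacetime" and T Om S and N :: "'a spacetime" and T' Om' S' +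
  fixes h :: "'a \<Rightarrow> 'a"
  assumes h: "h \<in> Hom Conf M N" and monic: "overlap_monic Conf orth_chi M N h"
begin

lemma h_smooth: "smooth_map M N h"
  using h by (simp add: Conf_def conformal_map_def)

lemma h_points: "p \<in> points M \<Longrightarrow> h p \<in> points N"
  by (rule smooth_map_onD(4)[OF h_smooth])

lemma image_frame:
  assumes cd: "c \<in> atlas M" "d \<in> atlas N" and p: "p \<in> fst c" "h p \<in> fst d"
  obtains k l where "k > 0" "l > 0"
    "\<And>v w. B.g d (h p) (mdiff c d h p v) (mdiff c d h p w) = k * A.g c p v w"
    "\<And>v w. Om' d (h p) (mdiff c d h p v) (mdiff c d h p w) = l * Om c p v w"
    "B.g d (h p) (T' d (h p)) (mdiff c d h p (T c p)) < 0"
    "B.g d (h p) (mdiff c d h p (T c p)) (mdiff c d h p (T c p)) < 0"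
proof -
  have "conformal_map M N h" "preserves_orientation M N h" "preserves_time_orientation M N h"
    using h by (simp_all add: Conf_def)
  then obtain \<omega> where \<omega>: "\<And>v w. B.g d (h p) (mdiff c d h p v) (mdiff c d h p w) = exp (\<omega> p) * A.g c p v w"
    and "\<exists>l>0. \<forall>v w. Om' d (h p) (mdiff c d h p v) (mdiff c d h p w) = l * Om c p v w"
    and T: "B.g d (h p) (T' d (h p)) (mdiff c d h p (T c p)) < 0"
    unfolding conformal_map_def preserves_orientation_def preserves_time_orientation_def
    using cd p A.T_in B.T_in A.Om_in B.Om_in by metis
  then obtain l where l: "l > 0" "\<And>v w. Om' d (h p) (mdiff c d h p v) (mdiff c d h p w) = l * Om c p v w" by blast
  have "B.g d (h p) (mdiff c d h p (T c p)) (mdiff c d h p (T c p)) < 0"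
    unfolding \<omega> using A.timelike[OF A.T_in cd(1) p(1)] by (simp add: mult_pos_neg)
  then show ?thesis using that[of "exp (\<omega> p)" l] \<omega> l T by simp
qed

text \<open>Conformality and the preserved orientations give the signs against the image of
  \<open>T\<close>. That image lies in the cone of \<open>T'\<close>, so \<open>same_cone\<close>
  converts them into signs against \<open>T'\<close>.\<close>

lemma image_future_right_null:
  assumes cd: "c \<in> atlas M" "d \<in> atlas N" and p: "p \<in> fst c" "h p \<in> fst d" and v: "future_right_null M c p v"
  shows "future_right_null N d (h p) (mdiff c d h p v)"
proof -
  obtain k l where *: "k > 0" "l > 0"
    "\<And>v w. B.g d (h p) (mdiff c d h p v) (mdiff c d h p w) = k * A.g c p v w"
    "\<And>v w. Om' d (h p) (mdiff c d h p v) (mdiff c d h p w) = l * Om c p v w"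
    "B.g d (h p) (T' d (h p)) (mdiff c d h p (T c p)) < 0"
    "B.g d (h p) (mdiff c d h p (T c p)) (mdiff c d h p (T c p)) < 0"
    by (rule image_frame[OF cd p]) blast
  interpret L: lorentz_plane "B.g d (h p)" "Om' d (h p)" by (rule B.lorentz[OF B.Om_in cd(2) p(2)])
  let ?D = "mdiff c d h p"
  have v': "A.g c p v v = 0" "A.g c p (T c p) v < 0" "Om c p (T c p) v > 0"
    using v unfolding A.future_right_null_iff[OF cd(1) p(1)] by blast+
  have n: "B.g d (h p) (?D v) (?D v) = 0" "B.g d (h p) (?D (T c p)) (?D v) < 0" "Om' d (h p) (?D (T c p)) (?D v) > 0"
    using v' *(1,2) by (simp_all add: *(3,4) mult_pos_neg)
  have "B.g d (h p) (?D (T c p)) 0 = 0" using linear_0[OF bilinear_linear(1)[OF L.g_bil]] .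
  then have nz: "?D v \<noteq> 0" using n(2) by force
  show ?thesis unfolding B.future_right_null_iff[OF cd(2) p(2)]
    using n L.same_cone[OF B.timelike[OF B.T_in cd(2) p(2)] *(6,5) nz n(1)] by simp
qed

text \<open>Supplies the sign of \<open>b\<close> in \<open>leaf_map_derivative\<close>: a
  future-directed null vector pairs negatively with every vector in the future timelike
  cone.\<close>

lemma image_null_field:
  assumes cd: "c \<in> atlas M" "d \<in> atlas N" and p: "p \<in> fst c" "h p \<in> fst d"
  shows "B.g d (h p) (B.null_field d (h p)) (mdiff c d h p (T c p)) < 0"
proof -
  obtain k l where *: "B.g d (h p) (T' d (h p)) (mdiff c d h p (T c p)) < 0"
    "B.g d (h p) (mdiff c d h p (T c p)) (mdiff c d h p (T c p)) < 0"
    by (rule image_frame[OF cd p])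
  interpret L: lorentz_plane "B.g d (h p)" "Om' d (h p)" by (rule B.lorentz[OF B.Om_in cd(2) p(2)])
  note n = B.null_field[OF cd(2) p(2)]
  show ?thesis
    using L.same_cone(1)[OF B.timelike[OF B.T_in cd(2) p(2)] *(2,1) B.null_field_nonzero[OF cd(2) p(2)] n(1)] n(2) L.g_sym
    by simp
qed

lemma image_coordinates:
  assumes \<gamma>: "smooth_curve M I \<gamma>" and t: "t \<in> I" and d: "d \<in> atlas N" "h (\<gamma> t) \<in> fst d"
  obtains c J k where "c \<in> atlas M" "\<gamma> t \<in> fst c" "open J" "t \<in> J" "smooth_on J k" "smooth_on J (local_rep c d h \<circ> k)"
    "\<And>s. s \<in> I \<inter> J \<Longrightarrow> \<gamma> s \<in> fst c \<and> snd c (\<gamma> s) = k s"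
    "\<And>s. s \<in> I \<inter> J \<Longrightarrow> h (\<gamma> s) \<in> fst d \<and> snd d (h (\<gamma> s)) = local_rep c d h (k s)"
proof -
  have "\<gamma> t \<in> points M" using \<gamma> t by (auto simp: smooth_curve_def)
  then obtain c where c: "c \<in> atlas M" "\<gamma> t \<in> fst c" using smooth_manifoldD(5)[OF A.sm] by blast
  note cc = smooth_manifoldD(3)[OF A.sm c(1)] and dc = smooth_manifoldD(3)[OF B.sm d(1)]
  obtain J k where J: "open J" "t \<in> J" "\<gamma> ` (I \<inter> J) \<subseteq> fst c" "smooth_on J k" "\<forall>s\<in>I \<inter> J. snd c (\<gamma> s) = k s"
    using \<gamma> t c unfolding smooth_curve_def by blast
  define D where "D = snd c ` {p \<in> points M \<inter> fst c. h p \<in> fst d}"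
  have D: "open D" unfolding D_def
    by (rule local_rep_domain_open(2)[OF cc dc smooth_map_onD(1,2)[OF h_smooth]])
  have L: "smooth_on D (local_rep c d h)" unfolding D_def by (rule smooth_map_onD(3)[OF h_smooth c(1) d(1)])
  define J' where "J' = J \<inter> k -` D"
  have J': "open J'" unfolding J'_def
    by (rule continuous_open_preimage[OF smooth_on_imp_continuous_on[OF J(4)] J(1) D])
  have "snd c (\<gamma> t) \<in> D" using c d(2) is_chartD(5)[OF cc] unfolding D_def by blast
  then have tJ: "t \<in> J'" using J(2,5) t by (simp add: J'_def)
  have in_c: "\<gamma> s \<in> fst c \<and> snd c (\<gamma> s) = k s" if "s \<in> I \<inter> J'" for s using that J(3,5) by (auto simp: J'_def)
  have "h (\<gamma> s) \<in> fst d \<and> snd d (h (\<gamma> s)) = local_rep c d h (k s)" if s: "s \<in> I \<inter> J'" for s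
  proof -
    obtain p where p: "p \<in> fst c" "h p \<in> fst d" "k s = snd c p" using s by (auto simp: J'_def D_def)
    then have "p = \<gamma> s" using in_c[OF s] inj_onD[OF is_chartD(3)[OF cc]] by metis
    then show ?thesis using p local_rep_apply[OF cc p(1)] by metis
  qed
  moreover have "smooth_on J' k" using smooth_on_subset[OF J(4)] by (simp add: J'_def)
  moreover have "smooth_on J' (local_rep c d h \<circ> k)"
    unfolding o_def by (rule smooth_on_compose[OF J' D \<open>smooth_on J' k\<close> L]) (auto simp: J'_def)
  ultimately show ?thesis using that c J' tJ in_c by blast
qed

lemma image_right_moving:
  assumes \<gamma>: "right_moving_curve M I \<gamma>" shows "right_moving_curve N I (h \<circ> \<gamma>)"
  unfolding right_moving_curve_def
proof (intro conjI)
  have sm: "smooth_curve M I \<gamma>" and vel: "velocity_everywhere M (future_right_null M) I \<gamma>"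
    and "proper_interval I" using \<gamma> by (simp_all add: right_moving_curve_def)
  then show "proper_interval I" by simp
  show "smooth_curve N I (h \<circ> \<gamma>)" unfolding smooth_curve_def
  proof (intro conjI ballI impI)
    show "(h \<circ> \<gamma>) ` I \<subseteq> points N" using sm h_points by (auto simp: smooth_curve_def)
    fix t d assume td: "t \<in> I" "d \<in> atlas N" "(h \<circ> \<gamma>) t \<in> fst d"
    then have "h (\<gamma> t) \<in> fst d" by simp
    then obtain c J k where J: "c \<in> atlas M" "\<gamma> t \<in> fst c" "open J" "t \<in> J" "smooth_on J k"
      "smooth_on J (local_rep c d h \<circ> k)" "\<And>s. s \<in> I \<inter> J \<Longrightarrow> \<gamma> s \<in> fst c \<and> snd c (\<gamma> s) = k s"
      "\<And>s. s \<in> I \<inter> J \<Longrightarrow> h (\<gamma> s) \<in> fst d \<and> snd d (h (\<gamma> s)) = local_rep c d h (k s)"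
      by (rule image_coordinates[OF sm td(1,2)]) blast
    show "\<exists>J f. open J \<and> t \<in> J \<and> (h \<circ> \<gamma>) ` (I \<inter> J) \<subseteq> fst d \<and> smooth_on J f \<and>
        (\<forall>s\<in>I \<inter> J. snd d ((h \<circ> \<gamma>) s) = f s)"
      by (intro exI[of _ J] exI[of _ "local_rep c d h \<circ> k"]) (use J in auto)
  qed
  show "velocity_everywhere N (future_right_null N) I (h \<circ> \<gamma>)" unfolding velocity_everywhere_def
  proof (intro ballI impI)
    fix t d assume td: "t \<in> interior I" "d \<in> atlas N" "(h \<circ> \<gamma>) t \<in> fst d"
    then have d: "h (\<gamma> t) \<in> fst d" and t: "t \<in> I" using interior_subset by auto
    obtain c J k where c: "c \<in> atlas M" "\<gamma> t \<in> fst c"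
      and J: "open J" "t \<in> J" "smooth_on J k" and "smooth_on J (local_rep c d h \<circ> k)"
      and J': "\<And>s. s \<in> I \<inter> J \<Longrightarrow> \<gamma> s \<in> fst c \<and> snd c (\<gamma> s) = k s"
      "\<And>s. s \<in> I \<inter> J \<Longrightarrow> h (\<gamma> s) \<in> fst d \<and> snd d (h (\<gamma> s)) = local_rep c d h (k s)"
      by (rule image_coordinates[OF sm t td(2) d]) blast
    define w where "w = vector_derivative k (at t)"
    have "k differentiable at t"
      using smooth_on_has_derivative[OF J(3,1,2)] by (rule differentiableI)
    then have k: "(k has_vector_derivative w) (at t)" unfolding w_def by (simp add: vector_derivative_works)
    have open': "open (interior I \<inter> J)" "t \<in> interior I \<inter> J" using J td(1) by auto
    have inI: "s \<in> I \<inter> J" if "s \<in> interior I \<inter> J" for s using that interior_subset by auto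
    have "(snd c \<circ> \<gamma> has_vector_derivative w) (at t)"
      by (rule has_vector_derivative_transform_within_open[OF k open']) (use J'(1) inI in auto)
    then have "vector_derivative (snd c \<circ> \<gamma>) (at t) = w" by (rule vector_derivative_at)
    then have fr: "future_right_null M c (\<gamma> t) w" using vel td(1) c unfolding velocity_everywhere_def by metis
    have pt: "\<gamma> t \<in> points M" using smooth_manifoldD(7)[OF A.sm c(1)] c(2) by blast
    have kt: "k t = snd c (\<gamma> t)" using J'(1)[OF inI[OF open'(2)]] by simp
    have "(local_rep c d h has_derivative mdiff c d h (\<gamma> t)) (at (k t))"
      unfolding kt by (rule smooth_map_on_derivative[OF A.sm B.sm h_smooth c(1) td(2) pt c(2) d])
    from vector_derivative_diff_chain_within[OF k has_derivative_at_withinI[OF this]]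
    have "(local_rep c d h \<circ> k has_vector_derivative mdiff c d h (\<gamma> t) w) (at t)" by simp
    then have "(snd d \<circ> (h \<circ> \<gamma>) has_vector_derivative mdiff c d h (\<gamma> t) w) (at t)"
      by (rule has_vector_derivative_transform_within_open[OF _ open']) (use J'(2) inI in auto)
    then have "vector_derivative (snd d \<circ> (h \<circ> \<gamma>)) (at t) = mdiff c d h (\<gamma> t) w" by (rule vector_derivative_at)
    then show "future_right_null N d ((h \<circ> \<gamma>) t) (vector_derivative (snd d \<circ> (h \<circ> \<gamma>)) (at t))"
      using image_future_right_null[OF c(1) td(2) c(2) d fr] by simp
  qed
qed

lemma image_schi:
  assumes "(p, q) \<in> schi M" shows "(h p, h q) \<in> schi N"
proof -
  have "(h x, h y) \<in> chi N" if xy: "(x, y) \<in> chi M" for x y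
  proof -
    have pts: "h x \<in> points N" "h y \<in> points N" using xy h_points by (auto simp: chi_def)
    show ?thesis
    proof (cases "x = y")
      case False
      then obtain \<gamma> where "right_moving_curve M {0..1} \<gamma>" "\<gamma> 0 = x" "\<gamma> 1 = y"
        using xy by (auto simp: chi_def)
      then show ?thesis using pts image_right_moving[of "{0..1}" \<gamma>] by (force simp: chi_def)
    qed (use pts in \<open>simp add: chi_def\<close>)
  qed
  then show ?thesis using assms by (auto simp: schi_def)
qed

abbreviation "leaf_map \<equiv> fmap chi_Q M N h"

lemma leaf_map_proj:
  assumes p: "p \<in> points M" shows "leaf_map (A.proj p) = B.proj (h p)"
proof -
  have "B.proj (h q) = B.proj (h p)" if "q \<in> A.proj p" for q
    using B.proj_eqI[OF image_schi[of p q]] that by (simp add: chi_proj_def)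
  moreover have "p \<in> A.proj p" using equiv_class_self[OF A.schi_equiv p] by (simp add: chi_proj_def)
  ultimately have "(\<Union>q\<in>A.proj p. B.proj (h q)) = B.proj (h p)" by blast
  then show ?thesis using A.proj_in[OF p] by (simp add: chi_Q_def)
qed

lemma leaf_map_image: "leaf_map ` A.leaves = B.proj ` h ` points M"
proof
  show "leaf_map ` A.leaves \<subseteq> B.proj ` h ` points M"
  proof
    fix y assume "y \<in> leaf_map ` A.leaves"
    then obtain x where x: "x \<in> A.leaves" "y = leaf_map x" by blast
    obtain p where "p \<in> points M" "x = A.proj p" using A.leaf_rep[OF x(1)] by blast
    then show "y \<in> B.proj ` h ` points M" using x(2) leaf_map_proj by blast
  qed
  show "B.proj ` h ` points M \<subseteq> leaf_map ` A.leaves"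
  proof
    fix y assume "y \<in> B.proj ` h ` points M"
    then obtain p where p: "p \<in> points M" "y = B.proj (h p)" by blast
    show "y \<in> leaf_map ` A.leaves" unfolding p(2) leaf_map_proj[OF p(1), symmetric] by (rule imageI[OF A.proj_in[OF p(1)]])
  qed
qed

text \<open>
  Distinct leaves have disjoint open neighbourhoods in the leaf space, and chart domains inside the
  corresponding open subsets of \<open>M\<close> are spacetimes whose inclusions are orthogonal.
\<close>

lemma leaf_map_inj: "inj_on leaf_map A.leaves"
proof (rule inj_onI, rule ccontr)
  fix x y assume xy: "x \<in> A.leaves" "y \<in> A.leaves" "leaf_map x = leaf_map y" "x \<noteq> y"
  obtain p q where p: "p \<in> points M" "x = A.proj p" and q: "q \<in> points M" "y = A.proj q"
    using A.leaf_rep[OF xy(1)] A.leaf_rep[OF xy(2)] by blast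
  obtain U V where U: "openin A.qtop U" "x \<in> U" and V: "openin A.qtop V" "y \<in> V" and UV: "U \<inter> V = {}"
    using A.qtop_Hausdorff xy unfolding Hausdorff_space_def A.topspace_qtop disjnt_def by metis
  obtain c d where c: "c \<in> atlas M" "p \<in> fst c" and d: "d \<in> atlas M" "q \<in> fst d"
    using smooth_manifoldD(5)[OF A.sm p(1)] smooth_manifoldD(5)[OF A.sm q(1)] by blast
  define W1 where "W1 = {z \<in> points M. A.proj z \<in> U} \<inter> fst c"
  define W2 where "W2 = {z \<in> points M. A.proj z \<in> V} \<inter> fst d"
  have W1: "openin (mtop M) W1" "W1 \<subseteq> fst c" "p \<in> W1" and W2: "openin (mtop M) W2" "W2 \<subseteq> fst d" "q \<in> W2"
    unfolding W1_def W2_def using U V p q c d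
    by (auto simp: A.openin_qtop intro!: openin_Int is_chartD(1)[OF smooth_manifoldD(3)[OF A.sm]])
  interpret I1: open_subspacetime M T Om W1 c by unfold_locales (rule W1 c)+
  interpret I2: open_subspacetime M T Om W2 d by unfold_locales (rule W2 d)+
  have "orth_chi I1.sub I2.sub M I1.incl I2.incl"
    unfolding orth_chi_def I1.sub_points I2.sub_points
  proof (rule equals0I)
    fix z assume "z \<in> schi M \<inter> I1.incl ` W1 \<times> I2.incl ` W2"
    then obtain a b where ab: "(a, b) \<in> schi M" "a \<in> W1" "b \<in> W2" by auto
    then have "A.proj a = A.proj b" "A.proj a \<in> U" "A.proj b \<in> V"
      using A.proj_eqI[OF ab(1)] by (simp_all add: W1_def W2_def)
    then show False using UV by auto
  qed
  moreover have "I1.sub \<in> Obj Conf" "I2.sub \<in> Obj Conf" using I1.sub_spacetime I2.sub_spacetime by (simp_all add: Conf_def)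
  ultimately have "orth_chi I1.sub I2.sub N (Cmp Conf I1.sub M N h I1.incl) (Cmp Conf I2.sub M N h I2.incl)"
    using monic I1.incl_conf I2.incl_conf unfolding overlap_monic_def by blast
  then have "(h p, h q) \<notin> schi N"
    using W1(3) W2(3) by (force simp: orth_chi_def Conf_def I1.sub_points I2.sub_points compose_def)
  moreover have "B.proj (h p) = B.proj (h q)" using xy(3) leaf_map_proj p q by simp
  ultimately show False using B.proj_eq_iff[OF h_points[OF p(1)] h_points[OF q(1)]] by blast
qed

lemma proj_h_smooth: "smooth_map M B.qman (\<lambda>p. B.proj (h p))"
  by (rule smooth_map_on_compose[OF A.sm B.sm B.sm_q h_smooth B.proj_smooth]) (use h_points in blast)

lemma leaf_map_continuous: "continuous_map A.qtop B.qtop leaf_map"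
  unfolding continuous_map_def
proof (intro conjI allI impI)
  show "leaf_map \<in> topspace A.qtop \<rightarrow> topspace B.qtop"
    unfolding A.topspace_qtop B.topspace_qtop
  proof
    fix x assume "x \<in> A.leaves"
    then obtain p where p: "p \<in> points M" "x = A.proj p" using A.leaf_rep by blast
    show "leaf_map x \<in> B.leaves" unfolding p(2) leaf_map_proj[OF p(1)] by (rule B.proj_in[OF h_points[OF p(1)]])
  qed
  fix U assume U: "openin B.qtop U"
  have "continuous_map (mtop M) B.qtop (\<lambda>p. B.proj (h p))"
    using smooth_map_onD(2)[OF proj_h_smooth] by (simp add: B.qman_simps)
  then have "openin (mtop M) {p \<in> points M. B.proj (h p) \<in> U}" using U by (rule openin_continuous_map_preimage)
  moreover have "{p \<in> points M. A.proj p \<in> {x \<in> A.leaves. leaf_map x \<in> U}} = {p \<in> points M. B.proj (h p) \<in> U}"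
    using A.proj_in leaf_map_proj by auto
  ultimately show "openin A.qtop {x \<in> topspace A.qtop. leaf_map x \<in> U}"
    unfolding A.openin_qtop A.topspace_qtop by auto
qed

text \<open>Pulled back to \<open>M\<close>, a coordinate of the induced map is a coordinate of the
  projection of \<open>N\<close> after \<open>h\<close>, hence smooth.
  \<open>leaf_function_factor\<close> brings this down to the leaf space.\<close>

lemma leaf_map_smooth: "smooth_map A.qman B.qman leaf_map"
proof (rule smooth_map_on_localI[OF A.sm_q B.sm_q openin_topspace])
  show "continuous_map (subtopology (mtop A.qman) (points A.qman)) (mtop B.qman) leaf_map"
    using leaf_map_continuous by (simp add: A.qman_simps B.qman_simps)
  fix x assume "x \<in> points A.qman"
  then obtain p where p: "p \<in> points M" "x = A.proj p" using A.leaf_rep unfolding A.qman_simps(3) by blast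
  have "x \<in> A.leaves" "leaf_map x \<in> B.leaves"
    using A.proj_in B.proj_in h_points leaf_map_proj p by simp_all
  then obtain a e where a: "a \<in> A.qatlas" "A.proj p \<in> fst a" and e: "e \<in> B.qatlas" "leaf_map x \<in> fst e"
    using A.qatlas_cover B.qatlas_cover p(2) by blast
  obtain c where c: "A.straight c" "p \<in> fst c" by (rule A.straight_at[OF p(1)])
  note cD = A.straightD[OF c(1)] and ec = B.qatlas_chart[OF e(1)]
  define V where "V = {q \<in> points M \<inter> fst c. B.proj (h q) \<in> fst e}"
  have V: "open (snd c ` V)" unfolding V_def
    by (rule local_rep_domain_open(2)[OF cD(2) ec openin_topspace])
      (use smooth_map_onD(2)[OF proj_h_smooth] in \<open>simp add: B.qman_simps\<close>)
  have "smooth_on (snd c ` V) (local_rep c e (\<lambda>p. B.proj (h p)))" unfolding V_def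
    using smooth_map_onD(3)[OF proj_h_smooth cD(1)] e(1) by (simp add: B.qman_simps)
  then have "smooth_on (snd c ` V) (snd e \<circ> leaf_map \<circ> A.proj \<circ> inv_chart c)"
    by (rule smooth_on_eq[OF V]) (use leaf_map_proj chart_inv(1)[OF cD(2)] in \<open>auto simp: local_rep_def V_def\<close>)
  moreover have "p \<in> V" using p c e leaf_map_proj by (auto simp: V_def)
  ultimately have "smooth_near c ((snd e \<circ> leaf_map) \<circ> A.proj) p"
    unfolding smooth_near_def using V by (intro exI[of _ "snd c ` V"]) (auto simp: V_def comp_assoc)
  from A.leaf_function_factor(1)[OF A.qatlas_chart[OF a(1)] A.proj_continuous c a(2)
      A.qatlas_regular[OF a(1) cD(1) c(2) a(2)] this]
  obtain U where "open U" "snd a (A.proj p) \<in> U" "smooth_on U (local_rep a e leaf_map)"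
    unfolding local_rep_def by blast
  then show "\<exists>a\<in>atlas A.qman. \<exists>e\<in>atlas B.qman. x \<in> fst a \<and> leaf_map x \<in> fst e \<and>
      (\<exists>U. open U \<and> snd a x \<in> U \<and> smooth_on U (local_rep a e leaf_map))"
    using a e p unfolding A.qman_simps B.qman_simps by blast
qed

text \<open>Differentiate \<open>leaf_map \<circ> proj = proj \<circ> h\<close> along
  \<open>T\<close>. The left side gives \<open>r * m\<close>, the right side \<open>- r' * b\<close>
  by \<open>mdiff_proj_form\<close>, where \<open>b < 0\<close> and \<open>r'\<close> is nonzero. In
  positive charts \<open>r\<close> and \<open>r'\<close> are negative, which forces
  \<open>m > 0\<close>.\<close>

lemma leaf_map_derivative:
  assumes a: "a \<in> A.qatlas" "e \<in> B.qatlas" and x: "x \<in> fst a" "leaf_map x \<in> fst e"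
  shows "mdiff a e leaf_map x 1 \<noteq> 0" "A.positive a \<Longrightarrow> B.positive e \<Longrightarrow> mdiff a e leaf_map x 1 > 0"
proof -
  have aq: "a \<in> atlas A.qman" "e \<in> atlas B.qman" using a by (simp_all add: A.qman_simps B.qman_simps)
  have xq: "x \<in> points A.qman" using smooth_manifoldD(7)[OF A.sm_q aq(1)] x(1) by blast
  then obtain p where p: "p \<in> points M" "x = A.proj p" using A.leaf_rep unfolding A.qman_simps(3) by blast
  have ap: "A.proj p \<in> fst a" and ep: "B.proj (h p) \<in> fst e" using x leaf_map_proj p by auto
  obtain c where c: "c \<in> atlas M" "p \<in> fst c" using smooth_manifoldD(5)[OF A.sm p(1)] by blast
  obtain d where d: "d \<in> atlas N" "h p \<in> fst d" using smooth_manifoldD(5)[OF B.sm h_points[OF p(1)]] by blast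
  define m where "m = mdiff a e leaf_map x 1"
  define r where "r = mdiff c a A.proj p (T c p)"
  define r' where "r' = mdiff d e B.proj (h p) (T' d (h p))"
  define b where "b = B.g d (h p) (B.null_field d (h p)) (mdiff c d h p (T c p))"
  have "mdiff a e leaf_map x v = v * m" for v
    unfolding m_def by (rule real_linear_apply[OF mdiff_linear[OF A.sm_q B.sm_q leaf_map_smooth aq xq x]])
  then have "r * m = mdiff a e leaf_map (A.proj p) (mdiff c a A.proj p (T c p))" by (simp add: r_def p(2))
  also have "\<dots> = mdiff c e (\<lambda>q. leaf_map (A.proj q)) p (T c p)"
    by (rule mdiff_compose(1)[OF A.sm A.sm_q B.sm_q A.proj_smooth leaf_map_smooth c(1) aq, symmetric])
      (use p c ap xq x in auto)
  also have "\<dots> = mdiff c e (\<lambda>q. B.proj (h q)) p (T c p)"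
    by (rule fun_cong[OF mdiff_cong[OF A.sm B.sm_q proj_h_smooth c(1) aq(2) p(1) c(2) ep]]) (simp add: leaf_map_proj)
  also have "\<dots> = mdiff d e B.proj (h p) (mdiff c d h p (T c p))"
    by (rule mdiff_compose(1)[OF A.sm B.sm B.sm_q h_smooth B.proj_smooth c(1) d(1) aq(2) p(1) c(2) h_points[OF p(1)] d(2) ep])
  also have "\<dots> = - r' * b" unfolding r'_def b_def by (rule B.mdiff_proj_form[OF a(2) d ep])
  finally have eq: "r * m = - r' * b" .
  have b: "b < 0" unfolding b_def by (rule image_null_field[OF c(1) d(1) c(2) d(2)])
  have r': "r' \<noteq> 0" unfolding r'_def by (rule B.mdiff_proj_T_nonzero[OF a(2) d ep])
  then show "mdiff a e leaf_map x 1 \<noteq> 0" using eq b unfolding m_def[symmetric] by auto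
  assume pos: "A.positive a" "B.positive e"
  have "r < 0" using pos(1) p(1) c ap unfolding A.positive_def r_def by blast
  moreover have "r' < 0" using pos(2) h_points[OF p(1)] d ep unfolding B.positive_def r'_def by blast
  ultimately have "r < 0" "r * m < 0" using eq b by (simp_all add: mult_neg_neg)
  then show "mdiff a e leaf_map x 1 > 0" unfolding m_def[symmetric] by (simp add: mult_less_0_iff)
qed

lemma leaf_map_Emb1:
  "leaf_map \<in> Hom Emb1 (fobj chi_Q M) (fobj chi_Q N)"
  "chi_cauchy_map M N h \<Longrightarrow> is_iso Emb1 (fobj chi_Q M) (fobj chi_Q N) leaf_map"
proof -
  have ext: "leaf_map \<in> extensional (points A.qman)" by (simp add: chi_Q_def A.qman_simps(3))
  have inj: "inj_on leaf_map (points A.qman)" using leaf_map_inj unfolding A.qman_simps(3) .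
  note * = curve_iso[OF A.qman_oriented B.qman_oriented leaf_map_smooth inj _ _ ext]
  show "leaf_map \<in> Hom Emb1 (fobj chi_Q M) (fobj chi_Q N)" unfolding A.fobj_chi_Q B.fobj_chi_Q
    by (rule *(1)) (use leaf_map_derivative in \<open>auto simp: A.qman_simps B.qman_simps A.qman_pos B.qman_pos\<close>)
  assume "chi_cauchy_map M N h"
  then obtain S'' where S'': "chi_cauchy_surface N S''" "S'' \<subseteq> h ` points M" by (auto simp: chi_cauchy_map_def)
  have "B.leaves \<subseteq> B.proj ` h ` points M"
  proof
    fix y assume "y \<in> B.leaves"
    then obtain q where q: "q \<in> points N" "y = B.proj q" using B.leaf_rep by blast
    obtain s where "s \<in> S''" "(q, s) \<in> schi N" using B.cauchy_surface_meets[OF S''(1) q(1)] by blast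
    then have "y = B.proj s" "s \<in> h ` points M" using B.proj_eqI[of q s] q(2) S''(2) by auto
    then show "y \<in> B.proj ` h ` points M" by (rule image_eqI)
  qed
  moreover have "B.proj ` h ` points M \<subseteq> B.leaves" by (intro image_subsetI, elim imageE) (simp add: B.proj_in h_points)
  ultimately have surj: "leaf_map ` points A.qman = points B.qman"
    unfolding A.qman_simps(3) B.qman_simps(3) leaf_map_image by blast
  show "is_iso Emb1 (fobj chi_Q M) (fobj chi_Q N) leaf_map" unfolding A.fobj_chi_Q B.fobj_chi_Q
    by (rule *(2)[OF _ _ surj]) (use leaf_map_derivative in \<open>auto simp: A.qman_simps B.qman_simps A.qman_pos B.qman_pos\<close>)
qed

end

section \<open>The quotient functor\<close>

lemma chiLoc_simps:
  "M \<in> Obj chiLoc \<longleftrightarrow> oriented_spacetime M \<and> chi_initial M"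
  "f \<in> Hom chiLoc M N \<longleftrightarrow> f \<in> Hom Conf M N \<and> overlap_monic Conf orth_chi M N f"
  "Idt chiLoc M = restrict (\<lambda>p. p) (points M)" "Cmp chiLoc L M N g f = compose (points L) g f"
  by (auto simp: chiLoc_def Conf_def)

lemma initial_spacetime_exists:
  assumes "M \<in> Obj chiLoc" obtains T Om S where "initial_spacetime M T Om S"
proof -
  obtain S where S: "chi_cauchy_surface M S" using assms by (auto simp: chiLoc_simps chi_initial_def)
  obtain T Om where "framed_spacetime M T Om" using framed_spacetime_exists assms chiLoc_simps(1) by blast
  then have "initial_spacetime M T Om S" using S by (simp add: initial_spacetime_def initial_spacetime_axioms_def)
  then show ?thesis by (rule that)
qed

lemma chiral_morphism_exists:
  assumes "M \<in> Obj chiLoc" "N \<in> Obj chiLoc" "f \<in> Hom chiLoc M N"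
  obtains T Om S T' Om' S' where "chiral_morphism M T Om S N T' Om' S' f"
proof -
  obtain T Om S where 1: "initial_spacetime M T Om S" by (rule initial_spacetime_exists[OF assms(1)])
  obtain T' Om' S' where 2: "initial_spacetime N T' Om' S'" by (rule initial_spacetime_exists[OF assms(2)])
  have "chiral_morphism M T Om S N T' Om' S' f"
    using 1 2 assms(3) by (simp add: chiral_morphism_def chiral_morphism_axioms_def chiLoc_simps)
  then show ?thesis by (rule that)
qed

lemma chi_Q_obj:
  assumes "M \<in> Obj chiLoc"
  shows "fobj chi_Q M \<in> Obj Emb1" "points (fobj chi_Q M) = points M // schi M"
proof -
  obtain T Om S where "initial_spacetime M T Om S" by (rule initial_spacetime_exists[OF assms])
  then interpret initial_spacetime M T Om S .
  show "fobj chi_Q M \<in> Obj Emb1" "points (fobj chi_Q M) = points M // schi M"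
    unfolding fobj_chi_Q using qman_oriented qman_simps(3) by (simp_all add: Emb1_def)
qed

lemma chi_Q_extensional: "fmap chi_Q M N f \<in> extensional (points M // schi M)"
  by (simp add: chi_Q_def)

lemma chi_Q_Idt:
  assumes M: "M \<in> Obj chiLoc" shows "fmap chi_Q M M (Idt chiLoc M) = Idt Emb1 (fobj chi_Q M)"
proof -
  obtain T Om S where "initial_spacetime M T Om S" by (rule initial_spacetime_exists[OF M])
  then interpret initial_spacetime M T Om S .
  have "fmap chi_Q M M (Idt chiLoc M) = restrict (\<lambda>x. x) leaves"
  proof (rule extensionalityI[OF chi_Q_extensional restrict_extensional])
    fix x assume x: "x \<in> leaves"
    then obtain p where p: "p \<in> points M" "x = proj p" using leaf_rep by blast
    have "proj (restrict (\<lambda>p. p) (points M) q) = x" if "q \<in> x" for q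
      using that proj_eqI[of p q] p equiv_type[OF schi_equiv] by (auto simp: chi_proj_def)
    moreover have "p \<in> x" using equiv_class_self[OF schi_equiv p(1)] p(2) by (simp add: chi_proj_def)
    ultimately have "(\<Union>q\<in>x. proj (restrict (\<lambda>p. p) (points M) q)) = x" by blast
    then show "fmap chi_Q M M (Idt chiLoc M) x = restrict (\<lambda>x. x) leaves x"
      using x by (simp add: chi_Q_def chiLoc_simps)
  qed
  then show ?thesis by (simp add: Emb1_def chi_Q_obj(2)[OF M])
qed

text \<open>Only the two factors are treated as morphisms: the formula for the composite is constant
  on a leaf because \<open>image_schi\<close> can be applied to each factor in turn.\<close>

lemma chi_Q_Cmp:
  assumes L: "L \<in> Obj chiLoc" and M: "M \<in> Obj chiLoc" and N: "N \<in> Obj chiLoc"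
    and f: "f \<in> Hom chiLoc L M" and g: "g \<in> Hom chiLoc M N"
  shows "fmap chi_Q L N (Cmp chiLoc L M N g f) =
    Cmp Emb1 (fobj chi_Q L) (fobj chi_Q M) (fobj chi_Q N) (fmap chi_Q M N g) (fmap chi_Q L M f)"
proof -
  obtain T Om S T' Om' S' where "chiral_morphism L T Om S M T' Om' S' f" by (rule chiral_morphism_exists[OF L M f])
  then interpret F: chiral_morphism L T Om S M T' Om' S' f .
  obtain U Pm R U' Pm' R' where "chiral_morphism M U Pm R N U' Pm' R' g" by (rule chiral_morphism_exists[OF M N g])
  then interpret G: chiral_morphism M U Pm R N U' Pm' R' g .
  have "fmap chi_Q L N (Cmp chiLoc L M N g f) = compose F.A.leaves G.leaf_map F.leaf_map"
  proof (rule extensionalityI[OF chi_Q_extensional compose_extensional])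
    fix x assume x: "x \<in> F.A.leaves"
    then obtain p where p: "p \<in> points L" "x = F.A.proj p" using F.A.leaf_rep by blast
    have gf: "G.B.proj (g (f q)) = G.B.proj (g (f p))" if "(p, q) \<in> schi L" for q
      using G.B.proj_eqI[OF G.image_schi[OF F.image_schi[OF that]]] by simp
    have "G.B.proj (compose (points L) g f q) = G.B.proj (g (f p))" if "q \<in> x" for q
      using that gf[of q] p equiv_type[OF F.A.schi_equiv] by (auto simp: chi_proj_def compose_def)
    moreover have "p \<in> x" using equiv_class_self[OF F.A.schi_equiv p(1)] p(2) by (simp add: chi_proj_def)
    ultimately have "(\<Union>q\<in>x. G.B.proj (compose (points L) g f q)) = G.B.proj (g (f p))" by blast
    moreover have "G.leaf_map (F.leaf_map x) = G.B.proj (g (f p))"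
      unfolding p(2) F.leaf_map_proj[OF p(1)] by (rule G.leaf_map_proj[OF F.h_points[OF p(1)]])
    moreover have "fmap chi_Q L N (Cmp chiLoc L M N g f) x = (\<Union>q\<in>x. G.B.proj (compose (points L) g f q))"
      using x by (simp add: chi_Q_def chiLoc_simps)
    ultimately show "fmap chi_Q L N (Cmp chiLoc L M N g f) x = compose F.A.leaves G.leaf_map F.leaf_map x"
      using x by (simp add: compose_eq)
  qed
  then show ?thesis by (simp add: Emb1_def chi_Q_obj(2)[OF L])
qed

lemma chi_Q_functor: "is_functor chiLoc Emb1 chi_Q"
  unfolding is_functor_def
proof (intro conjI ballI)
  fix M N f assume *: "M \<in> Obj chiLoc" "N \<in> Obj chiLoc" "f \<in> Hom chiLoc M N"
  obtain T Om S T' Om' S' where "chiral_morphism M T Om S N T' Om' S' f" by (rule chiral_morphism_exists[OF *])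
  then show "fmap chi_Q M N f \<in> Hom Emb1 (fobj chi_Q M) (fobj chi_Q N)" by (rule chiral_morphism.leaf_map_Emb1(1))
qed (fact chi_Q_obj(1) chi_Q_Idt chi_Q_Cmp)+

lemma functor_comp_functor:
  assumes F: "is_functor C D F" and G: "is_functor D E G"
  shows "is_functor C E (G \<circ>\<^sub>F F)"
  using assms unfolding is_functor_def functor_comp_def by simp

lemma functor_iso:
  assumes F: "is_functor C D F" and XY: "X \<in> Obj C" "Y \<in> Obj C" and k: "is_iso C X Y k"
  shows "is_iso D (fobj F X) (fobj F Y) (fmap F X Y k)"
proof -
  obtain l where l: "k \<in> Hom C X Y" "l \<in> Hom C Y X" "Cmp C X Y X l k = Idt C X" "Cmp C Y X Y k l = Idt C Y"
    using k by (auto simp: is_iso_def)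
  have F': "fmap F P P (Idt C P) = Idt D (fobj F P)" if "P \<in> Obj C" for P using F that by (simp add: is_functor_def)
  have "Cmp D (fobj F P) (fobj F Q) (fobj F R) (fmap F Q R v) (fmap F P Q u) = fmap F P R (Cmp C P Q R v u)"
    if "P \<in> Obj C" "Q \<in> Obj C" "R \<in> Obj C" "u \<in> Hom C P Q" "v \<in> Hom C Q R" for P Q R u v
    using F that by (simp add: is_functor_def)
  note this[OF XY(1,2,1) l(1,2)] this[OF XY(2,1,2) l(2,1)]
  moreover have "fmap F X Y k \<in> Hom D (fobj F X) (fobj F Y)" "fmap F Y X l \<in> Hom D (fobj F Y) (fobj F X)"
    using F XY l by (simp_all add: is_functor_def)
  ultimately show ?thesis unfolding is_iso_def using F' XY l(3,4) by auto
qed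

lemma chi_Q_orth:
  assumes M: "M1 \<in> Obj chiLoc" "M2 \<in> Obj chiLoc" "N \<in> Obj chiLoc"
    and f: "f1 \<in> Hom chiLoc M1 N" "f2 \<in> Hom chiLoc M2 N" and orth: "orth_chi M1 M2 N f1 f2"
  shows "orth_set (fobj chi_Q M1) (fobj chi_Q M2) (fobj chi_Q N) (fmap chi_Q M1 N f1) (fmap chi_Q M2 N f2)"
proof -
  obtain T Om S T' Om' S' where "chiral_morphism M1 T Om S N T' Om' S' f1" by (rule chiral_morphism_exists[OF M(1,3) f(1)])
  then interpret F: chiral_morphism M1 T Om S N T' Om' S' f1 .
  obtain U Pm R U' Pm' R' where "chiral_morphism M2 U Pm R N U' Pm' R' f2" by (rule chiral_morphism_exists[OF M(2,3) f(2)])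
  then interpret G: chiral_morphism M2 U Pm R N U' Pm' R' f2 .
  have "F.B.proj (f1 p) \<noteq> F.B.proj (f2 q)" if pq: "p \<in> points M1" "q \<in> points M2" for p q
    using orth pq F.B.proj_eq_iff[OF F.h_points[OF pq(1)] G.h_points[OF pq(2)]] by (auto simp: orth_chi_def)
  then show ?thesis unfolding orth_set_def chi_Q_obj(2)[OF M(1)] chi_Q_obj(2)[OF M(2)] F.leaf_map_image G.leaf_map_image
    by blast
qed

theorem proposition4p62:
  fixes A :: "('a set oriented_curve, 'a set \<Rightarrow> 'a set, 'c star_algebra, 'c \<Rightarrow> 'c) func"
  assumes "is_functor Emb1 Obs A"
  shows "is_functor chiLoc Obs (A \<circ>\<^sub>F chi_Q) \<and>
         chiral_time_slice_axiom (A \<circ>\<^sub>F chi_Q) \<and>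
         (causality_axiom Emb1 orth_set A \<longrightarrow> causality_axiom chiLoc orth_chi (A \<circ>\<^sub>F chi_Q))"
proof (intro conjI impI)
  show "is_functor chiLoc Obs (A \<circ>\<^sub>F chi_Q)" by (rule functor_comp_functor[OF chi_Q_functor assms])
  show "chiral_time_slice_axiom (A \<circ>\<^sub>F chi_Q)" unfolding chiral_time_slice_axiom_def
  proof (intro ballI impI)
    fix M N :: "'a spacetime" and f
    assume *: "M \<in> Obj chiLoc" "N \<in> Obj chiLoc" "f \<in> Hom chiLoc M N" and cauchy: "chi_cauchy_map M N f"
    obtain T Om S T' Om' S' where "chiral_morphism M T Om S N T' Om' S' f" by (rule chiral_morphism_exists[OF *])
    then have "is_iso Emb1 (fobj chi_Q M) (fobj chi_Q N) (fmap chi_Q M N f)"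
      using cauchy by (rule chiral_morphism.leaf_map_Emb1(2))
    from functor_iso[OF assms chi_Q_obj(1)[OF *(1)] chi_Q_obj(1)[OF *(2)] this]
    show "is_iso Obs (fobj (A \<circ>\<^sub>F chi_Q) M) (fobj (A \<circ>\<^sub>F chi_Q) N) (fmap (A \<circ>\<^sub>F chi_Q) M N f)"
      by (simp add: functor_comp_def)
  qed
  assume causal: "causality_axiom Emb1 orth_set A"
  show "causality_axiom chiLoc orth_chi (A \<circ>\<^sub>F chi_Q)" unfolding causality_axiom_def
  proof (intro ballI impI)
    fix M1 M2 N :: "'a spacetime" and f1 f2 a1 a2
    assume *: "M1 \<in> Obj chiLoc" "M2 \<in> Obj chiLoc" "N \<in> Obj chiLoc" "f1 \<in> Hom chiLoc M1 N" "f2 \<in> Hom chiLoc M2 N"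
      "orth_chi M1 M2 N f1 f2"
      and a: "a1 \<in> carrier (fobj (A \<circ>\<^sub>F chi_Q) M1)" "a2 \<in> carrier (fobj (A \<circ>\<^sub>F chi_Q) M2)"
    have hom: "fmap chi_Q M1 N f1 \<in> Hom Emb1 (fobj chi_Q M1) (fobj chi_Q N)"
      "fmap chi_Q M2 N f2 \<in> Hom Emb1 (fobj chi_Q M2) (fobj chi_Q N)"
      using chi_Q_functor * unfolding is_functor_def by blast+
    show "let x = fmap (A \<circ>\<^sub>F chi_Q) M1 N f1 a1; y = fmap (A \<circ>\<^sub>F chi_Q) M2 N f2 a2
        in (x \<otimes>\<^bsub>fobj (A \<circ>\<^sub>F chi_Q) N\<^esub> y) \<ominus>\<^bsub>fobj (A \<circ>\<^sub>F chi_Q) N\<^esub> (y \<otimes>\<^bsub>fobj (A \<circ>\<^sub>F chi_Q) N\<^esub> x) =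
          \<zero>\<^bsub>fobj (A \<circ>\<^sub>F chi_Q) N\<^esub>"
      using causal[unfolded causality_axiom_def, rule_format, OF chi_Q_obj(1)[OF *(1)] chi_Q_obj(1)[OF *(2)]
          chi_Q_obj(1)[OF *(3)] hom chi_Q_orth[OF *]] a
      by (simp add: functor_comp_def)
  qed
qed

end
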